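(* Let $\Omega\subset\mathbb{R}^2$ be a disk of radius $\rho$ containing a disk $B$ of radius $r$, let $0<k<+\infty$, $k\neq1$, let $f\in\mathcal{C}^{1,\alpha}(\partial\Omega)$ with $\alpha>0$, and let $u$ be the solution of $$\begin{cases}\nabla\cdot(1+(k-1)\chi(B))\nabla u=0 & \text{in }\Omega,\\ u=f & \text{on }\partial\Omega.\end{cases}$$ Let $$\epsilon:=\mathrm{dist}(B,\partial\Omega),\qquad \sigma:=\frac{k-1}{k+1},\qquad r^*:=\sqrt{\frac{\rho-r}{\rho r}}.$$ (i) If $k>1$, then there exists a constant $C_1>0$ independent of $k$, $r$, $\epsilon$ and $f$ such that for $\epsilon$ small enough, $$\frac{C_1\inf_{X\in J_1}|\langle\nabla\mathcal{D}_\Omega(f)(X),\nu_B(X_1)\rangle|}{1-\sigma+4r^*\sqrt{\epsilon}}\le\bigl|\nabla u|_+(X_1)\bigr|$$ and $$\frac{C_1\inf_{X\in J_2}|\langle\nabla\mathcal{D}_\Omega(f)(X),\nu_\Omega(X_2)\rangle|}{1-\sigma+4r^*\sqrt{\epsilon}}\le\bigl|\nabla u|_-(X_2)\bigr|.$$ (ii) For any $k\neq1$, there exists a constant $C_2$ independent of $k$, $r$ and $\epsilon$ such that for $\epsilon$ small enough, $$\|\nabla u\|_{L^\infty(\Omega)}\le\frac{C_2\|f\|_{\mathcal{C}^{1,\alpha}(\partial\Omega)}}{1-|\sigma|+r^*\sqrt{\epsilon}}.$$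
   Context: $\chi(B)$ is the indicator function of $B$; $\langle\cdot,\cdot\rangle$ is the scalar product in $\mathbb{R}^2$. $\nu_B$ and $\nu_\Omega$ are the outward unit normals to $\partial B$ and $\partial\Omega$. The subscript $+$ at $X_1\in\partial B$ denotes the limit from outside $B$; the subscript $-$ at $X_2\in\partial\Omega$ denotes the limit from inside $\Omega$. $X_1$ is the point of $\partial B$ closest to $\partial\Omega$ and $X_2$ is the point of $\partial\Omega$ closest to $\partial B$. $R_D$ denotes the reflection with respect to the boundary of a disk $D$ with center $Z$ and radius $s$: $R_D(X)=\frac{s^2(X-Z)}{|X-Z|^2}+Z$. $P_1$ is the fixed point of $R_BR_\Omega$ lying in $B$ and $P_2$ is the fixed point of $R_\Omega R_B$ lying outside $\Omega$ (products denote composition of maps). $J_1$ is the line segment between $P_1$ and $X_1$, and $J_2$ the line segment between $P_2$ and $X_2$. The double layer potential is $$\mathcal{D}_\Omega f(X)=\frac{1}{2\pi}\int_{\partial\Omega}\frac{\langle Y-X,\nu_Y\rangle}{|X-Y|^2}f(Y)\,d\sigma(Y),\quad X\in\mathbb{R}^2\setminus\partial\Omega,$$ where $\nu_Y$ is the outward unit normal to $\partial\Omega$ at $Y$; at $X_2\in\partial\Omega$ (an endpoint of $J_2$), its normal derivative, which is continuous across $\partial\Omega$, is understood as the boundary limit. (In the double layer potential $d\sigma$ is arc length, unrelated to the number $\sigma$.) *)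

theory Defs
  imports "HOL-Analysis.Analysis" "HOL-Probability.Essential_Supremum"
begin

text \<open>
  The Euclidean plane is the type \<^typ>\<open>complex\<close>: its inner product, norm and Lebesgue measure are
  those of the plane of pairs of reals.  A disk is an open \<^term>\<open>ball\<close>, its boundary a
  \<^term>\<open>sphere\<close>.
\<close>

section \<open>Disks\<close>

definition unit_normal :: "complex \<Rightarrow> real \<Rightarrow> complex \<Rightarrow> complex" where
  "unit_normal Z s X = (X - Z) /\<^sub>R s"

text \<open>At the center \<open>Z\<close> itself the reflection is undefined in the plane; here it takes the value
  \<open>Z\<close>, as \<open>x / 0 = 0\<close>.\<close>

definition reflect :: "complex \<Rightarrow> real \<Rightarrow> complex \<Rightarrow> complex" where
  "reflect Z s X = (s\<^sup>2 / (norm (X - Z))\<^sup>2) *\<^sub>R (X - Z) + Z"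

definition closest_point_to :: "complex set \<Rightarrow> complex set \<Rightarrow> complex \<Rightarrow> bool" where
  "closest_point_to T S X \<longleftrightarrow> X \<in> S \<and> (\<forall>Y\<in>S. infdist X T \<le> infdist Y T)"

text \<open>The point of the circle at arc length \<open>t\<close>, measured counterclockwise.\<close>

definition circle_point :: "complex \<Rightarrow> real \<Rightarrow> real \<Rightarrow> complex" where
  "circle_point Z s t = Z + of_real s * cis (t / s)"

definition circle_integral :: "complex \<Rightarrow> real \<Rightarrow> (complex \<Rightarrow> real) \<Rightarrow> real" where
  "circle_integral Z s g = integral {0..2 * pi * s} (\<lambda>t. g (circle_point Z s t))"


section \<open>Boundary data of class \<open>C\<^sup>1\<close> with Hoelder continuous tangential derivative\<close>

definition tangential_deriv :: "complex \<Rightarrow> real \<Rightarrow> (complex \<Rightarrow> real) \<Rightarrow> real \<Rightarrow> real" where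
  "tangential_deriv Z s f t = deriv (\<lambda>t. f (circle_point Z s t)) t"

definition C1_holder_circle :: "complex \<Rightarrow> real \<Rightarrow> real \<Rightarrow> (complex \<Rightarrow> real) \<Rightarrow> bool" where
  "C1_holder_circle Z s \<alpha> f \<longleftrightarrow>
     (\<forall>t. (\<lambda>t. f (circle_point Z s t)) differentiable (at t)) \<and>
     (\<exists>H. \<forall>t t'. \<bar>tangential_deriv Z s f t - tangential_deriv Z s f t'\<bar>
                  \<le> H * dist (circle_point Z s t) (circle_point Z s t') powr \<alpha>)"

text \<open>The three terms are the suprema of the function, of its tangential derivative and of the
  Hoelder quotient of the latter.  All of them are finite for functions satisfying
  \<^const>\<open>C1_holder_circle\<close>; pairs of parameters of the same point contribute the quotient \<open>0\<close>.\<close>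

definition C1_holder_norm :: "complex \<Rightarrow> real \<Rightarrow> real \<Rightarrow> (complex \<Rightarrow> real) \<Rightarrow> real" where
  "C1_holder_norm Z s \<alpha> f =
     (SUP X\<in>sphere Z s. \<bar>f X\<bar>) +
     (SUP t. \<bar>tangential_deriv Z s f t\<bar>) +
     (SUP (t, t')\<in>UNIV. \<bar>tangential_deriv Z s f t - tangential_deriv Z s f t'\<bar>
                  / dist (circle_point Z s t) (circle_point Z s t') powr \<alpha>)"


section \<open>Gradients\<close>

definition grad :: "(complex \<Rightarrow> real) \<Rightarrow> complex \<Rightarrow> complex" where
  "grad g X = (THE D. GDERIV g X :> D)"

text \<open>\<open>grad_limit u S X L\<close>: the gradient of \<open>u\<close> exists near \<open>X\<close> in \<open>S\<close> and tends to \<open>L\<close> when \<open>X\<close> is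
  approached from within \<open>S\<close>.\<close>

definition grad_limit :: "(complex \<Rightarrow> real) \<Rightarrow> complex set \<Rightarrow> complex \<Rightarrow> complex \<Rightarrow> bool" where
  "grad_limit u S X L \<longleftrightarrow>
     (\<forall>\<^sub>F Y in at X within S. \<exists>D. GDERIV u Y :> D) \<and> (grad u \<longlongrightarrow> L) (at X within S)"

text \<open>\<open>test_function S \<phi> \<phi>'\<close>: \<open>\<phi>\<close> is continuously differentiable, has compact support in \<open>S\<close>, and
  its gradient is \<open>\<phi>'\<close>.\<close>

definition test_function ::
    "complex set \<Rightarrow> (complex \<Rightarrow> real) \<Rightarrow> (complex \<Rightarrow> complex) \<Rightarrow> bool" where
  "test_function S \<phi> \<phi>' \<longleftrightarrow>
     (\<forall>X. GDERIV \<phi> X :> \<phi>' X) \<and> continuous_on UNIV \<phi>' \<and>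
     compact (closure {X. \<phi> X \<noteq> 0}) \<and> closure {X. \<phi> X \<noteq> 0} \<subseteq> S"

definition weak_gradient ::
    "complex set \<Rightarrow> (complex \<Rightarrow> real) \<Rightarrow> (complex \<Rightarrow> complex) \<Rightarrow> bool" where
  "weak_gradient S u G \<longleftrightarrow>
     (\<forall>\<phi> \<phi>'. test_function S \<phi> \<phi>' \<longrightarrow>
        (LINT X:S|lebesgue. u X *\<^sub>R \<phi>' X) = - (LINT X:S|lebesgue. \<phi> X *\<^sub>R G X))"

definition square_integrable_on :: "complex set \<Rightarrow> (complex \<Rightarrow> complex) \<Rightarrow> bool" where
  "square_integrable_on S G \<longleftrightarrow>
     G \<in> borel_measurable (lebesgue_on S) \<and> set_integrable lebesgue S (\<lambda>X. (norm (G X))\<^sup>2)"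

definition Linfty_norm :: "complex set \<Rightarrow> (complex \<Rightarrow> complex) \<Rightarrow> ereal" where
  "Linfty_norm S G = esssup (lebesgue_on S) (\<lambda>X. ereal (norm (G X)))"


section \<open>The conductivity problem\<close>

definition conductivity :: "real \<Rightarrow> complex set \<Rightarrow> complex \<Rightarrow> real" where
  "conductivity k B X = 1 + (k - 1) * indicator B X"

text \<open>Weak formulation of the divergence form equation in \<open>\<Omega>\<close>: \<open>u\<close> has a square integrable weak
  gradient \<open>G\<close>, and the boundary values are attained continuously.  Continuity up to the boundary
  selects the representative of \<open>u\<close> whose pointwise gradient is considered.\<close>

definition conductivity_solution ::
    "complex set \<Rightarrow> complex set \<Rightarrow> real \<Rightarrow> (complex \<Rightarrow> real) \<Rightarrow>
     (complex \<Rightarrow> real) \<Rightarrow> (complex \<Rightarrow> complex) \<Rightarrow> bool" where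
  "conductivity_solution \<Omega> B k f u G \<longleftrightarrow>
     continuous_on (closure \<Omega>) u \<and> (\<forall>X\<in>frontier \<Omega>. u X = f X) \<and>
     square_integrable_on \<Omega> G \<and> weak_gradient \<Omega> u G \<and>
     (\<forall>\<phi> \<phi>'. test_function \<Omega> \<phi> \<phi>' \<longrightarrow>
        (LINT X:\<Omega>|lebesgue. conductivity k B X * (G X \<bullet> \<phi>' X)) = 0)"


section \<open>The double layer potential of a circle\<close>

definition double_layer :: "complex \<Rightarrow> real \<Rightarrow> (complex \<Rightarrow> real) \<Rightarrow> complex \<Rightarrow> real" where
  "double_layer Z s f X =
     1 / (2 * pi) *
     circle_integral Z s (\<lambda>Y. ((Y - X) \<bullet> unit_normal Z s Y) / (norm (X - Y))\<^sup>2 * f Y)"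

text \<open>The component of the gradient of the double layer potential in the direction \<open>n\<close>; on the
  circle it is the limit from its complement.  It is used there only with \<open>n\<close> the normal, for
  which the limit exists because the normal derivative is continuous across the circle.\<close>

definition double_layer_deriv ::
    "complex \<Rightarrow> real \<Rightarrow> (complex \<Rightarrow> real) \<Rightarrow> complex \<Rightarrow> complex \<Rightarrow> real" where
  "double_layer_deriv Z s f n X =
     (if X \<in> sphere Z s
      then Lim (at X within - sphere Z s) (\<lambda>Y. grad (double_layer Z s f) Y \<bullet> n)
      else grad (double_layer Z s f) X \<bullet> n)"


section \<open>Parameters\<close>

definition contrast :: "real \<Rightarrow> real" where
  "contrast k = (k - 1) / (k + 1)"

definition r_star :: "real \<Rightarrow> real \<Rightarrow> real" where
  "r_star \<rho> r = sqrt ((\<rho> - r) / (\<rho> * r))"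

end

theory Submission
  imports Defs "HOL-Complex_Analysis.Complex_Analysis" "HOL-Real_Asymp.Real_Asymp"
begin

text \<open>
  Both boundary circles are exchanged for a series of reflected images.  Let \<open>h\<close> be holomorphic in
  \<open>\<Omega>\<close> with \<open>Re h = f\<close> on \<open>\<partial>\<Omega>\<close>, and let \<open>T = R\<^sub>B R\<^sub>\<Omega>\<close>, which is holomorphic because it is the composition of
  two reflections.  The series \<open>V = \<Sum>m. \<sigma>^m * h (T^m X)\<close> satisfies \<open>V = h + \<sigma> (V \<circ> T)\<close>, and the solution of the conductivity problem
  is \<open>(1 - \<sigma>) Re V\<close> in \<open>B\<close> and \<open>Re V - \<sigma> Re (V \<circ> R\<^sub>B)\<close> outside \<open>B\<close>.  The map \<open>T\<close> is a
  Moebius map with attracting fixed point \<open>P\<^sub>1\<close> and multiplier \<open>q\<^sup>2\<close>, so that \<open>\<nabla>u\<close> is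
  controlled by a geometric series of ratio \<open>\<sigma> q\<^sup>2\<close>, and \<open>1 - q\<^sup>2\<close> is comparable to
  \<open>r\<^sup>* \<surd>\<epsilon>\<close>.  On the axis of symmetry the derivatives of the iterates are positive and the iterates stay
  between \<open>P\<^sub>1\<close> and the starting point, where the normal derivative of the double layer potential is half of
  that of \<open>Re h\<close>; if it does not vanish it has constant sign there, and all terms of the series add up.
  Uniqueness of the weak solution follows from a strong maximum principle, proved with explicit test fields that mimic the
  fundamental solution in a conformal coordinate straightening the interface.
\<close>

section \<open>Cauchy integrals of Hoelder continuous functions on the unit circle\<close>

text \<open>The equation is weak while the gradient statements are pointwise, so the given
  \<open>u\<close> and \<open>G\<close> must be identified with the explicit series; hence existence
  and uniqueness are both proved although a solution is given. The series pays off because the disk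
  B enters only through \<open>T\<close>: the derivative of the m-th iterate is at most
  \<open>4 * q^(2*m)\<close> on the whole closed disk, whatever the radii, and h does not depend on
  B. So the constants depend on \<rho> and \<alpha> alone. This needs h' bounded up to the circle,
  which continuity of the tangential derivative does not give; the Hoelder condition enters exactly
  there, through a singular integral with an integrable majorant. The lower bounds rest on signs:
  the infimum over a segment is either 0, and nothing is claimed, or it fixes the sign of the normal
  derivative along the axis. Outside \<Omega> the potential is, up to sign and a constant, the
  mirror image of the one inside, so the segment beyond \<open>X2\<close> is traded for one inside
  \<Omega>. Smallness of \<epsilon> serves two ends: the disks are not concentric, and
  \<open>r_star \<rho> r * sqrt \<epsilon>\<close> is at most 1.\<close>

definition cauchy_circle :: "(complex \<Rightarrow> complex) \<Rightarrow> complex \<Rightarrow> complex" where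
  "cauchy_circle g z = integral {0..2*pi} (\<lambda>t. cis t * g (cis t) / (cis t - z)) / (2*pi)"

lemma continuous_on_cis_comp:
  fixes g :: "complex \<Rightarrow> 'a::topological_space"
  assumes "continuous_on (sphere 0 1) g"
  shows "continuous_on S (\<lambda>t. g (cis t))"
  by (rule continuous_on_compose2[OF assms]) (auto intro: continuous_intros)

lemma cauchy_circle_has_field_derivative:
  assumes g: "continuous_on (sphere 0 1) g" and z: "norm z \<noteq> 1"
  shows "(cauchy_circle g has_field_derivative
           integral {0..2*pi} (\<lambda>t. cis t * g (cis t) / (cis t - z)^2) / (2*pi)) (at z)"
proof -
  have "open (- sphere (0::complex) 1)" "z \<in> - sphere 0 1" using z by auto
  then obtain e where e: "e > 0" "ball z e \<subseteq> - sphere 0 1"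
    using open_contains_ball by blast
  have ne: "cis t \<noteq> x" if "x \<in> ball z e" for x t
    using e(2) that norm_cis[of t] by (metis ComplD mem_sphere_0 subsetD)
  have "((\<lambda>x. integral (cbox 0 (2*pi)) (\<lambda>t. cis t * g (cis t) / (cis t - x))) has_field_derivative
        integral (cbox 0 (2*pi)) (\<lambda>t. cis t * g (cis t) / (cis t - z)^2)) (at z within ball z e)"
  proof (rule leibniz_rule_field_derivative)
    show "((\<lambda>x. cis t * g (cis t) / (cis t - x)) has_field_derivative
         cis t * g (cis t) / (cis t - x)^2) (at x within ball z e)" if "x \<in> ball z e" for x t
      using ne[OF that, of t]
      by (auto intro!: derivative_eq_intros simp: power2_eq_square field_simps)
    show "(\<lambda>t. cis t * g (cis t) / (cis t - x)) integrable_on cbox 0 (2*pi)" if "x \<in> ball z e" for x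
      using ne[OF that] by (intro integrable_continuous continuous_intros continuous_on_cis_comp g) auto
    have "continuous_on (ball z e \<times> cbox 0 (2*pi)) (\<lambda>p. cis (snd p) * g (cis (snd p)) / (cis (snd p) - fst p)^2)"
      using ne by (intro continuous_intros continuous_on_compose2[OF g]) (auto simp: )
    then show "continuous_on (ball z e \<times> cbox 0 (2*pi)) (\<lambda>(x, t). cis t * g (cis t) / (cis t - x)^2)"
      by (simp add: case_prod_unfold)
  qed (use e in auto)
  then have "((\<lambda>x. integral {0..2*pi} (\<lambda>t. cis t * g (cis t) / (cis t - x))) has_field_derivative
        integral {0..2*pi} (\<lambda>t. cis t * g (cis t) / (cis t - z)^2)) (at z)"
    using e by (simp add: at_within_open[of z "ball z e"])
  from DERIV_cdivide[OF this, of "2*pi"] show ?thesis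
    by (simp add: cauchy_circle_def[abs_def])
qed

text \<open>Integration by parts along the circle moves the derivative from the kernel to
  \<open>F\<close>. As \<open>cnj e\<close> is \<open>1 / e\<close> on the circle, the result is
  again a Cauchy integral, and its boundary behaviour is governed by the regularity of
  \<open>D\<close>.\<close>

lemma cauchy_circle_has_field_derivative_parts:
  assumes F: "\<And>t. ((\<lambda>t. F (cis t)) has_vector_derivative D (cis t)) (at t)"
    and cF: "continuous_on (sphere 0 1) F" and cD: "continuous_on (sphere 0 1) D" and z: "norm z \<noteq> 1"
  shows "(cauchy_circle F has_field_derivative
           - \<i> * cauchy_circle (\<lambda>e. cnj e * D e) z) (at z)"
proof -
  have ne: "cis t \<noteq> z" for t using z norm_cis[of t] by metis
  \<comment> \<open>A periodic primitive: its values at 0 and \<open>2*pi\<close> agree, so the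
    integral of its derivative vanishes.\<close>
  have "((\<lambda>t. \<i> * F (cis t) / (cis t - z)) has_vector_derivative
       \<i> * D (cis t) / (cis t - z) + cis t * F (cis t) / (cis t - z)^2) (at t within {0..2*pi})" for t
  proof -
    have c: "(cis has_vector_derivative \<i> * cis t) (at t within {0..2*pi})"
      by (auto intro!: derivative_eq_intros simp: has_vector_derivative_def scaleR_conv_of_real)
    have inv: "((\<lambda>t. inverse (cis t - z)) has_vector_derivative (\<i> * cis t) * (- inverse ((cis t - z)^2)))
        (at t within {0..2*pi})"
    proof (rule field_vector_diff_chain_within[unfolded o_def, where g = inverse and f = "\<lambda>t. cis t - z"])
      show "((\<lambda>t. cis t - z) has_vector_derivative \<i> * cis t) (at t within {0..2*pi})"
        by (rule derivative_eq_intros c refl | simp)+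
      show "(inverse has_field_derivative - inverse ((cis t - z)\<^sup>2)) (at (cis t - z) within (\<lambda>t. cis t - z) ` {0..2 * pi})"
        using ne[of t] DERIV_inverse[of "cis t - z" "(\<lambda>t. cis t - z) ` {0..2 * pi}"] by (simp add: numeral_2_eq_2)
    qed
    have 1: "((\<lambda>t. F (cis t) * inverse (cis t - z)) has_vector_derivative
        F (cis t) * ((\<i> * cis t) * (- inverse ((cis t - z)^2))) + D (cis t) * inverse (cis t - z)) (at t within {0..2*pi})"
      by (rule has_vector_derivative_mult[OF has_vector_derivative_at_within[OF F] inv])
    have 2: "\<i> * (F (cis t) * ((\<i> * cis t) * (- inverse ((cis t - z)^2))) + D (cis t) * inverse (cis t - z)) =
        \<i> * D (cis t) / (cis t - z) + cis t * F (cis t) / (cis t - z)^2"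
    proof -
      have "\<i> * (F (cis t) * (\<i> * cis t * - inverse ((cis t - z)\<^sup>2))) = (\<i> * \<i>) * (- (cis t * F (cis t) * inverse ((cis t - z)\<^sup>2)))"
        by (simp only: mult_ac mult_minus_right)
      then show ?thesis unfolding distrib_left by (simp add: divide_inverse mult.assoc)
    qed
    show ?thesis
      using has_vector_derivative_mult_right[OF 1, of \<i>] unfolding 2
      by (simp add: divide_inverse mult.assoc)
  qed
  from fundamental_theorem_of_calculus[OF _ this]
  have 0: "((\<lambda>t. \<i> * D (cis t) / (cis t - z) + cis t * F (cis t) / (cis t - z)^2) has_integral 0) {0..2*pi}"
    by simp
  have i1: "(\<lambda>t. D (cis t) / (cis t - z)) integrable_on {0..2*pi}"
    using ne by (intro integrable_continuous_real continuous_intros continuous_on_cis_comp cD) auto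
  have i2: "(\<lambda>t. cis t * F (cis t) / (cis t - z)^2) integrable_on {0..2*pi}"
    using ne by (intro integrable_continuous_real continuous_intros continuous_on_cis_comp cF) auto
  have "\<i> * integral {0..2*pi} (\<lambda>t. D (cis t) / (cis t - z)) + integral {0..2*pi} (\<lambda>t. cis t * F (cis t) / (cis t - z)^2) = 0"
    using has_integral_add[OF has_integral_mult_right[OF integrable_integral[OF i1], of \<i>] integrable_integral[OF i2]] 0
    by (auto intro: has_integral_unique)
  moreover have "cauchy_circle (\<lambda>e. cnj e * D e) z = integral {0..2*pi} (\<lambda>t. D (cis t) / (cis t - z)) / (2*pi)"
    unfolding cauchy_circle_def by (simp add: cis_cnj cis_mult flip: mult.assoc)
  ultimately have eq: "- \<i> * cauchy_circle (\<lambda>e. cnj e * D e) z = integral {0..2*pi} (\<lambda>t. cis t * F (cis t) / (cis t - z)^2) / (2*pi)"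
    by (simp add: add_eq_0_iff)
  show ?thesis unfolding eq by (rule cauchy_circle_has_field_derivative[OF cF z])
qed

section \<open>Reduction to a singular integral with a fixed singularity\<close>

lemma integral_circle_rotate:
  fixes \<phi> :: "complex \<Rightarrow> complex"
  assumes \<phi>: "continuous_on (sphere 0 1) \<phi>" and e: "norm e = 1"
  shows "integral {0..2*pi} (\<lambda>t. \<phi> (e * cis t)) = integral {0..2*pi} (\<lambda>t. \<phi> (cis t))"
proof -
  define \<theta> where "\<theta> = Arg2pi e"
  have e': "e = cis \<theta>" and \<theta>: "0 \<le> \<theta>" "\<theta> < 2*pi"
    using Arg2pi[of e] e by (auto simp: \<theta>_def cis_conv_exp is_Arg_def)
  have int: "(\<lambda>t. \<phi> (cis t)) integrable_on {a..b}" for a b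
    by (intro integrable_continuous_real continuous_on_cis_comp \<phi>)
  have "integral {0..2*pi} (\<lambda>t. \<phi> (e * cis t)) = integral {\<theta> - \<theta>..(2*pi+\<theta>) - \<theta>} (\<lambda>t. (\<lambda>t. \<phi> (cis t)) (t + \<theta>))"
    by (simp add: e' cis_mult add.commute)
  also have "\<dots> = integral {\<theta>..2*pi+\<theta>} (\<lambda>t. \<phi> (cis t))"
    by (rule integral_shift_real_ivl)
  also have "\<dots> = integral {\<theta>..2*pi} (\<lambda>t. \<phi> (cis t)) + integral {2*pi..2*pi+\<theta>} (\<lambda>t. \<phi> (cis t))"
    using \<theta> by (intro Henstock_Kurzweil_Integration.integral_combine[symmetric] int) auto
  also have "integral {2*pi..2*pi+\<theta>} (\<lambda>t. \<phi> (cis t)) = integral {0..\<theta>} (\<lambda>t. \<phi> (cis t))"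
    using integral_shift_real_ivl[of "2*pi" "2*pi" "2*pi+\<theta>" "\<lambda>t. \<phi> (cis t)"]
    by (simp add: cis_mult[symmetric])
  also have "integral {\<theta>..2*pi} (\<lambda>t. \<phi> (cis t)) + integral {0..\<theta>} (\<lambda>t. \<phi> (cis t)) = integral {0..2*pi} (\<lambda>t. \<phi> (cis t))"
    using \<theta> by (subst add.commute) (intro Henstock_Kurzweil_Integration.integral_combine int, auto)
  finally show ?thesis .
qed

text \<open>Zero tangential derivative makes the integral constant in the disk, and at 0 the kernel
  is 1.\<close>

lemma cauchy_circle_const:
  assumes "norm z < 1" shows "cauchy_circle (\<lambda>_. c) z = c"
proof -
  have d: "(cauchy_circle (\<lambda>_. c) has_field_derivative 0) (at x)" if "x \<in> ball 0 1" for x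
    using cauchy_circle_has_field_derivative_parts[of "\<lambda>_. c" "\<lambda>_. 0" x] that
    by (simp add: cauchy_circle_def)
  have "cauchy_circle (\<lambda>_. c) z = cauchy_circle (\<lambda>_. c) 0"
    using has_field_derivative_zero_constant[OF convex_ball has_field_derivative_at_within[OF d]] assms
    by (metis dist_0_norm mem_ball norm_zero zero_less_one)
  also have "\<dots> = c" by (simp add: cauchy_circle_def scaleR_conv_of_real)
  finally show ?thesis .
qed

text \<open>\<open>e\<close> is the direction and \<open>r\<close> the modulus of the point, with
  \<open>r = 1\<close> allowed. After the rotation the singularity sits at the parameters 0 and
  \<open>2*pi\<close> for every \<open>e\<close>, so one majorant serves all of them.\<close>

definition circle_singular :: "(complex \<Rightarrow> complex) \<Rightarrow> complex \<Rightarrow> real \<Rightarrow> complex" where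
  "circle_singular g e r = integral {0..2*pi} (\<lambda>s. cis s * (g (e * cis s) - g e) / (cis s - r))"

text \<open>Rotating \<open>e\<close> to 1 and subtracting the Cauchy integral of the constant
  \<open>g e\<close> leaves a numerator that vanishes at the singularity.\<close>

lemma cauchy_circle_eq_singular:
  assumes g: "continuous_on (sphere 0 1) g" and e: "norm e = 1" and r: "0 \<le> r" "r < 1"
  shows "cauchy_circle g (r * e) = g e + circle_singular g e r / (2*pi)"
proof -
  have ne: "w \<noteq> of_real r * e" if "norm w = 1" for w using that r e by (auto simp: norm_mult)
  have ne': "cis t \<noteq> of_real r" for t using ne[of "e * cis t"] e by (auto simp: norm_mult)
  have [simp]: "e \<noteq> 0" using e by auto
  have "integral {0..2*pi} (\<lambda>t. (\<lambda>w. w * g w / (w - r * e)) (cis t)) =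
        integral {0..2*pi} (\<lambda>t. (\<lambda>w. w * g w / (w - r * e)) (e * cis t))"
    using ne by (intro integral_circle_rotate[symmetric] e continuous_intros g) auto
  also have "\<dots> = integral {0..2*pi} (\<lambda>t. cis t * g (e * cis t) / (cis t - r))"
  proof (intro arg_cong2[where f = integral] ext refl)
    fix t
    have "e * cis t - of_real r * e = e * (cis t - of_real r)" by (simp add: algebra_simps)
    then show "e * cis t * g (e * cis t) / (e * cis t - of_real r * e) = cis t * g (e * cis t) / (cis t - of_real r)"
      by simp
  qed
  finally have 1: "cauchy_circle g (r * e) = integral {0..2*pi} (\<lambda>t. cis t * g (e * cis t) / (cis t - r)) / (2*pi)"
    by (simp add: cauchy_circle_def)
  have cg: "continuous_on {0..2*pi} (\<lambda>t. g (e * cis t))"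
    by (rule continuous_on_compose2[OF g]) (auto intro!: continuous_intros simp: norm_mult e)
  have "circle_singular g e r = integral {0..2*pi} (\<lambda>s. cis s * g (e * cis s) / (cis s - r) - cis s * g e / (cis s - r))"
    unfolding circle_singular_def by (simp add: algebra_simps diff_divide_distrib)
  also have "\<dots> = integral {0..2*pi} (\<lambda>s. cis s * g (e * cis s) / (cis s - r)) - integral {0..2*pi} (\<lambda>s. cis s * g e / (cis s - r))"
    using ne' by (intro Henstock_Kurzweil_Integration.integral_diff integrable_continuous_real continuous_intros cg) auto
  also have "integral {0..2*pi} (\<lambda>s. cis s * g e / (cis s - r)) = 2*pi* g e"
    using cauchy_circle_const[of "of_real r" "g e"] r by (simp add: cauchy_circle_def field_simps)
  finally show ?thesis using 1 by (simp add: field_simps)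
qed

section \<open>An integrable majorant from the comparison of chord and arc\<close>

lemma sin_ge_linear:
  fixes x :: real assumes "0 \<le> x" "x \<le> pi/2" shows "2 / pi * x \<le> sin x"
proof -
  have c: "concave_on {0..pi} sin"
  proof (rule f''_le0_imp_concave[where f' = cos and f'' = "\<lambda>x. - sin x"])
    show "- sin x \<le> 0" if "x \<in> {0..pi}" for x using that by (auto intro: sin_ge_zero)
  qed (auto intro!: derivative_eq_intros)
  have "2/pi*x \<le> 1" using assms by (simp add: field_simps)
  then show ?thesis using concave_onD[OF c, of "2 / pi * x" 0 "pi/2"] assms by simp
qed

lemma norm_cis_minus_one: "norm (cis s - 1) = 2 * \<bar>sin (s/2)\<bar>"
proof -
  have "(norm (cis s - 1))\<^sup>2 = (cos s - 1)\<^sup>2 + (sin s)\<^sup>2" by (simp add: cmod_power2)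
  also have "\<dots> = 2 - 2 * cos s" using sin_cos_squared_add[of s] by (simp add: power2_eq_square algebra_simps)
  also have "\<dots> = (2 * \<bar>sin (s/2)\<bar>)\<^sup>2"
    using cos_double_sin[of "s/2"] by (simp add: power_mult_distrib)
  finally show ?thesis by (rule power2_eq_imp_eq) auto
qed

lemma norm_cis_minus_one_ge:
  assumes "0 \<le> s" "s \<le> 2*pi" shows "2 / pi * min s (2*pi - s) \<le> norm (cis s - 1)"
proof -
  have "2 / pi * (min s (2*pi - s) / 2) \<le> sin (min s (2*pi - s) / 2)"
    using assms by (intro sin_ge_linear) (auto simp: min_def)
  also have "sin (min s (2*pi - s) / 2) = sin (s/2)"
    using sin_pi_minus[of "s/2"] by (auto simp: min_def diff_divide_distrib)
  finally show ?thesis unfolding norm_cis_minus_one by auto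
qed

text \<open>The chord from 1 to \<open>cis s\<close> is at least \<open>2/pi\<close> times the
  shorter arc, and the power of the shorter arc is at most the sum of both powers. The leading 2
  pays for replacing \<open>r\<close> by 1 in the denominator. The exponent exceeds -1, hence
  integrability.\<close>

definition singular_majorant :: "real \<Rightarrow> real \<Rightarrow> real" where
  "singular_majorant \<beta> s = 2 * (2/pi) powr (\<beta> - 1) * (s powr (\<beta> - 1) + (2*pi - s) powr (\<beta> - 1))"

lemma singular_majorant_integrable:
  assumes "0 < \<beta>" shows "singular_majorant \<beta> integrable_on {0..2*pi}"
proof -
  have 1: "(\<lambda>s. s powr (\<beta> - 1)) integrable_on {0..2*pi}"
    by (rule integrable_on_powr_from_0) (use assms in auto)
  have "(\<lambda>x. - x + 2*pi) ` {0..2*pi} = {0..2*pi}"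
    by (auto intro!: image_eqI[of _ _ "2*pi - _"])
  then have 2: "(\<lambda>s. (2*pi - s) powr (\<beta> - 1)) integrable_on {0..2*pi}"
    using integrable_affinity[of "\<lambda>s. s powr (\<beta> - 1)" 0 "2*pi" "-1" "2*pi"] 1 by simp
  show ?thesis unfolding singular_majorant_def[abs_def]
    by (intro integrable_on_mult_right integrable_add 1 2)
qed

section \<open>Cauchy integrals of Hoelder data up to the circle\<close>

locale holder_circle =
  fixes g :: "complex \<Rightarrow> complex" and M \<beta> :: real
  assumes \<beta>: "0 < \<beta>" "\<beta> \<le> 1"
    and holder: "\<And>e e'. norm e = 1 \<Longrightarrow> norm e' = 1 \<Longrightarrow> norm (g e - g e') \<le> M * dist e e' powr \<beta>"
begin

lemma M_nonneg: "0 \<le> M"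
proof -
  have "0 \<le> M * 2 powr \<beta>"
    using order_trans[OF norm_ge_zero holder[of 1 "-1"]] by (simp add: dist_norm)
  then show ?thesis by (simp add: zero_le_mult_iff)
qed

lemma continuous: "continuous_on (sphere 0 1) g"
proof (rule continuous_onI)
  fix x :: complex and e :: real assume x: "x \<in> sphere 0 1" and e: "e > 0"
  define d where "d = (e / (M + 1)) powr (1/\<beta>)"
  have "dist (g x') (g x) \<le> e" if "x' \<in> sphere 0 1" "dist x' x < d" for x'
  proof -
    have "dist (g x') (g x) \<le> M * dist x' x powr \<beta>" using holder[of x' x] x that by (simp add: dist_norm)
    also have "\<dots> \<le> M * d powr \<beta>" using that M_nonneg \<beta> by (intro mult_left_mono powr_mono2) auto
    also have "d powr \<beta> = e / (M + 1)" using \<beta> e M_nonneg by (simp add: d_def powr_powr)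
    also have "M * (e / (M + 1)) \<le> e" using M_nonneg e by (simp add: field_simps)
    finally show ?thesis .
  qed
  moreover have "d > 0" using e M_nonneg by (simp add: d_def)
  ultimately show "\<exists>d>0. \<forall>x'\<in>sphere 0 1. dist x' x < d \<longrightarrow> dist (g x') (g x) \<le> e" by blast
qed

lemma singular_bound:
  fixes r :: real
  assumes e: "norm e = 1" and r: "0 \<le> r" "r \<le> 1" and s: "s \<in> {0..2*pi}"
  shows "norm (cis s * (g (e * cis s) - g e) / (cis s - r)) \<le> M * singular_majorant \<beta> s"
proof (cases "cis s = 1")
  case True
  then show ?thesis using M_nonneg by (simp add: singular_majorant_def)
next
  case False
  define d where "d = norm (cis s - 1)"
  have d: "d > 0" using False by (simp add: d_def)
  \<comment> \<open>\<open>r\<close> has distance \<open>1 - r\<close> from 1, which is at most its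
    distance from \<open>cis s\<close>. So replacing \<open>r\<close> by 1 in the denominator costs
    a factor 2, uniformly up to \<open>r = 1\<close>.\<close>
  have "d \<le> norm (cis s - r) + norm (of_real r - 1 :: complex)"
    unfolding d_def using norm_triangle_ineq[of "cis s - of_real r" "of_real r - 1"] by simp
  moreover have "norm (of_real r - 1 :: complex) = 1 - r"
    using r norm_of_real[of "r - 1", where 'a = complex] by simp
  moreover have "1 - r \<le> norm (cis s - r)"
    using norm_triangle_ineq2[of "cis s" "of_real r"] r by simp
  ultimately have den: "d / 2 \<le> norm (cis s - r)" by simp
  have "e * cis s - e = e * (cis s - 1)" by (simp add: algebra_simps)
  then have "dist (e * cis s) e = d" using e by (simp add: dist_norm norm_mult d_def)
  then have num: "norm (g (e * cis s) - g e) \<le> M * d powr \<beta>"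
    using holder[of "e * cis s" e] e by (simp add: norm_mult)
  define m where "m = min s (2*pi - s)"
  have s0: "s \<noteq> 0" "s \<noteq> 2*pi" using False by auto
  then have m: "m > 0" using s by (auto simp: m_def)
  have md: "2/pi * m \<le> d" using norm_cis_minus_one_ge[of s] s by (simp add: m_def d_def)
  have "norm (cis s * (g (e * cis s) - g e) / (cis s - r)) = norm (g (e * cis s) - g e) / norm (cis s - r)"
    by (simp add: norm_divide norm_mult)
  also have "\<dots> \<le> (M * d powr \<beta>) / (d/2)"
    using num den d M_nonneg by (intro frac_le) auto
  also have "\<dots> = M * (2 * d powr (\<beta> - 1))" using d by (simp add: powr_diff)
  also have "d powr (\<beta> - 1) \<le> (2/pi * m) powr (\<beta> - 1)"
    using md m \<beta> by (intro powr_mono2') auto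
  also have "\<dots> = (2/pi) powr (\<beta> - 1) * m powr (\<beta> - 1)"
    using m by (subst powr_mult) auto
  also have "m powr (\<beta> - 1) \<le> s powr (\<beta> - 1) + (2*pi - s) powr (\<beta> - 1)"
    by (auto simp: m_def min_def)
  finally show ?thesis using M_nonneg by (simp add: singular_majorant_def mult_left_mono mult.assoc)
qed

lemma singular_limit_pointwise:
  assumes x: "\<And>n. norm (x n) = 1" "x \<longlonglongrightarrow> e" and r: "\<rho> \<longlonglongrightarrow> r" and s: "s \<in> {0..2*pi}"
    and r0: "r \<ge> 0"
  shows "(\<lambda>n. cis s * (g (x n * cis s) - g (x n)) / (cis s - of_real (\<rho> n)))
           \<longlonglongrightarrow> cis s * (g (e * cis s) - g e) / (cis s - of_real r)"
proof -
  have e: "norm e = 1" using tendsto_norm[OF x(2)] x(1) by (simp add: LIMSEQ_const_iff)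
  show ?thesis
  proof (cases "cis s = of_real r")
    case True
    \<comment> \<open>Then \<open>cis s = 1\<close>: every numerator vanishes, and the limit is 0 as
      well, since \<open>x / 0 = 0\<close>.\<close>
    then have "norm (of_real r :: complex) = 1" by (metis norm_cis)
    then have "cis s = 1" using True r0 by simp
    then show ?thesis by simp
  next
    case False
    have g: "(\<lambda>n. g (y n)) \<longlonglongrightarrow> g l" if "\<And>n. norm (y n) = 1" "y \<longlonglongrightarrow> l" for y l
    proof -
      have "norm l = 1" using tendsto_norm[OF that(2)] that(1) by (simp add: LIMSEQ_const_iff)
      then show ?thesis
        using continuous[unfolded continuous_on_sequentially] that by (auto simp: o_def)
    qed
    have 1: "(\<lambda>n. g (x n * cis s)) \<longlonglongrightarrow> g (e * cis s)"
      by (rule g) (use x in \<open>auto intro!: tendsto_intros simp: norm_mult\<close>)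
    show ?thesis
      using False by (intro tendsto_intros 1 g x r) auto
  qed
qed

lemma singular_integrable:
  fixes r :: real
  assumes e: "norm e = 1" and r: "0 \<le> r" "r \<le> 1"
  shows "(\<lambda>s. cis s * (g (e * cis s) - g e) / (cis s - r)) integrable_on {0..2*pi}"
proof -
  have *: "(\<lambda>s. cis s * (g (e * cis s) - g e) / (cis s - r)) integrable_on {0..2*pi}" if "0 \<le> r" "r < 1" for r :: real
  proof -
    have "cis t \<noteq> of_real r" for t
    proof
      assume "cis t = of_real r"
      then have "\<bar>r\<bar> = 1" by (metis norm_cis norm_of_real)
      with that show False by simp
    qed
    moreover have "continuous_on {0..2*pi} (\<lambda>t. g (e * cis t))"
      by (rule continuous_on_compose2[OF continuous]) (auto intro!: continuous_intros simp: norm_mult e)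
    ultimately show ?thesis by (intro integrable_continuous_real continuous_intros) auto
  qed
  \<comment> \<open>Below radius 1 the integrand is continuous; radius 1 itself is reached as a
    dominated limit along these radii.\<close>
  define \<rho> where "\<rho> n = r * (1 - 1 / real (n + 1))" for n :: nat
  have \<rho>: "0 \<le> \<rho> n" "\<rho> n < 1" for n
  proof -
    have "1 / real (n + 1) \<in> {0<..1}" by auto
    then have u: "0 \<le> 1 - 1 / real (n+1)" "1 - 1 / real (n+1) < 1" by auto
    then show "0 \<le> \<rho> n" using r by (simp add: \<rho>_def)
    have "r * (1 - 1 / real (n+1)) \<le> 1 * (1 - 1 / real (n+1))" using r u by (intro mult_right_mono) auto
    also have "\<dots> < 1" using u by simp
    finally show "\<rho> n < 1" unfolding \<rho>_def .
  qed
  have lim: "\<rho> \<longlonglongrightarrow> r"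
  proof -
    have "(\<lambda>n. r * (1 - 1 / real (n + 1))) \<longlonglongrightarrow> r * (1 - 0)"
      using LIMSEQ_Suc[OF lim_1_over_n[where 'a=real]] by (intro tendsto_intros) (simp add: add.commute)
    then show ?thesis by (simp add: \<rho>_def[abs_def])
  qed
  show ?thesis
  proof (rule dominated_convergence(1)[where f = "\<lambda>n s. cis s * (g (e * cis s) - g e) / (cis s - of_real (\<rho> n))"])
    show "(\<lambda>s. M * singular_majorant \<beta> s) integrable_on {0..2 * pi}"
      by (intro integrable_on_mult_right singular_majorant_integrable \<beta>)
    show "norm (cis s * (g (e * cis s) - g e) / (cis s - of_real (\<rho> n))) \<le> M * singular_majorant \<beta> s"
      if "s \<in> {0..2*pi}" for n s
      using singular_bound[OF e, of "\<rho> n"] \<rho>[of n] that by simp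
    show "(\<lambda>n. cis s * (g (e * cis s) - g e) / (cis s - of_real (\<rho> n))) \<longlonglongrightarrow> cis s * (g (e * cis s) - g e) / (cis s - of_real r)"
      if "s \<in> {0..2*pi}" for s
      using singular_limit_pointwise[of "\<lambda>_. e" e \<rho> r s] that r e lim by simp
  qed (use * \<rho> in auto)
qed

lemma circle_singular_tendsto:
  assumes x: "\<And>n. norm (x n) = 1" "x \<longlonglongrightarrow> e" and r: "\<rho> \<longlonglongrightarrow> r" "\<And>n. 0 \<le> \<rho> n" "\<And>n. \<rho> n \<le> 1"
  shows "(\<lambda>n. circle_singular g (x n) (\<rho> n)) \<longlonglongrightarrow> circle_singular g e r"
  unfolding circle_singular_def
proof (rule dominated_convergence(2))
  show "(\<lambda>s. M * singular_majorant \<beta> s) integrable_on {0..2 * pi}"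
    by (intro integrable_on_mult_right singular_majorant_integrable \<beta>)
  show "(\<lambda>n. cis s * (g (x n * cis s) - g (x n)) / (cis s - of_real (\<rho> n)))
      \<longlonglongrightarrow> cis s * (g (e * cis s) - g e) / (cis s - of_real r)" if "s \<in> {0..2*pi}" for s
    using singular_limit_pointwise[OF x r(1) that] LIMSEQ_le_const[OF r(1)] r(2) by blast
qed (use singular_integrable singular_bound x r in auto)

text \<open>Subtracting \<open>g (sgn z)\<close> makes the integral converge up to the circle.  The origin is separate since \<open>sgn 0 = 0\<close>.\<close>

definition cauchy_ext :: "complex \<Rightarrow> complex" where
  "cauchy_ext z = (if z = 0 then cauchy_circle g 0
      else g (sgn z) + circle_singular g (sgn z) (norm z) / (2*pi))"

lemma cauchy_ext_eq: "cauchy_ext z = cauchy_circle g z" if "norm z < 1"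
proof (cases "z = 0")
  case False
  then have "of_real (norm z) * sgn z = z" by (simp add: sgn_div_norm scaleR_conv_of_real)
  then show ?thesis
    using cauchy_circle_eq_singular[OF continuous, of "sgn z" "norm z"] that False
    by (simp add: cauchy_ext_def norm_sgn)
qed (simp add: cauchy_ext_def)

text \<open>Two relatively open pieces cover the closed disk: the open disk, where the function is
  holomorphic, and the punctured closed disk, where direction and modulus are continuous and
  dominated convergence applies.\<close>

lemma continuous_cauchy_ext: "continuous_on (cball 0 1) cauchy_ext"
proof -
  have 1: "continuous_on (ball 0 1) cauchy_ext"
  proof (rule continuous_on_eq)
    show "continuous_on (ball 0 1) (cauchy_circle g)"
      using cauchy_circle_has_field_derivative[OF continuous]
      by (intro continuous_at_imp_continuous_on ballI DERIV_isCont[OF cauchy_circle_has_field_derivative[OF continuous]]) auto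
  qed (simp add: cauchy_ext_eq)
  have 2: "continuous_on (cball 0 1 - {0}) cauchy_ext"
    unfolding continuous_on_sequentially
  proof (intro allI ballI impI)
    fix x l assume l: "l \<in> cball 0 1 - {0::complex}" and x: "(\<forall>n. x n \<in> cball 0 1 - {0}) \<and> x \<longlonglongrightarrow> l"
    have s: "(\<lambda>n. sgn (x n)) \<longlonglongrightarrow> sgn l" using x l by (intro tendsto_intros) auto
    have n: "(\<lambda>n. norm (x n)) \<longlonglongrightarrow> norm l" using x by (intro tendsto_intros) auto
    have ns: "norm (sgn (x n)) = 1" for n using x by (simp add: norm_sgn)
    have "(\<lambda>n. g (sgn (x n)) + circle_singular g (sgn (x n)) (norm (x n)) / (2*pi)) \<longlonglongrightarrow>
       g (sgn l) + circle_singular g (sgn l) (norm l) / (2*pi)"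
    proof (intro tendsto_intros circle_singular_tendsto s n ns)
      show "(\<lambda>n. g (sgn (x n))) \<longlonglongrightarrow> g (sgn l)"
        using continuous[unfolded continuous_on_sequentially, rule_format, of "sgn l" "\<lambda>n. sgn (x n)"] s ns l
        by (simp add: o_def norm_sgn)
    qed (use x l in auto)
    then show "(cauchy_ext \<circ> x) \<longlonglongrightarrow> cauchy_ext l"
      using x l by (simp add: cauchy_ext_def o_def)
  qed
  have "cball 0 1 = ball 0 1 \<union> (cball 0 1 - {0::complex})" by auto
  moreover have "openin (top_of_set (cball 0 1)) (ball 0 (1::real) :: complex set)"
    by (rule open_subset) auto
  moreover have "openin (top_of_set (cball 0 1)) (cball 0 1 - {0::complex})"
    by (simp add: openin_delete)
  ultimately show ?thesis using continuous_on_Un_local_open[OF _ _ 1 2] by metis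
qed

lemma norm_cauchy_ext_le:
  assumes A: "\<And>e. norm e = 1 \<Longrightarrow> norm (g e) \<le> A" and z: "norm z \<le> 1"
  shows "norm (cauchy_ext z) \<le> A + M * (integral {0..2*pi} (singular_majorant \<beta>) / (2*pi))"
proof -
  have *: "norm (g e + circle_singular g e r / (2*pi)) \<le> A + M * (integral {0..2*pi} (singular_majorant \<beta>) / (2*pi))"
    if e: "norm e = 1" and r: "0 \<le> r" "r \<le> 1" for e and r :: real
  proof -
    have "norm (circle_singular g e r) \<le> integral {0..2*pi} (\<lambda>s. M * singular_majorant \<beta> s)"
      unfolding circle_singular_def
      by (intro integral_norm_bound_integral singular_integrable e r integrable_on_mult_right
          singular_majorant_integrable \<beta> singular_bound)
    also have "\<dots> = M * integral {0..2*pi} (singular_majorant \<beta>)" by simp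
    finally have "norm (circle_singular g e r / (2*pi)) \<le> M * integral {0..2*pi} (singular_majorant \<beta>) / (2*pi)"
      by (simp add: norm_divide norm_mult divide_right_mono)
    then show ?thesis using A[OF e] norm_triangle_ineq[of "g e" "circle_singular g e r / (2*pi)"] by simp
  qed
  show ?thesis
  proof (cases "z = 0")
    case True
    then show ?thesis
      using *[of 1 0] cauchy_circle_eq_singular[OF continuous, of 1 0] by (simp add: cauchy_ext_def)
  next
    case False
    then show ?thesis using *[of "sgn z" "norm z"] z by (simp add: cauchy_ext_def norm_sgn)
  qed
qed

text \<open>On the circle the kernel \<open>cis s / (cis s - 1)\<close> has constant real part 1/2,
  so for real data the real part of the singular term is half the difference between mean and value.
  This is Schwarz's formula: twice the Cauchy integral minus the mean has the data as real
  part.\<close>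

lemma Re_cauchy_ext:
  assumes e: "norm e = 1" and real: "\<And>e. norm e = 1 \<Longrightarrow> g e \<in> \<real>"
  shows "2 * Re (cauchy_ext e) - Re (cauchy_circle g 0) = Re (g e)"
proof -
  have ge: "(\<lambda>s. Re (g (e * cis s))) integrable_on {0..2*pi}"
    by (intro integrable_continuous_real continuous_intros continuous_on_compose2[OF continuous])
       (auto simp: norm_mult e)
  have "Re (circle_singular g e 1) = integral {0..2*pi} (\<lambda>s. Re (cis s * (g (e * cis s) - g e) / (cis s - 1)))"
    unfolding circle_singular_def
    using integral_linear[OF singular_integrable[OF e, of 1] bounded_linear_Re] by (simp add: o_def del: Re_divide)
  also have "\<dots> = integral {0..2*pi} (\<lambda>s. (Re (g (e * cis s)) - Re (g e)) / 2)"
  proof (intro integral_cong)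
    fix s :: real
    show "Re (cis s * (g (e * cis s) - g e) / (cis s - 1)) = (Re (g (e * cis s)) - Re (g e)) / 2"
    proof (cases "cis s = 1")
      case False
      have r: "g (e * cis s) - g e = of_real (Re (g (e * cis s)) - Re (g e))"
        using real[of e] real[of "e * cis s"] e by (simp add: norm_mult)
      have h: "Re (cis s / (cis s - 1)) = 1/2"
      proof -
        have "cos s \<noteq> 1"
        proof
          assume "cos s = 1"
          then have "sin s = 0" by (rule cos_one_sin_zero)
          with \<open>cos s = 1\<close> have "cis s = 1" by (simp add: complex_eq_iff)
          with False show False by simp
        qed
        moreover have "(cos s - 1)\<^sup>2 + (sin s)\<^sup>2 = 2 * (1 - cos s)"
          using sin_cos_squared_add[of s] by (simp add: power2_eq_square algebra_simps)
        moreover have "cos s * (cos s - 1) + sin s * sin s = 1 - cos s"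
          using sin_cos_squared_add[of s] by (simp add: power2_eq_square algebra_simps)
        ultimately show ?thesis by (simp add: Re_divide)
      qed
      have "cis s * (g (e * cis s) - g e) / (cis s - 1) = (Re (g (e * cis s)) - Re (g e)) *\<^sub>R (cis s / (cis s - 1))"
        unfolding r by (simp add: scaleR_conv_of_real)
      then show ?thesis using h by simp
    qed simp
  qed
  also have "\<dots> = (integral {0..2*pi} (\<lambda>s. Re (g (e * cis s))) - 2*pi* Re (g e)) / 2"
    using Henstock_Kurzweil_Integration.integral_diff[OF ge integrable_const_ivl[of "Re (g e)"]] by simp
  also have "integral {0..2*pi} (\<lambda>s. Re (g (e * cis s))) = Re (integral {0..2*pi} (\<lambda>s. g (e * cis s)))"
  proof -
    have "(\<lambda>s. g (e * cis s)) integrable_on {0..2*pi}"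
      by (intro integrable_continuous_real continuous_intros continuous_on_compose2[OF continuous])
       (auto simp: norm_mult e)
    from integral_linear[OF this bounded_linear_Re] show ?thesis by (simp add: o_def)
  qed
  also have "\<dots> = 2*pi*Re (cauchy_circle g 0)"
    by (subst integral_circle_rotate[OF continuous e]) (simp add: cauchy_circle_def Re_divide_of_real flip: of_real_mult)
  finally have "Re (circle_singular g e 1) = pi * (Re (cauchy_circle g 0) - Re (g e))"
    by (simp add: algebra_simps)
  moreover have "cauchy_ext e = g e + circle_singular g e 1 / of_real (2*pi)"
    using e by (auto simp: cauchy_ext_def sgn_div_norm)
  moreover have "Re (circle_singular g e 1 / of_real (2*pi)) = Re (circle_singular g e 1) / (2*pi)"
    by (rule Re_divide_of_real)
  ultimately have "Re (cauchy_ext e) = Re (g e) + (pi * (Re (cauchy_circle g 0) - Re (g e))) / (2*pi)"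
    by (simp del: of_real_mult)
  also have "(pi * (Re (cauchy_circle g 0) - Re (g e))) / (2*pi) = (Re (cauchy_circle g 0) - Re (g e)) / 2" by simp
  finally show ?thesis by (simp add: diff_divide_distrib)
qed

end

section \<open>Reflections in two eccentric circles\<close>

text \<open>In the normalised position the outer circle has centre \<open>0\<close> and the inner one has centre \<open>L > 0\<close>.
  \<open>T\<close> is the composition of the two reflections, with fixed points \<open>a\<close>, \<open>b\<close>, and \<open>q\<close> is the smaller root of
  \<open>q + 1/q = (\<rho>\<^sup>2 + r\<^sup>2 - L\<^sup>2) / (\<rho> r)\<close>.  Since \<open>(T y - a) / (T y - b) = q\<^sup>2 (y - a) / (y - b)\<close>, the iterate
  \<open>mob m\<close> is explicit.\<close>

locale eccentric =
  fixes \<rho> r L :: real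
  assumes r_pos: "0 < r" and L_pos: "0 < L" and gap: "L + r < \<rho>"
begin

definition q :: real where
  "q = (let \<kappa> = (\<rho>\<^sup>2 + r\<^sup>2 - L\<^sup>2) / (2 * \<rho> * r) in \<kappa> - sqrt (\<kappa>\<^sup>2 - 1))"

lemma rho_pos: "0 < \<rho>" and r_less: "r < \<rho>" and L_less: "L < \<rho>" using r_pos L_pos gap by linarith+

lemma q_eq: "\<rho> * r * (q\<^sup>2 + 1) = q * (\<rho>\<^sup>2 + r\<^sup>2 - L\<^sup>2)" and q_pos: "0 < q" and q_less: "q < 1"
proof -
  define \<kappa> where "\<kappa> = (\<rho>\<^sup>2 + r\<^sup>2 - L\<^sup>2) / (2 * \<rho> * r)"
  have \<kappa>e: "2 * \<rho> * r * \<kappa> = \<rho>\<^sup>2 + r\<^sup>2 - L\<^sup>2" using rho_pos r_pos by (simp add: \<kappa>_def)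
  \<comment> \<open>The gap between the circles is what makes \<kappa> exceed 1, that is, the two
    roots real and distinct.\<close>
  have "L\<^sup>2 < (\<rho> - r)\<^sup>2" using gap L_pos by (intro power_strict_mono) auto
  then have "2 * \<rho> * r * 1 < 2 * \<rho> * r * \<kappa>" unfolding \<kappa>e by (simp add: power2_eq_square algebra_simps)
  moreover have "0 < 2 * \<rho> * r" using rho_pos r_pos by simp
  ultimately have \<kappa>: "1 < \<kappa>" using mult_less_cancel_left_pos by blast
  have q: "q = \<kappa> - sqrt (\<kappa>\<^sup>2 - 1)" by (simp add: q_def \<kappa>_def Let_def)
  have k2: "1 < \<kappa>\<^sup>2" using \<kappa> by (simp add: one_less_power)
  have "q\<^sup>2 + 1 = 2 * \<kappa> * q" using k2 unfolding q by (simp add: power2_eq_square algebra_simps)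
  then have "\<rho> * r * (q\<^sup>2 + 1) = q * (2 * \<rho> * r * \<kappa>)" by simp
  then show "\<rho> * r * (q\<^sup>2 + 1) = q * (\<rho>\<^sup>2 + r\<^sup>2 - L\<^sup>2)" unfolding \<kappa>e .
  have "sqrt (\<kappa>\<^sup>2 - 1) < \<kappa>" using \<kappa> by (intro real_less_lsqrt) auto
  then show "0 < q" unfolding q by simp
  have "(\<kappa> - 1)\<^sup>2 < \<kappa>\<^sup>2 - 1" using \<kappa> by (simp add: power2_eq_square algebra_simps)
  then have "\<kappa> - 1 < sqrt (\<kappa>\<^sup>2 - 1)" by (rule real_less_rsqrt)
  then show "q < 1" unfolding q by simp
qed

section \<open>The fixed points of the double reflection\<close>

lemma key: "L\<^sup>2 * q = (\<rho> - r * q) * (\<rho> * q - r)"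
  using q_eq by (simp add: power2_eq_square algebra_simps)

text \<open>These are the limiting points of the pencil spanned by the two circles, mirror images of
  each other in both. In this form the quadratic equation for \<open>q\<close> is enough to verify
  that they are fixed.\<close>

definition a :: real where "a = L * \<rho> / (\<rho> - r * q)"
definition b :: real where "b = \<rho> * (\<rho> - r * q) / L"

lemma s_pos: "L < \<rho> - r * q"
proof -
  have "r * q < r * 1" using q_less r_pos by (intro mult_strict_left_mono) auto
  then show ?thesis using gap by simp
qed

lemma ab: "a * b = \<rho>\<^sup>2"
  using s_pos L_pos by (simp add: a_def b_def power2_eq_square)

lemma a_pos: "0 < a" using s_pos L_pos rho_pos by (simp add: a_def)

lemma a_less: "a < \<rho>"
proof -
  have "L * \<rho> < (\<rho> - r * q) * \<rho>" using s_pos rho_pos by (intro mult_strict_right_mono) auto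
  then show ?thesis using s_pos L_pos by (simp add: a_def divide_less_eq mult.commute)
qed

lemma b_gt: "\<rho> < b"
proof -
  have "\<rho> * L < \<rho> * (\<rho> - r * q)" using s_pos rho_pos by (intro mult_strict_left_mono) auto
  then show ?thesis using L_pos by (simp add: b_def less_divide_eq)
qed

text \<open>The composition of \<open>\<rho>\<^sup>2 / cnj y\<close> with the reflection in the
  inner circle, multiplied out so that it is also right at 0, which the first reflection sends to
  infinity.\<close>

definition T :: "complex \<Rightarrow> complex" where "T y = of_real L + of_real (r\<^sup>2) * y / (of_real (\<rho>\<^sup>2) - of_real L * y)"

lemma T_den: "\<rho> * r < norm (of_real (\<rho>\<^sup>2) - of_real L * y)" if "norm y \<le> \<rho>" for y :: complex
proof -
  have "norm (of_real (\<rho>\<^sup>2) - of_real L * y) \<ge> \<rho>\<^sup>2 - L * norm y"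
    using norm_triangle_ineq2[of "of_real (\<rho>\<^sup>2)" "of_real L * y"] L_pos by (simp add: norm_mult norm_power)
  moreover have "L * norm y \<le> L * \<rho>" using that L_pos by simp
  moreover have "\<rho> * (L + r) < \<rho> * \<rho>" using gap rho_pos by simp
  ultimately show ?thesis by (simp add: power2_eq_square algebra_simps)
qed

lemma T_den_nz: "of_real (\<rho>\<^sup>2) - of_real L * y \<noteq> 0" if "norm y \<le> \<rho>" for y :: complex
proof -
  have "0 < \<rho> * r" using rho_pos r_pos by simp
  with T_den[OF that] have "0 < norm (of_real (\<rho>\<^sup>2) - of_real L * y)" by linarith
  then show ?thesis unfolding zero_less_norm_iff .
qed

lemma T_in: "norm (T y - L) < r" if "norm y \<le> \<rho>" for y
proof -
  have pos: "0 < \<rho> * r" using rho_pos r_pos by simp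
  have "norm (T y - L) = r\<^sup>2 * norm y / norm (of_real (\<rho>\<^sup>2) - of_real L * y)"
    by (simp add: T_def norm_divide norm_mult norm_power)
  also have "\<dots> \<le> r\<^sup>2 * \<rho> / norm (of_real (\<rho>\<^sup>2) - of_real L * y)"
    using that by (intro divide_right_mono mult_left_mono) auto
  also have "\<dots> < r\<^sup>2 * \<rho> / (\<rho> * r)"
    using T_den[OF that] pos less_trans[OF pos T_den[OF that]] rho_pos r_pos
    by (intro divide_strict_left_mono mult_pos_pos zero_less_power)
  also have "\<dots> = r" using rho_pos r_pos by (simp add: power2_eq_square)
  finally show ?thesis .
qed

lemma T_norm: "norm (T y) < \<rho>" if "norm y \<le> \<rho>" for y
  using T_in[OF that] norm_triangle_ineq[of "T y - L" "of_real L"] gap L_pos by simp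

text \<open>Together with \<open>B_eq\<close> this gives the two eigenvalues of the matrix of
  \<open>T\<close>, namely \<open>\<rho> * r * q\<close> and \<open>\<rho> * r / q\<close>; their
  quotient is the multiplier.\<close>

lemma A_eq: "r\<^sup>2 - L\<^sup>2 + a * L = \<rho> * r * q"
proof -
  have s: "\<rho> - r * q \<noteq> 0" using s_pos L_pos by simp
  have as: "a * (\<rho> - r * q) = L * \<rho>" using s by (simp add: a_def)
  have "(r\<^sup>2 - L\<^sup>2 + a * L) * (\<rho> - r * q) = (r\<^sup>2 - L\<^sup>2) * (\<rho> - r * q) + (a * (\<rho> - r * q)) * L"
    by (simp add: algebra_simps)
  also have "\<dots> = \<rho> * r * q * (\<rho> - r * q)"
    unfolding as using arg_cong[OF key, of "\<lambda>x. x * r"] by (simp add: power2_eq_square algebra_simps)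
  finally show ?thesis using s by simp
qed

lemma B_eq: "(r\<^sup>2 - L\<^sup>2 + b * L) * q = \<rho> * r"
proof -
  have bL: "b * L = \<rho> * (\<rho> - r * q)" using L_pos by (simp add: b_def)
  show ?thesis unfolding bL using q_eq by (simp add: power2_eq_square algebra_simps)
qed

text \<open>The two assumptions compare the coefficients of 1 and \<open>y\<close>; they say that
  \<open>p\<close> is a fixed point with eigenvalue \<open>k\<close>.\<close>

lemma T_minus:
  assumes "norm y \<le> \<rho>" and AB: "(L - p) * \<rho>\<^sup>2 = - p * k" "r\<^sup>2 - L\<^sup>2 + p * L = k"
  shows "(T y - of_real p) * (of_real (\<rho>\<^sup>2) - of_real L * y) = of_real k * (y - of_real p)"
proof -
  define w where "w = of_real (\<rho>\<^sup>2) - of_real L * y"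
  have w: "w \<noteq> 0" using T_den_nz[OF assms(1)] by (simp add: w_def)
  have "T y - of_real p = of_real (L - p) + of_real (r\<^sup>2) * y / w" by (simp add: T_def w_def)
  then have "(T y - of_real p) * w = (of_real (L - p) + of_real (r\<^sup>2) * y / w) * w" by (simp only:)
  also have "\<dots> = of_real (L - p) * w + of_real (r\<^sup>2) * y" using w by (simp add: distrib_right)
  also have "\<dots> = of_real ((L - p) * \<rho>\<^sup>2) + of_real (r\<^sup>2 - L\<^sup>2 + p * L) * y"
    unfolding w_def by (simp add: algebra_simps power2_eq_square)
  also have "\<dots> = of_real k * (y - of_real p)" unfolding AB by (simp add: algebra_simps)
  finally show ?thesis by (simp add: w_def)
qed

lemma T_minus_a: "(T y - of_real a) * (of_real (\<rho>\<^sup>2) - of_real L * y) = of_real (\<rho> * r * q) * (y - of_real a)"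
  if "norm y \<le> \<rho>" for y
proof (rule T_minus[OF that _ A_eq])
  have "a * (\<rho> - r * q) = L * \<rho>" using s_pos L_pos by (simp add: a_def)
  from arg_cong[OF this, of "\<lambda>x. \<rho> * x"] show "(L - a) * \<rho>\<^sup>2 = - a * (\<rho> * r * q)"
    by (simp add: algebra_simps power2_eq_square)
qed

lemma T_minus_b: "(T y - of_real b) * (of_real (\<rho>\<^sup>2) - of_real L * y) = of_real (\<rho> * r / q) * (y - of_real b)"
  if "norm y \<le> \<rho>" for y
proof (rule T_minus[OF that])
  show "r\<^sup>2 - L\<^sup>2 + b * L = \<rho> * r / q" using B_eq q_pos by (simp add: eq_divide_eq)
  have bL: "b * L = \<rho> * (\<rho> - r * q)" using L_pos by (simp add: b_def)
  have "(L - b) * L * q = L\<^sup>2 * q - b * L * q" by (simp add: algebra_simps power2_eq_square)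
  also have "\<dots> = - ((\<rho> - r * q) * r)" unfolding key bL by (simp add: algebra_simps)
  finally have e: "(L - b) * L * q = - ((\<rho> - r * q) * r)" .
  have "L * ((L - b) * \<rho>\<^sup>2 * q) = ((L - b) * L * q) * \<rho>\<^sup>2" by (simp only: mult_ac)
  also have "\<dots> = - ((\<rho> - r * q) * r) * \<rho>\<^sup>2" unfolding e ..
  also have "\<dots> = - (b * L) * (\<rho> * r)" unfolding bL by (simp add: mult_ac power2_eq_square)
  also have "\<dots> = L * (- b * (\<rho> * r))" by simp
  finally have "(L - b) * \<rho>\<^sup>2 * q = - b * (\<rho> * r)"
    by (rule iffD1[OF mult_left_cancel, rotated]) (use L_pos in simp)
  then have "(L - b) * \<rho>\<^sup>2 = (- b * (\<rho> * r)) / q"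
    by (rule iffD2[OF nonzero_eq_divide_eq, rotated]) (use q_pos in simp)
  then show "(L - b) * \<rho>\<^sup>2 = - b * (\<rho> * r / q)" by simp
qed

text \<open>The quotient of the distances to two mirror points is constant on the circle
  (Apollonius). Here \<open>a * (y - b) = a * y - \<rho>\<^sup>2\<close>, and the difference of the
  squared sides factors into two nonnegative terms.\<close>

lemma norm_a_le_b: "\<rho> * norm (y - of_real a) \<le> a * norm (y - of_real b)" if "norm y \<le> \<rho>" for y :: complex
proof -
  have "(\<rho> * norm (y - of_real a))\<^sup>2 \<le> (a * norm (y - of_real b))\<^sup>2"
  proof -
    have n: "(norm y)\<^sup>2 \<le> \<rho>\<^sup>2" using that by (simp add: power_mono)
    have aa: "a\<^sup>2 \<le> \<rho>\<^sup>2" using a_less a_pos by (simp add: power_mono)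
    have e: "a * norm (y - of_real b) = norm (of_real a * y - of_real (\<rho>\<^sup>2))"
    proof -
      have "of_real a * y - of_real (\<rho>\<^sup>2) = of_real a * (y - of_real b)"
        unfolding ab[symmetric] by (simp add: algebra_simps)
      then show ?thesis using a_pos by (simp add: norm_mult)
    qed
    have "(a * norm (y - of_real b))\<^sup>2 - (\<rho> * norm (y - of_real a))\<^sup>2 = (\<rho>\<^sup>2 - (norm y)\<^sup>2) * (\<rho>\<^sup>2 - a\<^sup>2)"
      unfolding e unfolding power_mult_distrib cmod_power2 by (simp add: power2_eq_square algebra_simps)
    moreover have "0 \<le> (\<rho>\<^sup>2 - (norm y)\<^sup>2) * (\<rho>\<^sup>2 - a\<^sup>2)" using n aa by (intro mult_nonneg_nonneg) auto
    ultimately show ?thesis by linarith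
  qed
  then show ?thesis by (rule power2_le_imp_le) (use a_pos in simp)
qed

lemma norm_a_less_b: "norm (y - of_real a) < norm (y - of_real b)" if "norm y \<le> \<rho>" for y :: complex
proof -
  have "y \<noteq> b" using that b_gt rho_pos by auto
  then have "a * norm (y - of_real b) < \<rho> * norm (y - of_real b)" using a_less by simp
  then have "\<rho> * norm (y - of_real a) < \<rho> * norm (y - of_real b)" using norm_a_le_b[OF that] by linarith
  then show ?thesis using rho_pos by simp
qed

section \<open>The iterates in closed form\<close>

definition mden :: "nat \<Rightarrow> complex \<Rightarrow> complex" where
  "mden m y = (y - of_real b) - of_real (q^(2*m)) * (y - of_real a)"

text \<open>The solution \<open>z\<close> of
  \<open>(z - a) / (z - b) = q^(2*m) * (y - a) / (y - b)\<close>.\<close>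

definition mob :: "nat \<Rightarrow> complex \<Rightarrow> complex" where
  "mob m y = (of_real a * (y - of_real b) - of_real (q^(2*m) * b) * (y - of_real a)) / mden m y"

definition mob' :: "nat \<Rightarrow> complex \<Rightarrow> complex" where
  "mob' m y = of_real (q^(2*m) * (b - a)\<^sup>2) / (mden m y)\<^sup>2"

lemma qm: "0 < q^(2*m)" "q^(2*m) \<le> 1" for m :: nat
  using q_pos q_less by (auto simp: power_le_one)

text \<open>\<open>y\<close> is closer to \<open>a\<close> than to \<open>b\<close>, so the
  subtracted part of the denominator cannot cancel the rest. The last bound comes from
  \<open>b - a = (1 - t) * (y - a) - mden m y\<close> with \<open>t = q^(2*m)\<close>, whose first
  summand is again at most the denominator in modulus. Its factor 2 becomes the 4 in
  \<open>norm_mob'\<close>, free of all radii.\<close>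

lemma norm_mden: "(1 - q^(2*m)) * norm (y - of_real a) \<le> norm (mden m y)" "mden m y \<noteq> 0"
    "b - a \<le> 2 * norm (mden m y)"
  if "norm y \<le> \<rho>" for y :: complex
proof -
  define t where "t = q^(2*m)"
  have t: "0 < t" "t \<le> 1" using qm by (auto simp: t_def)
  have d: "mden m y = (y - b) - of_real t * (y - a)" by (simp add: mden_def t_def)
  have 1: "norm (y - of_real b) - t * norm (y - of_real a) \<le> norm (mden m y)"
    unfolding d using norm_triangle_ineq2[of "y - b" "of_real t * (y - a)"] t by (simp add: norm_mult)
  have 2: "norm (y - of_real a) < norm (y - of_real b)" by (rule norm_a_less_b[OF that])
  have 3: "t * norm (y - of_real a) \<le> norm (y - of_real a)" using t by (simp add: mult_left_le_one_le)
  show "mden m y \<noteq> 0" using 1 2 3 by auto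
  show 4: "(1 - q^(2*m)) * norm (y - of_real a) \<le> norm (mden m y)" using 1 2 by (simp add: t_def algebra_simps)
  have "of_real (b - a) = of_real (1 - t) * (y - a) - mden m y" unfolding d by (simp add: algebra_simps)
  then have "norm (of_real (b - a) :: complex) \<le> norm (of_real (1 - t) * (y - a)) + norm (mden m y)"
    by (metis norm_triangle_ineq4)
  also have "norm (of_real (1 - t) * (y - a)) = (1 - t) * norm (y - of_real a)"
    unfolding norm_mult norm_of_real using t by simp
  finally have "\<bar>b - a\<bar> \<le> (1 - t) * norm (y - of_real a) + norm (mden m y)" unfolding norm_of_real .
  then show "b - a \<le> 2 * norm (mden m y)" using 4 unfolding t_def by linarith
qed

lemma norm_mob': "norm (mob' m y) \<le> 4 * q^(2*m)" if "norm y \<le> \<rho>" for y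
proof -
  have "b - a > 0" using a_less b_gt by simp
  then have "(b - a)\<^sup>2 \<le> (2 * norm (mden m y))\<^sup>2" using norm_mden(3)[OF that, of m] by (intro power_mono) auto
  moreover have "norm (mden m y) > 0" using norm_mden(2)[OF that] by simp
  ultimately have "(b - a)\<^sup>2 / (norm (mden m y))\<^sup>2 \<le> 4" by (simp add: field_simps)
  then have "q^(2*m) * ((b - a)\<^sup>2 / (norm (mden m y))\<^sup>2) \<le> q^(2*m) * 4"
    using qm[of m] by (intro mult_left_mono) auto
  moreover have "norm (mob' m y) = q^(2*m) * ((b - a)\<^sup>2 / (norm (mden m y))\<^sup>2)"
    unfolding mob'_def norm_divide norm_mult norm_power norm_of_real using q_pos
    by (simp flip: of_real_diff)
  ultimately show ?thesis by simp
qed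

lemma mob_has_derivative: "(mob m has_field_derivative mob' m y) (at y within S)" if "norm y \<le> \<rho>" for y
proof -
  have nz: "mden m y \<noteq> 0" by (rule norm_mden(2)[OF that])
  have "(mob m has_field_derivative
     ((of_real a - of_real (q^(2*m) * b)) * mden m y - (of_real a * (y - of_real b) - of_real (q^(2*m) * b) * (y - of_real a)) * (1 - of_real (q^(2*m)))) / (mden m y)\<^sup>2) (at y within S)"
    unfolding mob_def[abs_def] using nz unfolding mden_def
    by (auto intro!: derivative_eq_intros simp: power2_eq_square)
  also have "((of_real a - of_real (q^(2*m) * b)) * mden m y - (of_real a * (y - of_real b) - of_real (q^(2*m) * b) * (y - of_real a)) * (1 - of_real (q^(2*m)))) =
      of_real (q^(2*m)) * of_real ((b - a)\<^sup>2)"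
    unfolding mden_def by (simp add: power2_eq_square algebra_simps)
  finally show ?thesis by (simp add: mob'_def)
qed

lemma continuous_mob': "continuous_on (cball 0 \<rho>) (mob' m)"
  unfolding mob'_def[abs_def] using norm_mden(2)
  by (intro continuous_intros) (auto simp: mden_def[abs_def] intro!: continuous_intros)

lemma mob_0: "mob 0 y = y"
proof -
  have "of_real a - of_real b \<noteq> (0::complex)" using a_less b_gt by simp
  moreover have "mden 0 y = of_real a - of_real b" by (simp add: mden_def)
  moreover have "of_real a * (y - of_real b) - of_real (q^(2*0) * b) * (y - of_real a) = (of_real a - of_real b) * y"
    by (simp add: algebra_simps)
  ultimately show ?thesis by (simp add: mob_def)
qed

text \<open>\<open>T y - a\<close> and \<open>T y - b\<close> carry the common factor
  \<open>B / w\<close>, which cancels from the quotient, and leave a factor \<open>q\<^sup>2\<close>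
  at \<open>y - a\<close>.\<close>

lemma mob_Suc: "mob (Suc m) y = mob m (T y)" if "norm y \<le> \<rho>" for y
proof -
  define w where "w = (of_real (\<rho>\<^sup>2) - of_real L * y)"
  define B where "B = (of_real (\<rho> * r / q) :: complex)"
  have w: "w \<noteq> 0" using T_den_nz[OF that] by (simp add: w_def)
  have B: "B \<noteq> 0" using rho_pos r_pos q_pos by (simp add: B_def)
  have qB: "of_real (\<rho> * r * q) = of_real (q\<^sup>2) * B" using q_pos by (simp add: B_def power2_eq_square)
  have 1: "T y - of_real a = of_real (q\<^sup>2) * B * (y - of_real a) / w"
    using T_minus_a[OF that, folded w_def, unfolded qB] w by (simp add: eq_divide_eq)
  have 2: "T y - of_real b = B * (y - of_real b) / w"
    using T_minus_b[OF that, folded w_def B_def] w by (simp add: eq_divide_eq)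
  have alg: "p * (B * X / w) - t * (s * B * Y / w) = B / w * (p * X - (s * t) * Y)" for X Y p t s :: complex
    by (simp add: divide_inverse algebra_simps)
  have t1: "of_real (q^(2*Suc m)) = of_real (q\<^sup>2) * (of_real (q^(2*m)) :: complex)"
    and t2: "of_real (q^(2*Suc m) * b) = of_real (q\<^sup>2) * (of_real (q^(2*m) * b) :: complex)"
    by (simp_all add: power2_eq_square)
  have "mden m (T y) = B / w * mden (Suc m) y"
    unfolding mden_def 1 2 t1 using alg[of 1] by simp
  moreover have "of_real a * (T y - of_real b) - of_real (q^(2*m) * b) * (T y - of_real a) =
      B / w * (of_real a * (y - of_real b) - of_real (q^(2*Suc m) * b) * (y - of_real a))"
    unfolding 1 2 t2 by (rule alg)
  ultimately show ?thesis using B w by (simp add: mob_def)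
qed

lemma norm_mob: "norm y \<le> \<rho> \<Longrightarrow> norm (mob m y) \<le> \<rho>" "norm y < \<rho> \<Longrightarrow> norm (mob m y) < \<rho>"
    "norm y \<le> \<rho> \<Longrightarrow> norm (mob (Suc m) y) < \<rho>"
proof -
  have 1: "norm y < \<rho> \<Longrightarrow> norm (mob m y) < \<rho>" for y m
    by (induction m arbitrary: y) (auto simp: mob_0 mob_Suc T_norm)
  show "norm y < \<rho> \<Longrightarrow> norm (mob m y) < \<rho>" by (rule 1)
  show "norm y \<le> \<rho> \<Longrightarrow> norm (mob (Suc m) y) < \<rho>" using 1[of "T y"] T_norm[of y] by (simp add: mob_Suc)
  then show "norm y \<le> \<rho> \<Longrightarrow> norm (mob m y) \<le> \<rho>"
    using 1[of "T y" "m - 1"] T_norm[of y] by (cases m) (auto simp: mob_0 mob_Suc intro: less_imp_le)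
qed

text \<open>With \<open>u = b - y\<close> and \<open>v = y - a\<close> the iterate is the mean of
  \<open>a\<close> and \<open>b\<close> with weights \<open>u\<close> and \<open>t * v\<close>. For
  \<open>t = 1\<close> this is \<open>y\<close> itself, and lowering \<open>t\<close> moves it
  towards \<open>a\<close>.\<close>

lemma mob_axis:
  assumes y: "a \<le> y" "y \<le> \<rho>"
  obtains y' where "a \<le> y'" "y' \<le> y" "mob m (of_real y) = of_real y'"
proof -
  define t where "t = q^(2*m)"
  define u v where "u = b - y" and "v = y - a"
  have t: "0 < t" "t \<le> 1" using qm by (auto simp: t_def)
  have uv: "u > 0" "v \<ge> 0" using y b_gt by (auto simp: u_def v_def)
  have d: "u + t * v > 0" using uv t by (simp add: add_pos_nonneg)
  define y' where "y' = (a * u + t * b * v) / (u + t * v)"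
  have md: "mden m (of_real y) = of_real (- (u + t * v))" by (simp add: mden_def u_def v_def t_def)
  have num: "of_real a * (of_real y - of_real b) - of_real (q^(2*m) * b) * (of_real y - of_real a) =
      (of_real (- (a * u + t * b * v)) :: complex)"
    by (simp add: u_def v_def t_def algebra_simps)
  have "mob m (of_real y) = of_real ((- (a * u + t * b * v)) / (- (u + t * v)))"
    unfolding mob_def md num by (simp only: of_real_divide)
  then have 1: "mob m (of_real y) = of_real y'" unfolding y'_def minus_divide_divide .
  have "a * (u + t * v) \<le> a * u + t * b * v"
    using t uv a_less b_gt by (simp add: algebra_simps mult_left_mono mult_right_mono)
  then have 2: "a \<le> y'" using d by (simp add: y'_def field_simps)
  have "y * (u + t * v) - (a * u + t * b * v) = v * u * (1 - t)"
    by (simp add: u_def v_def algebra_simps)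
  moreover have "v * u * (1 - t) \<ge> 0" using uv t by simp
  ultimately have 3: "y' \<le> y" using d by (simp add: y'_def field_simps)
  from that[OF 2 3 1] show ?thesis .
qed

text \<open>The derivative is \<open>t * ((u + v) / (u + t * v))\<^sup>2\<close> and
  \<open>t\<close> is at most 1. On the axis this matches the upper bound \<open>norm_mob'\<close>
  up to the factor 4.\<close>

lemma mob'_axis:
  assumes y: "a \<le> y" "y \<le> \<rho>"
  obtains d where "q^(2*m) \<le> d" "mob' m (of_real y) = of_real d"
proof -
  define t where "t = q^(2*m)"
  define u v where "u = b - y" and "v = y - a"
  have t: "0 < t" "t \<le> 1" using qm by (auto simp: t_def)
  have uv: "u > 0" "v \<ge> 0" using y b_gt by (auto simp: u_def v_def)
  have d: "u + t * v > 0" using uv t by (simp add: add_pos_nonneg)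
  have md: "mden m (of_real y) = of_real (- (u + t * v))" by (simp add: mden_def u_def v_def t_def)
  have bu: "b - a = u + v" by (simp add: u_def v_def)
  have "mob' m (of_real y) = of_real (t * (u + v)\<^sup>2 / (- (u + t * v))\<^sup>2)"
    unfolding mob'_def md bu by (simp only: t_def of_real_divide of_real_power)
  then have 1: "mob' m (of_real y) = of_real (t * ((u + v)\<^sup>2 / (u + t * v)\<^sup>2))"
    unfolding power2_minus by simp
  have "t * v \<le> v" using uv t by (simp add: mult_left_le_one_le)
  then have "(u + t * v)\<^sup>2 \<le> (u + v)\<^sup>2" using d by (intro power_mono) auto
  then have "1 \<le> (u + v)\<^sup>2 / (u + t * v)\<^sup>2" using d by simp
  then have "t * 1 \<le> t * ((u + v)\<^sup>2 / (u + t * v)\<^sup>2)" using t by (intro mult_left_mono) auto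
  with 1 show ?thesis using that by (simp add: t_def)
qed

text \<open>At a fixed point other than \<open>a\<close> and \<open>b\<close> the denominator of
  \<open>T\<close> would equal both eigenvalues, which differ; \<open>b\<close> lies outside the
  disk.\<close>

lemma fixed_point_T: "y = a" if "norm y \<le> \<rho>" "T y = y" for y
proof (rule ccontr)
  assume "y \<noteq> a"
  have b: "y \<noteq> b" using that b_gt rho_pos by auto
  have w: "of_real (\<rho>\<^sup>2) - of_real L * y = of_real (\<rho> * r * q)"
    using T_minus_a[OF that(1), unfolded that(2) mult.commute[of "y - of_real a"]] \<open>y \<noteq> a\<close>
    by (metis mult_right_cancel right_minus_eq)
  have w': "of_real (\<rho>\<^sup>2) - of_real L * y = of_real (\<rho> * r / q)"
    using T_minus_b[OF that(1), unfolded that(2) mult.commute[of "y - of_real b"]] b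
    by (metis mult_right_cancel right_minus_eq)
  have "\<rho> * r * q = \<rho> * r / q" using w w' by (metis of_real_eq_iff)
  then have "q * q = 1" using rho_pos r_pos q_pos by (simp add: field_simps)
  moreover have "q * q < 1 * 1" using q_pos q_less by (intro mult_strict_mono) auto
  ultimately show False by simp
qed

section \<open>The multiplier in terms of the gap\<close>

lemma one_minus_q: "\<rho> * r * (1 - q)\<^sup>2 = q * ((\<rho> - r)\<^sup>2 - L\<^sup>2)"
  using q_eq by (simp add: power2_eq_square algebra_simps)

text \<open>\<open>x\<close> stands for \<open>r_star \<rho> r * sqrt \<epsilon>\<close>. By
  \<open>one_minus_q\<close> the square of \<open>1 - q\<close> is
  \<open>q * (\<rho> - r - L) * (\<rho> - r + L) / (\<rho> * r)\<close>, where
  \<open>\<rho> - r + L\<close> lies between \<open>\<rho> - r\<close> and twice that. So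
  \<open>1 - q\<close> is of the order of the square root of the gap.\<close>

lemma multiplier_bounds:
  fixes x :: real
  assumes x: "0 \<le> x" "\<rho> * r * x\<^sup>2 = (\<rho> - r) * (\<rho> - r - L)"
  shows "1 - q\<^sup>2 \<le> 4 * x" and "x \<le> 1 \<Longrightarrow> x / 2 \<le> 1 - q\<^sup>2"
proof -
  have pr: "0 < \<rho> * r" using rho_pos r_pos by simp
  have f: "(\<rho> - r)\<^sup>2 - L\<^sup>2 = (\<rho> - r - L) * (\<rho> - r + L)" by (simp add: power2_eq_square algebra_simps)
  have g: "\<rho> - r - L > 0" using gap by simp
  have "(1 - q)\<^sup>2 \<le> (2 * x)\<^sup>2"
  proof -
    have "q * ((\<rho> - r - L) * (\<rho> - r + L)) \<le> 1 * ((\<rho> - r - L) * (2 * (\<rho> - r)))"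
      using q_pos q_less g L_pos by (intro mult_mono) auto
    then have "\<rho> * r * (1 - q)\<^sup>2 \<le> 2 * (\<rho> * r * x\<^sup>2)"
      unfolding one_minus_q f x(2) by (simp add: algebra_simps)
    then have "\<rho> * r * (1 - q)\<^sup>2 \<le> \<rho> * r * (2 * x\<^sup>2)" by simp
    then have "(1 - q)\<^sup>2 \<le> 2 * x\<^sup>2" using pr by (simp only: mult_le_cancel_left_pos)
    moreover have "2 * x\<^sup>2 \<le> (2 * x)\<^sup>2" by (simp add: power_mult_distrib)
    ultimately show ?thesis by linarith
  qed
  then have 1: "1 - q \<le> 2 * x" by (rule power2_le_imp_le) (use x in simp)
  have fac: "1 - q\<^sup>2 = (1 - q) * (1 + q)" by (simp add: power2_eq_square algebra_simps)
  have "(1 - q) * (1 + q) \<le> (2 * x) * 2" using 1 q_pos q_less x by (intro mult_mono) auto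
  then show "1 - q\<^sup>2 \<le> 4 * x" unfolding fac by simp
  assume x1: "x \<le> 1"
  have low: "1 - q \<le> 1 - q\<^sup>2" unfolding fac using q_pos q_less by simp
  show "x / 2 \<le> 1 - q\<^sup>2"
  \<comment> \<open>A small \<open>q\<close> makes \<open>1 - q\<close> at least 1/2, and
    \<open>x \<le> 1\<close> finishes. Otherwise the factor \<open>q\<close> in the identity is at
    least 1/4 and the squares can be compared.\<close>
  proof (cases "q \<le> 1/2")
    case True
    then show ?thesis using low x1 by simp
  next
    case False
    have "q * ((\<rho> - r - L) * (\<rho> - r)) \<le> q * ((\<rho> - r - L) * (\<rho> - r + L))"
      using q_pos g L_pos by (intro mult_left_mono) auto
    moreover have "\<rho> * r * (q * x\<^sup>2) = q * ((\<rho> - r - L) * (\<rho> - r))"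
      using arg_cong[OF x(2), of "\<lambda>z. q * z"] by (simp only: mult_ac)
    ultimately have "\<rho> * r * (q * x\<^sup>2) \<le> \<rho> * r * (1 - q)\<^sup>2"
      unfolding one_minus_q f by (simp only:)
    then have "q * x\<^sup>2 \<le> (1 - q)\<^sup>2" using pr by (simp only: mult_le_cancel_left_pos)
    moreover have "(x/2)\<^sup>2 \<le> q * x\<^sup>2"
    proof -
      have "(1/4) * x\<^sup>2 \<le> q * x\<^sup>2" using False by (intro mult_right_mono) auto
      then show ?thesis by (simp add: power_divide)
    qed
    ultimately have "(x/2)\<^sup>2 \<le> (1 - q)\<^sup>2" by linarith
    then have "x/2 \<le> 1 - q" by (rule power2_le_imp_le) (use q_less in simp)
    then show ?thesis using low by simp
  qed
qed

end

section \<open>Lipschitz functions tested against C1 functions\<close>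

lemma continuous_borel_lebesgue:
  fixes f :: "complex \<Rightarrow> 'a::{real_normed_vector,second_countable_topology}"
  assumes "continuous_on UNIV f" shows "f \<in> borel_measurable lebesgue"
  using continuous_imp_measurable_on_sets_lebesgue[OF assms] unfolding lebesgue_on_UNIV_eq by simp

lemma integrable_compact_support:
  fixes f :: "complex \<Rightarrow> 'a::{banach,second_countable_topology}"
  assumes f: "continuous_on UNIV f" and K: "compact K" "\<And>x. x \<notin> K \<Longrightarrow> f x = 0"
  shows "integrable lebesgue f"
proof -
  have "integrable lborel (\<lambda>x. indicat_real K x *\<^sub>R f x)"
    by (rule borel_integrable_compact[OF K(1)]) (rule continuous_on_subset[OF f], simp)
  also have "(\<lambda>x. indicat_real K x *\<^sub>R f x) = f" using K(2) by (auto simp: indicator_def)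
  finally show ?thesis
    using f by (subst integrable_completion) (auto intro: borel_measurable_continuous_onI)
qed

lemma lebesgue_integral_translate:
  fixes f :: "complex \<Rightarrow> 'a::{banach,second_countable_topology}"
  assumes f: "continuous_on UNIV f"
  shows "(LINT x|lebesgue. f (x + v)) = integral\<^sup>L lebesgue f"
proof -
  have m: "f \<in> borel_measurable borel" using f by (rule borel_measurable_continuous_onI)
  have m': "(\<lambda>x. f (x + v)) \<in> borel_measurable borel"
    by (rule borel_measurable_continuous_onI) (auto intro!: continuous_intros continuous_on_compose2[OF f])
  have "integral\<^sup>L lborel f = integral\<^sup>L (distr lborel borel ((+) v)) f" by (simp add: lborel_distr_plus)
  also have "\<dots> = (LINT x|lborel. f (v + x))" by (rule integral_distr) (use m in auto)
  finally show ?thesis using m m' by (simp add: integral_completion add.commute[of v])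
qed

text \<open>Summation by parts for integrals: translation invariance moves the shift from \<phi> to
  \<open>W\<close>.\<close>

lemma difference_parts:
  fixes W \<phi> :: "complex \<Rightarrow> real"
  assumes W: "continuous_on UNIV W" and \<phi>: "continuous_on UNIV \<phi>" and K: "compact K" "\<And>x. x \<notin> K \<Longrightarrow> \<phi> x = 0"
  shows "(LINT x|lebesgue. W x * (\<phi> x - \<phi> (x - v))) = - (LINT x|lebesgue. (W (x + v) - W x) * \<phi> x)"
proof -
  have c1: "continuous_on UNIV (\<lambda>x. W (x + v))" "continuous_on UNIV (\<lambda>x. \<phi> (x - v))"
    by (auto intro!: continuous_intros continuous_on_compose2[OF W] continuous_on_compose2[OF \<phi>])
  have i1: "integrable lebesgue (\<lambda>x. W x * \<phi> x)"
    by (rule integrable_compact_support[of _ K]) (use K in \<open>auto intro!: continuous_intros W \<phi>\<close>)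
  have i2: "integrable lebesgue (\<lambda>x. W (x + v) * \<phi> x)"
    by (rule integrable_compact_support[of _ K]) (use K in \<open>auto intro!: continuous_intros c1 \<phi>\<close>)
  have i3: "integrable lebesgue (\<lambda>x. W x * \<phi> (x - v))"
  proof (rule integrable_compact_support)
    show "compact ((\<lambda>x. x + v) ` K)" using K by (intro compact_continuous_image continuous_intros)
    fix x assume "x \<notin> (\<lambda>x. x + v) ` K"
    then have "x - v \<notin> K" by (metis diff_add_cancel image_eqI)
    then show "W x * \<phi> (x - v) = 0" using K by simp
  qed (auto intro!: continuous_intros c1 W)
  have "(LINT x|lebesgue. W x * \<phi> (x - v)) = (LINT x|lebesgue. W (x + v) * \<phi> x)"
    using lebesgue_integral_translate[of "\<lambda>x. W x * \<phi> (x - v)" v] by (simp add: continuous_intros c1 W)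
  then show ?thesis
    using i1 i2 i3 by (simp add: right_diff_distrib left_diff_distrib)
qed

lemma GDERIV_quotient_tendsto:
  fixes f :: "complex \<Rightarrow> real"
  assumes f: "GDERIV f x :> D" and k: "k \<longlonglongrightarrow> (0::real)" "\<And>n. k n \<noteq> 0"
  shows "(\<lambda>n. (f (x + k n *\<^sub>R v) - f x) / k n) \<longlonglongrightarrow> v \<bullet> D"
proof -
  have "((\<lambda>t::real. x + t *\<^sub>R v) has_derivative (\<lambda>t. t *\<^sub>R v)) (at 0)"
    by (auto intro!: derivative_eq_intros)
  then have "((\<lambda>t. f (x + t *\<^sub>R v)) has_derivative (\<lambda>t. (t *\<^sub>R v) \<bullet> D)) (at 0)"
    using has_derivative_compose[of "\<lambda>t::real. x + t *\<^sub>R v" "\<lambda>t. t *\<^sub>R v" 0 UNIV f "\<lambda>h. h \<bullet> D"] f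
    by (simp add: gderiv_def)
  then have "((\<lambda>t. f (x + t *\<^sub>R v)) has_real_derivative v \<bullet> D) (at 0)"
    unfolding has_field_derivative_def by (rule has_derivative_eq_rhs) (simp add: fun_eq_iff mult.commute)
  then have "((\<lambda>t. (f (x + t *\<^sub>R v) - f x) / t) \<longlongrightarrow> v \<bullet> D) (at 0)"
    by (simp add: DERIV_def)
  moreover have "filterlim k (at 0) sequentially"
    using k by (intro filterlim_atI) auto
  ultimately show ?thesis by (rule filterlim_compose)
qed

lemma test_functionD:
  assumes "test_function S \<phi> \<phi>'"
  obtains K where "compact K" "K \<subseteq> S" "\<And>x. x \<notin> K \<Longrightarrow> \<phi> x = 0" "\<And>x. x \<notin> K \<Longrightarrow> \<phi>' x = 0"
proof -
  define K where "K = closure {X. \<phi> X \<noteq> 0}"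
  have t: "\<And>X. GDERIV \<phi> X :> \<phi>' X" "compact K" "K \<subseteq> S" using assms by (auto simp: test_function_def K_def)
  have z: "\<phi> x = 0" if "x \<notin> K" for x using that closure_subset[of "{X. \<phi> X \<noteq> 0}"] by (auto simp: K_def)
  have z': "\<phi>' x = 0" if "x \<notin> K" for x
  proof -
    have op: "open (- K)" using t(2) compact_imp_closed by (simp add: open_closed)
    have "((\<lambda>x. 0::real) has_derivative (\<lambda>h. 0)) (at x)" by simp
    then have "(\<phi> has_derivative (\<lambda>h. 0)) (at x)"
      by (rule has_derivative_transform_within_open[OF _ op]) (use that z in auto)
    then have "(\<lambda>h. h \<bullet> \<phi>' x) = (\<lambda>h. 0)"
      using t(1)[of x] unfolding gderiv_def by (rule has_derivative_unique[rotated])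
    then have "\<phi>' x \<bullet> \<phi>' x = 0" by (rule fun_cong)
    then show ?thesis by simp
  qed
  show thesis by (rule that[of K]) (fact t(2) t(3) z z')+
qed

lemma test_function_continuous:
  assumes "test_function S \<phi> \<phi>'" shows "continuous_on UNIV \<phi>"
proof -
  have "isCont \<phi> x" for x
    using assms unfolding test_function_def gderiv_def by (intro has_derivative_continuous) auto
  then show ?thesis by (simp add: continuous_at_imp_continuous_on)
qed

lemma test_function_lipschitz:
  assumes t: "test_function S \<phi> \<phi>'"
  obtains M where "M \<ge> 0" "\<And>x y. \<bar>\<phi> x - \<phi> y\<bar> \<le> M * norm (x - y)" "\<And>x. norm (\<phi>' x) \<le> M"
proof -
  obtain K where K: "compact K" "\<And>x. x \<notin> K \<Longrightarrow> \<phi>' x = 0" using test_functionD[OF t] by metis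
  have "continuous_on K \<phi>'" using t by (auto simp: test_function_def intro: continuous_on_subset)
  then have "bounded (\<phi>' ` K)" using K by (simp add: compact_continuous_image compact_imp_bounded)
  then obtain M where M: "M > 0" "\<And>x. x \<in> K \<Longrightarrow> norm (\<phi>' x) \<le> M" by (auto simp: bounded_pos)
  have b: "norm (\<phi>' x) \<le> M" for x using M K(2)[of x] by (cases "x \<in> K") auto
  have l: "\<bar>\<phi> x - \<phi> y\<bar> \<le> M * norm (x - y)" for x y
  proof -
    have "norm (\<phi> x - \<phi> y) \<le> M * norm (x - y)"
    proof (rule differentiable_bound[of UNIV \<phi> "\<lambda>x h. h \<bullet> \<phi>' x"])
      show "onorm (\<lambda>h. h \<bullet> \<phi>' x) \<le> M" for x
      proof (rule onorm_le)
        fix h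
        have "norm (h \<bullet> \<phi>' x) \<le> norm h * norm (\<phi>' x)" using Cauchy_Schwarz_ineq2 by simp
        also have "\<dots> \<le> norm h * M" by (intro mult_left_mono b) auto
        finally show "norm (h \<bullet> \<phi>' x) \<le> M * norm h" by (simp add: mult.commute)
      qed
    qed (use t in \<open>auto simp: test_function_def gderiv_def\<close>)
    then show ?thesis by simp
  qed
  show thesis by (rule that[of M]) (use M(1) l b in auto)
qed

text \<open>Integration by parts holds exactly for difference quotients, and the Lipschitz bound allows passing to
  the limit by dominated convergence.\<close>

locale lipschitz_grad =
  fixes S :: "complex set" and W :: "complex \<Rightarrow> real" and D :: "complex \<Rightarrow> complex" and C :: real
  assumes lip: "\<And>x y. \<bar>W x - W y\<bar> \<le> C * norm (x - y)"
    and grad: "AE x in lebesgue. x \<in> S \<longrightarrow> GDERIV W x :> D x"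
    and meas: "D \<in> borel_measurable (lebesgue_on S)" and S: "S \<in> sets lebesgue"
begin

lemma C_nonneg: "0 \<le> C" using order_trans[OF abs_ge_zero lip[of 1 0]] by simp

lemma cont: "continuous_on UNIV W"
proof -
  have "C-lipschitz_on UNIV W" using lip C_nonneg by (auto simp: lipschitz_on_def dist_real_def dist_norm)
  then show ?thesis by (rule lipschitz_on_continuous_on)
qed

lemma meas_inner: "(\<lambda>x. indicator S x * (v \<bullet> D x)) \<in> borel_measurable lebesgue"
proof -
  have "(\<lambda>x. v \<bullet> D x) \<in> borel_measurable (lebesgue_on S)" using meas by simp
  then have "(\<lambda>x. if x \<in> S then v \<bullet> D x else 0) \<in> borel_measurable lebesgue" using S by (simp add: borel_measurable_if)
  also have "(\<lambda>x. if x \<in> S then v \<bullet> D x else 0) = (\<lambda>x. indicator S x * (v \<bullet> D x))" by (auto simp: indicator_def)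
  finally show ?thesis .
qed

lemma quot_W: "\<bar>(W (x + h *\<^sub>R v) - W x) / h\<bar> \<le> C * norm v" if "h > 0"
proof -
  have "\<bar>W (x + h *\<^sub>R v) - W x\<bar> \<le> C * norm v * h"
    using lip[of "x + h *\<^sub>R v" x] that by (simp add: mult.assoc mult.commute[of h])
  then show ?thesis using that by (simp add: pos_divide_le_eq)
qed

text \<open>One compact set carries all difference quotients of step at most 1, so its indicator
  serves as integrable majorant for the whole sequence.\<close>

lemma enlarged_support:
  fixes w :: complex and \<phi> :: "complex \<Rightarrow> real"
  assumes K: "compact K" "\<And>x. x \<notin> K \<Longrightarrow> \<phi> x = 0"
  obtains K' where "compact K'" "K \<subseteq> K'" "\<And>x h. 0 \<le> h \<Longrightarrow> h \<le> 1 \<Longrightarrow> x \<notin> K' \<Longrightarrow> \<phi> (x - h *\<^sub>R w) = (0::real)"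
proof -
  obtain R where R: "\<And>x. x \<in> K \<Longrightarrow> norm x \<le> R" using compact_imp_bounded[OF K(1)] by (auto simp: bounded_iff)
  have "\<phi> (x - h *\<^sub>R w) = 0" if "0 \<le> h" "h \<le> 1" "x \<notin> cball 0 (R + norm w)" for x h
  proof (rule K(2))
    have "norm (h *\<^sub>R w) \<le> norm w" using that by (simp add: mult_left_le_one_le)
    then have "norm (x - h *\<^sub>R w) > R" using that(3) norm_triangle_ineq2[of x "h *\<^sub>R w"] unfolding mem_cball_0 by linarith
    then show "x - h *\<^sub>R w \<notin> K" using R[of "x - h *\<^sub>R w"] by linarith
  qed
  moreover have "K \<subseteq> cball 0 (R + norm w)"
  proof
    fix x assume "x \<in> K"
    then show "x \<in> cball 0 (R + norm w)" unfolding mem_cball_0 using R[of x] norm_ge_zero[of w] by linarith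
  qed
  ultimately show thesis by (intro that[of "cball 0 (R + norm w)"] compact_cball)
qed

lemma h_seq: "(\<lambda>n. inverse (real (Suc n))) \<longlonglongrightarrow> 0" "(\<lambda>n. - inverse (real (Suc n))) \<longlonglongrightarrow> 0"
    "0 < inverse (real (Suc n))" "inverse (real (Suc n)) \<le> 1"
proof -
  show "(\<lambda>n. - inverse (real (Suc n))) \<longlonglongrightarrow> 0" using tendsto_minus[OF LIMSEQ_inverse_real_of_nat] by simp
  show "inverse (real (Suc n)) \<le> 1" by (rule inverse_le_1_iff[THEN iffD2]) simp
qed (rule LIMSEQ_inverse_real_of_nat, simp)

lemma quot_\<phi>_tendsto:
  assumes "test_function S \<phi> \<phi>'"
  shows "(\<lambda>n. (\<phi> x - \<phi> (x - inverse (real (Suc n)) *\<^sub>R w)) / inverse (real (Suc n))) \<longlonglongrightarrow> w \<bullet> \<phi>' x"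
proof -
  have "(\<lambda>n. (\<phi> (x + (- inverse (real (Suc n))) *\<^sub>R w) - \<phi> x) / (- inverse (real (Suc n)))) \<longlonglongrightarrow> w \<bullet> \<phi>' x"
    using assms by (intro GDERIV_quotient_tendsto h_seq) (auto simp: test_function_def)
  moreover have "(\<phi> (x + (- inverse (real (Suc n))) *\<^sub>R w) - \<phi> x) / (- inverse (real (Suc n))) =
     (\<phi> x - \<phi> (x - inverse (real (Suc n)) *\<^sub>R w)) / inverse (real (Suc n))" for n
  proof -
    have "(a - b) / (- k) = (b - a) / k" for a b k :: real by (cases "k = 0") (auto simp: divide_simps)
    then show ?thesis by (simp only: scaleR_minus_left add_uminus_conv_diff)
  qed
  ultimately show ?thesis by simp
qed

lemma integration_by_parts:
  assumes t: "test_function S \<phi> \<phi>'"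
  shows "(LINT x|lebesgue. W x * (v \<bullet> \<phi>' x)) = - (LINT x|lebesgue. indicator S x * (v \<bullet> D x) * \<phi> x)"
proof -
  obtain K where K: "compact K" "K \<subseteq> S" "\<And>x. x \<notin> K \<Longrightarrow> \<phi> x = 0" "\<And>x. x \<notin> K \<Longrightarrow> \<phi>' x = 0"
    using test_functionD[OF t] by metis
  obtain M where M: "M \<ge> 0" "\<And>x y. \<bar>\<phi> x - \<phi> y\<bar> \<le> M * norm (x - y)" "\<And>x. norm (\<phi>' x) \<le> M"
    using test_function_lipschitz[OF t] by metis
  obtain K' where K': "compact K'" "K \<subseteq> K'" "\<And>x h. 0 \<le> h \<Longrightarrow> h \<le> 1 \<Longrightarrow> x \<notin> K' \<Longrightarrow> \<phi> (x - h *\<^sub>R v) = 0"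
    using enlarged_support[where w = v and \<phi> = \<phi>, OF K(1,3)] by metis
  have c\<phi>: "continuous_on UNIV \<phi>" by (rule test_function_continuous[OF t])
  have c\<phi>': "continuous_on UNIV \<phi>'" using t by (simp add: test_function_def)
  have bm: "K' \<in> sets lebesgue" using K'(1) by (simp add: compact_imp_closed)
  have fin: "emeasure lebesgue K' < \<infinity>" using lmeasurable_compact[OF K'(1)] by (auto simp: fmeasurable_def)
  define h where "h n = inverse (real (Suc n))" for n
  have h: "0 < h n" "h n \<le> 1" "h n \<noteq> 0" for n using h_seq by (auto simp: h_def)
  have cs: "continuous_on UNIV (\<lambda>x. \<phi> (x - u))" "continuous_on UNIV (\<lambda>x. W (x + u))" for u
    by (auto intro!: continuous_intros continuous_on_compose2[OF c\<phi>] continuous_on_compose2[OF cont])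
  have "bounded (W ` K')" using K'(1) cont
    by (meson compact_continuous_image compact_imp_bounded continuous_on_subset subset_UNIV)
  then obtain N where N: "\<And>x. x \<in> K' \<Longrightarrow> \<bar>W x\<bar> \<le> N" "N > 0" by (auto simp: bounded_pos)
  have L1: "(\<lambda>n. LINT x|lebesgue. W x * ((\<phi> x - \<phi> (x - h n *\<^sub>R v)) / h n)) \<longlonglongrightarrow> (LINT x|lebesgue. W x * (v \<bullet> \<phi>' x))"
  proof (rule integral_dominated_convergence[where w = "\<lambda>x. N * (M * norm v) * indicator K' x"])
    show "AE x in lebesgue. (\<lambda>n. W x * ((\<phi> x - \<phi> (x - h n *\<^sub>R v)) / h n)) \<longlonglongrightarrow> W x * (v \<bullet> \<phi>' x)"
      using quot_\<phi>_tendsto[OF t] by (intro AE_I2 tendsto_intros) (simp add: h_def)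
    show "AE x in lebesgue. norm (W x * ((\<phi> x - \<phi> (x - h n *\<^sub>R v)) / h n)) \<le> N * (M * norm v) * indicator K' x" for n
    proof (intro AE_I2)
      fix x
      show "norm (W x * ((\<phi> x - \<phi> (x - h n *\<^sub>R v)) / h n)) \<le> N * (M * norm v) * indicator K' x"
      proof (cases "x \<in> K'")
        case True
        have "\<bar>(\<phi> x - \<phi> (x - h n *\<^sub>R v)) / h n\<bar> \<le> M * norm v"
          using M(2)[of x "x - h n *\<^sub>R v"] h[of n] by (simp add: field_simps)
        then have "\<bar>W x\<bar> * \<bar>(\<phi> x - \<phi> (x - h n *\<^sub>R v)) / h n\<bar> \<le> N * (M * norm v)"
          using N True by (intro mult_mono) (auto simp: less_imp_le)
        then show ?thesis using True by (simp add: abs_mult)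
      next
        case False
        then have "\<phi> x = 0" "\<phi> (x - h n *\<^sub>R v) = 0" using K'(2) K'(3)[of "h n" x] h[of n] K(3) by (auto simp: less_imp_le)
        then show ?thesis using False by simp
      qed
    qed
    show "(\<lambda>x. W x * (v \<bullet> \<phi>' x)) \<in> borel_measurable lebesgue"
      by (intro continuous_borel_lebesgue continuous_intros cont c\<phi>')
    show "(\<lambda>x. W x * ((\<phi> x - \<phi> (x - h n *\<^sub>R v)) / h n)) \<in> borel_measurable lebesgue" for n
      by (intro continuous_borel_lebesgue continuous_intros cont c\<phi> cs) (simp add: h)
    show "integrable lebesgue (\<lambda>x. N * (M * norm v) * indicator K' x)"
      by (intro integrable_mult_right integrable_real_indicator bm fin)
  qed
  have L2: "(\<lambda>n. LINT x|lebesgue. ((W (x + h n *\<^sub>R v) - W x) / h n) * \<phi> x) \<longlonglongrightarrow> (LINT x|lebesgue. indicator S x * (v \<bullet> D x) * \<phi> x)"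
  proof (rule integral_dominated_convergence[where w = "\<lambda>x. C * norm v * \<bar>\<phi> x\<bar>"])
    show "AE x in lebesgue. (\<lambda>n. ((W (x + h n *\<^sub>R v) - W x) / h n) * \<phi> x) \<longlonglongrightarrow> indicator S x * (v \<bullet> D x) * \<phi> x"
      using grad
    proof (rule AE_mp, intro AE_I2 impI)
      fix x assume g: "x \<in> S \<longrightarrow> GDERIV W x :> D x"
      show "(\<lambda>n. ((W (x + h n *\<^sub>R v) - W x) / h n) * \<phi> x) \<longlonglongrightarrow> indicator S x * (v \<bullet> D x) * \<phi> x"
      proof (cases "x \<in> S")
        case True
        have "(\<lambda>n. (W (x + h n *\<^sub>R v) - W x) / h n) \<longlonglongrightarrow> v \<bullet> D x"
          using g True h_seq by (intro GDERIV_quotient_tendsto) (auto simp: h_def)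
        from tendsto_mult[OF this tendsto_const[of "\<phi> x"]] show ?thesis using True by simp
      next
        case False
        then have "\<phi> x = 0" using K by auto
        then show ?thesis by simp
      qed
    qed
    show "AE x in lebesgue. norm (((W (x + h n *\<^sub>R v) - W x) / h n) * \<phi> x) \<le> C * norm v * \<bar>\<phi> x\<bar>" for n
    proof (intro AE_I2)
      fix x show "norm (((W (x + h n *\<^sub>R v) - W x) / h n) * \<phi> x) \<le> C * norm v * \<bar>\<phi> x\<bar>"
        unfolding real_norm_def abs_mult by (intro mult_right_mono quot_W h) auto
    qed
    show "integrable lebesgue (\<lambda>x. C * norm v * \<bar>\<phi> x\<bar>)"
      by (rule integrable_compact_support[OF _ K(1)]) (use K(3) in \<open>auto intro!: continuous_intros c\<phi>\<close>)
    show "(\<lambda>x. indicator S x * (v \<bullet> D x) * \<phi> x) \<in> borel_measurable lebesgue"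
      by (intro borel_measurable_times meas_inner continuous_borel_lebesgue c\<phi>)
    show "(\<lambda>x. (W (x + h n *\<^sub>R v) - W x) / h n * \<phi> x) \<in> borel_measurable lebesgue" for n
      by (intro continuous_borel_lebesgue continuous_intros cont c\<phi> cs) (simp add: h)
  qed
  have "(LINT x|lebesgue. W x * ((\<phi> x - \<phi> (x - h n *\<^sub>R v)) / h n)) = - (LINT x|lebesgue. ((W (x + h n *\<^sub>R v) - W x) / h n) * \<phi> x)" for n
  proof -
    have "(LINT x|lebesgue. W x * ((\<phi> x - \<phi> (x - h n *\<^sub>R v)) / h n)) = (LINT x|lebesgue. W x * (\<phi> x - \<phi> (x - h n *\<^sub>R v)) / h n)"
      by simp
    also have "\<dots> = (LINT x|lebesgue. W x * (\<phi> x - \<phi> (x - h n *\<^sub>R v))) / h n" by (rule integral_divide_zero)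
    also have "\<dots> = - ((LINT x|lebesgue. (W (x + h n *\<^sub>R v) - W x) * \<phi> x) / h n)"
      proof -
      have "(LINT x|lebesgue. W x * (\<phi> x - \<phi> (x - h n *\<^sub>R v))) = - (LINT x|lebesgue. (W (x + h n *\<^sub>R v) - W x) * \<phi> x)"
        by (rule difference_parts[OF cont c\<phi> K(1)]) (rule K(3))
      then show ?thesis by (simp only: minus_divide_left)
    qed
    also have "(LINT x|lebesgue. (W (x + h n *\<^sub>R v) - W x) * \<phi> x) / h n = (LINT x|lebesgue. (W (x + h n *\<^sub>R v) - W x) * \<phi> x / h n)"
      by (rule integral_divide_zero[symmetric])
    finally show ?thesis by simp
  qed
  then have "(\<lambda>n. LINT x|lebesgue. W x * ((\<phi> x - \<phi> (x - h n *\<^sub>R v)) / h n)) \<longlonglongrightarrow> - (LINT x|lebesgue. indicator S x * (v \<bullet> D x) * \<phi> x)"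
    using tendsto_minus[OF L2] by simp
  with L1 show ?thesis by (rule LIMSEQ_unique)
qed

lemma null_lagrangian_aux:
  assumes t: "test_function S \<phi> \<phi>'"
  shows "(\<lambda>n. LINT x|lebesgue. ((W (x + inverse (real (Suc n)) *\<^sub>R v) - W x) / inverse (real (Suc n))) *
      ((\<phi> x - \<phi> (x - inverse (real (Suc n)) *\<^sub>R w)) / inverse (real (Suc n))))
      \<longlonglongrightarrow> (LINT x|lebesgue. indicator S x * (v \<bullet> D x) * (w \<bullet> \<phi>' x))"
proof -
  obtain K where K: "compact K" "K \<subseteq> S" "\<And>x. x \<notin> K \<Longrightarrow> \<phi> x = 0" "\<And>x. x \<notin> K \<Longrightarrow> \<phi>' x = 0"
    using test_functionD[OF t] by metis
  obtain M where M: "M \<ge> 0" "\<And>x y. \<bar>\<phi> x - \<phi> y\<bar> \<le> M * norm (x - y)" "\<And>x. norm (\<phi>' x) \<le> M"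
    using test_function_lipschitz[OF t] by metis
  obtain K' where K': "compact K'" "K \<subseteq> K'" "\<And>x h. 0 \<le> h \<Longrightarrow> h \<le> 1 \<Longrightarrow> x \<notin> K' \<Longrightarrow> \<phi> (x - h *\<^sub>R w) = 0"
    using enlarged_support[where w = w and \<phi> = \<phi>, OF K(1,3)] by metis
  have c\<phi>: "continuous_on UNIV \<phi>" by (rule test_function_continuous[OF t])
  have c\<phi>': "continuous_on UNIV \<phi>'" using t by (simp add: test_function_def)
  have bm: "K' \<in> sets lebesgue" using K'(1) by (simp add: compact_imp_closed)
  have fin: "emeasure lebesgue K' < \<infinity>" using lmeasurable_compact[OF K'(1)] by (auto simp: fmeasurable_def)
  define h where "h n = inverse (real (Suc n))" for n
  have h: "0 < h n" "h n \<le> 1" "h n \<noteq> 0" for n using h_seq by (auto simp: h_def)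
  have cs: "continuous_on UNIV (\<lambda>x. \<phi> (x - u))" "continuous_on UNIV (\<lambda>x. W (x + u))" for u
    by (auto intro!: continuous_intros continuous_on_compose2[OF c\<phi>] continuous_on_compose2[OF cont])
  have "(\<lambda>n. LINT x|lebesgue. ((W (x + h n *\<^sub>R v) - W x) / h n) * ((\<phi> x - \<phi> (x - h n *\<^sub>R w)) / h n))
      \<longlonglongrightarrow> (LINT x|lebesgue. indicator S x * (v \<bullet> D x) * (w \<bullet> \<phi>' x))"
  proof (rule integral_dominated_convergence[where w = "\<lambda>x. (C * norm v) * (M * norm w) * indicator K' x"])
    show "AE x in lebesgue. (\<lambda>n. ((W (x + h n *\<^sub>R v) - W x) / h n) * ((\<phi> x - \<phi> (x - h n *\<^sub>R w)) / h n))
       \<longlonglongrightarrow> indicator S x * (v \<bullet> D x) * (w \<bullet> \<phi>' x)"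
      using grad
    proof (rule AE_mp, intro AE_I2 impI)
      fix x assume g: "x \<in> S \<longrightarrow> GDERIV W x :> D x"
      have q: "(\<lambda>n. (\<phi> x - \<phi> (x - h n *\<^sub>R w)) / h n) \<longlonglongrightarrow> w \<bullet> \<phi>' x"
        using quot_\<phi>_tendsto[OF t] by (simp add: h_def)
      show "(\<lambda>n. ((W (x + h n *\<^sub>R v) - W x) / h n) * ((\<phi> x - \<phi> (x - h n *\<^sub>R w)) / h n))
       \<longlonglongrightarrow> indicator S x * (v \<bullet> D x) * (w \<bullet> \<phi>' x)"
      proof (cases "x \<in> S")
        case True
        have "(\<lambda>n. (W (x + h n *\<^sub>R v) - W x) / h n) \<longlonglongrightarrow> v \<bullet> D x"
          using g True h_seq by (intro GDERIV_quotient_tendsto) (auto simp: h_def)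
        from tendsto_mult[OF this q] show ?thesis using True by simp
      next
        case False
        \<comment> \<open>Outside \<open>S\<close> the quotients of \<open>W\<close> need not
          converge, but the Lipschitz bound keeps them bounded while those of \<phi> tend to
          0.\<close>
        then have z: "\<phi>' x = 0" using K by auto
        have "Bfun (\<lambda>n. (W (x + h n *\<^sub>R v) - W x) / h n) sequentially"
          by (rule BfunI[of _ "C * norm v"]) (intro always_eventually allI, use quot_W[OF h(1)] in simp)
        moreover have "(\<lambda>n. (\<phi> x - \<phi> (x - h n *\<^sub>R w)) / h n) \<longlonglongrightarrow> 0" using q z by simp
        ultimately have "(\<lambda>n. ((W (x + h n *\<^sub>R v) - W x) / h n) * ((\<phi> x - \<phi> (x - h n *\<^sub>R w)) / h n)) \<longlonglongrightarrow> 0"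
          by (simp only: tendsto_Zfun_iff diff_zero bounded_bilinear.Bfun_prod_Zfun[OF bounded_bilinear_mult])
        then show ?thesis using False by simp
      qed
    qed
    show "AE x in lebesgue. norm (((W (x + h n *\<^sub>R v) - W x) / h n) * ((\<phi> x - \<phi> (x - h n *\<^sub>R w)) / h n)) \<le>
        (C * norm v) * (M * norm w) * indicator K' x" for n
    proof (intro AE_I2)
      fix x
      show "norm (((W (x + h n *\<^sub>R v) - W x) / h n) * ((\<phi> x - \<phi> (x - h n *\<^sub>R w)) / h n)) \<le>
        (C * norm v) * (M * norm w) * indicator K' x"
      proof (cases "x \<in> K'")
        case True
        have "\<bar>(\<phi> x - \<phi> (x - h n *\<^sub>R w)) / h n\<bar> \<le> M * norm w"
          using M(2)[of x "x - h n *\<^sub>R w"] h[of n] by (simp add: field_simps)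
        then have "\<bar>(W (x + h n *\<^sub>R v) - W x) / h n\<bar> * \<bar>(\<phi> x - \<phi> (x - h n *\<^sub>R w)) / h n\<bar> \<le> (C * norm v) * (M * norm w)"
          using quot_W[OF h(1)] C_nonneg by (intro mult_mono) auto
        then show ?thesis using True by (simp add: abs_mult)
      next
        case False
        then have "\<phi> x = 0" "\<phi> (x - h n *\<^sub>R w) = 0" using K'(2) K'(3)[of "h n" x] h[of n] K(3) by (auto simp: less_imp_le)
        then show ?thesis using False by simp
      qed
    qed
    show "(\<lambda>x. indicator S x * (v \<bullet> D x) * (w \<bullet> \<phi>' x)) \<in> borel_measurable lebesgue"
      by (intro borel_measurable_times meas_inner continuous_borel_lebesgue continuous_intros c\<phi>')
    show "(\<lambda>x. (W (x + h n *\<^sub>R v) - W x) / h n * ((\<phi> x - \<phi> (x - h n *\<^sub>R w)) / h n)) \<in> borel_measurable lebesgue" for n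
      by (intro continuous_borel_lebesgue continuous_intros cont c\<phi> cs) (simp_all add: h)
    show "integrable lebesgue (\<lambda>x. (C * norm v) * (M * norm w) * indicator K' x)"
      by (intro integrable_mult_right integrable_real_indicator bm fin)
  qed
  then show ?thesis by (simp add: h_def)
qed

text \<open>Once both differences act on \<phi>, the expression is symmetric in \<open>v\<close> and
  \<open>w\<close>; differences commute exactly.\<close>

lemma second_difference_parts:
  assumes t: "test_function S \<phi> \<phi>'"
  shows "(LINT x|lebesgue. (W (x + v) - W x) * (\<phi> x - \<phi> (x - w))) =
     - (LINT x|lebesgue. W x * (\<phi> x - \<phi> (x - w) - \<phi> (x - v) + \<phi> (x - v - w)))"
proof -
  obtain K where K: "compact K" "K \<subseteq> S" "\<And>x. x \<notin> K \<Longrightarrow> \<phi> x = 0" "\<And>x. x \<notin> K \<Longrightarrow> \<phi>' x = 0"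
    using test_functionD[OF t] by metis
  have c\<phi>: "continuous_on UNIV \<phi>" by (rule test_function_continuous[OF t])
  define \<psi> where "\<psi> x = \<phi> x - \<phi> (x - w)" for x
  have c\<psi>: "continuous_on UNIV \<psi>"
    unfolding \<psi>_def by (auto intro!: continuous_intros c\<phi> continuous_on_compose2[OF c\<phi>])
  define K2 where "K2 = K \<union> (\<lambda>x. x + w) ` K"
  have K2: "compact K2" unfolding K2_def using K by (intro compact_Un compact_continuous_image continuous_intros)
  have K3: "\<psi> x = 0" if "x \<notin> K2" for x
  proof -
    have "x \<notin> K" "x - w \<notin> K" using that unfolding K2_def by (auto simp: image_iff)
    then show ?thesis using K by (simp add: \<psi>_def)
  qed
  show ?thesis
    using difference_parts[OF cont c\<psi> K2 K3, of v] unfolding \<psi>_def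
    by (simp add: algebra_simps)
qed

lemma second_difference_sym:
  assumes t: "test_function S \<phi> \<phi>'"
  shows "(LINT x|lebesgue. (W (x + v) - W x) * (\<phi> x - \<phi> (x - w))) =
     (LINT x|lebesgue. (W (x + w) - W x) * (\<phi> x - \<phi> (x - v)))"
proof -
  have "\<phi> x - \<phi> (x - w) - \<phi> (x - v) + \<phi> (x - v - w) = \<phi> x - \<phi> (x - v) - \<phi> (x - w) + \<phi> (x - w - v)" for x
    by (simp add: diff_diff_add add.commute)
  then show ?thesis unfolding second_difference_parts[OF t] by (simp only:)
qed

text \<open>Formally both sides are minus the integral of \<phi> times a mixed second derivative of
  \<open>W\<close>. A Lipschitz \<open>W\<close> has none, so the symmetry is taken from the
  difference quotients and passed to the limit.\<close>

lemma null_lagrangian: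
  assumes t: "test_function S \<phi> \<phi>'"
  shows "(LINT x|lebesgue. indicator S x * (v \<bullet> D x) * (w \<bullet> \<phi>' x)) = (LINT x|lebesgue. indicator S x * (w \<bullet> D x) * (v \<bullet> \<phi>' x))"
proof -
  define h where "h n = inverse (real (Suc n))" for n
  define l where "l n v w = (LINT x|lebesgue. ((W (x + h n *\<^sub>R v) - W x) / h n) * ((\<phi> x - \<phi> (x - h n *\<^sub>R w)) / h n))" for n v w
  have e: "l n v w = (LINT x|lebesgue. (W (x + h n *\<^sub>R v) - W x) * (\<phi> x - \<phi> (x - h n *\<^sub>R w))) / (h n * h n)" for n v w
    unfolding l_def times_divide_times_eq by (rule integral_divide_zero)
  have "l n v w = l n w v" for n unfolding e second_difference_sym[OF t, of "h n *\<^sub>R v"] ..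
  then have eq: "(\<lambda>n. l n v w) = (\<lambda>n. l n w v)" by (rule ext)
  have lim: "(\<lambda>n. l n v w) \<longlonglongrightarrow> (LINT x|lebesgue. indicator S x * (v \<bullet> D x) * (w \<bullet> \<phi>' x))" for v w
    using null_lagrangian_aux[OF t, of v w] by (simp only: l_def h_def)
  show ?thesis by (rule LIMSEQ_unique[OF lim[of v w]]) (unfold eq, rule lim)
qed

end

section \<open>A strong maximum principle\<close>

lemma integrable_lebesgueI:
  fixes f :: "complex \<Rightarrow> 'a::{banach,second_countable_topology}"
  assumes "integrable lborel f" shows "integrable lebesgue f"
  using assms by (subst integrable_completion) (auto intro: borel_measurable_integrable)

lemma integrable_compact_continuous:
  fixes f :: "complex \<Rightarrow> 'a::{banach,second_countable_topology}"
  assumes "compact K" "continuous_on K f" shows "integrable lebesgue (\<lambda>X. indicator K X *\<^sub>R f X)"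
  by (rule integrable_lebesgueI[OF borel_integrable_compact[OF assms]])

lemma integrable_bounded_mult:
  fixes f :: "'b \<Rightarrow> 'a::{banach,second_countable_topology}" and u :: "'b \<Rightarrow> real"
  assumes f: "integrable M f" and u: "u \<in> borel_measurable M" "\<And>x. \<bar>u x\<bar> \<le> B"
  shows "integrable M (\<lambda>x. u x *\<^sub>R f x)"
proof (rule Bochner_Integration.integrable_bound)
  show "integrable M (\<lambda>x. B * norm (f x))" using f by simp
  show "(\<lambda>x. u x *\<^sub>R f x) \<in> borel_measurable M"
    using u(1) borel_measurable_integrable[OF f] by (rule borel_measurable_scaleR)
  show "AE x in M. norm (u x *\<^sub>R f x) \<le> norm (B * norm (f x))"
  proof (rule AE_I2)
    fix x
    have "norm (u x *\<^sub>R f x) \<le> B * norm (f x)" using u(2) by (simp add: mult_right_mono)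
    then show "norm (u x *\<^sub>R f x) \<le> norm (B * norm (f x))" by simp
  qed
qed

lemma gderiv_components:
  assumes Y: "(Y has_derivative L) (at X)"
  shows "GDERIV (\<lambda>X. Re (Y X)) X :> Complex (Re (L 1)) (Re (L \<i>))"
    and "GDERIV (\<lambda>X. Im (Y X)) X :> Complex (Im (L 1)) (Im (L \<i>))"
proof -
  have lin: "linear L" using Y by (rule has_derivative_linear)
  have L: "L h = Re h *\<^sub>R L 1 + Im h *\<^sub>R L \<i>" for h
  proof -
    have "h = Re h *\<^sub>R 1 + Im h *\<^sub>R \<i>" by (simp add: complex_eq_iff)
    then have "L h = L (Re h *\<^sub>R 1 + Im h *\<^sub>R \<i>)" by simp
    then show ?thesis by (simp only: linear_add[OF lin] linear_scale[OF lin])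
  qed
  have 1: "(\<lambda>h. Re (L h)) = (\<lambda>h. h \<bullet> Complex (Re (L 1)) (Re (L \<i>)))"
    and 2: "(\<lambda>h. Im (L h)) = (\<lambda>h. h \<bullet> Complex (Im (L 1)) (Im (L \<i>)))"
    by (rule ext, subst L, simp add: inner_complex_def)+
  show "GDERIV (\<lambda>X. Re (Y X)) X :> Complex (Re (L 1)) (Re (L \<i>))"
    unfolding gderiv_def 1[symmetric] by (rule has_derivative_Re[OF Y])
  show "GDERIV (\<lambda>X. Im (Y X)) X :> Complex (Im (L 1)) (Im (L \<i>))"
    unfolding gderiv_def 2[symmetric] by (rule has_derivative_Im[OF Y])
qed

text \<open>The open sets \<open>N\<close> and the complement of \<open>K\<close> cover the plane,
  and on the second one everything is 0.\<close>

lemma test_function_extend: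
  assumes N: "open N" "K \<subseteq> N" "compact K" "N \<subseteq> S"
    and f: "\<And>X. X \<in> N \<Longrightarrow> GDERIV f X :> f' X" "continuous_on N f'"
    and z: "\<And>X. X \<in> N \<Longrightarrow> X \<notin> K \<Longrightarrow> f X = 0" "\<And>X. X \<in> N \<Longrightarrow> X \<notin> K \<Longrightarrow> f' X = 0"
  shows "test_function S (\<lambda>X. if X \<in> N then f X else 0) (\<lambda>X. if X \<in> N then f' X else 0)"
proof -
  let ?f = "\<lambda>X. if X \<in> N then f X else 0" and ?f' = "\<lambda>X. if X \<in> N then f' X else 0"
  have oK: "open (- K)" using N(3) by (simp add: compact_imp_closed open_Compl)
  have zK: "?f X = 0" "?f' X = 0" if "X \<notin> K" for X using z that by auto
  have "GDERIV ?f X :> ?f' X" for X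
  proof (cases "X \<in> N")
    case True
    have "(?f has_derivative (\<lambda>h. h \<bullet> f' X)) (at X)"
      by (rule has_derivative_transform_within_open[OF f(1)[OF True, unfolded gderiv_def] N(1) True]) simp
    then show ?thesis using True by (simp add: gderiv_def)
  next
    case False
    then have X: "X \<in> - K" using N(2) by auto
    have "(?f has_derivative (\<lambda>h. 0)) (at X)"
      by (rule has_derivative_transform_within_open[OF has_derivative_const oK X]) (use zK in auto)
    then show ?thesis using False by (simp add: gderiv_def)
  qed
  moreover have "continuous_on UNIV ?f'"
  proof -
    have "continuous_on N ?f'" by (rule continuous_on_eq[OF f(2)]) simp
    moreover have "continuous_on (- K) ?f'" by (rule continuous_on_eq[of _ "\<lambda>_. 0"]) (use zK in auto)
    ultimately have "continuous_on (N \<union> - K) ?f'" using N(1) oK by (intro continuous_on_open_Un)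
    moreover have "N \<union> - K = UNIV" using N(2) by auto
    ultimately show ?thesis by simp
  qed
  moreover have "closure {X. ?f X \<noteq> 0} \<subseteq> K"
  proof (rule closure_minimal)
    show "{X. ?f X \<noteq> 0} \<subseteq> K"
    proof
      fix X assume "X \<in> {X. ?f X \<noteq> 0}"
      then have "?f X \<noteq> 0" by (rule CollectD)
      then show "X \<in> K" using zK(1)[of X] by blast
    qed
  qed (rule compact_imp_closed[OF N(3)])
  moreover from this have "compact (closure {X. ?f X \<noteq> 0})"
    using compact_Int_closed[OF N(3) closed_closure[of "{X. ?f X \<noteq> 0}"]] by (simp only: Int_absorb1)
  ultimately show ?thesis unfolding test_function_def using N(2,4) by blast
qed

section \<open>A regularised radial kernel\<close>

lemma max_sq_has_derivative: "((\<lambda>u. (max 0 u)\<^sup>2) has_real_derivative 2 * max 0 u) (at u)" for u :: real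
proof (cases u "0::real" rule: linorder_cases)
  case less
  show ?thesis
    by (rule has_field_derivative_transform_within_open[of "\<lambda>_. 0" _ _ "{..<0}"]) (use less in auto)
next
  case greater
  have "((\<lambda>u. u\<^sup>2) has_real_derivative 2 * max 0 u) (at u)"
    using greater by (auto intro!: derivative_eq_intros)
  then show ?thesis
    by (rule has_field_derivative_transform_within_open[of _ _ _ "{0<..}"]) (use greater in auto)
next
  case equal
  have "((\<lambda>h::real. (max 0 (0 + h))\<^sup>2 / h) \<longlongrightarrow> 0) (at 0)"
  proof (rule Lim_null_comparison)
    show "\<forall>\<^sub>F h::real in at 0. norm ((max 0 (0 + h))\<^sup>2 / h) \<le> \<bar>h\<bar>"
      by (intro always_eventually allI) (auto simp: max_def power2_eq_square)
    show "((\<lambda>h::real. \<bar>h\<bar>) \<longlongrightarrow> 0) (at 0)" by (auto intro!: tendsto_eq_intros)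
  qed
  then show ?thesis using equal by (simp add: DERIV_def)
qed

text \<open>In \<open>t\<close>, the square of the modulus of the chart, this is -1/t, the
  derivative of minus the logarithm, with the pole removed by \<delta> and a cut-off at 1; the
  square keeps the cut-off continuously differentiable.\<close>

definition kernel :: "real \<Rightarrow> real \<Rightarrow> real" where "kernel \<delta> t = - (max 0 (1 - t))\<^sup>2 / (t + \<delta>)"

definition kernel' :: "real \<Rightarrow> real \<Rightarrow> real" where
  "kernel' \<delta> t = 2 * max 0 (1 - t) / (t + \<delta>) + (max 0 (1 - t))\<^sup>2 / (t + \<delta>)\<^sup>2"

lemma kernel_has_derivative: "(kernel \<delta> has_real_derivative kernel' \<delta> t) (at t)" if "\<delta> > 0" "t > - \<delta>"
proof -
  have 1: "((\<lambda>t. (max 0 (1 - t))\<^sup>2) has_real_derivative 2 * max 0 (1 - t) * (- 1)) (at t)"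
    by (rule DERIV_chain2[OF max_sq_has_derivative]) (auto intro!: derivative_eq_intros)
  have 2: "t + \<delta> \<noteq> 0" using that by simp
  have "((\<lambda>t. - ((max 0 (1 - t))\<^sup>2 / (t + \<delta>))) has_real_derivative
      - ((2 * max 0 (1 - t) * (- 1) * (t + \<delta>) - (max 0 (1 - t))\<^sup>2 * 1) / ((t + \<delta>) * (t + \<delta>)))) (at t)"
    by (rule DERIV_minus[OF DERIV_divide[OF 1]]) (use 2 in \<open>auto intro!: derivative_eq_intros\<close>)
  also have "- ((2 * max 0 (1 - t) * (- 1) * (t + \<delta>) - (max 0 (1 - t))\<^sup>2 * 1) / ((t + \<delta>) * (t + \<delta>))) = kernel' \<delta> t"
    using 2 by (simp add: kernel'_def add_divide_distrib diff_divide_distrib power2_eq_square)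
  finally show ?thesis by (simp add: kernel_def[abs_def])
qed

lemma kernel_continuous: "continuous_on {0..} (kernel \<delta>)" "continuous_on {0..} (kernel' \<delta>)" if "\<delta> > 0"
  unfolding kernel_def[abs_def] kernel'_def[abs_def] using that by (auto intro!: continuous_intros)

lemma kernel_zero: "kernel \<delta> t = 0" "kernel' \<delta> t = 0" if "t \<ge> 1" using that by (auto simp: kernel_def kernel'_def)

lemma kernel_primitive:
  assumes "\<delta> > 0"
  obtains \<psi> where "\<And>t. t \<ge> 0 \<Longrightarrow> (\<psi> has_real_derivative kernel \<delta> t) (at t)" "\<And>t. t \<ge> 1 \<Longrightarrow> \<psi> t = 0"
proof -
  \<comment> \<open>Starting left of 0, but right of the pole at \<open>- \<delta>\<close>, makes
    the derivative at \<open>t = 0\<close> two-sided.\<close>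
  define l where "l = - \<delta> / 2"
  have l: "l < 0" "l > - \<delta>" using assms by (auto simp: l_def)
  define J where "J t = integral {l..t} (kernel \<delta>)" for t
  have c: "continuous_on {l..T} (kernel \<delta>)" for T
    unfolding kernel_def[abs_def] using l by (auto intro!: continuous_intros)
  have d: "(J has_real_derivative kernel \<delta> t) (at t)" if "t \<ge> 0" for t
  proof -
    have "(J has_real_derivative kernel \<delta> t) (at t within {l..t+1})"
      unfolding J_def by (rule integral_has_real_derivative[OF c]) (use l that in auto)
    then show ?thesis using l that by (simp add: at_within_Icc_at)
  qed
  have "J t - J 1 = 0" if "t \<ge> 1" for t
  proof -
    have "J 1 + integral {1..t} (kernel \<delta>) = J t"
      unfolding J_def using l that by (intro Henstock_Kurzweil_Integration.integral_combine integrable_continuous_real c) auto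
    moreover have "integral {1..t} (kernel \<delta>) = integral {1..t} (\<lambda>_. 0)"
      by (rule integral_cong) (simp add: kernel_zero)
    ultimately show ?thesis by simp
  qed
  moreover have "((\<lambda>t. J t - J 1) has_real_derivative kernel \<delta> t) (at t)" if "t \<ge> 0" for t
    using DERIV_diff[OF d[OF that] DERIV_const, of "J 1"] by simp
  ultimately show thesis by (intro that[of "\<lambda>t. J t - J 1"])
qed

text \<open>\<open>g\<close> is a conformal coordinate with \<open>g x0 = 0\<close> in which the conductivity \<open>a\<close> depends on \<open>Re g\<close> only: it is
  constant or jumps across \<open>Re g = 0\<close>.  The functions \<open>b n\<close> are smooth approximations of it.  For small \<open>\<delta>\<close>, the
  divergence of the test field concentrates at \<open>x0\<close>.\<close>

locale conformal_chart =
  fixes S N :: "complex set" and g g1 g2 :: "complex \<Rightarrow> complex" and a :: "complex \<Rightarrow> real" and x0 :: complex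
    and b bd :: "nat \<Rightarrow> real \<Rightarrow> real" and C :: real
  assumes S: "open S" and N: "open N" "N \<subseteq> S" and x0: "x0 \<in> N"
    and K: "compact {X\<in>N. norm (g X) \<le> 1}"
    and g1: "\<And>X. X \<in> N \<Longrightarrow> (g has_field_derivative g1 X) (at X)"
    and g2: "\<And>X. X \<in> N \<Longrightarrow> (g1 has_field_derivative g2 X) (at X)" and g2c: "continuous_on N g2"
    and g1_nz: "\<And>X. X \<in> N \<Longrightarrow> g1 X \<noteq> 0"
    and g_zero: "\<And>X. X \<in> N \<Longrightarrow> g X = 0 \<longleftrightarrow> X = x0"
    and a: "a \<in> borel_measurable lebesgue" "\<And>X. 0 < a X" "\<And>X. a X \<le> C"
    and b: "\<And>n s. (b n has_real_derivative bd n s) (at s)" "\<And>n. continuous_on UNIV (bd n)"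
    and bC: "\<And>n s. \<bar>b n s\<bar> \<le> C" "\<And>n s. \<bar>bd n s * s\<bar> \<le> C"
    and b_lim: "AE X in lebesgue. X \<in> N \<longrightarrow> (\<lambda>n. b n (Re (g X))) \<longlonglongrightarrow> a X"
    and bd_lim: "\<And>s. (\<lambda>n. bd n s * s) \<longlonglongrightarrow> 0"
begin

definition chart_disk :: "complex set" where "chart_disk = {X\<in>N. norm (g X) \<le> 1}"
definition chart_sq :: "complex \<Rightarrow> real" where "chart_sq X = (norm (g X))\<^sup>2"

lemma chart_disk: "compact chart_disk" "chart_disk \<subseteq> N" using K by (auto simp: chart_disk_def)

lemma cg: "continuous_on N g" "continuous_on N g1"
  by (auto intro!: continuous_at_imp_continuous_on DERIV_isCont[OF g1] DERIV_isCont[OF g2])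

lemma ctt: "continuous_on N chart_sq" unfolding chart_sq_def[abs_def] by (intro continuous_intros cg)

lemma chart_sq_nonneg: "0 \<le> chart_sq X" by (simp add: chart_sq_def)

lemma chart_sq_chart_disk: "X \<in> N \<Longrightarrow> X \<in> chart_disk \<longleftrightarrow> chart_sq X \<le> 1" by (simp add: chart_disk_def chart_sq_def power_le_one_iff)

lemma chart_sq_has_derivative: "(chart_sq has_derivative (\<lambda>h. h \<bullet> (2 *\<^sub>R (g X * cnj (g1 X))))) (at X)" if "X \<in> N"
proof -
  have "((\<lambda>X. g X \<bullet> g X) has_derivative (\<lambda>h. g X \<bullet> (g1 X * h) + (g1 X * h) \<bullet> g X)) (at X)"
    using g1[OF that] by (auto intro!: derivative_intros simp: has_field_derivative_def)
  also have "(\<lambda>h. g X \<bullet> (g1 X * h) + (g1 X * h) \<bullet> g X) = (\<lambda>h. h \<bullet> (2 *\<^sub>R (g X * cnj (g1 X))))"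
    by (rule ext) (simp add: inner_complex_def algebra_simps)
  finally show ?thesis by (simp add: chart_sq_def[abs_def] dot_square_norm)
qed

text \<open>Half the approximate conductivity times the gradient of
  \<psi>(\<open>chart_sq X\<close>), where \<psi> is a primitive of \<open>kernel \<delta>\<close>:
  the regularised flux of a fundamental solution.\<close>

definition field :: "nat \<Rightarrow> real \<Rightarrow> complex \<Rightarrow> complex" where
  "field n \<delta> X = (b n (Re (g X)) * kernel \<delta> (chart_sq X)) *\<^sub>R (g X * cnj (g1 X))"

definition field' :: "nat \<Rightarrow> real \<Rightarrow> complex \<Rightarrow> complex \<Rightarrow> complex" where
  "field' n \<delta> X h =
     (b n (Re (g X)) * kernel \<delta> (chart_sq X)) *\<^sub>R (g X * cnj (g2 X * h) + g1 X * h * cnj (g1 X)) +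
     (b n (Re (g X)) * (kernel' \<delta> (chart_sq X) * (h \<bullet> (2 *\<^sub>R (g X * cnj (g1 X))))) + bd n (Re (g X)) * Re (g1 X * h) * kernel \<delta> (chart_sq X)) *\<^sub>R (g X * cnj (g1 X))"

lemma field_has_derivative: "(field n \<delta> has_derivative field' n \<delta> X) (at X)" if X: "X \<in> N" and \<delta>: "\<delta> > 0"
proof -
  have 1: "((\<lambda>X. kernel \<delta> (chart_sq X)) has_derivative (\<lambda>h. kernel' \<delta> (chart_sq X) * (h \<bullet> (2 *\<^sub>R (g X * cnj (g1 X)))))) (at X)"
    using has_derivative_compose[OF chart_sq_has_derivative[OF X], of "kernel \<delta>" "(*) (kernel' \<delta> (chart_sq X))"]
      kernel_has_derivative[OF \<delta>, of "chart_sq X"] chart_sq_nonneg[of X] \<delta> by (auto simp: has_field_derivative_def)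
  have 2: "(g has_derivative (\<lambda>h. g1 X * h)) (at X)" "(g1 has_derivative (\<lambda>h. g2 X * h)) (at X)"
    using g1[OF X] g2[OF X] by (auto simp: has_field_derivative_def)
  have 3: "((\<lambda>X. b n (Re (g X))) has_derivative (\<lambda>h. bd n (Re (g X)) * Re (g1 X * h))) (at X)"
    using has_derivative_compose[OF has_derivative_Re[OF 2(1)], of "b n" "(*) (bd n (Re (g X)))"] b(1)
    by (auto simp: has_field_derivative_def)
  have 4: "((\<lambda>X. cnj (g1 X)) has_derivative (\<lambda>h. cnj (g2 X * h))) (at X)"
    by (rule has_derivative_cnj[OF 2(2)])
  show ?thesis
    unfolding field_def[abs_def] field'_def[abs_def]
    by (rule has_derivative_scaleR[OF has_derivative_mult[OF 3 1] has_derivative_mult[OF 2(1) 4]])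
qed

text \<open>The terms with \<open>g2\<close> cancel by the Cauchy-Riemann equations. As the field is
  radial in the chart, the derivative of the conductivity occurs only in the product
  \<open>bd n s * s\<close> with \<open>s = Re (g X)\<close>. This product stays bounded and tends
  to 0 even where \<open>b n\<close> approximates a jump, which is why the interface does no
  harm.\<close>

lemma field'_div: "Re (field' n \<delta> X 1) + Im (field' n \<delta> X \<i>) =
   (norm (g1 X))\<^sup>2 * (2 * b n (Re (g X)) * (kernel \<delta> (chart_sq X) + kernel' \<delta> (chart_sq X) * chart_sq X) + bd n (Re (g X)) * Re (g X) * kernel \<delta> (chart_sq X))"
  unfolding field'_def chart_sq_def cmod_power2
  by (simp add: inner_complex_def power2_eq_square algebra_simps)

lemma continuous_field': "continuous_on N (\<lambda>X. field' n \<delta> X h)" if "\<delta> > 0"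
proof -
  have bc: "continuous_on UNIV (b n)" by (intro continuous_at_imp_continuous_on ballI DERIV_isCont[OF b(1)])
  have k: "continuous_on N (\<lambda>X. kernel \<delta> (chart_sq X))" "continuous_on N (\<lambda>X. kernel' \<delta> (chart_sq X))"
    by (rule continuous_on_compose2[OF kernel_continuous(1)[OF that] ctt] continuous_on_compose2[OF kernel_continuous(2)[OF that] ctt];
        use chart_sq_nonneg in auto)+
  have bb: "continuous_on N (\<lambda>X. b n (Re (g X)))" "continuous_on N (\<lambda>X. bd n (Re (g X)))"
    by (rule continuous_on_compose2[OF bc], auto intro!: continuous_intros cg)
       (rule continuous_on_compose2[OF b(2)], auto intro!: continuous_intros cg)
  show ?thesis unfolding field'_def by (intro continuous_intros cg g2c k bb)
qed

lemma field_zero: "field n \<delta> X = 0" "field' n \<delta> X h = 0" if "X \<in> N" "X \<notin> chart_disk"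
proof -
  have "chart_sq X \<ge> 1" using chart_sq_chart_disk[OF that(1)] that(2) by simp
  then show "field n \<delta> X = 0" "field' n \<delta> X h = 0" by (simp_all add: field_def field'_def kernel_zero)
qed

lemma integrable_chart_disk_mult:
  fixes u :: "complex \<Rightarrow> real"
  assumes G: "set_integrable lebesgue S G" and u: "continuous_on N u"
  shows "integrable lebesgue (\<lambda>X. indicator chart_disk X *\<^sub>R (u X *\<^sub>R (G X :: complex)))"
proof -
  have cu: "continuous_on chart_disk u" by (rule continuous_on_subset[OF u chart_disk(2)])
  obtain B where B: "\<And>X. X \<in> chart_disk \<Longrightarrow> \<bar>u X\<bar> \<le> B" "B > 0"
    using compact_imp_bounded[OF compact_continuous_image[OF cu chart_disk(1)]] by (auto simp: bounded_pos)
  have "integrable lebesgue (\<lambda>X. (indicator chart_disk X *\<^sub>R u X) *\<^sub>R (indicator S X *\<^sub>R G X))"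
  proof (rule integrable_bounded_mult)
    show "integrable lebesgue (\<lambda>X. indicator S X *\<^sub>R G X)" using G by (simp add: set_integrable_def)
    show "(\<lambda>X. indicator chart_disk X *\<^sub>R u X) \<in> borel_measurable lebesgue"
      by (rule borel_measurable_integrable[OF integrable_compact_continuous[OF chart_disk(1) cu]])
    show "\<bar>indicator chart_disk X *\<^sub>R u X\<bar> \<le> B" for X using B by (auto simp: indicator_def)
  qed
  moreover have "(indicator chart_disk X *\<^sub>R u X) *\<^sub>R (indicator S X *\<^sub>R G X) = indicator chart_disk X *\<^sub>R (u X *\<^sub>R G X)" for X
    using chart_disk(2) N(2) by (auto simp: indicator_def)
  ultimately show ?thesis by (simp only:)
qed

text \<open>The weak gradient is tested with the real and the imaginary part of the field; the
  suitable components of the two identities add up to the divergence theorem.\<close>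

lemma kernel_identity_n:
  assumes \<delta>: "\<delta> > 0" and wg: "weak_gradient S w G" and wc: "continuous_on S w" and G: "set_integrable lebesgue S G"
  shows "(LINT X:chart_disk|lebesgue. w X * (Re (field' n \<delta> X 1) + Im (field' n \<delta> X \<i>))) =
       - (LINT X:chart_disk|lebesgue. field n \<delta> X \<bullet> G X)"
proof -
  define Z1 where "Z1 X = Complex (Re (field' n \<delta> X 1)) (Re (field' n \<delta> X \<i>))" for X
  define Z2 where "Z2 X = Complex (Im (field' n \<delta> X 1)) (Im (field' n \<delta> X \<i>))" for X
  have "test_function S (\<lambda>X. if X \<in> N then Re (field n \<delta> X) else 0) (\<lambda>X. if X \<in> N then Z1 X else 0)" (is "test_function S ?f1 ?d1")
  proof (rule test_function_extend[OF N(1) chart_disk(2,1) N(2)])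
    show "continuous_on N Z1" unfolding Z1_def Complex_eq by (intro continuous_intros continuous_field' \<delta>)
  qed (auto simp: Z1_def field_zero complex_eq_iff intro: gderiv_components(1)[OF field_has_derivative[OF _ \<delta>]])
  then have e1: "(LINT X:S|lebesgue. w X *\<^sub>R ?d1 X) = - (LINT X:S|lebesgue. ?f1 X *\<^sub>R G X)"
    using wg unfolding weak_gradient_def by blast
  have "test_function S (\<lambda>X. if X \<in> N then Im (field n \<delta> X) else 0) (\<lambda>X. if X \<in> N then Z2 X else 0)" (is "test_function S ?f2 ?d2")
  proof (rule test_function_extend[OF N(1) chart_disk(2,1) N(2)])
    show "continuous_on N Z2" unfolding Z2_def Complex_eq by (intro continuous_intros continuous_field' \<delta>)
  qed (auto simp: Z2_def field_zero complex_eq_iff intro: gderiv_components(2)[OF field_has_derivative[OF _ \<delta>]])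
  then have e2: "(LINT X:S|lebesgue. w X *\<^sub>R ?d2 X) = - (LINT X:S|lebesgue. ?f2 X *\<^sub>R G X)"
    using wg unfolding weak_gradient_def by blast
  have ind: "indicator S X *\<^sub>R (w X *\<^sub>R (if X \<in> N then u X else 0)) = indicator chart_disk X *\<^sub>R (w X *\<^sub>R u X)"
     if "\<And>X. X \<in> N \<Longrightarrow> X \<notin> chart_disk \<Longrightarrow> u X = 0" for u :: "complex \<Rightarrow> complex" and X and w :: "complex \<Rightarrow> real"
    using that[of X] chart_disk(2) N(2) by (auto simp: indicator_def)
  have ind': "indicator S X *\<^sub>R ((if X \<in> N then u X else 0) *\<^sub>R G X) = indicator chart_disk X *\<^sub>R (u X *\<^sub>R G X)"
     if "\<And>X. X \<in> N \<Longrightarrow> X \<notin> chart_disk \<Longrightarrow> u X = 0" for u :: "complex \<Rightarrow> real" and X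
    using that[of X] chart_disk(2) N(2) by (auto simp: indicator_def)
  have cw: "continuous_on chart_disk w" using chart_disk(2) N(2) by (intro continuous_on_subset[OF wc]) auto
  have i1: "integrable lebesgue (\<lambda>X. indicator chart_disk X *\<^sub>R (w X *\<^sub>R u X))" if "continuous_on N u" for u :: "complex \<Rightarrow> complex"
    by (intro integrable_compact_continuous chart_disk(1) continuous_intros cw continuous_on_subset[OF that chart_disk(2)])
  have cf: "continuous_on N (field n \<delta>)"
    by (intro continuous_at_imp_continuous_on ballI has_derivative_continuous[OF field_has_derivative[OF _ \<delta>]])
  have i2: "integrable lebesgue (\<lambda>X. indicator chart_disk X *\<^sub>R (u X *\<^sub>R G X))" if "continuous_on N u" for u :: "complex \<Rightarrow> real"
    by (rule integrable_chart_disk_mult[OF G that])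
  have Z: "continuous_on N Z1" "continuous_on N Z2"
    unfolding Z1_def Z2_def Complex_eq by (intro continuous_intros continuous_field' \<delta>)+
  have rf: "continuous_on N (\<lambda>X. Re (field n \<delta> X))" "continuous_on N (\<lambda>X. Im (field n \<delta> X))"
    by (intro continuous_intros cf)+
  have f1: "(LINT X|lebesgue. indicator chart_disk X *\<^sub>R (w X *\<^sub>R Z1 X)) = - (LINT X|lebesgue. indicator chart_disk X *\<^sub>R (Re (field n \<delta> X) *\<^sub>R G X))"
  proof -
    have "(\<lambda>X. indicator S X *\<^sub>R (w X *\<^sub>R (if X \<in> N then Z1 X else 0))) = (\<lambda>X. indicator chart_disk X *\<^sub>R (w X *\<^sub>R Z1 X))"
      by (rule ext, rule ind) (simp add: Z1_def field_zero complex_eq_iff)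
    moreover have "(\<lambda>X. indicator S X *\<^sub>R ((if X \<in> N then Re (field n \<delta> X) else 0) *\<^sub>R G X)) = (\<lambda>X. indicator chart_disk X *\<^sub>R (Re (field n \<delta> X) *\<^sub>R G X))"
      by (rule ext, rule ind') (simp add: field_zero)
    ultimately show ?thesis using e1 unfolding set_lebesgue_integral_def by (simp only:)
  qed
  have f2: "(LINT X|lebesgue. indicator chart_disk X *\<^sub>R (w X *\<^sub>R Z2 X)) = - (LINT X|lebesgue. indicator chart_disk X *\<^sub>R (Im (field n \<delta> X) *\<^sub>R G X))"
  proof -
    have "(\<lambda>X. indicator S X *\<^sub>R (w X *\<^sub>R (if X \<in> N then Z2 X else 0))) = (\<lambda>X. indicator chart_disk X *\<^sub>R (w X *\<^sub>R Z2 X))"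
      by (rule ext, rule ind) (simp add: Z2_def field_zero complex_eq_iff)
    moreover have "(\<lambda>X. indicator S X *\<^sub>R ((if X \<in> N then Im (field n \<delta> X) else 0) *\<^sub>R G X)) = (\<lambda>X. indicator chart_disk X *\<^sub>R (Im (field n \<delta> X) *\<^sub>R G X))"
      by (rule ext, rule ind') (simp add: field_zero)
    ultimately show ?thesis using e2 unfolding set_lebesgue_integral_def by (simp only:)
  qed
  have "(LINT X|lebesgue. Re (indicator chart_disk X *\<^sub>R (w X *\<^sub>R Z1 X))) = - (LINT X|lebesgue. Re (indicator chart_disk X *\<^sub>R (Re (field n \<delta> X) *\<^sub>R G X)))"
    unfolding integral_Re[OF i1[OF Z(1)]] integral_Re[OF i2[OF rf(1)]] f1 by simp
  moreover have "(LINT X|lebesgue. Im (indicator chart_disk X *\<^sub>R (w X *\<^sub>R Z2 X))) = - (LINT X|lebesgue. Im (indicator chart_disk X *\<^sub>R (Im (field n \<delta> X) *\<^sub>R G X)))"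
    unfolding integral_Im[OF i1[OF Z(2)]] integral_Im[OF i2[OF rf(2)]] f2 by simp
  ultimately have "(LINT X|lebesgue. Re (indicator chart_disk X *\<^sub>R (w X *\<^sub>R Z1 X)) + Im (indicator chart_disk X *\<^sub>R (w X *\<^sub>R Z2 X))) =
     - (LINT X|lebesgue. Re (indicator chart_disk X *\<^sub>R (Re (field n \<delta> X) *\<^sub>R G X)) + Im (indicator chart_disk X *\<^sub>R (Im (field n \<delta> X) *\<^sub>R G X)))"
    unfolding Bochner_Integration.integral_add[OF integrable_Re[OF i1[OF Z(1)]] integrable_Im[OF i1[OF Z(2)]]]
      Bochner_Integration.integral_add[OF integrable_Re[OF i2[OF rf(1)]] integrable_Im[OF i2[OF rf(2)]]]
    by linarith
  then show ?thesis
    unfolding set_lebesgue_integral_def by (simp add: Z1_def Z2_def inner_complex_def algebra_simps)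
qed

text \<open>The derivative of \<open>t * kernel \<delta> t\<close>; for the exact kernel -1/t it
  would vanish.\<close>

definition kernel_div :: "real \<Rightarrow> real \<Rightarrow> real" where "kernel_div \<delta> t = kernel \<delta> t + kernel' \<delta> t * t"

text \<open>As \<open>n\<close> grows, the flux term tends to the integral of
  \<open>a X * (e X \<bullet> G X)\<close>. Since \<open>2 *\<^sub>R e X\<close> is the gradient of
  a compactly supported function of \<open>chart_sq\<close>, the equation itself makes that integral
  0. Only the divergence term survives.\<close>

lemma kernel_identity:
  assumes \<delta>: "\<delta> > 0" and wg: "weak_gradient S w G" and wc: "continuous_on S w" and G: "set_integrable lebesgue S G"
    and eq: "\<And>\<phi> \<phi>'. test_function S \<phi> \<phi>' \<Longrightarrow> (LINT X:S|lebesgue. a X * (G X \<bullet> \<phi>' X)) = 0"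
  shows "(LINT X|lebesgue. indicator chart_disk X * (a X * (w X * ((norm (g1 X))\<^sup>2 * kernel_div \<delta> (chart_sq X))))) = 0"
proof -
  have k: "continuous_on N (\<lambda>X. kernel \<delta> (chart_sq X))" "continuous_on N (\<lambda>X. kernel' \<delta> (chart_sq X))"
    by (rule continuous_on_compose2[OF kernel_continuous(1)[OF \<delta>] ctt] continuous_on_compose2[OF kernel_continuous(2)[OF \<delta>] ctt];
        use chart_sq_nonneg in auto)+
  have cw: "continuous_on chart_disk w" using chart_disk(2) N(2) by (intro continuous_on_subset[OF wc]) auto
  have KKn: "continuous_on chart_disk f" if "continuous_on N f" for f :: "complex \<Rightarrow> 'a::topological_space"
    using continuous_on_subset[OF that chart_disk(2)] .
  have C0: "0 \<le> C" using order_trans[OF abs_ge_zero bC(1)] .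
  define d where "d n X = (norm (g1 X))\<^sup>2 * (2 * b n (Re (g X)) * (kernel \<delta> (chart_sq X) + kernel' \<delta> (chart_sq X) * chart_sq X) + bd n (Re (g X)) * Re (g X) * kernel \<delta> (chart_sq X))" for n X
  have bc: "continuous_on UNIV (b n)" for n by (intro continuous_at_imp_continuous_on ballI DERIV_isCont[OF b(1)])
  have bb: "continuous_on N (\<lambda>X. b n (Re (g X)))" "continuous_on N (\<lambda>X. bd n (Re (g X)))" for n
    by (rule continuous_on_compose2[OF bc], auto intro!: continuous_intros cg)
       (rule continuous_on_compose2[OF b(2)], auto intro!: continuous_intros cg)
  have cd: "continuous_on N (d n)" for n unfolding d_def[abs_def] by (intro continuous_intros cg k bb ctt)
  have L: "(\<lambda>n. LINT X|lebesgue. indicator chart_disk X * (w X * d n X)) \<longlonglongrightarrow>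
      (LINT X|lebesgue. indicator chart_disk X * (w X * ((norm (g1 X))\<^sup>2 * (2 * a X * kernel_div \<delta> (chart_sq X)))))"
  proof (rule integral_dominated_convergence[where w = "\<lambda>X. indicator chart_disk X *\<^sub>R (\<bar>w X\<bar> * ((norm (g1 X))\<^sup>2 * (2 * C * \<bar>kernel_div \<delta> (chart_sq X)\<bar> + C * \<bar>kernel \<delta> (chart_sq X)\<bar>)))"])
    show "integrable lebesgue (\<lambda>X. indicator chart_disk X *\<^sub>R (\<bar>w X\<bar> * ((norm (g1 X))\<^sup>2 * (2 * C * \<bar>kernel_div \<delta> (chart_sq X)\<bar> + C * \<bar>kernel \<delta> (chart_sq X)\<bar>))))"
      unfolding kernel_div_def by (intro integrable_compact_continuous chart_disk(1) continuous_intros cw KKn cg k ctt)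
    show "AE X in lebesgue. (\<lambda>n. indicator chart_disk X * (w X * d n X)) \<longlonglongrightarrow> indicator chart_disk X * (w X * ((norm (g1 X))\<^sup>2 * (2 * a X * kernel_div \<delta> (chart_sq X))))"
      using b_lim
    proof (rule AE_mp, intro AE_I2 impI)
      fix X assume l: "X \<in> N \<longrightarrow> (\<lambda>n. b n (Re (g X))) \<longlonglongrightarrow> a X"
      show "(\<lambda>n. indicator chart_disk X * (w X * d n X)) \<longlonglongrightarrow> indicator chart_disk X * (w X * ((norm (g1 X))\<^sup>2 * (2 * a X * kernel_div \<delta> (chart_sq X))))"
      proof (cases "X \<in> chart_disk")
        case True
        then have l': "(\<lambda>n. b n (Re (g X))) \<longlonglongrightarrow> a X" using l chart_disk(2) by auto
        have "(\<lambda>n. indicator chart_disk X * (w X * d n X)) \<longlonglongrightarrow> indicator chart_disk X * (w X * ((norm (g1 X))\<^sup>2 * (2 * a X * (kernel \<delta> (chart_sq X) + kernel' \<delta> (chart_sq X) * chart_sq X) + 0 * kernel \<delta> (chart_sq X))))"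
          unfolding d_def by (intro tendsto_intros l' bd_lim)
        then show ?thesis by (simp add: kernel_div_def)
      qed simp
    qed
    show "AE X in lebesgue. norm (indicator chart_disk X * (w X * d n X)) \<le> indicator chart_disk X *\<^sub>R (\<bar>w X\<bar> * ((norm (g1 X))\<^sup>2 * (2 * C * \<bar>kernel_div \<delta> (chart_sq X)\<bar> + C * \<bar>kernel \<delta> (chart_sq X)\<bar>)))" for n
    proof (rule AE_I2)
      fix X
      have "\<bar>2 * b n (Re (g X)) * kernel_div \<delta> (chart_sq X) + bd n (Re (g X)) * Re (g X) * kernel \<delta> (chart_sq X)\<bar> \<le> \<bar>2 * b n (Re (g X)) * kernel_div \<delta> (chart_sq X)\<bar> + \<bar>bd n (Re (g X)) * Re (g X) * kernel \<delta> (chart_sq X)\<bar>"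
        by (rule abs_triangle_ineq)
      also have "\<dots> = 2 * \<bar>b n (Re (g X))\<bar> * \<bar>kernel_div \<delta> (chart_sq X)\<bar> + \<bar>bd n (Re (g X)) * Re (g X)\<bar> * \<bar>kernel \<delta> (chart_sq X)\<bar>"
        by (simp add: abs_mult)
      also have "\<dots> \<le> 2 * C * \<bar>kernel_div \<delta> (chart_sq X)\<bar> + C * \<bar>kernel \<delta> (chart_sq X)\<bar>"
        by (intro add_mono mult_right_mono mult_left_mono bC) auto
      finally have "(norm (g1 X))\<^sup>2 * \<bar>2 * b n (Re (g X)) * kernel_div \<delta> (chart_sq X) + bd n (Re (g X)) * Re (g X) * kernel \<delta> (chart_sq X)\<bar> \<le> (norm (g1 X))\<^sup>2 * (2 * C * \<bar>kernel_div \<delta> (chart_sq X)\<bar> + C * \<bar>kernel \<delta> (chart_sq X)\<bar>)"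
        by (rule mult_left_mono) simp
      then have "\<bar>w X\<bar> * ((norm (g1 X))\<^sup>2 * \<bar>2 * b n (Re (g X)) * kernel_div \<delta> (chart_sq X) + bd n (Re (g X)) * Re (g X) * kernel \<delta> (chart_sq X)\<bar>) \<le> \<bar>w X\<bar> * ((norm (g1 X))\<^sup>2 * (2 * C * \<bar>kernel_div \<delta> (chart_sq X)\<bar> + C * \<bar>kernel \<delta> (chart_sq X)\<bar>))"
        by (rule mult_left_mono) simp
      then show "norm (indicator chart_disk X * (w X * d n X)) \<le> indicator chart_disk X *\<^sub>R (\<bar>w X\<bar> * ((norm (g1 X))\<^sup>2 * (2 * C * \<bar>kernel_div \<delta> (chart_sq X)\<bar> + C * \<bar>kernel \<delta> (chart_sq X)\<bar>)))"
        by (cases "X \<in> chart_disk") (simp_all add: d_def kernel_div_def abs_mult)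
    qed
    show ms: "(\<lambda>X. indicator chart_disk X * (w X * d n X)) \<in> borel_measurable lebesgue" for n
      using borel_measurable_integrable[OF integrable_compact_continuous[OF chart_disk(1) continuous_on_mult[OF cw KKn[OF cd]]]] by simp
    have "(\<lambda>X. a X * (indicator chart_disk X *\<^sub>R (w X * ((norm (g1 X))\<^sup>2 * (2 * kernel_div \<delta> (chart_sq X)))))) \<in> borel_measurable lebesgue"
      unfolding kernel_div_def
      by (intro borel_measurable_times a(1) borel_measurable_integrable integrable_compact_continuous chart_disk(1) continuous_intros cw KKn cg k ctt)
    then show "(\<lambda>X. indicator chart_disk X * (w X * ((norm (g1 X))\<^sup>2 * (2 * a X * kernel_div \<delta> (chart_sq X))))) \<in> borel_measurable lebesgue"
      by (simp add: mult_ac)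
  qed
  define e where "e X = kernel \<delta> (chart_sq X) *\<^sub>R (g X * cnj (g1 X))" for X
  have ce: "continuous_on N e" unfolding e_def[abs_def] by (intro continuous_intros k cg)
  have ie: "integrable lebesgue (\<lambda>X. indicator chart_disk X * (e X \<bullet> G X))"
  proof -
    have c: "continuous_on N (\<lambda>X. Re (e X))" "continuous_on N (\<lambda>X. Im (e X))" by (intro continuous_intros ce)+
    have "integrable lebesgue (\<lambda>X. Re (indicator chart_disk X *\<^sub>R (Re (e X) *\<^sub>R G X)) + Im (indicator chart_disk X *\<^sub>R (Im (e X) *\<^sub>R G X)))"
      using integrable_chart_disk_mult[OF G c(1)] integrable_chart_disk_mult[OF G c(2)] by (intro Bochner_Integration.integrable_add integrable_Re integrable_Im)
    then show ?thesis by (simp add: inner_complex_def algebra_simps)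
  qed
  have R: "(\<lambda>n. LINT X|lebesgue. indicator chart_disk X * (field n \<delta> X \<bullet> G X)) \<longlonglongrightarrow> (LINT X|lebesgue. a X * (indicator chart_disk X * (e X \<bullet> G X)))"
  proof (rule integral_dominated_convergence[where w = "\<lambda>X. C * \<bar>indicator chart_disk X * (e X \<bullet> G X)\<bar>"])
    have eq: "indicator chart_disk X * (field n \<delta> X \<bullet> G X) = b n (Re (g X)) * (indicator chart_disk X * (e X \<bullet> G X))" for n X
      by (simp add: field_def e_def mult_ac)
    show "integrable lebesgue (\<lambda>X. C * \<bar>indicator chart_disk X * (e X \<bullet> G X)\<bar>)" using ie by auto
    show "AE X in lebesgue. (\<lambda>n. indicator chart_disk X * (field n \<delta> X \<bullet> G X)) \<longlonglongrightarrow> a X * (indicator chart_disk X * (e X \<bullet> G X))"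
      using b_lim
    proof (rule AE_mp, intro AE_I2 impI)
      fix X assume l: "X \<in> N \<longrightarrow> (\<lambda>n. b n (Re (g X))) \<longlonglongrightarrow> a X"
      show "(\<lambda>n. indicator chart_disk X * (field n \<delta> X \<bullet> G X)) \<longlonglongrightarrow> a X * (indicator chart_disk X * (e X \<bullet> G X))"
      proof (cases "X \<in> chart_disk")
        case True
        then have "(\<lambda>n. b n (Re (g X))) \<longlonglongrightarrow> a X" using l chart_disk(2) by auto
        then show ?thesis unfolding eq by (intro tendsto_intros)
      qed simp
    qed
    show "AE X in lebesgue. norm (indicator chart_disk X * (field n \<delta> X \<bullet> G X)) \<le> C * \<bar>indicator chart_disk X * (e X \<bullet> G X)\<bar>" for n
      unfolding eq real_norm_def abs_mult[of "b n _"] by (intro AE_I2 mult_right_mono bC) auto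
    show "(\<lambda>X. a X * (indicator chart_disk X * (e X \<bullet> G X))) \<in> borel_measurable lebesgue"
      using a(1) borel_measurable_integrable[OF ie] by (rule borel_measurable_times)
    show "(\<lambda>X. indicator chart_disk X * (field n \<delta> X \<bullet> G X)) \<in> borel_measurable lebesgue" for n
    proof -
      have cf: "continuous_on N (field n \<delta>)"
        by (intro continuous_at_imp_continuous_on ballI has_derivative_continuous[OF field_has_derivative[OF _ \<delta>]])
      have c: "continuous_on N (\<lambda>X. Re (field n \<delta> X))" "continuous_on N (\<lambda>X. Im (field n \<delta> X))" by (intro continuous_intros cf)+
      have "integrable lebesgue (\<lambda>X. Re (indicator chart_disk X *\<^sub>R (Re (field n \<delta> X) *\<^sub>R G X)) + Im (indicator chart_disk X *\<^sub>R (Im (field n \<delta> X) *\<^sub>R G X)))"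
        using integrable_chart_disk_mult[OF G c(1)] integrable_chart_disk_mult[OF G c(2)] by (intro Bochner_Integration.integrable_add integrable_Re integrable_Im)
      then show ?thesis by (intro borel_measurable_integrable) (simp add: inner_complex_def algebra_simps)
    qed
  qed
  have "(LINT X|lebesgue. a X * (indicator chart_disk X * (e X \<bullet> G X))) = 0"
  proof -
    obtain \<psi> where \<psi>: "\<And>t. t \<ge> 0 \<Longrightarrow> (\<psi> has_real_derivative kernel \<delta> t) (at t)" "\<And>t. t \<ge> 1 \<Longrightarrow> \<psi> t = 0"
      using kernel_primitive[OF \<delta>] by blast
    have "test_function S (\<lambda>X. if X \<in> N then \<psi> (chart_sq X) else 0) (\<lambda>X. if X \<in> N then 2 *\<^sub>R e X else 0)"
    proof (rule test_function_extend[OF N(1) chart_disk(2,1) N(2)])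
      fix X assume X: "X \<in> N"
      have "((\<lambda>X. \<psi> (chart_sq X)) has_derivative (\<lambda>h. kernel \<delta> (chart_sq X) * (h \<bullet> (2 *\<^sub>R (g X * cnj (g1 X)))))) (at X)"
        using has_derivative_compose[OF chart_sq_has_derivative[OF X], of \<psi> "(*) (kernel \<delta> (chart_sq X))"] \<psi>(1)[OF chart_sq_nonneg[of X]]
        by (simp add: has_field_derivative_def)
      then show "GDERIV (\<lambda>X. \<psi> (chart_sq X)) X :> 2 *\<^sub>R e X"
        unfolding gderiv_def e_def by (simp add: mult_ac)
      assume "X \<notin> chart_disk"
      then have "1 \<le> chart_sq X" using chart_sq_chart_disk[OF X] by simp
      then show "\<psi> (chart_sq X) = 0" "2 *\<^sub>R e X = 0" by (simp_all add: \<psi>(2) e_def kernel_zero)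
    qed (intro continuous_intros ce)
    from eq[OF this] have "(LINT X|lebesgue. indicator S X * (a X * (G X \<bullet> (if X \<in> N then 2 *\<^sub>R e X else 0)))) = 0"
      by (simp add: set_lebesgue_integral_def)
    moreover have "indicator S X * (a X * (G X \<bullet> (if X \<in> N then 2 *\<^sub>R e X else 0))) = 2 * (a X * (indicator chart_disk X * (e X \<bullet> G X)))" for X
    proof (cases "X \<in> N \<and> X \<notin> chart_disk")
      case True
      then have "e X = 0" using chart_sq_chart_disk[of X] by (simp add: e_def kernel_zero)
      then show ?thesis by simp
    next
      case False
      then show ?thesis using chart_disk(2) N(2) by (auto simp: indicator_def inner_commute)
    qed
    ultimately show ?thesis by simp
  qed
  moreover have "(LINT X|lebesgue. indicator chart_disk X * (w X * d n X)) = - (LINT X|lebesgue. indicator chart_disk X * (field n \<delta> X \<bullet> G X))" for n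
    using kernel_identity_n[OF \<delta> wg wc G, of n] unfolding set_lebesgue_integral_def field'_div d_def by simp
  ultimately have "(LINT X|lebesgue. indicator chart_disk X * (w X * ((norm (g1 X))\<^sup>2 * (2 * a X * kernel_div \<delta> (chart_sq X))))) = 0"
    using LIMSEQ_unique[OF L] tendsto_minus[OF R] by simp
  moreover have "indicator chart_disk X * (w X * ((norm (g1 X))\<^sup>2 * (2 * a X * kernel_div \<delta> (chart_sq X)))) = 2 * (indicator chart_disk X * (a X * (w X * ((norm (g1 X))\<^sup>2 * kernel_div \<delta> (chart_sq X)))))" for X
    by simp
  ultimately show ?thesis by simp
qed

text \<open>Constants solve the equation; applied to 1, \<open>kernel_identity\<close> equates the
  masses of the two weights that are compared in \<open>strong_maximum\<close>.\<close>

lemma weak_gradient_const: "weak_gradient S (\<lambda>_. 1) (\<lambda>_. 0)"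
  unfolding weak_gradient_def
proof (intro allI impI)
  fix \<phi> \<phi>' assume t: "test_function S \<phi> \<phi>'"
  have lg: "lipschitz_grad S (\<lambda>_. 1) (\<lambda>_. 0) 0"
    using S by unfold_locales (auto simp: gderiv_def)
  obtain K where K: "compact K" "K \<subseteq> S" "\<And>x. x \<notin> K \<Longrightarrow> \<phi>' x = 0" using test_functionD[OF t] by metis
  have c: "continuous_on UNIV \<phi>'" using t by (simp add: test_function_def)
  have i: "integrable lebesgue \<phi>'" by (rule integrable_compact_support[OF c K(1)]) (rule K(3))
  have z: "(LINT x|lebesgue. v \<bullet> \<phi>' x) = 0" for v
    using lipschitz_grad.integration_by_parts[OF lg t, of v] by simp
  have "integral\<^sup>L lebesgue \<phi>' = 0"
    using z[of 1] z[of \<i>] integral_Re[OF i] integral_Im[OF i] by (simp add: inner_complex_def complex_eq_iff)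
  moreover have "indicator S x *\<^sub>R (1 *\<^sub>R \<phi>' x) = \<phi>' x" for x using K by (cases "x \<in> S") auto
  ultimately show "(LINT X:S|lebesgue. 1 *\<^sub>R \<phi>' X) = - (LINT X:S|lebesgue. \<phi> X *\<^sub>R 0)"
    by (simp add: set_lebesgue_integral_def)
qed

text \<open>A positive linear functional: integration over the chart disk against the density
  \<open>a\<close>.\<close>

definition chart_energy :: "(complex \<Rightarrow> real) \<Rightarrow> real" where
  "chart_energy f = (LINT X|lebesgue. indicator chart_disk X * (a X * f X))"

lemma chart_energy_integrable:
  assumes "continuous_on chart_disk f" shows "integrable lebesgue (\<lambda>X. indicator chart_disk X * (a X * f X))"
proof -
  have "\<bar>a X\<bar> \<le> C" for X using a(2,3)[of X] by simp
  from integrable_bounded_mult[OF integrable_compact_continuous[OF chart_disk(1) assms] a(1) this]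
  show ?thesis by (simp add: mult_ac)
qed

lemma chart_energy_mono:
  assumes "continuous_on chart_disk f" "continuous_on chart_disk h" "\<And>X. X \<in> chart_disk \<Longrightarrow> f X \<le> h X"
  shows "chart_energy f \<le> chart_energy h"
  unfolding chart_energy_def
proof (rule integral_mono[OF chart_energy_integrable[OF assms(1)] chart_energy_integrable[OF assms(2)]])
  fix X show "indicator chart_disk X * (a X * f X) \<le> indicator chart_disk X * (a X * h X)"
    using assms(3)[of X] a(2)[of X] by (cases "X \<in> chart_disk") auto
qed

lemma chart_energy_add: "continuous_on chart_disk f \<Longrightarrow> continuous_on chart_disk h \<Longrightarrow> chart_energy (\<lambda>X. f X + h X) = chart_energy f + chart_energy h"
  unfolding chart_energy_def using Bochner_Integration.integral_add[OF chart_energy_integrable chart_energy_integrable]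
  by (simp add: distrib_left)

lemma chart_energy_cmult: "chart_energy (\<lambda>X. c * f X) = c * chart_energy f"
  unfolding chart_energy_def by (subst integral_mult_right_zero[symmetric]) (simp add: mult_ac)

lemma chart_energy_cong: "(\<And>X. X \<in> chart_disk \<Longrightarrow> f X = h X) \<Longrightarrow> chart_energy f = chart_energy h"
  unfolding chart_energy_def by (intro Bochner_Integration.integral_cong) (auto simp: indicator_def)

lemma chart_energy_tendsto:
  assumes f: "\<And>n. continuous_on chart_disk (f n)" and h: "continuous_on chart_disk h" and b: "continuous_on chart_disk B"
    and dom: "\<And>n X. X \<in> chart_disk \<Longrightarrow> \<bar>f n X\<bar> \<le> B X"
    and lim: "\<And>X. X \<in> chart_disk \<Longrightarrow> X \<noteq> x0 \<Longrightarrow> (\<lambda>n. f n X) \<longlonglongrightarrow> h X"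
  shows "(\<lambda>n. chart_energy (f n)) \<longlonglongrightarrow> chart_energy h"
  unfolding chart_energy_def
proof (rule integral_dominated_convergence[OF _ _ chart_energy_integrable[OF b]])
  have "AE X in lebesgue. X \<noteq> x0" by (rule AE_I'[of "{x0}"]) auto
  then show "AE X in lebesgue. (\<lambda>n. indicator chart_disk X * (a X * f n X)) \<longlonglongrightarrow> indicator chart_disk X * (a X * h X)"
  proof (rule AE_mp, intro AE_I2 impI)
    fix X assume "X \<noteq> x0"
    then show "(\<lambda>n. indicator chart_disk X * (a X * f n X)) \<longlonglongrightarrow> indicator chart_disk X * (a X * h X)"
      using lim[of X] by (cases "X \<in> chart_disk") (auto intro!: tendsto_intros)
  qed
  show "AE X in lebesgue. norm (indicator chart_disk X * (a X * f n X)) \<le> indicator chart_disk X * (a X * B X)" for n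
  proof (rule AE_I2)
    fix X show "norm (indicator chart_disk X * (a X * f n X)) \<le> indicator chart_disk X * (a X * B X)"
      using dom[of X n] a(2)[of X] by (cases "X \<in> chart_disk") (auto simp: abs_mult)
  qed
qed (intro borel_measurable_integrable chart_energy_integrable f h)+

text \<open>A bounded nonnegative part minus a nonnegative part that concentrates at
  \<open>t = 0\<close> as \<delta> tends to 0.\<close>

lemma kernel_div_eq: "kernel_div \<delta> t = 2 * (1 - t) * (t / (t + \<delta>)) - (1 - t)\<^sup>2 * (\<delta> / (t + \<delta>)\<^sup>2)" if "0 \<le> t" "t \<le> 1" "\<delta> > 0"
proof -
  define s where "s = t + \<delta>"
  have s: "s \<noteq> 0" using that by (simp add: s_def)
  have \<delta>: "\<delta> = s - t" by (simp add: s_def)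
  have m: "max 0 (1 - t) = 1 - t" using that by simp
  show ?thesis unfolding kernel_div_def kernel_def kernel'_def m s_def[symmetric] unfolding \<delta>
    using s by (simp add: divide_simps power2_eq_square) (simp add: algebra_simps)
qed

end

section \<open>The mean value argument\<close>

context conformal_chart
begin

lemma open_chart_disk: "open {X\<in>N. norm (g X) < 1}"
proof -
  have "N \<inter> (\<lambda>X. norm (g X)) -` {..<1} = {X\<in>N. norm (g X) < 1}" by auto
  then show ?thesis using continuous_open_preimage[OF continuous_on_norm[OF cg(1)] N(1) open_lessThan[of 1]] by simp
qed

text \<open>The nonnegative \<open>v\<close> satisfies the kernel identity, so its integral against
  the spread weight \<open>A n\<close> equals that against \<open>B n\<close>. The latter
  concentrates at \<open>x0\<close> with bounded mass, and \<open>v x0 = 0\<close>, so both tend to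
  0. In the limit \<open>v\<close> has integral 0 against a weight that is positive almost
  everywhere in the open chart disk.\<close>

theorem strong_maximum:
  assumes wg: "weak_gradient S w G" and wc: "continuous_on S w" and G: "set_integrable lebesgue S G"
    and eq: "\<And>\<phi> \<phi>'. test_function S \<phi> \<phi>' \<Longrightarrow> (LINT X:S|lebesgue. a X * (G X \<bullet> \<phi>' X)) = 0"
    and max: "\<And>X. X \<in> chart_disk \<Longrightarrow> w X \<le> w x0"
    and X: "X \<in> N" "norm (g X) < 1"
  shows "w X = w x0"
proof -
  define v where "v X = w x0 - w X" for X
  define \<mu> where "\<mu> X = (norm (g1 X))\<^sup>2" for X
  define \<delta> where "\<delta> n = inverse (real (Suc n))" for n
  have \<delta>: "\<delta> n > 0" for n by (simp add: \<delta>_def)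
  have \<delta>0: "\<delta> \<longlonglongrightarrow> 0" unfolding \<delta>_def[abs_def] by (rule LIMSEQ_inverse_real_of_nat)
  have KKn: "continuous_on chart_disk f" if "continuous_on N f" for f :: "complex \<Rightarrow> real"
    using continuous_on_subset[OF that chart_disk(2)] .
  have cv: "continuous_on chart_disk v" unfolding v_def using chart_disk(2) N(2)
    by (intro continuous_intros continuous_on_subset[OF wc]) auto
  have c\<mu>: "continuous_on chart_disk \<mu>" unfolding \<mu>_def[abs_def] by (intro KKn continuous_intros cg)
  have ct: "continuous_on chart_disk chart_sq" by (rule KKn[OF ctt])
  have td: "chart_sq X + \<delta> n \<noteq> 0" "chart_sq X + \<delta> n > 0" for X n using chart_sq_nonneg[of X] \<delta>[of n] by linarith+
  have t1: "chart_sq X \<le> 1" if "X \<in> chart_disk" for X using chart_sq_chart_disk[of X] that chart_disk(2) by auto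
  have v0: "v X \<ge> 0" if "X \<in> chart_disk" for X using max[OF that] by (simp add: v_def)
  define A where "A n X = 2 * (1 - chart_sq X) * (chart_sq X / (chart_sq X + \<delta> n))" for n X
  define B where "B n X = (1 - chart_sq X)\<^sup>2 * (\<delta> n / (chart_sq X + \<delta> n)\<^sup>2)" for n X
  have cA: "continuous_on chart_disk (A n)" for n unfolding A_def[abs_def] by (intro continuous_intros ct) (use td in auto)
  have cB: "continuous_on chart_disk (B n)" for n unfolding B_def[abs_def] by (intro continuous_intros ct) (use td in auto)
  have frac: "0 \<le> chart_sq X / (chart_sq X + \<delta> n)" "chart_sq X / (chart_sq X + \<delta> n) \<le> 1" for X n
    using td(2)[of X n] chart_sq_nonneg[of X] \<delta>[of n] by (auto simp: divide_le_eq)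
  have A_le: "A n X \<le> 2" "0 \<le> A n X" "A n X \<le> 2 * (1 - chart_sq X)" if "X \<in> chart_disk" for n X
  proof -
    have "2 * (1 - chart_sq X) * (chart_sq X / (chart_sq X + \<delta> n)) \<le> 2 * (1 - chart_sq X) * 1"
      using t1[OF that] frac by (intro mult_left_mono) auto
    then show "A n X \<le> 2 * (1 - chart_sq X)" by (simp add: A_def)
    then show "A n X \<le> 2" using chart_sq_nonneg[of X] by simp
    show "0 \<le> A n X" unfolding A_def using t1[OF that] frac(1)[of X n] by (intro mult_nonneg_nonneg) auto
  qed
  have B0: "0 \<le> B n X" for n X unfolding B_def using \<delta>[of n] by (intro mult_nonneg_nonneg) auto
  \<comment> \<open>Multiplied by \<open>chart_sq\<close>, the concentrating weight becomes
    harmless: the bound is at most 1 and tends to 0 off \<open>x0\<close>.\<close>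
  have tB: "chart_sq X * B n X \<le> \<delta> n / (chart_sq X + \<delta> n)" if "X \<in> chart_disk" for n X
  proof -
    have "(1 - chart_sq X)\<^sup>2 \<le> 1" using t1[OF that] chart_sq_nonneg[of X] by (simp add: power_le_one_iff abs_le_square_iff)
    then have "(1 - chart_sq X)\<^sup>2 * ((chart_sq X / (chart_sq X + \<delta> n)) * (\<delta> n / (chart_sq X + \<delta> n))) \<le> 1 * (1 * (\<delta> n / (chart_sq X + \<delta> n)))"
      using td(2)[of X n] \<delta>[of n] by (intro mult_mono mult_nonneg_nonneg frac) auto
    then show ?thesis by (simp add: B_def power2_eq_square mult_ac)
  qed
  have AB: "chart_energy (\<lambda>X. f X * \<mu> X * A n X) = chart_energy (\<lambda>X. f X * \<mu> X * B n X)"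
    if f: "continuous_on chart_disk f" "chart_energy (\<lambda>X. f X * (\<mu> X * kernel_div (\<delta> n) (chart_sq X))) = 0" for f n
  proof -
    have "chart_energy (\<lambda>X. f X * \<mu> X * A n X) = chart_energy (\<lambda>X. f X * \<mu> X * B n X + f X * (\<mu> X * kernel_div (\<delta> n) (chart_sq X)))"
      by (rule chart_energy_cong) (simp add: kernel_div_eq[OF chart_sq_nonneg t1 \<delta>] A_def B_def algebra_simps)
    also have "\<dots> = chart_energy (\<lambda>X. f X * \<mu> X * B n X) + chart_energy (\<lambda>X. f X * (\<mu> X * kernel_div (\<delta> n) (chart_sq X)))"
    proof (rule chart_energy_add)
      show "continuous_on chart_disk (\<lambda>X. f X * \<mu> X * B n X)" by (intro continuous_intros f(1) c\<mu> cB)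
      have "continuous_on chart_disk (\<lambda>X. f X * (\<mu> X * (A n X - B n X)))" by (intro continuous_intros f(1) c\<mu> cB cA)
      then show "continuous_on chart_disk (\<lambda>X. f X * (\<mu> X * kernel_div (\<delta> n) (chart_sq X)))"
        by (rule continuous_on_eq) (simp add: kernel_div_eq[OF chart_sq_nonneg t1 \<delta>] A_def B_def)
    qed
    finally show ?thesis using f(2) by simp
  qed
  have k1: "chart_energy (\<lambda>X. 1 * (\<mu> X * kernel_div (\<delta> n) (chart_sq X))) = 0" for n
    using kernel_identity[OF \<delta>[of n] weak_gradient_const] by (simp add: chart_energy_def \<mu>_def set_integrable_def set_lebesgue_integral_def)
  have kw: "chart_energy (\<lambda>X. w X * (\<mu> X * kernel_div (\<delta> n) (chart_sq X))) = 0" for n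
    using kernel_identity[OF \<delta>[of n] wg wc G eq] by (simp add: chart_energy_def \<mu>_def)
  have ck: "continuous_on chart_disk (\<lambda>X. \<mu> X * kernel_div (\<delta> n) (chart_sq X))" for n
  proof -
    have "continuous_on chart_disk (\<lambda>X. \<mu> X * (A n X - B n X))" by (intro continuous_intros c\<mu> cB cA)
    then show ?thesis by (rule continuous_on_eq) (simp add: kernel_div_eq[OF chart_sq_nonneg t1 \<delta>] A_def B_def)
  qed
  have cw: "continuous_on chart_disk w" using chart_disk(2) N(2) by (intro continuous_on_subset[OF wc]) auto
  have kv: "chart_energy (\<lambda>X. v X * (\<mu> X * kernel_div (\<delta> n) (chart_sq X))) = 0" for n
  proof -
    have "chart_energy (\<lambda>X. v X * (\<mu> X * kernel_div (\<delta> n) (chart_sq X))) =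
      chart_energy (\<lambda>X. w x0 * (1 * (\<mu> X * kernel_div (\<delta> n) (chart_sq X))) + (- 1) * (w X * (\<mu> X * kernel_div (\<delta> n) (chart_sq X))))"
      by (rule chart_energy_cong) (simp add: v_def algebra_simps)
    also have "\<dots> = chart_energy (\<lambda>X. w x0 * (1 * (\<mu> X * kernel_div (\<delta> n) (chart_sq X)))) + chart_energy (\<lambda>X. (- 1) * (w X * (\<mu> X * kernel_div (\<delta> n) (chart_sq X))))"
      by (intro chart_energy_add continuous_intros ck cw)
    finally show ?thesis unfolding chart_energy_cmult kw using k1[of n] by simp
  qed
  define M where "M = chart_energy \<mu>"
  \<comment> \<open>The constant 1 compares the mass of \<open>B n\<close> with that of the bounded
    weight \<open>A n\<close>, uniformly in \<open>n\<close>.\<close>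
  have massB: "chart_energy (\<lambda>X. \<mu> X * B n X) \<le> 2 * M" for n
  proof -
    have "chart_energy (\<lambda>X. \<mu> X * B n X) = chart_energy (\<lambda>X. \<mu> X * A n X)" using AB[of "\<lambda>_. 1" n] k1 by simp
    also have "\<dots> \<le> chart_energy (\<lambda>X. 2 * \<mu> X)"
    proof (rule chart_energy_mono)
      fix X assume "X \<in> chart_disk"
      then have "\<mu> X * A n X \<le> \<mu> X * 2" using A_le(1) by (intro mult_left_mono) (auto simp: \<mu>_def)
      then show "\<mu> X * A n X \<le> 2 * \<mu> X" by simp
    qed (intro continuous_intros c\<mu> cA)+
    finally show ?thesis by (simp add: chart_energy_cmult M_def)
  qed
  have limA: "(\<lambda>n. chart_energy (\<lambda>X. v X * \<mu> X * A n X)) \<longlonglongrightarrow> chart_energy (\<lambda>X. v X * \<mu> X * (2 * (1 - chart_sq X)))"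
  proof (rule chart_energy_tendsto)
    show "\<bar>v X * \<mu> X * A n X\<bar> \<le> v X * \<mu> X * 2" if "X \<in> chart_disk" for n X
    proof -
      have "0 \<le> v X * \<mu> X" using v0[OF that] by (simp add: \<mu>_def)
      then show ?thesis using A_le[OF that, of n] by (subst abs_of_nonneg) (auto intro: mult_left_mono mult_nonneg_nonneg)
    qed
    show "(\<lambda>n. v X * \<mu> X * A n X) \<longlonglongrightarrow> v X * \<mu> X * (2 * (1 - chart_sq X))" if "X \<in> chart_disk" "X \<noteq> x0" for X
    proof -
      have "g X \<noteq> 0" using g_zero[of X] that chart_disk(2) by auto
      then have "chart_sq X \<noteq> 0" by (simp add: chart_sq_def)
      then have "(\<lambda>n. chart_sq X / (chart_sq X + \<delta> n)) \<longlonglongrightarrow> chart_sq X / (chart_sq X + 0)" by (intro tendsto_intros \<delta>0) simp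
      then have "(\<lambda>n. v X * \<mu> X * (2 * (1 - chart_sq X) * (chart_sq X / (chart_sq X + \<delta> n)))) \<longlonglongrightarrow> v X * \<mu> X * (2 * (1 - chart_sq X) * (chart_sq X / (chart_sq X + 0)))"
        by (intro tendsto_mult tendsto_const)
      then show ?thesis using \<open>chart_sq X \<noteq> 0\<close> by (simp add: A_def)
    qed
  qed (intro continuous_intros cv c\<mu> cA ct)+
  have lim\<delta>: "(\<lambda>n. chart_energy (\<lambda>X. \<mu> X * (\<delta> n / (chart_sq X + \<delta> n)))) \<longlonglongrightarrow> chart_energy (\<lambda>X. 0)"
  proof (rule chart_energy_tendsto)
    show "\<bar>\<mu> X * (\<delta> n / (chart_sq X + \<delta> n))\<bar> \<le> \<mu> X" if "X \<in> chart_disk" for n X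
    proof -
      have "\<delta> n / (chart_sq X + \<delta> n) \<le> 1" "0 \<le> \<delta> n / (chart_sq X + \<delta> n)" using td(2)[of X n] chart_sq_nonneg[of X] \<delta>[of n] by (auto simp: divide_le_eq)
      note q = this
      have \<mu>0: "0 \<le> \<mu> X" by (simp add: \<mu>_def)
      show ?thesis
        using mult_nonneg_nonneg[OF \<mu>0 q(2)] mult_left_mono[OF q(1) \<mu>0] by (simp only: abs_of_nonneg mult_1_right)
    qed
    show "(\<lambda>n. \<mu> X * (\<delta> n / (chart_sq X + \<delta> n))) \<longlonglongrightarrow> 0" if "X \<in> chart_disk" "X \<noteq> x0" for X
    proof -
      have "g X \<noteq> 0" using g_zero[of X] that chart_disk(2) by auto
      then have "chart_sq X \<noteq> 0" by (simp add: chart_sq_def)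
      then have "(\<lambda>n. \<mu> X * (\<delta> n / (chart_sq X + \<delta> n))) \<longlonglongrightarrow> \<mu> X * (0 / (chart_sq X + 0))" by (intro tendsto_intros \<delta>0) simp
      then show ?thesis by simp
    qed
    show "continuous_on chart_disk (\<lambda>X. \<mu> X * (\<delta> n / (chart_sq X + \<delta> n)))" for n
      by (intro continuous_intros c\<mu> ct) (use td in auto)
  qed (intro continuous_intros c\<mu>)+
  have E0: "chart_energy (\<lambda>X. 0) = 0" by (simp add: chart_energy_def)
  have small: "chart_energy (\<lambda>X. v X * \<mu> X * (2 * (1 - chart_sq X))) \<le> \<eta> * (2 * M)" if \<eta>: "\<eta> > 0" for \<eta>
  proof -
    \<comment> \<open>The compact set where \<open>v\<close> is at least \<eta> misses
      \<open>x0\<close>, so \<open>chart_sq\<close> is bounded away from 0 on it.\<close>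
    obtain c where c: "c \<ge> 0" "\<And>X. X \<in> chart_disk \<Longrightarrow> v X \<le> \<eta> + c * chart_sq X"
    proof -
      define K' where "K' = {X\<in>chart_disk. \<eta> \<le> v X}"
      have "chart_disk \<inter> v -` {\<eta>..} = K'" by (auto simp: K'_def)
      then have "closedin (top_of_set chart_disk) K'" using continuous_closedin_preimage[OF cv closed_atLeast[of \<eta>]] by simp
      then have K': "compact K'" by (rule closedin_compact[OF chart_disk(1)])
      show thesis
      proof (cases "K' = {}")
        case True
        have "v X \<le> \<eta> + 0 * chart_sq X" if "X \<in> chart_disk" for X
        proof -
          have "X \<notin> K'" using True by simp
          then show ?thesis using that by (simp add: K'_def)
        qed
        then show thesis by (intro that[of 0] order_refl) auto
      next
        case False
        have sub: "K' \<subseteq> chart_disk" by (auto simp: K'_def)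
        obtain Y where Y0: "Y \<in> K'" "\<forall>X\<in>K'. chart_sq Y \<le> chart_sq X"
          using continuous_attains_inf[OF K' False continuous_on_subset[OF ct sub]] by (rule bexE)
        obtain Y' where Y0': "Y' \<in> K'" "\<forall>X\<in>K'. v X \<le> v Y'"
          using continuous_attains_sup[OF K' False continuous_on_subset[OF cv sub]] by (rule bexE)
        note Y = Y0(1) bspec[OF Y0(2)] and Y' = Y0'(1) bspec[OF Y0'(2)]
        have "v Y \<noteq> 0" using Y(1) \<eta> by (auto simp: K'_def)
        then have "Y \<noteq> x0" by (auto simp: v_def)
        then have "g Y \<noteq> 0" using g_zero[of Y] Y(1) sub chart_disk(2) by auto
        then have tY: "chart_sq Y > 0" by (simp add: chart_sq_def)
        have vY': "v Y' \<ge> 0" using v0 Y'(1) sub by auto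
        have "v X \<le> \<eta> + v Y' / chart_sq Y * chart_sq X" if X: "X \<in> chart_disk" for X
        proof (cases "X \<in> K'")
          case True
          have "v Y' * 1 \<le> v Y' * (chart_sq X / chart_sq Y)" using Y(2)[OF True] tY vY' by (intro mult_left_mono) auto
          then show ?thesis using Y'(2)[OF True] \<eta> by simp
        next
          case False
          then have "v X \<le> \<eta>" using X by (auto simp: K'_def)
          moreover have "0 \<le> v Y' / chart_sq Y * chart_sq X" using vY' tY chart_sq_nonneg[of X] by simp
          ultimately show ?thesis by simp
        qed
        moreover have "0 \<le> v Y' / chart_sq Y" using vY' tY by simp
        ultimately show thesis by (intro that[of "v Y' / chart_sq Y"]) auto
      qed
    qed
    have "chart_energy (\<lambda>X. v X * \<mu> X * A n X) \<le> \<eta> * (2 * M) + c * chart_energy (\<lambda>X. \<mu> X * (\<delta> n / (chart_sq X + \<delta> n)))" for n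
    proof -
      have cd: "continuous_on chart_disk (\<lambda>X. \<mu> X * (\<delta> n / (chart_sq X + \<delta> n)))"
        by (intro continuous_intros c\<mu> ct) (use td in auto)
      have "chart_energy (\<lambda>X. v X * \<mu> X * A n X) = chart_energy (\<lambda>X. v X * \<mu> X * B n X)" by (rule AB[OF cv kv])
      also have "\<dots> \<le> chart_energy (\<lambda>X. \<eta> * (\<mu> X * B n X) + c * (\<mu> X * (\<delta> n / (chart_sq X + \<delta> n))))"
      proof (rule chart_energy_mono)
        fix X assume X: "X \<in> chart_disk"
        have "0 \<le> \<mu> X" by (simp add: \<mu>_def)
        have "v X * (\<mu> X * B n X) \<le> (\<eta> + c * chart_sq X) * (\<mu> X * B n X)"
          using c(2)[OF X] B0[of n X] \<open>0 \<le> \<mu> X\<close> by (intro mult_right_mono) auto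
        moreover have "c * (\<mu> X * (chart_sq X * B n X)) \<le> c * (\<mu> X * (\<delta> n / (chart_sq X + \<delta> n)))"
          using tB[OF X, of n] c(1) \<open>0 \<le> \<mu> X\<close> by (intro mult_left_mono) auto
        ultimately show "v X * \<mu> X * B n X \<le> \<eta> * (\<mu> X * B n X) + c * (\<mu> X * (\<delta> n / (chart_sq X + \<delta> n)))"
          by (simp add: algebra_simps)
      qed (intro continuous_intros cv c\<mu> cB cd)+
      also have "\<dots> = chart_energy (\<lambda>X. \<eta> * (\<mu> X * B n X)) + chart_energy (\<lambda>X. c * (\<mu> X * (\<delta> n / (chart_sq X + \<delta> n))))"
        by (intro chart_energy_add continuous_intros c\<mu> cB cd)
      also have "\<dots> \<le> \<eta> * (2 * M) + c * chart_energy (\<lambda>X. \<mu> X * (\<delta> n / (chart_sq X + \<delta> n)))"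
        unfolding chart_energy_cmult using massB[of n] \<eta> by simp
      finally show ?thesis .
    qed
    moreover have "(\<lambda>n. \<eta> * (2 * M) + c * chart_energy (\<lambda>X. \<mu> X * (\<delta> n / (chart_sq X + \<delta> n)))) \<longlonglongrightarrow> \<eta> * (2 * M) + c * 0"
      using lim\<delta> unfolding E0 by (intro tendsto_intros)
    ultimately have "chart_energy (\<lambda>X. v X * \<mu> X * (2 * (1 - chart_sq X))) \<le> \<eta> * (2 * M) + c * 0"
      by (intro LIMSEQ_le[OF limA]) auto
    then show ?thesis by simp
  qed
  have M0: "0 \<le> M" unfolding M_def using chart_energy_mono[of "\<lambda>_. 0" \<mu>] c\<mu> E0 by (simp add: \<mu>_def)
  have le0: "chart_energy (\<lambda>X. v X * \<mu> X * (2 * (1 - chart_sq X))) \<le> 0"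
  proof (rule field_le_epsilon)
    fix e :: real assume "e > 0"
    \<comment> \<open>The extra 1 keeps the divisor positive also when \<open>M\<close> is
      0.\<close>
    then have "chart_energy (\<lambda>X. v X * \<mu> X * (2 * (1 - chart_sq X))) \<le> e / (2 * M + 1) * (2 * M)" using M0 by (intro small) auto
    also have "\<dots> = e * (2 * M / (2 * M + 1))" by simp
    also have "\<dots> \<le> e * 1" using \<open>e > 0\<close> M0 by (intro mult_left_mono) auto
    finally show "chart_energy (\<lambda>X. v X * \<mu> X * (2 * (1 - chart_sq X))) \<le> 0 + e" by (simp only: mult_1_right add_0)
  qed
  have nn: "0 \<le> indicator chart_disk X * (a X * (v X * \<mu> X * (2 * (1 - chart_sq X))))" for X
    using v0[of X] t1[of X] a(2)[of X] by (cases "X \<in> chart_disk") (auto simp: \<mu>_def)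
  have int: "integrable lebesgue (\<lambda>X. indicator chart_disk X * (a X * (v X * \<mu> X * (2 * (1 - chart_sq X)))))"
    by (intro chart_energy_integrable continuous_intros cv c\<mu> ct)
  have "chart_energy (\<lambda>X. v X * \<mu> X * (2 * (1 - chart_sq X))) = 0"
    using le0 Bochner_Integration.integral_nonneg[of lebesgue, OF nn] unfolding chart_energy_def by (rule antisym)
  then have ae: "AE X in lebesgue. indicator chart_disk X * (a X * (v X * \<mu> X * (2 * (1 - chart_sq X)))) = 0"
    using integral_nonneg_eq_0_iff_AE[OF int AE_I2[OF nn]] by (simp add: chart_energy_def)
  \<comment> \<open>On this open set the integrand does not vanish, as its other factors are
    positive there. So the set is null, and an open null set is empty.\<close>
  define P where "P = {X\<in>N. norm (g X) < 1 \<and> w X \<noteq> w x0}"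
  have openP: "open P"
  proof -
    have cwN: "continuous_on N w" by (rule continuous_on_subset[OF wc N(2)])
    have "open {X\<in>N. norm (g X) < 1}"
      by (rule open_chart_disk)
    moreover have "open {X\<in>N. w X \<noteq> w x0}"
    proof -
      have "N \<inter> w -` (- {w x0}) = {X\<in>N. w X \<noteq> w x0}" by auto
      then show ?thesis using continuous_open_preimage[OF cwN N(1), of "- {w x0}"] by (simp add: open_Compl)
    qed
    ultimately have "open ({X\<in>N. norm (g X) < 1} \<inter> {X\<in>N. w X \<noteq> w x0})" by (rule open_Int)
    also have "\<dots> = P" by (auto simp: P_def)
    finally show ?thesis .
  qed
  have "negligible P"
  proof -
    have ne: "indicator chart_disk X * (a X * (v X * \<mu> X * (2 * (1 - chart_sq X)))) \<noteq> 0" if "X \<in> P" for X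
    proof -
      have X: "X \<in> N" "norm (g X) < 1" "v X \<noteq> 0" using that by (auto simp: P_def v_def)
      have "chart_sq X < 1" unfolding chart_sq_def using X(2) by (simp add: power_less_one_iff abs_square_less_1)
      moreover have "X \<in> chart_disk" using X by (simp add: chart_disk_def)
      moreover have "\<mu> X \<noteq> 0" using g1_nz[OF X(1)] by (simp add: \<mu>_def)
      ultimately show ?thesis using X(3) a(2)[of X] by simp
    qed
    have "AE X in lebesgue. X \<notin> P"
      using ae
    proof eventually_elim
      case (elim X)
      then show ?case using ne[of X] by blast
    qed
    moreover have "P \<in> sets lebesgue" using openP by simp
    ultimately show ?thesis by (simp add: negligible_iff_null_sets AE_iff_null_sets)
  qed
  then have "P = {}" using open_not_negligible[OF openP] by blast
  then have "X \<notin> P" by simp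
  then show ?thesis using X by (simp add: P_def)
qed

end

section \<open>Functions with vanishing integrals against test functions\<close>

definition C1_fun :: "(complex \<Rightarrow> real) \<Rightarrow> bool" where
  "C1_fun f \<longleftrightarrow> (\<exists>f'. (\<forall>X. GDERIV f X :> f' X) \<and> continuous_on UNIV f')"

lemma GDERIV_continuous_on:
  assumes "\<And>X. GDERIV f X :> f' X" shows "continuous_on UNIV f"
proof -
  have "isCont f X" for X using assms unfolding gderiv_def by (rule has_derivative_continuous)
  then show ?thesis by (simp add: continuous_at_imp_continuous_on)
qed

lemma C1_fun_mult: assumes "C1_fun f" "C1_fun g" shows "C1_fun (\<lambda>X. f X * g X)"
proof -
  obtain f' where f: "\<And>X. GDERIV f X :> f' X" "continuous_on UNIV f'" using assms(1) by (auto simp: C1_fun_def)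
  obtain g' where g: "\<And>X. GDERIV g X :> g' X" "continuous_on UNIV g'" using assms(2) by (auto simp: C1_fun_def)
  have "continuous_on UNIV (\<lambda>X. f X *\<^sub>R g' X + g X *\<^sub>R f' X)"
    by (intro continuous_intros f(2) g(2) GDERIV_continuous_on[OF f(1)] GDERIV_continuous_on[OF g(1)])
  then show ?thesis unfolding C1_fun_def using GDERIV_mult[OF f(1) g(1)]
    by (intro exI[of _ "\<lambda>X. f X *\<^sub>R g' X + g X *\<^sub>R f' X"]) simp
qed

lemma C1_fun_compose:
  assumes "C1_fun f" and s: "\<And>t. (s has_real_derivative s' t) (at t)" "continuous_on UNIV s'"
  shows "C1_fun (\<lambda>X. s (f X))"
proof -
  obtain f' where f: "\<And>X. GDERIV f X :> f' X" "continuous_on UNIV f'" using assms(1) by (auto simp: C1_fun_def)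
  have "continuous_on UNIV (\<lambda>X. s' (f X) *\<^sub>R f' X)"
    by (intro continuous_intros f(2) continuous_on_compose2[OF s(2) GDERIV_continuous_on[OF f(1)]]) auto
  then show ?thesis unfolding C1_fun_def using GDERIV_DERIV_compose[OF f(1) s(1)]
    by (intro exI[of _ "\<lambda>X. s' (f X) *\<^sub>R f' X"]) simp
qed

text \<open>A continuously differentiable function that is 0 on the negative axis and tends to 1:
  \<open>bump (real m * y)\<close> approximates the indicator of \<open>y > 0\<close>, and a
  constant shift moves the support strictly inside.\<close>

definition bump :: "real \<Rightarrow> real" where "bump t = (max 0 t)\<^sup>2 / (1 + (max 0 t)\<^sup>2)"

lemma C1_fun_bump: assumes "C1_fun f" shows "C1_fun (\<lambda>X. bump (f X))"
proof (rule C1_fun_compose[OF assms])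
  have nz: "1 + x\<^sup>2 \<noteq> 0" for x :: real using zero_le_power2[of x] by linarith
  show "(bump has_real_derivative ((2 * max 0 t) * (1 + (max 0 t)\<^sup>2) - (max 0 t)\<^sup>2 * (0 + 2 * max 0 t)) / ((1 + (max 0 t)\<^sup>2) * (1 + (max 0 t)\<^sup>2))) (at t)" for t
    unfolding bump_def[abs_def]
    by (rule DERIV_divide[OF max_sq_has_derivative DERIV_add[OF DERIV_const max_sq_has_derivative] nz])
  show "continuous_on UNIV (\<lambda>t::real. ((2 * max 0 t) * (1 + (max 0 t)\<^sup>2) - (max 0 t)\<^sup>2 * (0 + 2 * max 0 t)) / ((1 + (max 0 t)\<^sup>2) * (1 + (max 0 t)\<^sup>2)))"
    by (intro continuous_intros) (use nz in auto)
qed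

lemma bump_bounds: "0 \<le> bump t" "bump t \<le> 1" "bump t = 0 \<longleftrightarrow> t \<le> 0"
proof -
  have nz: "1 + x\<^sup>2 > 0" for x :: real using zero_le_power2[of x] by linarith
  show "0 \<le> bump t" "bump t \<le> 1" "bump t = 0 \<longleftrightarrow> t \<le> 0"
    using nz[of "max 0 t"] by (auto simp: bump_def max_def divide_le_eq)
qed

lemma bump_tendsto:
  assumes d: "d \<ge> 0" shows "(\<lambda>m. bump (real m * y - d)) \<longlonglongrightarrow> (if y > 0 then 1 else 0)"
proof (cases "y > 0")
  case True
  have at: "filterlim (\<lambda>m. real m * y - d) at_top sequentially"
    using True by real_asymp
  have "((\<lambda>t::real. t\<^sup>2 / (1 + t\<^sup>2)) \<longlongrightarrow> 1) at_top" by real_asymp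
  then have "(bump \<longlongrightarrow> 1) at_top"
    by (rule Lim_transform_eventually) (auto simp: bump_def intro!: eventually_mono[OF eventually_ge_at_top[of 0]])
  from filterlim_compose[OF this at] show ?thesis using True by simp
next
  case False
  have "bump (real m * y - d) = 0" for m
  proof -
    have "real m * y \<le> 0" using False by (simp add: mult_nonneg_nonpos)
    then show ?thesis using d bump_bounds(3) by simp
  qed
  then show ?thesis using False by simp
qed

lemma C1_fun_affine: "C1_fun (\<lambda>X. p * (Re X - q) - d)" "C1_fun (\<lambda>X. p * (q - Re X) - d)"
  "C1_fun (\<lambda>X. p * (Im X - q) - d)" "C1_fun (\<lambda>X. p * (q - Im X) - d)"
proof -
  have "GDERIV (\<lambda>X. p * (Re X - q) - d) X :> of_real p" for X
    unfolding gderiv_def by (auto intro!: derivative_eq_intros simp: inner_complex_def mult.commute)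
  then show "C1_fun (\<lambda>X. p * (Re X - q) - d)" unfolding C1_fun_def by (intro exI[of _ "\<lambda>_. of_real p"]) auto
  have "GDERIV (\<lambda>X. p * (q - Re X) - d) X :> of_real (- p)" for X
    unfolding gderiv_def by (auto intro!: derivative_eq_intros simp: inner_complex_def mult.commute)
  then show "C1_fun (\<lambda>X. p * (q - Re X) - d)" unfolding C1_fun_def by (intro exI[of _ "\<lambda>_. of_real (-p)"]) auto
  have "GDERIV (\<lambda>X. p * (Im X - q) - d) X :> \<i> * of_real p" for X
    unfolding gderiv_def by (auto intro!: derivative_eq_intros simp: inner_complex_def mult.commute)
  then show "C1_fun (\<lambda>X. p * (Im X - q) - d)" unfolding C1_fun_def by (intro exI[of _ "\<lambda>_. \<i> * of_real p"]) auto
  have "GDERIV (\<lambda>X. p * (q - Im X) - d) X :> \<i> * of_real (- p)" for X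
    unfolding gderiv_def by (auto intro!: derivative_eq_intros simp: inner_complex_def mult.commute)
  then show "C1_fun (\<lambda>X. p * (q - Im X) - d)" unfolding C1_fun_def by (intro exI[of _ "\<lambda>_. \<i> * of_real (-p)"]) auto
qed

lemma C1_fun_quadratic: "C1_fun (\<lambda>X. p * (s - (norm (X - Z))\<^sup>2) - d)"
proof -
  have "GDERIV (\<lambda>X. p * (s - (norm (X - Z))\<^sup>2) - d) X :> (- 2 * p) *\<^sub>R (X - Z)" for X
    unfolding gderiv_def power2_norm_eq_inner
    by (auto intro!: derivative_eq_intros simp: inner_commute algebra_simps)
  then show ?thesis unfolding C1_fun_def by (intro exI[of _ "\<lambda>X. (- 2 * p) *\<^sub>R (X - Z)"]) (auto intro!: continuous_intros)
qed

lemma test_function_C1: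
  assumes "C1_fun f" "compact K" "K \<subseteq> S" "\<And>X. X \<notin> K \<Longrightarrow> f X = 0"
  shows "\<exists>f'. test_function S f f'"
proof -
  obtain f' where f: "\<And>X. GDERIV f X :> f' X" "continuous_on UNIV f'" using assms(1) by (auto simp: C1_fun_def)
  have sub: "closure {X. f X \<noteq> 0} \<subseteq> K"
    by (rule closure_minimal) (use assms(4) compact_imp_closed[OF assms(2)] in auto)
  moreover have "compact (closure {X. f X \<noteq> 0})"
    using compact_Int_closed[OF assms(2) closed_closure[of "{X. f X \<noteq> 0}"]] sub by (simp only: Int_absorb1)
  ultimately have "test_function S f f'" using f assms(3) by (auto simp: test_function_def)
  then show ?thesis by (intro exI[of _ f'])
qed

text \<open>The indicator of the box within the disk is a bounded limit of test functions, products
  of five bumps: one for each side of the box and one for the disk.\<close>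

lemma integral_box_eq_0:
  assumes G: "set_integrable lebesgue (ball Z \<rho>) (G :: complex \<Rightarrow> complex)"
    and eq: "\<And>\<phi> \<phi>'. test_function (ball Z \<rho>) \<phi> \<phi>' \<Longrightarrow> (LINT X:ball Z \<rho>|lebesgue. \<phi> X *\<^sub>R G X) = 0"
  shows "(LINT X|lebesgue. indicator (box a b) X *\<^sub>R (indicator (ball Z \<rho>) X *\<^sub>R G X)) = 0"
proof -
  define h where "h X = indicator (ball Z \<rho>) X *\<^sub>R G X" for X
  have h: "integrable lebesgue h" using G by (simp add: set_integrable_def h_def[abs_def])
  define f where "f m X = bump (real m * (Re X - Re a) - 0) * bump (real m * (Re b - Re X) - 0) * bump (real m * (Im X - Im a) - 0)
     * bump (real m * (Im b - Im X) - 0) * bump (real m * (\<rho>\<^sup>2 - (norm (X - Z))\<^sup>2) - 1)" for m X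
  have C1: "C1_fun (f m)" for m
    unfolding f_def by (intro C1_fun_mult C1_fun_bump C1_fun_affine C1_fun_quadratic)
  then have cont: "continuous_on UNIV (f m)" for m
    unfolding C1_fun_def using GDERIV_continuous_on by blast
  have f01: "0 \<le> f m X" "f m X \<le> 1" for m X
    unfolding f_def by (auto intro!: mult_nonneg_nonneg mult_le_one bump_bounds)
  have "(LINT X|lebesgue. f m X *\<^sub>R h X) = 0" for m
  proof -
    \<comment> \<open>The shift by 1 in the last factor confines the support to a closed disk whose
      squared radius is \<open>\<rho>\<^sup>2 - 1 / m\<close>, compact in the open one; for
      \<open>m = 0\<close> the set is empty.\<close>
    define K where "K = {X. 1 \<le> real m * (\<rho>\<^sup>2 - (norm (X - Z))\<^sup>2)} \<inter> cball Z \<bar>\<rho>\<bar>"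
    have "closed {X. 1 \<le> real m * (\<rho>\<^sup>2 - (norm (X - Z))\<^sup>2)}" by (intro closed_Collect_le continuous_intros)
    then have K: "compact K" unfolding K_def using closed_Int_compact compact_cball by blast
    have sq: "norm (X - Z) < \<bar>\<rho>\<bar>" if "1 \<le> real m * (\<rho>\<^sup>2 - (norm (X - Z))\<^sup>2)" for X
    proof -
      have "0 < \<rho>\<^sup>2 - (norm (X - Z))\<^sup>2" using that by (smt (verit) mult_nonneg_nonpos of_nat_0_le_iff)
      then have "(norm (X - Z))\<^sup>2 < \<bar>\<rho>\<bar>\<^sup>2" by simp
      then show ?thesis by (rule power2_less_imp_less) simp
    qed
    show ?thesis
    proof (cases "\<rho> > 0")
      case True
      have "K \<subseteq> ball Z \<rho>" using sq True by (auto simp: K_def dist_norm norm_minus_commute)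
      moreover have "f m X = 0" if "X \<notin> K" for X
      proof -
        have "\<not> 1 < real m * (\<rho>\<^sup>2 - (norm (X - Z))\<^sup>2)"
        proof
          assume "1 < real m * (\<rho>\<^sup>2 - (norm (X - Z))\<^sup>2)"
          then have "1 \<le> real m * (\<rho>\<^sup>2 - (norm (X - Z))\<^sup>2)" by simp
          then have "X \<in> K" using sq[of X] by (simp add: K_def dist_norm norm_minus_commute)
          then show False using that by simp
        qed
        then have "bump (real m * (\<rho>\<^sup>2 - (norm (X - Z))\<^sup>2) - 1) = 0" by (subst bump_bounds(3)) simp
        then show ?thesis by (simp add: f_def)
      qed
      ultimately obtain f' where "test_function (ball Z \<rho>) (f m) f'"
        using test_function_C1[OF C1 K] by blast
      from eq[OF this] have "(LINT X|lebesgue. indicator (ball Z \<rho>) X *\<^sub>R (f m X *\<^sub>R G X)) = 0"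
        by (simp only: set_lebesgue_integral_def)
      moreover have "indicator (ball Z \<rho>) X *\<^sub>R (f m X *\<^sub>R G X) = f m X *\<^sub>R h X" for X by (simp add: h_def)
      ultimately show ?thesis by simp
    next
      case False
      then have "h X = 0" for X by (simp add: h_def ball_empty)
      then show ?thesis by simp
    qed
  qed
  moreover have "(\<lambda>m. LINT X|lebesgue. f m X *\<^sub>R h X) \<longlonglongrightarrow> (LINT X|lebesgue. indicator (box a b) X *\<^sub>R h X)"
  proof (rule integral_dominated_convergence[where w = "\<lambda>X. norm (h X)"])
    show "AE X in lebesgue. (\<lambda>m. f m X *\<^sub>R h X) \<longlonglongrightarrow> indicator (box a b) X *\<^sub>R h X"
    proof (rule AE_I2)
      fix X
      show "(\<lambda>m. f m X *\<^sub>R h X) \<longlonglongrightarrow> indicator (box a b) X *\<^sub>R h X"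
      proof (cases "X \<in> ball Z \<rho>")
        case True
        then have "(norm (X - Z))\<^sup>2 < \<rho>\<^sup>2" by (intro power_strict_mono) (auto simp: dist_norm norm_minus_commute)
        then have "(\<lambda>m. f m X) \<longlonglongrightarrow> (if Re X - Re a > 0 then 1 else 0) * (if Re b - Re X > 0 then 1 else 0) * (if Im X - Im a > 0 then 1 else 0)
          * (if Im b - Im X > 0 then 1 else 0) * (if \<rho>\<^sup>2 - (norm (X - Z))\<^sup>2 > 0 then 1 else 0)"
          unfolding f_def by (intro tendsto_mult bump_tendsto) auto
        also have "(if Re X - Re a > 0 then 1 else 0) * (if Re b - Re X > 0 then 1 else 0) * (if Im X - Im a > 0 then 1 else 0)
          * (if Im b - Im X > 0 then 1 else 0) * (if \<rho>\<^sup>2 - (norm (X - Z))\<^sup>2 > 0 then 1 else 0) = (indicator (box a b) X :: real)"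
          using \<open>(norm (X - Z))\<^sup>2 < \<rho>\<^sup>2\<close> by (auto simp: indicator_def in_box_complex_iff)
        finally show ?thesis by (intro tendsto_intros)
      qed (simp add: h_def)
    qed
    show "AE X in lebesgue. norm (f m X *\<^sub>R h X) \<le> norm (h X)" for m
      using f01 by (intro AE_I2) (simp add: mult_left_le_one_le)
    show "(\<lambda>X. f m X *\<^sub>R h X) \<in> borel_measurable lebesgue" for m
      by (intro borel_measurable_scaleR continuous_borel_lebesgue cont borel_measurable_integrable h)
    show "(\<lambda>X. indicator (box a b) X *\<^sub>R h X) \<in> borel_measurable lebesgue"
      by (intro borel_measurable_scaleR borel_measurable_indicator borel_measurable_integrable h) simp
  qed (use h in simp)
  ultimately show ?thesis by (simp add: LIMSEQ_const_iff h_def[symmetric])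
qed

text \<open>Boxes form an intersection-stable generator of the Borel sets, so Dynkin's argument
  spreads the vanishing of the integrals to Borel sets, and null sets do the rest. A function whose
  integral over every measurable set is 0 vanishes almost everywhere.\<close>

theorem weak_zero_imp_AE_zero:
  assumes G: "set_integrable lebesgue (ball Z \<rho>) (G :: complex \<Rightarrow> complex)"
    and eq: "\<And>\<phi> \<phi>'. test_function (ball Z \<rho>) \<phi> \<phi>' \<Longrightarrow> (LINT X:ball Z \<rho>|lebesgue. \<phi> X *\<^sub>R G X) = 0"
  shows "AE X in lebesgue. X \<in> ball Z \<rho> \<longrightarrow> G X = 0"
proof -
  define h where "h X = indicator (ball Z \<rho>) X *\<^sub>R G X" for X
  have h: "integrable lebesgue h" using G by (simp add: set_integrable_def h_def[abs_def])
  have box: "(LINT X|lebesgue. indicator (box a b) X *\<^sub>R h X) = 0" for a b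
    using integral_box_eq_0[OF G eq] by (simp add: h_def)
  have hA: "integrable lebesgue (\<lambda>X. indicator A X *\<^sub>R h X)" if "A \<in> sets lebesgue" for A
    using integrable_mult_indicator[OF that h] .
  \<comment> \<open>A box around the disk gives the integral over the whole plane, which the
    complement step needs.\<close>
  obtain a b where ab: "ball Z \<rho> \<subseteq> box a b" using bounded_subset_box_symmetric[OF bounded_ball] by metis
  have "indicator (box a b) X *\<^sub>R h X = h X" for X using ab by (auto simp: h_def indicator_def)
  then have UN: "integral\<^sup>L lebesgue h = 0" using box[of a b] by simp
  have leb: "A \<in> sets lebesgue" if "A \<in> sets borel" for A :: "complex set" using that by simp
  have ss: "sets borel = sigma_sets UNIV (range (\<lambda>(a, b). box a b :: complex set))"
    by (subst borel_eq_box) simp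
  have borel: "(LINT X|lebesgue. indicator A X *\<^sub>R h X) = 0" if "A \<in> sets borel" for A
  proof -
    have "Int_stable (range (\<lambda>(a, b). box a b :: complex set))"
      unfolding Int_stable_def by (auto simp: box_Int_box)
    moreover have "range (\<lambda>(a, b). box a b :: complex set) \<subseteq> Pow UNIV" by simp
    moreover have "A \<in> sigma_sets UNIV (range (\<lambda>(a, b). box a b :: complex set))" using that ss by simp
    ultimately show ?thesis
    proof (induction rule: sigma_sets_induct_disjoint)
      case (basic A) then show ?case using box by auto
    next
      case empty show ?case by simp
    next
      case (compl A)
      have A: "A \<in> sets lebesgue" using compl(1) ss leb by simp
      have "(LINT X|lebesgue. indicator (UNIV - A) X *\<^sub>R h X) = (LINT X|lebesgue. h X - indicator A X *\<^sub>R h X)"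
        by (intro Bochner_Integration.integral_cong) (auto simp: indicator_def)
      also have "\<dots> = 0" using UN compl(2) by (subst Bochner_Integration.integral_diff[OF h hA[OF A]]) simp
      finally show ?case .
    next
      case (union A)
      have A: "A i \<in> sets lebesgue" for i
      proof (rule leb)
        show "A i \<in> sets borel" unfolding ss using union(2) by blast
      qed
      have "(LINT X:(\<Union>i. A i)|lebesgue. h X) = (\<Sum>i. LINT X:A i|lebesgue. h X)"
      proof (rule lebesgue_integral_countable_add)
        show "A i \<inter> A j = {}" if "i \<noteq> j" for i j using union(1) that by (auto simp: disjoint_family_on_def)
        show "set_integrable lebesgue (\<Union>i. A i) h" unfolding set_integrable_def by (rule hA) (use A in auto)
      qed (rule A)
      then show ?case using union(3) by (simp add: set_lebesgue_integral_def)
    qed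
  qed
  have leb0: "(LINT X|lebesgue. indicator A X *\<^sub>R h X) = 0" if A: "A \<in> sets lebesgue" for A
  proof -
    obtain C T where CT: "fsigma C" "T \<in> null_sets lebesgue" "C \<union> T = A" "disjnt C T"
      using lebesgue_set_almost_fsigma[OF A] by metis
    have C: "C \<in> sets borel" using CT(1) by (induction rule: fsigma.induct) auto
    have "(LINT X|lebesgue. indicator A X *\<^sub>R h X) = (LINT X|lebesgue. indicator C X *\<^sub>R h X)"
    proof (rule integral_cong_AE)
      show "AE X in lebesgue. indicator A X *\<^sub>R h X = indicator C X *\<^sub>R h X"
        using AE_not_in[OF CT(2)] by (rule AE_mp) (use CT(3) in \<open>auto intro!: AE_I2 simp: indicator_def\<close>)
    qed (use hA[OF A] hA[OF leb[OF C]] in \<open>auto intro: borel_measurable_integrable\<close>)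
    then show ?thesis using borel[OF C] by simp
  qed
  have hc: "integrable lebesgue (\<lambda>X. Re (h X))" "integrable lebesgue (\<lambda>X. Im (h X))"
    by (intro integrable_Re integrable_Im h)+
  have "AE X in lebesgue. Re (h X) = 0"
  proof (rule density_unique_real[OF hc(1) integrable_zero])
    fix A :: "complex set" assume A: "A \<in> sets lebesgue"
    have "(LINT X|lebesgue. Re (indicator A X *\<^sub>R h X)) = 0" using integral_Re[OF hA[OF A]] leb0[OF A] by simp
    then show "(LINT X:A|lebesgue. Re (h X)) = (LINT X:A|lebesgue. 0)" by (simp add: set_lebesgue_integral_def)
  qed
  moreover have "AE X in lebesgue. Im (h X) = 0"
  proof (rule density_unique_real[OF hc(2) integrable_zero])
    fix A :: "complex set" assume A: "A \<in> sets lebesgue"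
    have "(LINT X|lebesgue. Im (indicator A X *\<^sub>R h X)) = 0" using integral_Im[OF hA[OF A]] leb0[OF A] by simp
    then show "(LINT X:A|lebesgue. Im (h X)) = (LINT X:A|lebesgue. 0)" by (simp add: set_lebesgue_integral_def)
  qed
  ultimately show ?thesis
  proof eventually_elim
    case (elim X)
    then show ?case by (auto simp: h_def complex_eq_iff)
  qed
qed

section \<open>Uniqueness for the conductivity problem\<close>

lemma square_integrable_imp_set_integrable:
  assumes "square_integrable_on (ball Z \<rho>) G"
  shows "set_integrable lebesgue (ball Z \<rho>) G"
proof -
  have m: "G \<in> borel_measurable (lebesgue_on (ball Z \<rho>))" and i: "integrable lebesgue (\<lambda>X. indicator (ball Z \<rho>) X *\<^sub>R (norm (G X))\<^sup>2)"
    using assms by (auto simp: square_integrable_on_def set_integrable_def)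
  have m': "(\<lambda>X. indicator (ball Z \<rho>) X *\<^sub>R G X) \<in> borel_measurable lebesgue"
  proof -
    have "(\<lambda>X. if X \<in> ball Z \<rho> then G X else 0) \<in> borel_measurable lebesgue"
      by (rule iffD2[OF borel_measurable_if m]) simp
    moreover have "(\<lambda>X. if X \<in> ball Z \<rho> then G X else 0) = (\<lambda>X. indicator (ball Z \<rho>) X *\<^sub>R G X)" by (auto simp: indicator_def)
    ultimately show ?thesis by simp
  qed
  have "emeasure lebesgue (ball Z \<rho>) < \<infinity>"
    using lmeasurable_ball[of Z \<rho>] by (auto simp: fmeasurable_def)
  then have i1: "integrable lebesgue (indicator (ball Z \<rho>) :: complex \<Rightarrow> real)"
    by (intro integrable_real_indicator) auto
  show ?thesis unfolding set_integrable_def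
  proof (rule Bochner_Integration.integrable_bound[OF Bochner_Integration.integrable_add[OF i1 i] m'], rule AE_I2)
    fix X
    have "norm (G X) \<le> 1 + (norm (G X))\<^sup>2"
      using zero_le_power2[of "norm (G X) - 1/2"] by (simp add: power2_eq_square algebra_simps)
    then show "norm (indicator (ball Z \<rho>) X *\<^sub>R G X) \<le> norm (indicator (ball Z \<rho>) X + indicator (ball Z \<rho>) X *\<^sub>R (norm (G X))\<^sup>2)"
      by (auto simp: indicator_def)
  qed
qed

lemma integrable_bounded_inner:
  assumes G: "set_integrable lebesgue S (G :: complex \<Rightarrow> complex)" and t: "test_function S \<phi> \<phi>'"
    and a: "a \<in> borel_measurable lebesgue" "\<And>X. \<bar>a X\<bar> \<le> (C::real)"
  shows "integrable lebesgue (\<lambda>X. indicator S X * (a X * (G X \<bullet> \<phi>' X)))"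
proof -
  obtain M where M: "M \<ge> 0" "\<And>x. norm (\<phi>' x) \<le> M" using test_function_lipschitz[OF t] by metis
  have c: "continuous_on UNIV \<phi>'" using t by (simp add: test_function_def)
  have C: "C \<ge> 0" using order_trans[OF abs_ge_zero a(2)] .
  have G': "integrable lebesgue (\<lambda>X. indicator S X *\<^sub>R G X)" using G by (simp add: set_integrable_def)
  have b: "\<bar>a X * Re (\<phi>' X)\<bar> \<le> C * M" "\<bar>a X * Im (\<phi>' X)\<bar> \<le> C * M" for X
    unfolding abs_mult using a(2)[of X] C order_trans[OF abs_Re_le_cmod M(2)[of X]] order_trans[OF abs_Im_le_cmod M(2)[of X]]
    by (auto intro!: mult_mono)
  have m: "(\<lambda>X. a X * Re (\<phi>' X)) \<in> borel_measurable lebesgue" "(\<lambda>X. a X * Im (\<phi>' X)) \<in> borel_measurable lebesgue"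
    by (intro borel_measurable_times a(1) continuous_borel_lebesgue continuous_intros c)+
  have "integrable lebesgue (\<lambda>X. Re ((a X * Re (\<phi>' X)) *\<^sub>R (indicator S X *\<^sub>R G X)) + Im ((a X * Im (\<phi>' X)) *\<^sub>R (indicator S X *\<^sub>R G X)))"
    by (intro Bochner_Integration.integrable_add integrable_Re integrable_Im integrable_bounded_mult[OF G' m(1) b(1)] integrable_bounded_mult[OF G' m(2) b(2)])
  then show ?thesis by (simp add: inner_complex_def algebra_simps)
qed

lemma conductivity_bounds:
  assumes "0 < k" shows "conductivity k B X > 0" "conductivity k B X \<le> 1 + \<bar>k - 1\<bar>" "\<bar>conductivity k B X\<bar> \<le> 1 + \<bar>k - 1\<bar>"
  using assms by (auto simp: conductivity_def indicator_def)

lemma conductivity_measurable: "B \<in> sets lebesgue \<Longrightarrow> conductivity k B \<in> borel_measurable lebesgue"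
  unfolding conductivity_def[abs_def] by (intro borel_measurable_add borel_measurable_times borel_measurable_const borel_measurable_indicator)

lemma solution_difference:
  assumes k: "0 < k" and B: "B \<in> sets lebesgue"
    and u: "conductivity_solution (ball Z \<rho>) B k f u G" and v: "conductivity_solution (ball Z \<rho>) B k f v H" and \<rho>: "\<rho> > 0"
  shows "set_integrable lebesgue (ball Z \<rho>) (\<lambda>X. G X - H X)"
    and "weak_gradient (ball Z \<rho>) (\<lambda>X. u X - v X) (\<lambda>X. G X - H X)"
    and "\<And>\<phi> \<phi>'. test_function (ball Z \<rho>) \<phi> \<phi>' \<Longrightarrow>
       (LINT X:ball Z \<rho>|lebesgue. conductivity k B X * ((G X - H X) \<bullet> \<phi>' X)) = 0"
    and "continuous_on (cball Z \<rho>) (\<lambda>X. u X - v X)" and "\<And>X. X \<in> sphere Z \<rho> \<Longrightarrow> u X - v X = 0"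
proof -
  let ?S = "ball Z \<rho>"
  have cu: "continuous_on (cball Z \<rho>) u" "continuous_on (cball Z \<rho>) v" and G: "set_integrable lebesgue ?S G" "set_integrable lebesgue ?S H"
    and wg: "weak_gradient ?S u G" "weak_gradient ?S v H"
    using u v \<rho> by (auto simp: conductivity_solution_def intro: square_integrable_imp_set_integrable)
  show "continuous_on (cball Z \<rho>) (\<lambda>X. u X - v X)" by (intro continuous_intros cu)
  show "u X - v X = 0" if "X \<in> sphere Z \<rho>" for X
    using u v that \<rho> by (auto simp: conductivity_solution_def frontier_ball)
  show GH: "set_integrable lebesgue ?S (\<lambda>X. G X - H X)" using G by (rule set_integral_diff(1))
  show "weak_gradient ?S (\<lambda>X. u X - v X) (\<lambda>X. G X - H X)"
    unfolding weak_gradient_def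
  proof (intro allI impI)
    fix \<phi> \<phi>' assume t: "test_function ?S \<phi> \<phi>'"
    obtain K where K: "compact K" "K \<subseteq> ?S" "\<And>x. x \<notin> K \<Longrightarrow> \<phi> x = 0" "\<And>x. x \<notin> K \<Longrightarrow> \<phi>' x = 0"
      using test_functionD[OF t] by metis
    have c: "continuous_on UNIV \<phi>'" "continuous_on UNIV \<phi>" using t test_function_continuous[OF t] by (auto simp: test_function_def)
    have iu: "set_integrable lebesgue ?S (\<lambda>X. w X *\<^sub>R \<phi>' X)" if w: "continuous_on (cball Z \<rho>) w" for w
    proof -
      have "continuous_on K (\<lambda>X. w X *\<^sub>R \<phi>' X)"
        using K(2) by (intro continuous_intros continuous_on_subset[OF w] continuous_on_subset[OF c(1)]) (auto simp: less_imp_le)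
      from integrable_compact_continuous[OF K(1) this]
      have "integrable lebesgue (\<lambda>X. indicator K X *\<^sub>R (w X *\<^sub>R \<phi>' X))" .
      moreover have "indicator K X *\<^sub>R (w X *\<^sub>R \<phi>' X) = indicator ?S X *\<^sub>R (w X *\<^sub>R \<phi>' X)" for X
        using K(2) K(4)[of X] by (cases "X \<in> K") (auto simp: indicator_def)
      ultimately show ?thesis by (simp only: set_integrable_def)
    qed
    obtain B where B: "\<And>X. \<bar>\<phi> X\<bar> \<le> B"
    proof -
      have cK: "continuous_on K \<phi>" by (rule continuous_on_subset[OF c(2)]) simp
      obtain B where B: "B > 0" "\<And>X. X \<in> K \<Longrightarrow> \<bar>\<phi> X\<bar> \<le> B"
        using compact_imp_bounded[OF compact_continuous_image[OF cK K(1)]] by (auto simp: bounded_pos)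
      have "\<bar>\<phi> X\<bar> \<le> B" for X using B K(3)[of X] by (cases "X \<in> K") auto
      then show thesis by (rule that)
    qed
    have iG: "set_integrable lebesgue ?S (\<lambda>X. \<phi> X *\<^sub>R F X)" if F: "set_integrable lebesgue ?S F" for F :: "complex \<Rightarrow> complex"
    proof -
      have "integrable lebesgue (\<lambda>X. \<phi> X *\<^sub>R (indicator ?S X *\<^sub>R F X))"
        by (rule integrable_bounded_mult[OF _ continuous_borel_lebesgue[OF c(2)] B]) (use F in \<open>simp add: set_integrable_def\<close>)
      then show ?thesis by (simp add: set_integrable_def mult.commute)
    qed
    have "(LINT X:?S|lebesgue. (u X - v X) *\<^sub>R \<phi>' X) = (LINT X:?S|lebesgue. u X *\<^sub>R \<phi>' X) - (LINT X:?S|lebesgue. v X *\<^sub>R \<phi>' X)"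
      unfolding scaleR_diff_left by (rule set_integral_diff(2)[OF iu[OF cu(1)] iu[OF cu(2)]])
    also have "\<dots> = - (LINT X:?S|lebesgue. \<phi> X *\<^sub>R G X) + (LINT X:?S|lebesgue. \<phi> X *\<^sub>R H X)"
    proof -
      have "(LINT X:?S|lebesgue. u X *\<^sub>R \<phi>' X) = - (LINT X:?S|lebesgue. \<phi> X *\<^sub>R G X)"
        "(LINT X:?S|lebesgue. v X *\<^sub>R \<phi>' X) = - (LINT X:?S|lebesgue. \<phi> X *\<^sub>R H X)"
        using wg t unfolding weak_gradient_def by auto
      then show ?thesis by simp
    qed
    also have "\<dots> = - (LINT X:?S|lebesgue. \<phi> X *\<^sub>R (G X - H X))"
      unfolding scaleR_diff_right by (subst set_integral_diff(2)[OF iG[OF G(1)] iG[OF G(2)]]) simp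
    finally show "(LINT X:?S|lebesgue. (u X - v X) *\<^sub>R \<phi>' X) = - (LINT X:?S|lebesgue. \<phi> X *\<^sub>R (G X - H X))" .
  qed
  fix \<phi> \<phi>' assume t: "test_function ?S \<phi> \<phi>'"
  have i: "set_integrable lebesgue ?S (\<lambda>X. conductivity k B X * (F X \<bullet> \<phi>' X))" if F: "set_integrable lebesgue ?S F" for F
    using integrable_bounded_inner[OF F t conductivity_measurable[OF B] conductivity_bounds(3)[OF k]] by (simp add: set_integrable_def)
  have "(LINT X:?S|lebesgue. conductivity k B X * (G X \<bullet> \<phi>' X)) = 0" "(LINT X:?S|lebesgue. conductivity k B X * (H X \<bullet> \<phi>' X)) = 0"
    using u v t unfolding conductivity_solution_def by auto
  then show "(LINT X:?S|lebesgue. conductivity k B X * ((G X - H X) \<bullet> \<phi>' X)) = 0"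
    unfolding inner_diff_left right_diff_distrib by (subst set_integral_diff(2)[OF i[OF G(1)] i[OF G(2)]]) simp
qed

text \<open>Where the conductivity is locally constant, a dilation about \<open>x0\<close> is a
  chart; scaling by half the radius keeps the unit disk of the chart compact inside
  \<open>N\<close>.\<close>

lemma chart_interior:
  assumes k: "0 < k" and S: "open S" and N: "open N" "N \<subseteq> S" "x0 \<in> N"
    and const: "\<And>X. X \<in> N \<Longrightarrow> conductivity k B X = \<kappa>" and B: "B \<in> sets lebesgue"
  obtains N' g g1 g2 b bd where "conformal_chart S N' g g1 g2 (conductivity k B) x0 b bd (1 + \<bar>k - 1\<bar>)"
proof -
  obtain e where e: "e > 0" "ball x0 e \<subseteq> N" using N(1,3) open_contains_ball by blast
  define \<eta> where "\<eta> = e / 2"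
  have \<eta>: "\<eta> > 0" "\<eta> < e" using e by (auto simp: \<eta>_def)
  have \<kappa>: "\<bar>\<kappa>\<bar> \<le> 1 + \<bar>k - 1\<bar>" using const[OF N(3)] conductivity_bounds(3)[OF k, of B x0] by simp
  have "conformal_chart S (ball x0 e) (\<lambda>X. (X - x0) / \<eta>) (\<lambda>_. 1 / complex_of_real \<eta>) (\<lambda>_. 0) (conductivity k B) x0 (\<lambda>_ _. \<kappa>) (\<lambda>_ _. 0) (1 + \<bar>k - 1\<bar>)"
  proof
    have "{X \<in> ball x0 e. norm ((X - x0) / complex_of_real \<eta>) \<le> 1} = cball x0 \<eta>"
      using \<eta> by (auto simp: dist_norm norm_divide norm_minus_commute divide_le_eq)
    then show "compact {X \<in> ball x0 e. norm ((X - x0) / complex_of_real \<eta>) \<le> 1}" by simp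
    show "AE X in lebesgue. X \<in> ball x0 e \<longrightarrow> (\<lambda>n. \<kappa>) \<longlonglongrightarrow> conductivity k B X"
      using e(2) const by (intro AE_I2 impI) (simp add: subset_iff)
    show "ball x0 e \<subseteq> S" using e(2) N(2) by (rule order_trans)
    show "((\<lambda>X. (X - x0) / complex_of_real \<eta>) has_field_derivative 1 / complex_of_real \<eta>) (at X)" for X
      using \<eta> by (auto intro!: derivative_eq_intros)
  qed (use S e \<eta> \<kappa> conductivity_bounds[OF k] conductivity_measurable[OF B] in auto)
  then show thesis by (rule that)
qed

lemma arctan_frac_bound: "\<bar>s / (1 + s\<^sup>2)\<bar> \<le> 1" for s :: real
proof -
  have "\<bar>s\<bar> \<le> 1 + s\<^sup>2" using zero_le_power2[of "\<bar>s\<bar> - 1/2"] by (simp add: power2_eq_square algebra_simps)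
  moreover have "1 + s\<^sup>2 > 0" using zero_le_power2[of s] by linarith
  ultimately show ?thesis by (simp add: abs_divide divide_le_eq)
qed

text \<open>The coordinate is a Moebius map that sends the interface circle to the imaginary axis.\<close>

lemma chart_interface:
  assumes k: "0 < k" and S: "open S" and x0: "x0 \<in> sphere c r" "x0 \<in> S" and r: "r > 0"
  obtains N' g g1 g2 b bd where "conformal_chart S N' g g1 g2 (conductivity k (ball c r)) x0 b bd (1 + \<bar>k - 1\<bar>)"
proof -
  \<comment> \<open>The point of the interface circle opposite to \<open>x0\<close>. By Thales'
    theorem \<open>(X - x0) / (X - x')\<close> is purely imaginary on the circle, and its real part
    is negative inside.\<close>
  define x' where "x' = 2 * c - x0"
  obtain e where e: "e > 0" "ball x0 e \<subseteq> S" using S x0(2) open_contains_ball by blast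
  define d where "d = min e r"
  have d: "d > 0" "d \<le> r" "ball x0 d \<subseteq> S" using e r by (auto simp: d_def)
  \<comment> \<open>Near \<open>x0\<close> the modulus of \<open>X - x'\<close> is of the order of
    \<open>2 * r\<close>, so this scaling places the unit disk of the chart inside
    \<open>cball x0 (d/2)\<close>.\<close>
  define \<eta> where "\<eta> = d / (8 * r)"
  have \<eta>: "\<eta> > 0" "\<eta> \<le> 1/8" using d r by (auto simp: \<eta>_def divide_le_eq)
  have xx: "norm (x0 - x') = 2 * r"
  proof -
    have "norm (x0 - x') = norm (2 * (x0 - c))" by (simp add: x'_def algebra_simps)
    also have "\<dots> = 2 * norm (x0 - c)" by (simp only: norm_mult norm_numeral)
    finally show ?thesis using x0(1) by (simp add: dist_norm norm_minus_commute)
  qed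
  have ne: "X \<noteq> x'" if "X \<in> cball x0 d" for X
    using that xx d r by (auto simp: dist_norm)
  define g where "g X = (X - x0) / (X - x') / \<eta>" for X
  define g1 where "g1 X = (x0 - x') / (X - x')\<^sup>2 / \<eta>" for X
  define g2 where "g2 X = - 2 * (x0 - x') / (X - x')^3 / \<eta>" for X
  have g1: "(g has_field_derivative g1 X) (at X)" if "X \<noteq> x'" for X
  proof -
    have "(g has_field_derivative ((1 * (X - x') - (X - x0) * 1) / ((X - x') * (X - x')) / \<eta>)) (at X)"
      unfolding g_def[abs_def]
      by (rule DERIV_cdivide[OF DERIV_divide]) (use that in \<open>auto intro!: derivative_eq_intros\<close>)
    moreover have "(1 * (X - x') - (X - x0) * 1) / ((X - x') * (X - x')) / \<eta> = g1 X"
      by (simp add: g1_def power2_eq_square)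
    ultimately show ?thesis by simp
  qed
  have g2: "(g1 has_field_derivative g2 X) (at X)" if "X \<noteq> x'" for X
  proof -
    have nz: "X - x' \<noteq> 0" using that by simp
    have "((\<lambda>X. (x0 - x') * inverse ((X - x')\<^sup>2) / \<eta>) has_field_derivative
       (x0 - x') * (- (inverse ((X - x')\<^sup>2) * (2 * (X - x')) * inverse ((X - x')\<^sup>2))) / \<eta>) (at X)"
      using nz \<eta>(1) by (auto intro!: derivative_eq_intros)
    moreover have "(x0 - x') * (- (inverse ((X - x')\<^sup>2) * (2 * (X - x')) * inverse ((X - x')\<^sup>2))) / \<eta> = g2 X"
    proof -
      have "a * (- (inverse (d\<^sup>2) * (2 * d) * inverse (d\<^sup>2))) / e = - 2 * a / d^3 / e" if "d \<noteq> 0" for a d e :: complex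
        using that by (simp add: power2_eq_square power3_eq_cube divide_inverse mult_ac)
      from this[OF nz] show ?thesis unfolding g2_def .
    qed
    ultimately show ?thesis by (simp add: g1_def[abs_def] divide_inverse)
  qed
  have sgn: "Re (g X) < 0 \<longleftrightarrow> X \<in> ball c r" "Re (g X) = 0 \<longleftrightarrow> X \<in> sphere c r" if "X \<noteq> x'" for X
  proof -
    have n: "(norm (X - x'))\<^sup>2 > 0" using that by simp
    have r2: "(norm (x0 - c))\<^sup>2 = r\<^sup>2" using x0(1) by (simp add: dist_norm norm_minus_commute)
    have "Re (g X) = Re ((X - x0) * cnj (X - x')) / (norm (X - x'))\<^sup>2 / \<eta>"
      unfolding g_def by (simp add: complex_div_cnj[of "X - x0"] Re_divide_of_real flip: of_real_power)
    also have "Re ((X - x0) * cnj (X - x')) = (norm (X - c))\<^sup>2 - (norm (x0 - c))\<^sup>2"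
      unfolding x'_def cmod_power2 by (simp add: power2_eq_square algebra_simps)
    finally have Re: "Re (g X) = ((norm (X - c))\<^sup>2 - r\<^sup>2) / ((norm (X - x'))\<^sup>2 * \<eta>)" unfolding r2 by simp
    have den: "(norm (X - x'))\<^sup>2 * \<eta> > 0" using n \<eta> by simp
    have "Re (g X) < 0 \<longleftrightarrow> (norm (X - c))\<^sup>2 < r\<^sup>2" unfolding Re using den by (simp add: divide_less_0_iff)
    also have "\<dots> \<longleftrightarrow> norm (X - c) < r" using power_mono_iff[of r "norm (X - c)" 2] r by (simp add: not_le[symmetric])
    finally show "Re (g X) < 0 \<longleftrightarrow> X \<in> ball c r" by (simp add: dist_norm norm_minus_commute)
    have "Re (g X) = 0 \<longleftrightarrow> (norm (X - c))\<^sup>2 = r\<^sup>2" unfolding Re using den by auto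
    also have "\<dots> \<longleftrightarrow> norm (X - c) = r" using r by (simp add: power2_eq_iff_nonneg)
    finally show "Re (g X) = 0 \<longleftrightarrow> X \<in> sphere c r" by (simp add: dist_norm norm_minus_commute)
  qed
  \<comment> \<open>A smooth step from \<open>k\<close> at negative \<open>s\<close>, inside the
    disk, to 1 at positive \<open>s\<close>.\<close>
  define b where "b n s = 1 + (k - 1) * (1/2 - arctan (real n * s) / pi)" for n s
  define bd where "bd n s = - (k - 1) / pi * (real n / (1 + (real n * s)\<^sup>2))" for n s
  have pos: "1 + (real n * s)\<^sup>2 > 0" for n s using zero_le_power2[of "real n * s"] by linarith
  have bdb: "\<bar>bd n s * s\<bar> \<le> 1 + \<bar>k - 1\<bar>" for n s
  proof -
    have "\<bar>bd n s * s\<bar> = \<bar>k - 1\<bar> / pi * \<bar>(real n * s) / (1 + (real n * s)\<^sup>2)\<bar>"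
      by (simp add: bd_def abs_mult abs_divide abs_minus_commute)
    also have "\<dots> \<le> \<bar>k - 1\<bar> / pi * 1" by (intro mult_left_mono arctan_frac_bound) auto
    also have "\<dots> \<le> \<bar>k - 1\<bar> * 1"
      using pi_gt3 mult_left_mono[of 1 pi "\<bar>k - 1\<bar>"] by (simp add: divide_le_eq)
    finally show ?thesis by simp
  qed
  have bb: "\<bar>b n s\<bar> \<le> 1 + \<bar>k - 1\<bar>" for n s
  proof -
    have "\<bar>1/2 - arctan (real n * s) / pi\<bar> \<le> 1"
      using arctan_bounded[of "real n * s"] pi_gt_zero by (auto simp: abs_le_iff field_simps)
    then have "\<bar>k - 1\<bar> * \<bar>1/2 - arctan (real n * s) / pi\<bar> \<le> \<bar>k - 1\<bar> * 1" by (intro mult_left_mono) auto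
    then have "\<bar>(k - 1) * (1/2 - arctan (real n * s) / pi)\<bar> \<le> \<bar>k - 1\<bar>" by (simp add: abs_mult)
    from order_trans[OF abs_triangle_ineq add_left_mono[OF this, of "\<bar>1\<bar>"]] show ?thesis unfolding b_def by simp
  qed
  have blim: "(\<lambda>n. b n s) \<longlonglongrightarrow> (if s < 0 then k else 1)" if "s \<noteq> 0" for s
  proof -
    have "(\<lambda>n. arctan (real n * s)) \<longlonglongrightarrow> (if s < 0 then - (pi/2) else pi/2)"
    proof (cases "s < 0")
      case True
      have "filterlim (\<lambda>n. real n * s) at_bot sequentially" using True by real_asymp
      from filterlim_compose[OF tendsto_arctan_at_bot this] show ?thesis using True by simp
    next
      case False
      then have "s > 0" using that by simp
      then have "filterlim (\<lambda>n. real n * s) at_top sequentially" by real_asymp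
      from filterlim_compose[OF tendsto_arctan_at_top this] show ?thesis using False by simp
    qed
    then have "(\<lambda>n. b n s) \<longlonglongrightarrow> 1 + (k - 1) * (1/2 - (if s < 0 then - (pi/2) else pi/2) / pi)"
      unfolding b_def by (intro tendsto_intros) auto
    then show ?thesis by (auto split: if_splits)
  qed
  have "conformal_chart S (ball x0 d) g g1 g2 (conductivity k (ball c r)) x0 b bd (1 + \<bar>k - 1\<bar>)"
  proof
    have "{X \<in> ball x0 d. norm (g X) \<le> 1} = {X \<in> cball x0 (d/2). norm (g X) \<le> 1}"
    proof -
      have "dist x0 X \<le> d / 2" if X: "X \<in> ball x0 d" "norm (g X) \<le> 1" for X
      proof -
        have nz: "norm (X - x') > 0" using ne[of X] X(1) by auto
        have "norm (g X) = norm (X - x0) / norm (X - x') / \<eta>" using \<eta> by (simp add: g_def norm_divide norm_mult)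
        then have "norm (X - x0) \<le> \<eta> * norm (X - x')" using X(2) nz \<eta> by (simp add: divide_le_eq mult.commute)
        also have "norm (X - x') \<le> norm (X - x0) + norm (x0 - x')" using norm_triangle_ineq[of "X - x0" "x0 - x'"] by simp
        finally have "norm (X - x0) \<le> \<eta> * (norm (X - x0) + 2 * r)" using \<eta> unfolding xx by simp
        moreover have "\<eta> * norm (X - x0) \<le> 1/8 * norm (X - x0)" using \<eta> by (intro mult_right_mono) auto
        moreover have "\<eta> * (2 * r) = d / 4" using r by (simp add: \<eta>_def)
        ultimately have "norm (X - x0) \<le> 1/8 * norm (X - x0) + d / 4" by (simp add: distrib_left)
        then show ?thesis using d by (simp add: dist_norm norm_minus_commute)
      qed
      then show ?thesis using d by auto
    qed
    moreover have "compact {X \<in> cball x0 (d/2). norm (g X) \<le> 1}"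
    proof -
      have cgg: "continuous_on (cball x0 (d/2)) g"
        using ne d by (intro continuous_at_imp_continuous_on ballI DERIV_isCont[OF g1]) auto
      have "closedin (top_of_set (cball x0 (d/2))) (cball x0 (d/2) \<inter> (\<lambda>X. norm (g X)) -` {..1})"
        by (intro continuous_closedin_preimage continuous_on_norm cgg) simp
      then have "compact (cball x0 (d/2) \<inter> (\<lambda>X. norm (g X)) -` {..1})"
        using closedin_compact compact_cball by blast
      also have "cball x0 (d/2) \<inter> (\<lambda>X. norm (g X)) -` {..1} = {X \<in> cball x0 (d/2). norm (g X) \<le> 1}" by auto
      finally show ?thesis .
    qed
    ultimately show "compact {X \<in> ball x0 d. norm (g X) \<le> 1}" by simp
    show "(g has_field_derivative g1 X) (at X)" "(g1 has_field_derivative g2 X) (at X)" if "X \<in> ball x0 d" for X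
      using g1 g2 ne[of X] that by auto
    show "continuous_on (ball x0 d) g2" unfolding g2_def[abs_def] using ne \<eta> by (intro continuous_intros) auto
    show "g1 X \<noteq> 0" if "X \<in> ball x0 d" for X
      using ne[of X] that \<eta> xx r by (auto simp: g1_def)
    show "g X = 0 \<longleftrightarrow> X = x0" if "X \<in> ball x0 d" for X
      using ne[of X] that \<eta> by (auto simp: g_def)
    show "(b n has_real_derivative bd n s) (at s)" for n s
    proof -
      have "((\<lambda>s. arctan (real n * s)) has_real_derivative inverse (1 + (real n * s)\<^sup>2) * real n) (at s)"
        by (rule DERIV_chain2[OF DERIV_arctan]) (auto intro!: derivative_eq_intros)
      then have "(b n has_real_derivative 0 + (k - 1) * (0 - (inverse (1 + (real n * s)\<^sup>2) * real n) / pi)) (at s)"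
        unfolding b_def[abs_def] by (intro DERIV_add DERIV_cmult DERIV_diff DERIV_const DERIV_cdivide)
      moreover have "0 + (k - 1) * (0 - (inverse (1 + (real n * s)\<^sup>2) * real n) / pi) = bd n s"
        by (simp only: bd_def divide_inverse diff_0 add_0 mult_minus_left mult_minus_right mult_ac)
      ultimately show ?thesis by simp
    qed
    show "continuous_on UNIV (bd n)" for n
      unfolding bd_def[abs_def] by (intro continuous_intros) (use pos less_irrefl in metis)
    show "AE X in lebesgue. X \<in> ball x0 d \<longrightarrow> (\<lambda>n. b n (Re (g X))) \<longlonglongrightarrow> conductivity k (ball c r) X"
    proof -
      have "AE X in lebesgue. X \<notin> sphere c r"
        by (rule AE_not_in) (rule negligible_sphere[unfolded negligible_iff_null_sets])
      then show ?thesis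
      proof eventually_elim
        case (elim X)
        show ?case
        proof
          assume "X \<in> ball x0 d"
          then have "X \<noteq> x'" using ne[of X] by simp
          with sgn[OF this] elim show "(\<lambda>n. b n (Re (g X))) \<longlonglongrightarrow> conductivity k (ball c r) X"
            using blim[of "Re (g X)"] by (auto simp: conductivity_def indicator_def)
        qed
      qed
    qed
    show "(\<lambda>n. bd n s * s) \<longlonglongrightarrow> 0" for s
    proof (cases "s = 0")
      case False
      have "(\<lambda>n. real n / (1 + (real n * s)\<^sup>2)) \<longlonglongrightarrow> 0" using False by real_asymp
      then have "(\<lambda>n. bd n s * s) \<longlonglongrightarrow> (- (k - 1) / pi * 0) * s" unfolding bd_def by (intro tendsto_intros)
      then show ?thesis by simp
    qed simp
  qed (use S d bb bdb conductivity_bounds[OF k] conductivity_measurable in auto)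
  then show thesis by (rule that)
qed

text \<open>Among the points of a positive maximum take one farthest from \<open>Z\<close>. It is
  interior by the boundary values, so the strong maximum principle makes a whole neighbourhood
  maximal, including points farther out. This replaces a connectedness argument.\<close>

theorem weak_maximum:
  assumes k: "0 < k" and r: "r > 0" and \<rho>: "\<rho> > 0"
    and wg: "weak_gradient (ball Z \<rho>) w G" and wc: "continuous_on (cball Z \<rho>) w" and G: "set_integrable lebesgue (ball Z \<rho>) G"
    and eq: "\<And>\<phi> \<phi>'. test_function (ball Z \<rho>) \<phi> \<phi>' \<Longrightarrow> (LINT X:ball Z \<rho>|lebesgue. conductivity k (ball c r) X * (G X \<bullet> \<phi>' X)) = 0"
    and bd: "\<And>X. X \<in> sphere Z \<rho> \<Longrightarrow> w X \<le> 0"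
    and X: "X \<in> cball Z \<rho>"
  shows "w X \<le> 0"
proof (rule ccontr)
  assume neg: "\<not> w X \<le> 0"
  have ne: "cball Z \<rho> \<noteq> {}" using X by blast
  obtain Y where Y0: "Y \<in> cball Z \<rho>" "\<forall>X\<in>cball Z \<rho>. w X \<le> w Y"
    using continuous_attains_sup[OF compact_cball ne wc] by (rule bexE)
  note Y = Y0(1) bspec[OF Y0(2)]
  have wY: "w Y > 0" using neg Y(2)[OF X] by simp
  define A where "A = {X \<in> cball Z \<rho>. w X = w Y}"
  have "closedin (top_of_set (cball Z \<rho>)) (cball Z \<rho> \<inter> w -` {w Y})" by (intro continuous_closedin_preimage wc) simp
  moreover have "cball Z \<rho> \<inter> w -` {w Y} = A" by (auto simp: A_def)
  ultimately have "closedin (top_of_set (cball Z \<rho>)) A" by simp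
  then have cA: "compact A" by (rule closedin_compact[OF compact_cball])
  have neA: "A \<noteq> {}" using Y(1) by (auto simp: A_def)
  have "continuous_on A (\<lambda>X. norm (X - Z))" by (intro continuous_intros)
  from continuous_attains_sup[OF cA neA this]
  obtain x0 where x00: "x0 \<in> A" "\<forall>X\<in>A. norm (X - Z) \<le> norm (x0 - Z)" by (rule bexE)
  note x0 = x00(1) bspec[OF x00(2)]
  have wx0: "w x0 = w Y" "x0 \<in> cball Z \<rho>" using x0(1) by (auto simp: A_def)
  have x0S: "x0 \<in> ball Z \<rho>"
  proof (rule ccontr)
    assume "x0 \<notin> ball Z \<rho>"
    then have "x0 \<in> sphere Z \<rho>" using wx0(2) by auto
    from bd[OF this] show False using wx0 wY by simp
  qed
  have "\<exists>N g g1 g2 b bd. conformal_chart (ball Z \<rho>) N g g1 g2 (conductivity k (ball c r)) x0 b bd (1 + \<bar>k - 1\<bar>)"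
  proof (cases "x0 \<in> sphere c r")
    case True
    obtain N g g1 g2 b bd where "conformal_chart (ball Z \<rho>) N g g1 g2 (conductivity k (ball c r)) x0 b bd (1 + \<bar>k - 1\<bar>)"
      by (rule chart_interface[OF k open_ball True x0S r])
    then show ?thesis by (intro exI)
  next
    case False
    have "\<exists>N \<kappa>. open N \<and> N \<subseteq> ball Z \<rho> \<and> x0 \<in> N \<and> (\<forall>X\<in>N. conductivity k (ball c r) X = \<kappa>)"
    proof (cases "x0 \<in> ball c r")
      case True
      then show ?thesis
        using x0S by (intro exI[of _ "ball Z \<rho> \<inter> ball c r"] exI[of _ k]) (auto simp: conductivity_def)
    next
      case F: False
      have "open (ball Z \<rho> - cball c r)" by (intro open_Diff) auto
      then show ?thesis
        using F False x0S by (intro exI[of _ "ball Z \<rho> - cball c r"] exI[of _ 1]) (auto simp: conductivity_def)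
    qed
    then obtain N \<kappa> where N: "open N" "N \<subseteq> ball Z \<rho>" "x0 \<in> N" and \<kappa>: "\<forall>X\<in>N. conductivity k (ball c r) X = \<kappa>" by (elim exE conjE)
    have B: "ball c r \<in> sets lebesgue" by simp
    obtain N g g1 g2 b bd where "conformal_chart (ball Z \<rho>) N g g1 g2 (conductivity k (ball c r)) x0 b bd (1 + \<bar>k - 1\<bar>)"
      by (rule chart_interior[OF k open_ball N bspec[OF \<kappa>] B])
    then show ?thesis by (intro exI)
  qed
  then obtain N g g1 g2 b bd where conf: "conformal_chart (ball Z \<rho>) N g g1 g2 (conductivity k (ball c r)) x0 b bd (1 + \<bar>k - 1\<bar>)"
    by (elim exE)
  interpret conformal_chart "ball Z \<rho>" N g g1 g2 "conductivity k (ball c r)" x0 b bd "1 + \<bar>k - 1\<bar>" by (rule conf)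
  have max: "w X \<le> w x0" if "X \<in> chart_disk" for X
    using Y(2)[of X] that chart_disk(2) N(2) wx0(1) by (auto simp: subset_iff less_imp_le)
  have eqx: "w X = w x0" if "X \<in> N" "norm (g X) < 1" for X
    by (rule strong_maximum[OF wg continuous_on_subset[OF wc ball_subset_cball] G eq max that])
  have op: "open {X\<in>N. norm (g X) < 1}" by (rule open_chart_disk)
  have "x0 \<in> {X\<in>N. norm (g X) < 1}" using conformal_chart.x0[OF conf] g_zero[of x0] by simp
  then obtain e where e: "e > 0" "ball x0 e \<subseteq> {X\<in>N. norm (g X) < 1}" using op open_contains_ball by blast
  \<comment> \<open>The direction away from \<open>Z\<close>, arbitrary at \<open>Z\<close> itself;
    a step along it increases the distance.\<close>
  define d where "d = (if x0 = Z then 1 else sgn (x0 - Z))"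
  have d: "norm d = 1" by (auto simp: d_def norm_sgn)
  define X1 where "X1 = x0 + (e/2) *\<^sub>R d"
  have "X1 \<in> ball x0 e" using e d by (simp add: X1_def dist_norm)
  then have X1: "X1 \<in> N" "norm (g X1) < 1" using e(2) by auto
  then have "X1 \<in> A" using eqx[OF X1] wx0 N(2) by (auto simp: A_def subset_iff less_imp_le)
  moreover have "norm (X1 - Z) = norm (x0 - Z) + e/2"
  proof -
    have x0d: "norm (x0 - Z) *\<^sub>R d = x0 - Z" by (auto simp: d_def sgn_div_norm)
    then have "X1 - Z = (norm (x0 - Z) + e/2) *\<^sub>R d" 
      unfolding X1_def scaleR_left_distrib x0d by simp
    then show ?thesis using d e by simp
  qed
  ultimately show False using bspec[OF x00(2), of X1] e by simp
qed

text \<open>The maximum principle for both differences gives equality of the functions. Then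
  \<open>G - H\<close> is a weak gradient of 0 and so integrates to 0 against every test
  function.\<close>

theorem conductivity_solution_unique:
  assumes k: "0 < k" and r: "r > 0" and \<rho>: "\<rho> > 0"
    and u: "conductivity_solution (ball Z \<rho>) (ball c r) k f u G" and v: "conductivity_solution (ball Z \<rho>) (ball c r) k f v H"
  shows "\<And>X. X \<in> cball Z \<rho> \<Longrightarrow> u X = v X" and "AE X in lebesgue. X \<in> ball Z \<rho> \<longrightarrow> G X = H X"
proof -
  have B: "ball c r \<in> sets lebesgue" by simp
  note d1 = solution_difference[OF k B u v \<rho>] and d2 = solution_difference[OF k B v u \<rho>]
  show eq: "u X = v X" if X: "X \<in> cball Z \<rho>" for X
  proof -
    have "u X - v X \<le> 0" by (rule weak_maximum[OF k r \<rho> d1(2) d1(4) d1(1) d1(3) _ X]) (use d1(5) in auto)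
    moreover have "v X - u X \<le> 0" by (rule weak_maximum[OF k r \<rho> d2(2) d2(4) d2(1) d2(3) _ X]) (use d2(5) in auto)
    ultimately show ?thesis by simp
  qed
  have "AE X in lebesgue. X \<in> ball Z \<rho> \<longrightarrow> G X - H X = 0"
  proof (rule weak_zero_imp_AE_zero[OF d1(1)])
    fix \<phi> \<phi>' assume "test_function (ball Z \<rho>) \<phi> \<phi>'"
    then have "(LINT X:ball Z \<rho>|lebesgue. (u X - v X) *\<^sub>R \<phi>' X) = - (LINT X:ball Z \<rho>|lebesgue. \<phi> X *\<^sub>R (G X - H X))"
      using d1(2) unfolding weak_gradient_def by blast
    moreover have "indicator (ball Z \<rho>) X *\<^sub>R ((u X - v X) *\<^sub>R \<phi>' X) = 0" for X
      using eq[of X] by (cases "X \<in> ball Z \<rho>") (auto simp: less_imp_le)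
    then have "(\<lambda>X. indicator (ball Z \<rho>) X *\<^sub>R ((u X - v X) *\<^sub>R \<phi>' X)) = (\<lambda>X. 0)" by (rule ext)
    ultimately show "(LINT X:ball Z \<rho>|lebesgue. \<phi> X *\<^sub>R (G X - H X)) = 0"
      unfolding set_lebesgue_integral_def by (simp only: integral_zero minus_equation_iff[of 0] neg_equal_0_iff_equal) simp
  qed
  then show "AE X in lebesgue. X \<in> ball Z \<rho> \<longrightarrow> G X = H X" by simp
qed

section \<open>The harmonic extension and the double layer potential\<close>

locale C1_holder_data =
  fixes Z :: complex and \<rho> \<alpha> :: real and f :: "complex \<Rightarrow> real"
  assumes \<rho>: "0 < \<rho>" and \<alpha>: "0 < \<alpha>" and f: "C1_holder_circle Z \<rho> \<alpha> f"
begin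

abbreviation "td \<equiv> tangential_deriv Z \<rho> f"

lemma dist_circle_point: "dist (circle_point Z \<rho> t) (circle_point Z \<rho> t') = \<rho> * dist (cis (t/\<rho>)) (cis (t'/\<rho>))"
proof -
  have "circle_point Z \<rho> t - circle_point Z \<rho> t' = of_real \<rho> * (cis (t/\<rho>) - cis (t'/\<rho>))"
    by (simp add: circle_point_def algebra_simps)
  then show ?thesis using \<rho> by (simp add: dist_norm norm_mult)
qed

lemma dist_le: "dist (circle_point Z \<rho> t) (circle_point Z \<rho> t') \<le> 2 * \<rho>"
  unfolding dist_circle_point using \<rho> norm_triangle_ineq4[of "cis (t/\<rho>)" "cis (t'/\<rho>)"] by (simp add: dist_norm)

definition H where "H = (SOME H. 0 \<le> H \<and> (\<forall>t t'. \<bar>td t - td t'\<bar> \<le> H * dist (circle_point Z \<rho> t) (circle_point Z \<rho> t') powr \<alpha>))"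

lemma H: "0 \<le> H" "\<bar>td t - td t'\<bar> \<le> H * dist (circle_point Z \<rho> t) (circle_point Z \<rho> t') powr \<alpha>"
proof -
  obtain h where h: "\<forall>t t'. \<bar>td t - td t'\<bar> \<le> h * dist (circle_point Z \<rho> t) (circle_point Z \<rho> t') powr \<alpha>"
    using f unfolding C1_holder_circle_def by blast
  have "\<bar>td t - td t'\<bar> \<le> \<bar>h\<bar> * dist (circle_point Z \<rho> t) (circle_point Z \<rho> t') powr \<alpha>" for t t'
    using spec[OF spec[OF h, of t], of t'] mult_right_mono[OF abs_ge_self[of h], of "dist (circle_point Z \<rho> t) (circle_point Z \<rho> t') powr \<alpha>"]
    by simp
  then have "\<exists>H. 0 \<le> H \<and> (\<forall>t t'. \<bar>td t - td t'\<bar> \<le> H * dist (circle_point Z \<rho> t) (circle_point Z \<rho> t') powr \<alpha>)"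
    by (intro exI[of _ "\<bar>h\<bar>"]) auto
  from someI_ex[OF this] show "0 \<le> H" "\<bar>td t - td t'\<bar> \<le> H * dist (circle_point Z \<rho> t) (circle_point Z \<rho> t') powr \<alpha>"
    unfolding H_def by auto
qed

definition A1 where "A1 = (SUP t. \<bar>td t\<bar>)"
definition A2 where "A2 = (SUP (t, t')\<in>UNIV. \<bar>td t - td t'\<bar> / dist (circle_point Z \<rho> t) (circle_point Z \<rho> t') powr \<alpha>)"

text \<open>The Hoelder bound on a circle of finite diameter makes the values bounded above; only
  then is the supremum an upper bound.\<close>

lemma A1: "\<bar>td t\<bar> \<le> A1"
proof -
  have "\<bar>td t\<bar> \<le> \<bar>td 0\<bar> + H * (2 * \<rho>) powr \<alpha>" for t
  proof -
    have "\<bar>td t - td 0\<bar> \<le> H * (2 * \<rho>) powr \<alpha>"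
      by (rule order_trans[OF H(2)]) (intro mult_left_mono powr_mono2 dist_le H(1), use \<alpha> in auto)
    then show ?thesis by linarith
  qed
  then have "bdd_above (range (\<lambda>t. \<bar>td t\<bar>))" by (rule bdd_aboveI2)
  then show ?thesis unfolding A1_def by (intro cSUP_upper) auto
qed

lemma A2: "\<bar>td t - td t'\<bar> \<le> A2 * dist (circle_point Z \<rho> t) (circle_point Z \<rho> t') powr \<alpha>" and A2_nonneg: "0 \<le> A2"
proof -
  have q: "(case p of (t, t') \<Rightarrow> \<bar>td t - td t'\<bar> / dist (circle_point Z \<rho> t) (circle_point Z \<rho> t') powr \<alpha>) \<le> H" for p
  proof (cases p)
    case (Pair t t')
    show ?thesis
    proof (cases "dist (circle_point Z \<rho> t) (circle_point Z \<rho> t') = 0")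
      case False
      then have "0 < dist (circle_point Z \<rho> t) (circle_point Z \<rho> t') powr \<alpha>" by simp
      then show ?thesis using H(2)[of t t'] Pair by (simp add: pos_divide_le_eq)
    qed (use Pair H(1) in simp)
  qed
  have bdd: "bdd_above (range (\<lambda>(t, t'). \<bar>td t - td t'\<bar> / dist (circle_point Z \<rho> t) (circle_point Z \<rho> t') powr \<alpha>))"
    by (rule bdd_aboveI2[where M = H]) (rule q)
  have up: "\<bar>td t - td t'\<bar> / dist (circle_point Z \<rho> t) (circle_point Z \<rho> t') powr \<alpha> \<le> A2" for t t'
    using cSUP_upper[OF UNIV_I bdd, of "(t, t')"] by (simp add: A2_def)
  show "0 \<le> A2" using up[of 0 0] by simp
  show "\<bar>td t - td t'\<bar> \<le> A2 * dist (circle_point Z \<rho> t) (circle_point Z \<rho> t') powr \<alpha>"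
  proof (cases "dist (circle_point Z \<rho> t) (circle_point Z \<rho> t') = 0")
    case True
    then show ?thesis using H(2)[of t t'] by simp
  next
    case False
    then have "0 < dist (circle_point Z \<rho> t) (circle_point Z \<rho> t') powr \<alpha>" by simp
    then show ?thesis using up[of t t'] by (simp add: pos_divide_le_eq)
  qed
qed

lemma A1_nonneg: "0 \<le> A1" using order_trans[OF abs_ge_zero A1[of 0]] .

section \<open>The boundary data transported to the unit circle\<close>

definition F :: "complex \<Rightarrow> complex" where "F e = of_real (f (Z + of_real \<rho> * e))"
definition D :: "complex \<Rightarrow> complex" where "D e = of_real (\<rho> * td (\<rho> * Arg2pi e))"

lemma cis_Arg2pi: "norm e = 1 \<Longrightarrow> cis (Arg2pi e) = e"
  using Arg2pi[of e] by (simp add: cis_conv_exp is_Arg_def)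

lemma circle_point_Arg: "norm e = 1 \<Longrightarrow> circle_point Z \<rho> (\<rho> * Arg2pi e) = Z + of_real \<rho> * e"
  using \<rho> by (simp add: circle_point_def cis_Arg2pi)

text \<open>Parameters of the same point have distance 0 on the circle, so the Hoelder condition
  forces equal derivatives there; the jump of \<open>Arg2pi\<close> does not show.\<close>

lemma D_cis: "D (cis t) = of_real (\<rho> * td (\<rho> * t))"
proof -
  have "circle_point Z \<rho> (\<rho> * Arg2pi (cis t)) = circle_point Z \<rho> (\<rho> * t)"
    unfolding circle_point_Arg[OF norm_cis] using \<rho> by (simp add: circle_point_def)
  then have "td (\<rho> * Arg2pi (cis t)) = td (\<rho> * t)" using H(2)[of "\<rho> * Arg2pi (cis t)" "\<rho> * t"] by simp
  then show ?thesis by (simp add: D_def)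
qed

lemma f_has_derivative: "((\<lambda>t. f (Z + \<rho> * cis t)) has_real_derivative \<rho> * td (\<rho> * t)) (at t)"
proof -
  have "(\<lambda>t. f (circle_point Z \<rho> t)) differentiable at (\<rho> * t)" using f by (simp add: C1_holder_circle_def)
  then have "((\<lambda>t. f (circle_point Z \<rho> t)) has_real_derivative td (\<rho> * t)) (at (\<rho> * t))"
    unfolding tangential_deriv_def by (simp add: DERIV_deriv_iff_real_differentiable)
  then have "((\<lambda>t. f (circle_point Z \<rho> (\<rho> * t))) has_real_derivative td (\<rho> * t) * \<rho>) (at t)"
    by (rule DERIV_chain2) (auto intro!: derivative_eq_intros)
  then show ?thesis using \<rho> by (simp add: circle_point_def mult.commute)
qed

lemma F_has_derivative: "((\<lambda>t. F (cis t)) has_vector_derivative D (cis t)) (at t)"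
  unfolding F_def D_cis
  by (rule has_vector_derivative_of_real[OF f_has_derivative])

lemma norm_D: "norm e = 1 \<Longrightarrow> norm (D e) \<le> \<rho> * A1"
  unfolding D_def norm_of_real abs_mult using A1[of "\<rho> * Arg2pi e"] \<rho> by simp

text \<open>\<alpha> may exceed 1, but the singular integral is estimated for exponents up to 1. On
  a circle of diameter 2 lowering the exponent costs the factor
  \<open>2 powr (\<alpha> - \<beta>)\<close>.\<close>

definition \<beta> where "\<beta> = min \<alpha> 1"

lemma \<beta>: "0 < \<beta>" "\<beta> \<le> 1" "\<beta> \<le> \<alpha>" using \<alpha> by (auto simp: \<beta>_def)

lemma dist_powr_le:
  fixes e e' :: complex
  assumes e: "norm e = 1" "norm e' = 1" and g: "\<beta> \<le> \<gamma>"
  shows "dist e e' powr \<gamma> \<le> 2 powr (\<gamma> - \<beta>) * dist e e' powr \<beta>"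
proof -
  have "dist e e' \<le> 2" using norm_triangle_ineq4[of e e'] e by (simp add: dist_norm)
  then have "dist e e' powr (\<gamma> - \<beta>) \<le> 2 powr (\<gamma> - \<beta>)" using g by (intro powr_mono2) auto
  then have "dist e e' powr (\<gamma> - \<beta>) * dist e e' powr \<beta> \<le> 2 powr (\<gamma> - \<beta>) * dist e e' powr \<beta>" by (intro mult_right_mono) auto
  moreover have "dist e e' powr (\<gamma> - \<beta>) * dist e e' powr \<beta> = dist e e' powr \<gamma>" by (simp flip: powr_add)
  ultimately show ?thesis by simp
qed

lemma holder_D:
  assumes e: "norm e = 1" "norm e' = 1"
  shows "norm (D e - D e') \<le> (\<rho> * A2 * \<rho> powr \<alpha> * 2 powr (\<alpha> - \<beta>)) * dist e e' powr \<beta>"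
proof -
  have d: "dist (circle_point Z \<rho> (\<rho> * Arg2pi e)) (circle_point Z \<rho> (\<rho> * Arg2pi e')) = \<rho> * dist e e'"
    unfolding dist_circle_point using \<rho> e by (simp add: cis_Arg2pi)
  have "norm (D e - D e') = \<rho> * \<bar>td (\<rho> * Arg2pi e) - td (\<rho> * Arg2pi e')\<bar>"
    unfolding D_def of_real_diff[symmetric] norm_of_real using \<rho> by (simp add: abs_mult flip: right_diff_distrib)
  also have "\<dots> \<le> \<rho> * (A2 * (\<rho> * dist e e') powr \<alpha>)"
    using A2[of "\<rho> * Arg2pi e" "\<rho> * Arg2pi e'"] \<rho> unfolding d by (intro mult_left_mono) auto
  also have "(\<rho> * dist e e') powr \<alpha> = \<rho> powr \<alpha> * dist e e' powr \<alpha>" using \<rho> by (simp add: powr_mult)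
  also have "\<rho> * (A2 * (\<rho> powr \<alpha> * dist e e' powr \<alpha>)) \<le> \<rho> * (A2 * (\<rho> powr \<alpha> * (2 powr (\<alpha> - \<beta>) * dist e e' powr \<beta>)))"
    using dist_powr_le[OF e \<beta>(3)] \<rho> A2_nonneg by (intro mult_left_mono) auto
  finally show ?thesis by (simp add: mult_ac)
qed

text \<open>Up to the factor -i, the density whose Cauchy integral is the derivative of the Cauchy
  integral of \<open>F\<close>.\<close>

definition g :: "complex \<Rightarrow> complex" where "g e = cnj e * D e"

definition M where "M = 2 * \<rho> * A1 + \<rho> * A2 * \<rho> powr \<alpha> * 2 powr (\<alpha> - \<beta>)"

lemma holder_g: "holder_circle g M \<beta>"
proof
  fix e e' :: complex assume e: "norm e = 1" "norm e' = 1"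
  have d1: "dist e e' \<le> 2 * dist e e' powr \<beta>"
  proof -
    have "dist e e' powr 1 \<le> 2 powr (1 - \<beta>) * dist e e' powr \<beta>" by (rule dist_powr_le[OF e \<beta>(2)])
    also have "\<dots> \<le> 2 powr 1 * dist e e' powr \<beta>" using \<beta> by (intro mult_right_mono powr_mono) auto
    finally show ?thesis by simp
  qed
  have "g e - g e' = cnj e * (D e - D e') + cnj (e - e') * D e'" by (simp add: g_def algebra_simps)
  then have "norm (g e - g e') \<le> norm (cnj e * (D e - D e')) + norm (cnj (e - e') * D e')" by (metis norm_triangle_ineq)
  also have "\<dots> = norm (D e - D e') + dist e e' * norm (D e')"
    unfolding norm_mult complex_mod_cnj dist_norm using e by simp
  also have "\<dots> \<le> (\<rho> * A2 * \<rho> powr \<alpha> * 2 powr (\<alpha> - \<beta>)) * dist e e' powr \<beta> + (2 * dist e e' powr \<beta>) * (\<rho> * A1)"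
    using holder_D[OF e] norm_D[OF e(2)] d1 by (intro add_mono mult_mono) auto
  finally show "norm (g e - g e') \<le> M * dist e e' powr \<beta>" by (simp add: M_def algebra_simps)
qed (use \<beta> in auto)

text \<open>Relative to \<open>e'\<close> the point \<open>e\<close> has the angles \<open>s\<close>
  and \<open>s - 2*pi\<close>; the shorter arc is at most \<open>pi/2\<close> times the
  chord.\<close>

lemma F_lipschitz:
  assumes e: "norm e = 1" "norm e' = 1"
  shows "norm (F e - F e') \<le> (\<rho> * A1 * (pi/2)) * dist e e'"
proof -
  define \<theta> where "\<theta> = Arg2pi e'"
  define s where "s = Arg2pi (e / e')"
  have e0: "e' \<noteq> 0" using e by auto
  have "norm (e / e') = 1" using e by (simp add: norm_divide)
  then have s: "cis s = e / e'" "0 \<le> s" "s \<le> 2 * pi" using cis_Arg2pi[of "e/e'"] Arg2pi[of "e/e'"] by (auto simp: s_def)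
  have e': "cis \<theta> = e'" using cis_Arg2pi[OF e(2)] by (simp add: \<theta>_def)
  define \<phi> where "\<phi> t = f (Z + \<rho> * cis t)" for t
  have lip: "\<bar>\<phi> t - \<phi> t'\<bar> \<le> \<rho> * A1 * \<bar>t - t'\<bar>" for t t'
  proof -
    have "norm (\<phi> t - \<phi> t') \<le> (\<rho> * A1) * norm (t - t')"
    proof (rule field_differentiable_bound[of UNIV \<phi> "\<lambda>t. \<rho> * td (\<rho> * t)"])
      show "(\<phi> has_field_derivative \<rho> * td (\<rho> * x)) (at x within UNIV)" for x
        unfolding \<phi>_def[abs_def] using f_has_derivative by simp
      show "norm (\<rho> * td (\<rho> * x)) \<le> \<rho> * A1" for x using A1[of "\<rho> * x"] \<rho> by (simp add: abs_mult)
    qed auto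
    then show ?thesis by simp
  qed
  have Fe: "F e = of_real (\<phi> (\<theta> + s))" "F e = of_real (\<phi> (\<theta> + s - 2*pi))" "F e' = of_real (\<phi> \<theta>)"
  proof -
    have "cis (\<theta> + s) = e" unfolding cis_mult[symmetric] e' s(1) using e0 by simp
    moreover have "cis (\<theta> + s - 2*pi) = cis (\<theta> + s)" by (simp add: complex_eq_iff cos_diff sin_diff)
    ultimately show "F e = of_real (\<phi> (\<theta> + s))" "F e = of_real (\<phi> (\<theta> + s - 2*pi))" "F e' = of_real (\<phi> \<theta>)"
      by (simp_all add: F_def \<phi>_def e')
  qed
  have "norm (F e - F e') \<le> \<rho> * A1 * min s (2*pi - s)"
  proof (cases "s \<le> 2*pi - s")
    case True
    have "norm (F e - F e') = \<bar>\<phi> (\<theta> + s) - \<phi> \<theta>\<bar>" unfolding Fe(1,3) of_real_diff[symmetric] norm_of_real ..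
    then show ?thesis using lip[of "\<theta> + s" \<theta>] s True by simp
  next
    case False
    have "norm (F e - F e') = \<bar>\<phi> (\<theta> + s - 2*pi) - \<phi> \<theta>\<bar>" unfolding Fe(2,3) of_real_diff[symmetric] norm_of_real ..
    then show ?thesis using lip[of "\<theta> + s - 2*pi" \<theta>] s False by simp
  qed
  also have "min s (2*pi - s) \<le> (pi/2) * norm (cis s - 1)"
    using norm_cis_minus_one_ge[OF s(2,3)] by (simp add: field_simps)
  also have "norm (cis s - 1) = dist e e'"
  proof -
    have "e / e' - 1 = (e - e') / e'" using e0 by (simp add: field_simps)
    then show ?thesis unfolding s(1) using e by (simp add: dist_norm norm_divide)
  qed
  finally show ?thesis using \<rho> A1_nonneg by (simp add: mult_left_mono mult.assoc)
qed

lemma holder_F: "holder_circle F (\<rho> * A1 * (pi/2)) 1"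
  by unfold_locales (use F_lipschitz in auto)

sublocale hF: holder_circle F "\<rho> * A1 * (pi/2)" 1 by (rule holder_F)
sublocale hg: holder_circle g M \<beta> by (rule holder_g)

lemma continuous_D: "continuous_on (sphere 0 1) D"
proof (rule continuous_on_eq)
  show "continuous_on (sphere 0 1) (\<lambda>e. e * g e)" by (intro continuous_intros hg.continuous)
  show "e * g e = D e" if "e \<in> sphere 0 1" for e
    using that complex_norm_square[of e] by (simp add: g_def flip: mult.assoc)
qed

definition mean :: real where "mean = Re (cauchy_circle F 0)"

text \<open>The holomorphic function whose real part is the harmonic extension of \<^term>\<open>f\<close>, and its derivative.\<close>

definition hol_ext :: "complex \<Rightarrow> complex" where
  "hol_ext X = 2 * hF.cauchy_ext ((X - Z) / \<rho>) - of_real mean"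

definition hol_ext' :: "complex \<Rightarrow> complex" where
  "hol_ext' X = - 2 * \<i> / \<rho> * hg.cauchy_ext ((X - Z) / \<rho>)"

lemma norm_scaled: "norm ((X - Z) / complex_of_real \<rho>) = dist Z X / \<rho>"
  using \<rho> by (simp add: norm_divide dist_norm norm_minus_commute)

lemma scaled_in: "X \<in> cball Z \<rho> \<Longrightarrow> (X - Z) / complex_of_real \<rho> \<in> cball 0 1"
  "X \<in> ball Z \<rho> \<Longrightarrow> (X - Z) / complex_of_real \<rho> \<in> ball 0 1"
  unfolding mem_cball_0 mem_ball_0 norm_scaled using \<rho> by (auto simp: divide_le_eq)

lemma continuous_hol_ext: "continuous_on (cball Z \<rho>) hol_ext" "continuous_on (cball Z \<rho>) hol_ext'"
proof -
  have c: "continuous_on (cball Z \<rho>) (\<lambda>X. (X - Z) / complex_of_real \<rho>)" using \<rho> by (intro continuous_intros) auto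
  have 1: "continuous_on (cball Z \<rho>) (\<lambda>X. hF.cauchy_ext ((X - Z) / \<rho>))"
    by (rule continuous_on_compose2[OF hF.continuous_cauchy_ext c]) (use scaled_in in blast)
  have 2: "continuous_on (cball Z \<rho>) (\<lambda>X. hg.cauchy_ext ((X - Z) / \<rho>))"
    by (rule continuous_on_compose2[OF hg.continuous_cauchy_ext c]) (use scaled_in in blast)
  show "continuous_on (cball Z \<rho>) hol_ext" "continuous_on (cball Z \<rho>) hol_ext'"
    unfolding hol_ext_def[abs_def] hol_ext'_def[abs_def] by (intro continuous_intros 1 2)+
qed

lemma hol_ext_has_derivative:
  assumes X: "X \<in> ball Z \<rho>" shows "(hol_ext has_field_derivative hol_ext' X) (at X)"
proof -
  define z where "z = (X - Z) / complex_of_real \<rho>"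
  have z: "norm z < 1" using scaled_in(2)[OF X] by (simp add: z_def)
  have "(cauchy_circle F has_field_derivative - \<i> * cauchy_circle g z) (at z)"
    using cauchy_circle_has_field_derivative_parts[OF F_has_derivative hF.continuous continuous_D] z by (simp add: g_def[abs_def])
  then have "((\<lambda>X. cauchy_circle F ((X - Z) / \<rho>)) has_field_derivative (- \<i> * cauchy_circle g z) * (1 / \<rho>)) (at X)"
    unfolding z_def by (rule DERIV_chain2) (use \<rho> in \<open>auto intro!: derivative_eq_intros\<close>)
  then have "((\<lambda>X. 2 * cauchy_circle F ((X - Z) / \<rho>) - of_real mean) has_field_derivative 2 * ((- \<i> * cauchy_circle g z) * (1 / \<rho>)) - 0) (at X)"
    by (intro DERIV_diff DERIV_const DERIV_cmult)
  moreover have "2 * ((- \<i> * cauchy_circle g z) * (1 / \<rho>)) - 0 = hol_ext' X"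
    using hg.cauchy_ext_eq[OF z] by (simp add: hol_ext'_def z_def)
  ultimately have "((\<lambda>X. 2 * cauchy_circle F ((X - Z) / \<rho>) - of_real mean) has_field_derivative hol_ext' X) (at X)" by simp
  then show ?thesis
  proof (rule has_field_derivative_transform_within_open[OF _ open_ball X])
    fix Y assume "Y \<in> ball Z \<rho>"
    then show "2 * cauchy_circle F ((Y - Z) / \<rho>) - of_real mean = hol_ext Y"
      using hF.cauchy_ext_eq[of "(Y - Z) / \<rho>"] scaled_in(2)[of Y] by (simp add: hol_ext_def)
  qed
qed

lemma Re_hol_ext: assumes X: "X \<in> sphere Z \<rho>" shows "Re (hol_ext X) = f X"
proof -
  have n: "norm ((X - Z) / complex_of_real \<rho>) = 1" unfolding norm_scaled using X \<rho> by simp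
  have "2 * Re (hF.cauchy_ext ((X - Z) / \<rho>)) - mean = Re (F ((X - Z) / \<rho>))"
    unfolding mean_def by (rule hF.Re_cauchy_ext[OF n]) (simp add: F_def)
  also have "\<dots> = f X" using \<rho> by (simp add: F_def)
  finally show ?thesis by (simp add: hol_ext_def)
qed

text \<open>It is free of \<open>f\<close>, and of the inner disk, and so can be chosen before them
  in the final theorem.\<close>

definition cst :: real where
  "cst = 2 / \<rho> * (\<rho> + (2 * \<rho> + \<rho> * \<rho> powr \<alpha> * 2 powr (\<alpha> - \<beta>)) * (integral {0..2*pi} (singular_majorant \<beta>) / (2*pi)))"

lemma norm_hol_ext': assumes X: "X \<in> cball Z \<rho>" shows "norm (hol_ext' X) \<le> cst * C1_holder_norm Z \<rho> \<alpha> f"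
proof -
  define A0 where "A0 = (SUP X\<in>sphere Z \<rho>. \<bar>f X\<bar>)"
  define N where "N = C1_holder_norm Z \<rho> \<alpha> f"
  have N: "N = A0 + A1 + A2" by (simp add: N_def C1_holder_norm_def A0_def A1_def A2_def)
  \<comment> \<open>This needs the supremum to be taken over a nonempty bounded set; it makes each
    of the other two terms at most the full norm.\<close>
  have A0: "0 \<le> A0"
  proof -
    have "continuous_on (sphere Z \<rho>) f"
    proof (rule continuous_on_eq)
      show "continuous_on (sphere Z \<rho>) (\<lambda>X. Re (F ((X - Z) / \<rho>)))"
      proof (intro continuous_intros continuous_on_compose2[OF hF.continuous])
        show "(\<lambda>X. (X - Z) / complex_of_real \<rho>) ` sphere Z \<rho> \<subseteq> sphere 0 1"
          unfolding image_subset_iff mem_sphere_0 norm_scaled using \<rho> by simp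
      qed (use \<rho> in auto)
      show "Re (F ((X - Z) / \<rho>)) = f X" for X using \<rho> by (simp add: F_def)
    qed
    then have "bounded (f ` sphere Z \<rho>)" by (intro compact_imp_bounded compact_continuous_image compact_sphere)
    then obtain B where B: "\<forall>X\<in>sphere Z \<rho>. \<bar>f X\<bar> \<le> B" by (auto simp: bounded_iff)
    have "Z + of_real \<rho> \<in> sphere Z \<rho>" using \<rho> by (simp add: dist_norm)
    then have "\<bar>f (Z + of_real \<rho>)\<bar> \<le> A0" unfolding A0_def by (rule cSUP_upper) (use B in \<open>auto intro: bdd_aboveI2\<close>)
    then show ?thesis by linarith
  qed
  have I: "0 \<le> integral {0..2*pi} (singular_majorant \<beta>)"
    by (rule integral_nonneg[OF singular_majorant_integrable[OF \<beta>(1)]]) (auto simp: singular_majorant_def)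
  define J where "J = integral {0..2*pi} (singular_majorant \<beta>) / (2*pi)"
  have J: "0 \<le> J" using I by (simp add: J_def)
  have "norm (hg.cauchy_ext ((X - Z) / \<rho>)) \<le> \<rho> * A1 + M * J"
    unfolding J_def
  proof (rule hg.norm_cauchy_ext_le)
    show "norm (g e) \<le> \<rho> * A1" if "norm e = 1" for e using norm_D[OF that] that by (simp add: g_def norm_mult)
    show "norm ((X - Z) / complex_of_real \<rho>) \<le> 1" using scaled_in(1)[OF X] by simp
  qed
  also have "\<dots> \<le> \<rho> * N + ((2 * \<rho> + \<rho> * \<rho> powr \<alpha> * 2 powr (\<alpha> - \<beta>)) * N) * J"
  proof (intro add_mono mult_left_mono mult_right_mono J)
    show "A1 \<le> N" using N A0 A2_nonneg by simp
    have "2 * \<rho> * A1 \<le> 2 * \<rho> * N" using N A0 A2_nonneg \<rho> by (intro mult_left_mono) auto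
    moreover have "(\<rho> * \<rho> powr \<alpha> * 2 powr (\<alpha> - \<beta>)) * A2 \<le> (\<rho> * \<rho> powr \<alpha> * 2 powr (\<alpha> - \<beta>)) * N"
      using N A0 A1_nonneg \<rho> by (intro mult_left_mono) auto
    ultimately show "M \<le> (2 * \<rho> + \<rho> * \<rho> powr \<alpha> * 2 powr (\<alpha> - \<beta>)) * N" by (simp add: M_def algebra_simps)
  qed (use \<rho> in simp)
  finally have "norm (hg.cauchy_ext ((X - Z) / \<rho>)) \<le> (\<rho> + (2 * \<rho> + \<rho> * \<rho> powr \<alpha> * 2 powr (\<alpha> - \<beta>)) * J) * N"
    by (simp add: algebra_simps)
  then have "2 / \<rho> * norm (hg.cauchy_ext ((X - Z) / \<rho>)) \<le> 2 / \<rho> * ((\<rho> + (2 * \<rho> + \<rho> * \<rho> powr \<alpha> * 2 powr (\<alpha> - \<beta>)) * J) * N)"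
    using \<rho> by (intro mult_left_mono) auto
  moreover have "norm (hol_ext' X) = 2 / \<rho> * norm (hg.cauchy_ext ((X - Z) / \<rho>))"
    using \<rho> by (simp add: hol_ext'_def norm_mult norm_divide)
  ultimately show ?thesis unfolding cst_def J_def[symmetric] N_def[symmetric] by (simp only: mult.assoc)
qed

section \<open>The double layer potential on both sides of the circle\<close>

lemma double_layer_eq_cauchy:
  assumes "X \<notin> sphere Z \<rho>"
  shows "double_layer Z \<rho> f X = Re (cauchy_circle F ((X - Z) / \<rho>))"
proof -
  define z where "z = (X - Z) / complex_of_real \<rho>"
  have X: "X = Z + \<rho> * z" using \<rho> by (simp add: z_def)
  have z1: "norm z \<noteq> 1" unfolding z_def norm_scaled using assms \<rho> by simp
  then have ne: "cis t \<noteq> z" for t by (metis norm_cis)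
  define h where "h t = ((circle_point Z \<rho> t - X) \<bullet> unit_normal Z \<rho> (circle_point Z \<rho> t)) / (norm (X - circle_point Z \<rho> t))\<^sup>2 * f (circle_point Z \<rho> t)" for t
  \<comment> \<open>The double layer kernel is the real part of the Cauchy kernel; the factor
    \<open>1 / \<rho>\<close> is absorbed when arc length is replaced by the angle.\<close>
  have h: "h (\<rho> * t) = Re (cis t * F (cis t) / (cis t - z)) / \<rho>" for t
  proof -
    have c: "circle_point Z \<rho> (\<rho> * t) = Z + \<rho> * cis t" using \<rho> by (simp add: circle_point_def)
    have 1: "circle_point Z \<rho> (\<rho> * t) - X = \<rho> * (cis t - z)" unfolding c X by (simp add: algebra_simps)
    have 2: "unit_normal Z \<rho> (circle_point Z \<rho> (\<rho> * t)) = cis t" unfolding unit_normal_def c using \<rho> by (simp add: scaleR_conv_of_real)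
    have 3: "norm (X - circle_point Z \<rho> (\<rho> * t)) = \<rho> * norm (cis t - z)"
      using 1 \<rho> by (subst norm_minus_commute) (simp add: norm_mult)
    have 4: "(of_real \<rho> * w) \<bullet> v = \<rho> * Re (v * cnj w)" for w v :: complex by (simp add: inner_complex_def algebra_simps)
    have "h (\<rho> * t) = (of_real \<rho> * (cis t - z)) \<bullet> cis t / (\<rho> * norm (cis t - z))\<^sup>2 * f (Z + \<rho> * cis t)"
      unfolding h_def 1 2 3 by (simp only: c)
    also have "\<dots> = \<rho> * Re (cis t * cnj (cis t - z)) / (\<rho> * norm (cis t - z))\<^sup>2 * f (Z + \<rho> * cis t)"
      unfolding 4 ..
    also have "\<dots> = Re (cis t * cnj (cis t - z)) / (norm (cis t - z))\<^sup>2 * f (Z + \<rho> * cis t) / \<rho>"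
      using \<rho> by (simp add: power_mult_distrib power2_eq_square)
    also have "Re (cis t * cnj (cis t - z)) / (norm (cis t - z))\<^sup>2 = Re (cis t / (cis t - z))"
      unfolding complex_div_cnj[of "cis t"] by (simp add: Re_divide_of_real flip: of_real_power)
    also have "Re (cis t / (cis t - z)) * f (Z + \<rho> * cis t) = Re (cis t * F (cis t) / (cis t - z))"
    proof -
      have "cis t * F (cis t) / (cis t - z) = f (Z + \<rho> * cis t) *\<^sub>R (cis t / (cis t - z))" by (simp add: F_def scaleR_conv_of_real)
      then show ?thesis by simp
    qed
    finally show ?thesis .
  qed
  have ci: "(\<lambda>t. cis t * F (cis t) / (cis t - z)) integrable_on {0..2*pi}"
    using ne by (intro integrable_continuous_real continuous_intros continuous_on_cis_comp hF.continuous) auto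
  have "((\<lambda>t. Re (cis t * F (cis t) / (cis t - z)) / \<rho>) has_integral Re (integral {0..2*pi} (\<lambda>t. cis t * F (cis t) / (cis t - z))) / \<rho>) {0..2*pi}"
    using has_integral_divide[OF has_integral_linear[OF integrable_integral[OF ci] bounded_linear_Re], of \<rho>] by (simp only: o_def)
  then have "((\<lambda>t. h (\<rho> * t)) has_integral Re (integral {0..2*pi} (\<lambda>t. cis t * F (cis t) / (cis t - z))) / \<rho>) {0..2*pi}"
    by (simp only: h)
  then have "(h has_integral \<rho> * (Re (integral {0..2*pi} (\<lambda>t. cis t * F (cis t) / (cis t - z))) / \<rho>)) ((\<lambda>x. x * \<rho>) ` {0..2*pi})"
    using has_integral_stretch_real[of "\<lambda>t. h (\<rho> * t)" "Re (integral {0..2*pi} (\<lambda>t. cis t * F (cis t) / (cis t - z))) / \<rho>" 0 "2*pi" "1/\<rho>"] \<rho>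
    by simp
  moreover have "(\<lambda>x. x * \<rho>) ` {0..2*pi} = {0..2*pi*\<rho>}"
    using image_mult_atLeastAtMost[OF \<rho>, of 0 "2*pi"] by (simp add: mult.commute)
  ultimately have "(h has_integral Re (integral {0..2*pi} (\<lambda>t. cis t * F (cis t) / (cis t - z)))) {0..2*pi*\<rho>}"
    using \<rho> by (simp only: times_divide_eq_right nonzero_mult_div_cancel_left less_irrefl not_False_eq_True order_less_imp_not_eq2)
  then have "integral {0..2*pi*\<rho>} h = Re (integral {0..2*pi} (\<lambda>t. cis t * F (cis t) / (cis t - z)))" by (rule integral_unique)
  moreover have "double_layer Z \<rho> f X = 1 / (2*pi) * integral {0..2*pi*\<rho>} h"
    unfolding double_layer_def circle_integral_def h_def ..
  moreover have "Re (cauchy_circle F z) = Re (integral {0..2*pi} (\<lambda>t. cis t * F (cis t) / (cis t - z))) / (2*pi)"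
    unfolding cauchy_circle_def by (rule trans[OF _ Re_divide_of_real]) simp
  ultimately show ?thesis by (simp add: z_def)
qed

lemma double_layer_inside:
  assumes "X \<in> ball Z \<rho>" shows "double_layer Z \<rho> f X = (Re (hol_ext X) + mean) / 2"
proof -
  have "hF.cauchy_ext ((X - Z) / \<rho>) = cauchy_circle F ((X - Z) / \<rho>)"
    using scaled_in(2)[OF assms] by (intro hF.cauchy_ext_eq) simp
  then show ?thesis using double_layer_eq_cauchy[of X] assms by (auto simp: hol_ext_def)
qed

text \<open>For a unit \<open>e\<close> and the mirror image \<open>w = 1 / cnj z\<close> one has
  \<open>Re (e / (e - z)) = 1 - Re (e / (e - w))\<close>. The constant 1 contributes the mean. So
  the potential outside is a reflected copy of the one inside.\<close>

lemma cauchy_circle_outside: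
  assumes z: "norm z > 1"
  shows "Re (cauchy_circle F z) = mean - Re (cauchy_circle F (1 / cnj z))"
proof -
  define w where "w = 1 / cnj z"
  have z0: "z \<noteq> 0" using z by auto
  have w: "norm w < 1" unfolding w_def norm_divide complex_mod_cnj norm_one by (rule iffD2[OF divide_less_eq_1_pos]) (use z in auto)
  have ne: "cis t \<noteq> z" "cis t \<noteq> w" for t using z w norm_cis[of t] by auto
  have id: "Re (cis t / (cis t - z)) = 1 - Re (cis t / (cis t - w))" for t
  proof -
    have cc: "cnj (cis t) * cis t = 1" using complex_norm_square[of "cis t"] by (simp add: mult.commute)
    have "cnj (cis t / (cis t - z)) = 1 / (1 - cis t * cnj z)"
    proof -
      have "cnj (cis t / (cis t - z)) = cnj (cis t) / (cnj (cis t) - cnj z)" by simp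
      also have "\<dots> = (cis t * cnj (cis t)) / (cis t * (cnj (cis t) - cnj z))" by simp
      also have "cis t * (cnj (cis t) - cnj z) = 1 - cis t * cnj z" using cc by (simp add: algebra_simps)
      finally show ?thesis using cc by (simp add: mult.commute)
    qed
    moreover have "cis t / (cis t - w) = 1 - 1 / (1 - cis t * cnj z)"
    proof -
      have nz: "1 - cis t * cnj z \<noteq> 0"
      proof
        assume "1 - cis t * cnj z = 0"
        then have "cis t = w" using z0 by (simp add: w_def field_simps)
        with ne(2) show False by blast
      qed
      have "cis t / (cis t - w) = (cnj z * cis t) / (cnj z * (cis t - w))" using z0 by simp
      also have "cnj z * (cis t - w) = - (1 - cis t * cnj z)" using z0 by (simp add: w_def algebra_simps)
      also have "cnj z * cis t / - (1 - cis t * cnj z) = 1 - 1 / (1 - cis t * cnj z)" using nz by (simp add: field_simps)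
      finally show ?thesis .
    qed
    ultimately have "cis t / (cis t - w) = 1 - cnj (cis t / (cis t - z))" by simp
    then show ?thesis by (simp only: minus_complex.sel cnj.sel one_complex.sel)
  qed
  have id2: "Re (cis t * F (cis t) / (cis t - z)) = Re (F (cis t)) - Re (cis t * F (cis t) / (cis t - w))" for t
  proof -
    have s: "cis t * F (cis t) / u = f (Z + \<rho> * cis t) *\<^sub>R (cis t / u)" for u by (simp add: F_def scaleR_conv_of_real)
    have "Re (cis t * F (cis t) / (cis t - z)) = f (Z + \<rho> * cis t) * (1 - Re (cis t / (cis t - w)))"
      unfolding s scaleR_complex.sel id ..
    moreover have "Re (cis t * F (cis t) / (cis t - w)) = f (Z + \<rho> * cis t) * Re (cis t / (cis t - w))"
      unfolding s scaleR_complex.sel ..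
    ultimately show ?thesis by (simp add: F_def algebra_simps)
  qed
  have i: "(\<lambda>t. cis t * F (cis t) / (cis t - u)) integrable_on {0..2*pi}" if "\<And>t. cis t \<noteq> u" for u
    using that by (intro integrable_continuous_real continuous_intros continuous_on_cis_comp hF.continuous) auto
  have iF: "(\<lambda>t. F (cis t)) integrable_on {0..2*pi}"
    by (intro integrable_continuous_real continuous_on_cis_comp hF.continuous)
  have Rei: "Re (integral {0..2*pi} \<phi>) = integral {0..2*pi} (\<lambda>t. Re (\<phi> t))" if "\<phi> integrable_on {0..2*pi}" for \<phi> :: "real \<Rightarrow> complex"
    using integral_linear[OF that bounded_linear_Re] by (simp add: o_def)
  have cR: "Re (cauchy_circle F u) = integral {0..2*pi} (\<lambda>t. Re (cis t * F (cis t) / (cis t - u))) / (2*pi)" if "\<And>t. cis t \<noteq> u" for u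
  proof -
    have "Re (cauchy_circle F u) = Re (integral {0..2*pi} (\<lambda>t. cis t * F (cis t) / (cis t - u))) / (2*pi)"
      unfolding cauchy_circle_def by (rule trans[OF _ Re_divide_of_real]) simp
    then show ?thesis using Rei[OF i[OF that]] by simp
  qed
  have m: "mean = integral {0..2*pi} (\<lambda>t. Re (F (cis t))) / (2*pi)"
    unfolding mean_def using cR[of 0] by simp
  have iR: "(\<lambda>t. Re (\<phi> t)) integrable_on {0..2*pi}" if "\<phi> integrable_on {0..2*pi}" for \<phi> :: "real \<Rightarrow> complex"
    using integrable_linear[OF that bounded_linear_Re] by (simp add: o_def)
  have "integral {0..2*pi} (\<lambda>t. Re (cis t * F (cis t) / (cis t - z))) =
      integral {0..2*pi} (\<lambda>t. Re (F (cis t))) - integral {0..2*pi} (\<lambda>t. Re (cis t * F (cis t) / (cis t - w)))"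
    unfolding id2 by (rule Henstock_Kurzweil_Integration.integral_diff[OF iR[OF iF] iR[OF i[OF ne(2)]]])
  then show ?thesis unfolding cR[OF ne(1)] w_def[symmetric] cR[OF ne(2)] m by (simp only: diff_divide_distrib)
qed

lemma double_layer_outside:
  assumes X: "X \<notin> cball Z \<rho>"
  shows "double_layer Z \<rho> f X = (mean - Re (hol_ext (Z + \<rho>\<^sup>2 / cnj (X - Z)))) / 2"
proof -
  define z where "z = (X - Z) / complex_of_real \<rho>"
  have z: "norm z > 1" unfolding z_def norm_scaled using X \<rho> by (simp add: less_divide_eq)
  have w: "(Z + \<rho>\<^sup>2 / cnj (X - Z) - Z) / complex_of_real \<rho> = 1 / cnj z" using \<rho> by (simp add: z_def power2_eq_square)
  have nw: "norm (1 / cnj z) < 1" unfolding norm_divide complex_mod_cnj norm_one by (rule iffD2[OF divide_less_eq_1_pos]) (use z in auto)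
  have "Re (hol_ext (Z + \<rho>\<^sup>2 / cnj (X - Z))) = 2 * Re (cauchy_circle F (1 / cnj z)) - mean"
    unfolding hol_ext_def w hF.cauchy_ext_eq[OF nw] by simp
  moreover have "double_layer Z \<rho> f X = Re (cauchy_circle F z)"
    unfolding z_def by (rule double_layer_eq_cauchy) (use X in auto)
  ultimately show ?thesis using cauchy_circle_outside[OF z] by simp
qed

end

section \<open>Solution by reflected images\<close>

lemma GDERIV_Re: "(E has_field_derivative E') (at X) \<Longrightarrow> GDERIV (\<lambda>X. Re (E X)) X :> cnj E'"
  and GDERIV_Im: "(E has_field_derivative E') (at X) \<Longrightarrow> GDERIV (\<lambda>X. Im (E X)) X :> \<i> * cnj E'"
proof -
  assume E: "(E has_field_derivative E') (at X)"
  have 1: "(\<lambda>h. Re (E' * h)) = (\<lambda>h. h \<bullet> cnj E')" "(\<lambda>h. Im (E' * h)) = (\<lambda>h. h \<bullet> (\<i> * cnj E'))"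
    by (auto simp: fun_eq_iff inner_complex_def algebra_simps)
  show "GDERIV (\<lambda>X. Re (E X)) X :> cnj E'"
    unfolding gderiv_def 1(1)[symmetric] by (rule has_derivative_Re[OF E[unfolded has_field_derivative_def]])
  show "GDERIV (\<lambda>X. Im (E X)) X :> \<i> * cnj E'"
    unfolding gderiv_def 1(2)[symmetric] by (rule has_derivative_Im[OF E[unfolded has_field_derivative_def]])
qed

lemma GDERIV_transform_open:
  assumes "GDERIV u X :> D" "open S" "X \<in> S" "\<And>Y. Y \<in> S \<Longrightarrow> u Y = v Y"
  shows "GDERIV v X :> D"
  using has_derivative_transform_within_open[OF assms(1)[unfolded gderiv_def] assms(2,3)] assms(4)
  by (simp add: gderiv_def)

text \<open>The form of \<open>reflect\<close> that displays it as the conjugate of a holomorphic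
  function.\<close>

definition inversion :: "complex \<Rightarrow> real \<Rightarrow> complex \<Rightarrow> complex" where
  "inversion c r X = c + of_real (r\<^sup>2) / cnj (X - c)"

lemma inversion_norm: "norm (inversion c r X - c) = r\<^sup>2 / norm (X - c)"
  unfolding inversion_def by (simp only: add_diff_cancel_left' norm_divide complex_mod_cnj norm_of_real abs_power2)

lemma inversion_sphere: "r > 0 \<Longrightarrow> X \<in> sphere c r \<Longrightarrow> inversion c r X = X"
proof -
  assume r: "r > 0" and X: "X \<in> sphere c r"
  have "norm (X - c) = r" using X by (simp add: dist_norm norm_minus_commute)
  then have e: "of_real (r\<^sup>2) = (X - c) * cnj (X - c)" using complex_norm_square[of "X - c"] by simp
  have "cnj (X - c) \<noteq> 0" using r \<open>norm (X - c) = r\<close> by auto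
  then show ?thesis unfolding inversion_def e by simp
qed

text \<open>Conjugation and inversion are both antiholomorphic, so the composition is holomorphic
  again.\<close>

lemma inversion_has_derivative_cnj:
  assumes V: "(V has_field_derivative W) (at (inversion c r X))" and X: "X \<noteq> c"
  shows "((\<lambda>X. cnj (V (inversion c r X))) has_field_derivative - (cnj W * of_real (r\<^sup>2) / (X - c)\<^sup>2)) (at X)"
proof -
  define \<zeta> where "\<zeta> X = cnj c + of_real (r\<^sup>2) / (X - c)" for X
  have inv: "inversion c r X = cnj (\<zeta> X)" for X by (simp add: inversion_def \<zeta>_def)
  have "(V has_field_derivative W) (at (cnj (\<zeta> X)))" using V unfolding inv .
  then have 1: "((cnj \<circ> V \<circ> cnj) has_field_derivative cnj W) (at (\<zeta> X))" by (rule has_field_derivative_cnj_cnj)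
  have "(\<zeta> has_field_derivative (0 + (0 * (X - c) - of_real (r\<^sup>2) * (1 - 0)) / ((X - c) * (X - c)))) (at X)"
    unfolding \<zeta>_def[abs_def]
    by (intro DERIV_add DERIV_const DERIV_divide DERIV_diff DERIV_ident) (use X in simp)
  from DERIV_chain2[OF 1 this]
  show ?thesis by (simp add: inv power2_eq_square)
qed

text \<open>Folding the plane onto the disk treats the two formulas for the solution at once; it is \<open>1\<close>-Lipschitz.\<close>

definition disk_fold :: "complex \<Rightarrow> real \<Rightarrow> complex \<Rightarrow> complex" where
  "disk_fold c r X = (if X \<in> ball c r then X else inversion c r X)"

lemma disk_fold_in: "r > 0 \<Longrightarrow> disk_fold c r X \<in> cball c r"
proof (cases "X \<in> ball c r")
  case False
  assume r: "r > 0"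
  have n: "r \<le> norm (X - c)" using False by (simp add: dist_norm norm_minus_commute)
  then have "r\<^sup>2 / norm (X - c) \<le> r" using r by (simp add: divide_le_eq power2_eq_square)
  then show ?thesis using False inversion_norm[of c r X] by (simp add: disk_fold_def dist_norm norm_minus_commute)
qed (simp add: disk_fold_def less_imp_le)

text \<open>For two outer points the images have distance
  \<open>r\<^sup>2 * dist X Y / (norm (X - c) * norm (Y - c))\<close>. For an inner and an outer
  point, the segment between them meets the circle in a point that the inversion fixes, which splits
  the estimate.\<close>

lemma disk_fold_contract:
  assumes r: "r > 0" shows "dist (disk_fold c r X) (disk_fold c r Y) \<le> dist X Y"
proof -
  have out: "dist (inversion c r X) (inversion c r Y) \<le> dist X Y" if "r \<le> norm (X - c)" "r \<le> norm (Y - c)" for X Y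
  proof -
    have nz: "X - c \<noteq> 0" "Y - c \<noteq> 0" using that r by auto
    have "inversion c r X - inversion c r Y = of_real (r\<^sup>2) * cnj (Y - X) / (cnj (X - c) * cnj (Y - c))"
      using nz by (simp add: inversion_def field_simps)
    then have "dist (inversion c r X) (inversion c r Y) = r\<^sup>2 * dist X Y / (norm (X - c) * norm (Y - c))"
      unfolding dist_norm by (simp only: norm_divide norm_mult complex_mod_cnj norm_of_real norm_minus_commute[of Y X]) simp
    also have "r * r \<le> norm (X - c) * norm (Y - c)" using that r by (intro mult_mono) auto
    then have "r\<^sup>2 * dist X Y / (norm (X - c) * norm (Y - c)) \<le> dist X Y"
      using nz mult_right_mono[of "r * r" "norm (X - c) * norm (Y - c)" "dist X Y"] by (simp add: divide_le_eq power2_eq_square mult.commute)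
    finally show ?thesis .
  qed
  have mixed: "dist X (inversion c r Y) \<le> dist X Y" if X: "X \<in> ball c r" and Y: "Y \<notin> ball c r" for X Y
  proof -
    have "closed_segment X Y \<inter> frontier (ball c r) \<noteq> {}"
      using X Y by (intro connected_Int_frontier) auto
    then obtain P where "P \<in> closed_segment X Y \<inter> frontier (ball c r)" by blast
    then have P: "P \<in> closed_segment X Y" "P \<in> sphere c r" using r by (simp_all add: frontier_ball)
    have "dist X (inversion c r Y) \<le> dist X P + dist P (inversion c r Y)" by (rule dist_triangle)
    also have "dist P (inversion c r Y) \<le> dist P Y"
      using out[of P Y] P(2) Y inversion_sphere[OF r P(2)] by (simp add: dist_norm norm_minus_commute)
    also have "dist X P + dist P Y = dist X Y" using P(1) unfolding between_mem_segment[symmetric] between by simp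
    finally show ?thesis by simp
  qed
  have o: "r \<le> norm (X - c)" if "X \<notin> ball c r" for X using that by (simp add: dist_norm norm_minus_commute)
  show ?thesis
  proof (cases "X \<in> ball c r"; cases "Y \<in> ball c r")
    assume X: "X \<in> ball c r" and Y: "Y \<notin> ball c r"
    then show ?thesis using mixed[OF X Y] by (simp add: disk_fold_def)
  next
    assume X: "X \<notin> ball c r" and Y: "Y \<in> ball c r"
    then show ?thesis using mixed[OF Y X] by (simp add: disk_fold_def dist_commute)
  next
    assume X: "X \<notin> ball c r" and Y: "Y \<notin> ball c r"
    then show ?thesis using out[OF o[OF X] o[OF Y]] by (simp add: disk_fold_def)
  qed (simp add: disk_fold_def)
qed

text \<open>Distinct centres give the axis its direction \<open>n\<close>; \<open>small_gap\<close>
  shows that small gaps exclude concentric disks.\<close>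

locale two_disks = C1_holder_data Z \<rho> \<alpha> f
  for Z :: complex and \<rho> \<alpha> :: real and f :: "complex \<Rightarrow> real" +
  fixes c :: complex and r k :: real
  assumes r: "0 < r" and c: "c \<noteq> Z" and inside: "dist Z c + r < \<rho>" and k: "0 < k"
begin

definition L where "L = norm (c - Z)"
definition n where "n = (c - Z) / of_real L"
definition \<sigma> where "\<sigma> = contrast k"

lemma L_pos: "0 < L" using c by (simp add: L_def)

sublocale ecc: eccentric \<rho> r L
  by unfold_locales (use r L_pos inside in \<open>auto simp: L_def dist_norm norm_minus_commute\<close>)

lemma n: "norm n = 1" "n * cnj n = 1" "cnj n * n = 1" "c = Z + n * L"
proof -
  show 1: "norm n = 1" using L_pos by (simp add: n_def norm_divide L_def)
  show "n * cnj n = 1" using complex_norm_square[of n] 1 by simp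
  then show "cnj n * n = 1" by (simp add: mult.commute)
  show "c = Z + n * L" using L_pos by (simp add: n_def)
qed

lemma \<sigma>: "\<bar>\<sigma>\<bar> < 1" "k * (1 - \<sigma>) = 1 + \<sigma>"
  using k by (auto simp: \<sigma>_def contrast_def field_simps abs_less_iff)

definition axis_coord where "axis_coord X = cnj n * (X - Z)"

lemma norm_axis_coord: "norm (axis_coord X) = dist Z X"
  unfolding axis_coord_def norm_mult complex_mod_cnj n(1) by (simp add: dist_norm norm_minus_commute)

lemma axis_coord_inv: "X = Z + n * axis_coord X"
  unfolding axis_coord_def using n(2) by (simp flip: mult.assoc)

definition iter_refl where "iter_refl m X = Z + n * ecc.mob m (axis_coord X)"
definition iter_refl_deriv where "iter_refl_deriv m X = ecc.mob' m (axis_coord X)"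
definition double_refl where "double_refl X = Z + n * ecc.T (axis_coord X)"

lemma dist_iter_refl: "dist Z (Z + n * w) = norm w" by (simp add: dist_norm norm_mult n(1))

lemma iter_refl_in: "X \<in> cball Z \<rho> \<Longrightarrow> iter_refl m X \<in> cball Z \<rho>" "X \<in> ball Z \<rho> \<Longrightarrow> iter_refl m X \<in> ball Z \<rho>"
  "X \<in> cball Z \<rho> \<Longrightarrow> iter_refl (Suc m) X \<in> ball Z \<rho>"
proof -
  have d: "dist Z (iter_refl m X) = norm (ecc.mob m (axis_coord X))" for m by (simp only: iter_refl_def dist_iter_refl)
  show "X \<in> cball Z \<rho> \<Longrightarrow> iter_refl m X \<in> cball Z \<rho>" "X \<in> ball Z \<rho> \<Longrightarrow> iter_refl m X \<in> ball Z \<rho>"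
    "X \<in> cball Z \<rho> \<Longrightarrow> iter_refl (Suc m) X \<in> ball Z \<rho>"
    using ecc.norm_mob[of "axis_coord X" m] by (simp_all add: d norm_axis_coord)
qed

lemma axis_coord_shift: "axis_coord (Z + n * w) = w" unfolding axis_coord_def using n(3) by (simp flip: mult.assoc)

lemma iter_refl_0: "iter_refl 0 X = X" unfolding iter_refl_def ecc.mob_0 using axis_coord_inv[of X] by simp

lemma iter_refl_Suc: "X \<in> cball Z \<rho> \<Longrightarrow> iter_refl (Suc m) X = iter_refl m (double_refl X)"
  unfolding iter_refl_def double_refl_def axis_coord_shift using ecc.mob_Suc[of "axis_coord X"] by (simp add: norm_axis_coord)

lemma double_refl_in: "X \<in> cball Z \<rho> \<Longrightarrow> double_refl X \<in> ball c r"
proof -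
  assume X: "X \<in> cball Z \<rho>"
  have "double_refl X - c = n * (ecc.T (axis_coord X) - of_real L)" unfolding double_refl_def by (subst n(4)) (simp add: algebra_simps)
  then have "norm (double_refl X - c) = norm (ecc.T (axis_coord X) - of_real L)" by (simp add: norm_mult n(1))
  also have "\<dots> < r" using X by (intro ecc.T_in) (simp add: norm_axis_coord)
  finally show "double_refl X \<in> ball c r" by (simp add: dist_norm norm_minus_commute)
qed

lemma cball_sub: "cball c r \<subseteq> ball Z \<rho>"
  using inside by (subst cball_subset_ball_iff) (simp add: dist_commute)

lemma ball_sub: "ball c r \<subseteq> ball Z \<rho>" "ball c r \<subseteq> cball Z \<rho>" "cball c r \<subseteq> cball Z \<rho>"
  using cball_sub ball_subset_cball[of c r] ball_subset_cball[of Z \<rho>] by blast+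

text \<open>On the outer circle the outer reflection is the identity, so only the inner one
  remains.\<close>

lemma double_refl_inversion:
  assumes X: "X \<in> sphere Z \<rho>" shows "inversion c r X = double_refl X"
proof -
  define y where "y = axis_coord X"
  have ny: "norm y = \<rho>" using X by (simp add: y_def norm_axis_coord)
  have y0: "y \<noteq> 0" using ny \<rho> by auto
  have "of_real (\<rho>\<^sup>2) = y * cnj y" using complex_norm_square[of y] ny by simp
  then have d: "of_real (\<rho>\<^sup>2) - of_real L * y = y * cnj (y - of_real L)" by (simp add: algebra_simps)
  have "ecc.T y = of_real L + of_real (r\<^sup>2) / cnj (y - of_real L)"
    unfolding ecc.T_def d using y0 by simp
  then have 1: "double_refl X = Z + n * of_real L + n * (of_real (r\<^sup>2) / cnj (y - of_real L))"
    unfolding double_refl_def y_def by (simp add: distrib_left)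
  have X': "X = Z + n * y" unfolding y_def by (rule axis_coord_inv)
  have "X - c = n * (y - of_real L)" by (subst X', subst n(4)) (simp add: algebra_simps)
  then have e: "cnj (X - c) = cnj n * cnj (y - of_real L)" by simp
  have nz: "n \<noteq> 0" using n(1) by auto
  have "of_real (r\<^sup>2) / (cnj n * cnj (y - of_real L)) = n * of_real (r\<^sup>2) / (n * cnj n * cnj (y - of_real L))"
    unfolding mult.assoc by (rule mult_divide_mult_cancel_left[OF nz, symmetric])
  then have "of_real (r\<^sup>2) / cnj (X - c) = n * (of_real (r\<^sup>2) / cnj (y - of_real L))"
    unfolding e n(2) by simp
  then show ?thesis unfolding 1 inversion_def by (subst n(4)) simp
qed

lemma iter_refl_has_derivative: "X \<in> cball Z \<rho> \<Longrightarrow> (iter_refl m has_field_derivative iter_refl_deriv m X) (at X)"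
proof -
  assume X: "X \<in> cball Z \<rho>"
  have 1: "(axis_coord has_field_derivative cnj n) (at X)" unfolding axis_coord_def[abs_def] by (auto intro!: derivative_eq_intros)
  have 2: "(ecc.mob m has_field_derivative ecc.mob' m (axis_coord X)) (at (axis_coord X))"
    using ecc.mob_has_derivative[of "axis_coord X" m UNIV] X by (simp add: norm_axis_coord)
  have "(iter_refl m has_field_derivative 0 + n * (ecc.mob' m (axis_coord X) * cnj n)) (at X)"
    unfolding iter_refl_def[abs_def] by (intro DERIV_add DERIV_const DERIV_cmult DERIV_chain2[OF 2 1])
  moreover have "0 + n * (ecc.mob' m (axis_coord X) * cnj n) = iter_refl_deriv m X"
    unfolding iter_refl_deriv_def using n(2) by (simp add: mult.left_commute mult.commute)
  ultimately show ?thesis by simp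
qed

lemma continuous_iter_refl: "continuous_on (cball Z \<rho>) (iter_refl m)" "continuous_on (cball Z \<rho>) (iter_refl_deriv m)"
proof -
  show "continuous_on (cball Z \<rho>) (iter_refl m)"
    by (intro continuous_at_imp_continuous_on ballI DERIV_isCont[OF iter_refl_has_derivative])
  have "continuous_on (cball Z \<rho>) axis_coord" unfolding axis_coord_def[abs_def] by (intro continuous_intros)
  then show "continuous_on (cball Z \<rho>) (iter_refl_deriv m)" unfolding iter_refl_deriv_def[abs_def]
    by (rule continuous_on_compose2[OF ecc.continuous_mob']) (auto simp: norm_axis_coord)
qed

section \<open>The series of images\<close>

definition V where "V X = (\<Sum>m. of_real (\<sigma>^m) * hol_ext (iter_refl m X))"
definition W where "W X = (\<Sum>m. of_real (\<sigma>^m) * (hol_ext' (iter_refl m X) * iter_refl_deriv m X))"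

definition ext_bound where "ext_bound = cst * C1_holder_norm Z \<rho> \<alpha> f"
text \<open>The 4 comes from \<open>norm_mob'\<close> and the rest is a geometric sum. The ratio
  with \<open>q\<^sup>2\<close> is available only for derivatives; \<open>V\<close> itself converges
  with ratio \<open>\<bar>\<sigma>\<bar>\<close>, and its size does not enter the estimates.\<close>

definition W_bound where "W_bound = 4 * ext_bound / (1 - \<bar>\<sigma>\<bar> * ecc.q\<^sup>2)"

lemma ext_bound: "X \<in> cball Z \<rho> \<Longrightarrow> norm (hol_ext' X) \<le> ext_bound" unfolding ext_bound_def by (rule norm_hol_ext')

lemma ext_bound_nonneg: "0 \<le> ext_bound"
  using order_trans[OF norm_ge_zero ext_bound[of Z]] \<rho> by simp

lemma q2: "0 < ecc.q\<^sup>2" "ecc.q\<^sup>2 < 1" using ecc.q_pos ecc.q_less by (auto simp: power_less_one_iff)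

lemma \<sigma>q: "\<bar>\<sigma>\<bar> * ecc.q\<^sup>2 < 1" "0 \<le> \<bar>\<sigma>\<bar> * ecc.q\<^sup>2"
proof -
  have "\<bar>\<sigma>\<bar> * ecc.q\<^sup>2 \<le> \<bar>\<sigma>\<bar> * 1" using q2 by (intro mult_left_mono) auto
  then show "\<bar>\<sigma>\<bar> * ecc.q\<^sup>2 < 1" using \<sigma> by simp
qed simp

lemma W_bound_nonneg: "0 \<le> W_bound" unfolding W_bound_def using ext_bound_nonneg \<sigma>q by simp

lemma term_bound_W:
  assumes X: "X \<in> cball Z \<rho>"
  shows "norm (of_real (\<sigma>^m) * (hol_ext' (iter_refl m X) * iter_refl_deriv m X)) \<le> 4 * ext_bound * (\<bar>\<sigma>\<bar> * ecc.q\<^sup>2)^m"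
proof -
  have "norm (iter_refl_deriv m X) \<le> 4 * ecc.q^(2*m)" unfolding iter_refl_deriv_def using X by (intro ecc.norm_mob') (simp add: norm_axis_coord)
  then have "norm (hol_ext' (iter_refl m X)) * norm (iter_refl_deriv m X) \<le> ext_bound * (4 * ecc.q^(2*m))"
    using ext_bound[OF iter_refl_in(1)[OF X]] ext_bound_nonneg by (intro mult_mono) auto
  then have "\<bar>\<sigma>\<bar>^m * (norm (hol_ext' (iter_refl m X)) * norm (iter_refl_deriv m X)) \<le> \<bar>\<sigma>\<bar>^m * (ext_bound * (4 * ecc.q^(2*m)))"
    by (intro mult_left_mono) auto
  moreover have "norm (of_real (\<sigma>^m) * (hol_ext' (iter_refl m X) * iter_refl_deriv m X)) = \<bar>\<sigma>\<bar>^m * (norm (hol_ext' (iter_refl m X)) * norm (iter_refl_deriv m X))"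
    unfolding norm_mult norm_of_real power_abs ..
  moreover have "\<bar>\<sigma>\<bar>^m * (ext_bound * (4 * ecc.q^(2*m))) = 4 * ext_bound * (\<bar>\<sigma>\<bar> * ecc.q\<^sup>2)^m"
    by (simp add: power_mult_distrib power_mult)
  ultimately show ?thesis by simp
qed

lemma summable_W_bound: "summable (\<lambda>m. 4 * ext_bound * (\<bar>\<sigma>\<bar> * ecc.q\<^sup>2)^m)"
  using \<sigma>q by (intro summable_mult summable_geometric) simp

lemma norm_W: assumes X: "X \<in> cball Z \<rho>" shows "norm (W X) \<le> W_bound"
proof -
  have "norm (W X) \<le> (\<Sum>m. 4 * ext_bound * (\<bar>\<sigma>\<bar> * ecc.q\<^sup>2)^m)"
    unfolding W_def by (rule norm_suminf_le[OF term_bound_W[OF X] summable_W_bound])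
  also have "\<dots> = 4 * ext_bound * (1 / (1 - \<bar>\<sigma>\<bar> * ecc.q\<^sup>2))"
    using \<sigma>q by (subst suminf_mult[OF summable_geometric]) (simp_all add: suminf_geometric)
  finally show ?thesis by (simp add: W_bound_def)
qed

lemma uniform_W: "uniform_limit (cball Z \<rho>) (\<lambda>m X. \<Sum>i<m. of_real (\<sigma>^i) * (hol_ext' (iter_refl i X) * iter_refl_deriv i X)) W sequentially"
  unfolding W_def[abs_def] by (rule Weierstrass_m_test[OF term_bound_W summable_W_bound])

lemma continuous_ext_iter_refl: "continuous_on (cball Z \<rho>) (\<lambda>X. hol_ext (iter_refl m X))" "continuous_on (cball Z \<rho>) (\<lambda>X. hol_ext' (iter_refl m X))"
  by (rule continuous_on_compose2[OF continuous_hol_ext(1) continuous_iter_refl(1)], use iter_refl_in in blast)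
     (rule continuous_on_compose2[OF continuous_hol_ext(2) continuous_iter_refl(1)], use iter_refl_in in blast)

lemma continuous_W: "continuous_on (cball Z \<rho>) W"
proof (rule uniform_limit_theorem[OF _ uniform_W])
  show "\<forall>\<^sub>F m in sequentially. continuous_on (cball Z \<rho>) (\<lambda>X. \<Sum>i<m. of_real (\<sigma>^i) * (hol_ext' (iter_refl i X) * iter_refl_deriv i X))"
    by (intro always_eventually allI continuous_intros continuous_ext_iter_refl continuous_iter_refl)
qed simp

definition V_bound where "V_bound = (SOME B. \<forall>X\<in>cball Z \<rho>. norm (hol_ext X) \<le> B)"

lemma V_bound: "X \<in> cball Z \<rho> \<Longrightarrow> norm (hol_ext X) \<le> V_bound"
proof -
  have "\<exists>B. \<forall>X\<in>cball Z \<rho>. norm (hol_ext X) \<le> B"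
    using compact_imp_bounded[OF compact_continuous_image[OF continuous_hol_ext(1) compact_cball]] by (auto simp: bounded_iff)
  from someI_ex[OF this] show "X \<in> cball Z \<rho> \<Longrightarrow> norm (hol_ext X) \<le> V_bound" unfolding V_bound_def by blast
qed

lemma term_bound_V:
  assumes X: "X \<in> cball Z \<rho>" shows "norm (of_real (\<sigma>^m) * hol_ext (iter_refl m X)) \<le> V_bound * \<bar>\<sigma>\<bar>^m"
  unfolding norm_mult norm_of_real power_abs mult.commute[of "\<bar>\<sigma>\<bar>^m"]
  by (intro mult_right_mono V_bound iter_refl_in(1) X) simp

lemma summable_V_bound: "summable (\<lambda>m. V_bound * \<bar>\<sigma>\<bar>^m)"
  using \<sigma> by (intro summable_mult summable_geometric) simp

lemma summable_V: "X \<in> cball Z \<rho> \<Longrightarrow> summable (\<lambda>m. of_real (\<sigma>^m) * hol_ext (iter_refl m X))"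
  by (rule summable_comparison_test'[OF summable_V_bound term_bound_V])

lemma continuous_V: "continuous_on (cball Z \<rho>) V"
proof -
  have "uniform_limit (cball Z \<rho>) (\<lambda>m X. \<Sum>i<m. of_real (\<sigma>^i) * hol_ext (iter_refl i X)) V sequentially"
    unfolding V_def[abs_def] by (rule Weierstrass_m_test[OF term_bound_V summable_V_bound])
  moreover have "\<forall>\<^sub>F m in sequentially. continuous_on (cball Z \<rho>) (\<lambda>X. \<Sum>i<m. of_real (\<sigma>^i) * hol_ext (iter_refl i X))"
    by (intro always_eventually allI continuous_intros continuous_ext_iter_refl)
  ultimately show ?thesis by (intro uniform_limit_theorem[where F = sequentially]) auto
qed

lemma term_has_derivative:
  assumes X: "X \<in> ball Z \<rho>"
  shows "((\<lambda>X. of_real (\<sigma>^m) * hol_ext (iter_refl m X)) has_field_derivative of_real (\<sigma>^m) * (hol_ext' (iter_refl m X) * iter_refl_deriv m X)) (at X within ball Z \<rho>)"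
proof -
  have X': "X \<in> cball Z \<rho>" using X by (simp add: less_imp_le)
  have 2: "(hol_ext has_field_derivative hol_ext' (iter_refl m X)) (at (iter_refl m X))" by (rule hol_ext_has_derivative[OF iter_refl_in(2)[OF X]])
  have "((hol_ext \<circ> iter_refl m) has_field_derivative hol_ext' (iter_refl m X) * iter_refl_deriv m X) (at X)"
    by (rule DERIV_chain[OF 2 iter_refl_has_derivative[OF X']])
  then have "((\<lambda>X. hol_ext (iter_refl m X)) has_field_derivative hol_ext' (iter_refl m X) * iter_refl_deriv m X) (at X)" unfolding comp_def .
  then show ?thesis by (rule has_field_derivative_at_within[OF DERIV_cmult])
qed

lemma V_has_derivative: assumes X: "X \<in> ball Z \<rho>" shows "(V has_field_derivative W X) (at X)"
proof -
  have Zb: "Z \<in> ball Z \<rho>" using \<rho> by simp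
  have Zc: "Z \<in> cball Z \<rho>" using \<rho> by simp
  have u: "uniform_limit (ball Z \<rho>) (\<lambda>m X. \<Sum>i<m. of_real (\<sigma>^i) * (hol_ext' (iter_refl i X) * iter_refl_deriv i X)) W sequentially"
    by (rule uniform_limit_on_subset[OF uniform_W ball_subset_cball])
  have "\<exists>g. \<forall>X\<in>ball Z \<rho>. (\<lambda>m. of_real (\<sigma>^m) * hol_ext (iter_refl m X)) sums g X \<and> (g has_field_derivative W X) (at X within ball Z \<rho>)"
    by (rule has_field_derivative_series[where f = "\<lambda>m X. of_real (\<sigma>^m) * hol_ext (iter_refl m X)", OF convex_ball term_has_derivative u Zb summable_V[OF Zc]])
  then obtain g where g: "\<forall>X\<in>ball Z \<rho>. (\<lambda>m. of_real (\<sigma>^m) * hol_ext (iter_refl m X)) sums g X \<and> (g has_field_derivative W X) (at X within ball Z \<rho>)" ..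
  have gX: "(g has_field_derivative W X) (at X)" using bspec[OF g X] unfolding at_within_open[OF X open_ball] by (rule conjunct2)
  show ?thesis
  proof (rule has_field_derivative_transform_within_open[OF gX open_ball X])
    show "g Y = V Y" if "Y \<in> ball Z \<rho>" for Y unfolding V_def by (rule sums_unique[OF conjunct1[OF bspec[OF g that]]])
  qed
qed

lemma V_rec: assumes X: "X \<in> cball Z \<rho>" shows "V X = hol_ext X + of_real \<sigma> * V (double_refl X)"
proof -
  have T: "double_refl X \<in> cball Z \<rho>" using double_refl_in[OF X] ball_sub(2) by blast
  define h where "h m = of_real (\<sigma>^m) * hol_ext (iter_refl m X)" for m
  have 1: "V X = h 0 + (\<Sum>m. h (Suc m))"
  proof -
    have "summable h" unfolding h_def[abs_def] by (rule summable_V[OF X])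
    from suminf_split_head[OF this] have "suminf h = h 0 + (\<Sum>m. h (Suc m))" by (simp only: diff_add_cancel add.commute[of "h 0"])
    moreover have "V X = suminf h" unfolding V_def h_def[abs_def] ..
    ultimately show ?thesis by simp
  qed
  have 2: "h 0 = hol_ext X" by (simp add: h_def iter_refl_0)
  have "h (Suc m) = of_real \<sigma> * (of_real (\<sigma>^m) * hol_ext (iter_refl m (double_refl X)))" for m
    unfolding h_def iter_refl_Suc[OF X] power_Suc of_real_mult by (rule mult.assoc)
  then have "(\<Sum>m. h (Suc m)) = (\<Sum>m. of_real \<sigma> * (of_real (\<sigma>^m) * hol_ext (iter_refl m (double_refl X))))" by (simp only:)
  then have 3: "(\<Sum>m. h (Suc m)) = of_real \<sigma> * V (double_refl X)"
    unfolding suminf_mult[OF summable_V[OF T]] V_def[symmetric] .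
  show ?thesis unfolding 1 2 3 ..
qed

end

section \<open>Weak solutions from conjugate pairs\<close>

lemma bounded_measurable_imp_set_integrable:
  fixes F :: "complex \<Rightarrow> complex"
  assumes F: "F \<in> borel_measurable (lebesgue_on (ball Z \<rho>))" and M: "\<And>X. X \<in> ball Z \<rho> \<Longrightarrow> norm (F X) \<le> M"
  shows "set_integrable lebesgue (ball Z \<rho>) F" and "square_integrable_on (ball Z \<rho>) F"
proof -
  have "emeasure lebesgue (ball Z \<rho>) < \<infinity>" using lmeasurable_ball[of Z \<rho>] by (auto simp: fmeasurable_def)
  then have i: "integrable lebesgue (indicator (ball Z \<rho>) :: complex \<Rightarrow> real)" by (intro integrable_real_indicator) auto
  have m: "(\<lambda>X. indicator (ball Z \<rho>) X *\<^sub>R F X) \<in> borel_measurable lebesgue"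
  proof -
    have "(\<lambda>X. if X \<in> ball Z \<rho> then F X else 0) \<in> borel_measurable lebesgue"
      by (rule iffD2[OF borel_measurable_if F]) simp
    moreover have "(\<lambda>X. if X \<in> ball Z \<rho> then F X else 0) = (\<lambda>X. indicator (ball Z \<rho>) X *\<^sub>R F X)" by (auto simp: indicator_def)
    ultimately show ?thesis by simp
  qed
  have n: "norm (indicator (ball Z \<rho>) X *\<^sub>R F X) \<le> \<bar>M\<bar>" for X
    using M[of X] by (cases "X \<in> ball Z \<rho>") auto
  have "integrable lebesgue (\<lambda>X. indicator (ball Z \<rho>) X * \<bar>M\<bar>)" using i by simp
  then show "set_integrable lebesgue (ball Z \<rho>) F" unfolding set_integrable_def
  proof (rule Bochner_Integration.integrable_bound[OF _ m], intro AE_I2)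
    fix X show "norm (indicator (ball Z \<rho>) X *\<^sub>R F X) \<le> norm (indicator (ball Z \<rho>) X * \<bar>M\<bar>)"
      using n[of X] by (cases "X \<in> ball Z \<rho>") auto
  qed
  have "integrable lebesgue (\<lambda>X. (norm (indicator (ball Z \<rho>) X *\<^sub>R F X))\<^sup>2)"
  proof (rule Bochner_Integration.integrable_bound[OF integrable_mult_left[OF i]])
    show "(\<lambda>X. (norm (indicator (ball Z \<rho>) X *\<^sub>R F X))\<^sup>2) \<in> borel_measurable lebesgue"
      by (rule borel_measurable_power[OF measurable_compose[OF m borel_measurable_norm]])
    show "AE X in lebesgue. norm ((norm (indicator (ball Z \<rho>) X *\<^sub>R F X))\<^sup>2) \<le> norm (indicator (ball Z \<rho>) X * \<bar>M\<bar>\<^sup>2)"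
    proof (rule AE_I2)
      fix X show "norm ((norm (indicator (ball Z \<rho>) X *\<^sub>R F X))\<^sup>2) \<le> norm (indicator (ball Z \<rho>) X * \<bar>M\<bar>\<^sup>2)"
        using power_mono[OF n[of X] norm_ge_zero, of 2] by (cases "X \<in> ball Z \<rho>") auto
    qed
  qed
  moreover have "(\<lambda>X. (norm (indicator (ball Z \<rho>) X *\<^sub>R F X))\<^sup>2) = (\<lambda>X. indicator (ball Z \<rho>) X *\<^sub>R (norm (F X))\<^sup>2)"
    by (auto simp: indicator_def)
  ultimately show "square_integrable_on (ball Z \<rho>) F" using F by (simp add: square_integrable_on_def set_integrable_def)
qed

text \<open>A conjugate function \<open>Wt\<close>, with \<open>\<nabla> Wt = i \<gamma> \<nabla> U\<close>, turns the equation into the vanishing of a null Lagrangian.\<close>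

lemma conjugate_imp_conductivity_solution:
  assumes U: "lipschitz_grad (ball Z \<rho>) U H C" and Wt: "lipschitz_grad (ball Z \<rho>) Wt (\<lambda>X. conductivity k B X *\<^sub>R (\<i> * H X)) C'"
    and k: "0 < k" and B: "B \<in> sets lebesgue" and \<rho>: "0 < \<rho>"
    and M: "\<And>X. X \<in> ball Z \<rho> \<Longrightarrow> norm (H X) \<le> M" and f: "\<And>X. X \<in> sphere Z \<rho> \<Longrightarrow> U X = f X"
  shows "conductivity_solution (ball Z \<rho>) B k f U H"
proof -
  let ?S = "ball Z \<rho>"
  define D where "D X = conductivity k B X *\<^sub>R (\<i> * H X)" for X
  interpret U: lipschitz_grad ?S U H C by (rule U)
  interpret W: lipschitz_grad ?S Wt D C' using Wt unfolding D_def[abs_def] .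
  have M0: "0 \<le> M" using order_trans[OF norm_ge_zero M[of Z]] \<rho> by simp
  have D: "norm (D X) \<le> (1 + \<bar>k - 1\<bar>) * M" if "X \<in> ?S" for X
    unfolding D_def norm_scaleR norm_mult norm_ii mult_1
    by (intro mult_mono conductivity_bounds(3) k M that) auto
  note HI = bounded_measurable_imp_set_integrable[OF U.meas M] and DI = bounded_measurable_imp_set_integrable[OF W.meas D]
  have bm: "integrable lebesgue (\<lambda>X. (v \<bullet> (indicator ?S X *\<^sub>R F X)) * \<psi> X)"
    if F: "set_integrable lebesgue ?S F" and p: "continuous_on UNIV \<psi>" "\<And>X. \<bar>\<psi> X\<bar> \<le> b"
    for F :: "complex \<Rightarrow> complex" and v \<psi> b
  proof -
    have "integrable lebesgue (\<lambda>X. v \<bullet> (indicator ?S X *\<^sub>R F X))" using F unfolding set_integrable_def by (intro integrable_inner_right impI)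
    from integrable_bounded_mult[OF this continuous_borel_lebesgue[OF p(1)] p(2)]
    show ?thesis by (simp add: mult.commute)
  qed
  have "weak_gradient ?S U H" unfolding weak_gradient_def
  proof (intro allI impI)
    fix \<phi> \<phi>' assume t: "test_function ?S \<phi> \<phi>'"
    obtain K where K: "compact K" "K \<subseteq> ?S" "\<And>x. x \<notin> K \<Longrightarrow> \<phi> x = 0" "\<And>x. x \<notin> K \<Longrightarrow> \<phi>' x = 0"
      using test_functionD[OF t] by metis
    have c: "continuous_on UNIV \<phi>'" "continuous_on UNIV \<phi>" using t test_function_continuous[OF t] by (auto simp: test_function_def)
    have e1: "(\<lambda>X. indicator ?S X *\<^sub>R (U X *\<^sub>R \<phi>' X)) = (\<lambda>X. U X *\<^sub>R \<phi>' X)"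
    proof
      fix X show "indicator ?S X *\<^sub>R (U X *\<^sub>R \<phi>' X) = U X *\<^sub>R \<phi>' X"
        using K(2) K(4)[of X] by (cases "X \<in> K") (auto simp: indicator_def)
    qed
    have i1: "integrable lebesgue (\<lambda>X. U X *\<^sub>R \<phi>' X)"
      by (rule integrable_compact_support[OF _ K(1)]) (auto intro!: continuous_intros U.cont c K(4))
    obtain b where b: "\<And>X. \<bar>\<phi> X\<bar> \<le> b"
    proof -
      obtain b where b: "b > 0" "\<And>X. X \<in> K \<Longrightarrow> \<bar>\<phi> X\<bar> \<le> b"
        using compact_imp_bounded[OF compact_continuous_image[OF continuous_on_subset[OF c(2)] K(1)]] by (auto simp: bounded_pos)
      have "\<bar>\<phi> X\<bar> \<le> b" for X using b K(3)[of X] by (cases "X \<in> K") auto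
      then show thesis by (rule that)
    qed
    have i2: "integrable lebesgue (\<lambda>X. \<phi> X *\<^sub>R (indicator ?S X *\<^sub>R H X))"
      by (rule integrable_bounded_mult[OF _ continuous_borel_lebesgue[OF c(2)] b]) (use HI(1) in \<open>simp add: set_integrable_def\<close>)
    have e2: "(\<lambda>X. indicator ?S X *\<^sub>R (\<phi> X *\<^sub>R H X)) = (\<lambda>X. \<phi> X *\<^sub>R (indicator ?S X *\<^sub>R H X))" by (simp add: mult.commute)
    have "v \<bullet> (LINT X|lebesgue. U X *\<^sub>R \<phi>' X) = v \<bullet> (- (LINT X|lebesgue. \<phi> X *\<^sub>R (indicator ?S X *\<^sub>R H X)))" for v
    proof -
      have "v \<bullet> (LINT X|lebesgue. U X *\<^sub>R \<phi>' X) = (LINT X|lebesgue. v \<bullet> (U X *\<^sub>R \<phi>' X))"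
        using i1 by (simp only: integral_inner_right)
      also have "\<dots> = (LINT X|lebesgue. U X * (v \<bullet> \<phi>' X))" by simp
      also have "\<dots> = - (LINT X|lebesgue. indicator ?S X * (v \<bullet> H X) * \<phi> X)" by (rule U.integration_by_parts[OF t])
      also have "(LINT X|lebesgue. indicator ?S X * (v \<bullet> H X) * \<phi> X) = (LINT X|lebesgue. v \<bullet> (\<phi> X *\<^sub>R (indicator ?S X *\<^sub>R H X)))"
        by (simp add: mult.commute mult.left_commute)
      also have "\<dots> = v \<bullet> (LINT X|lebesgue. \<phi> X *\<^sub>R (indicator ?S X *\<^sub>R H X))"
        using i2 by (simp only: integral_inner_right)
      finally show ?thesis by simp
    qed
    from vector_eq_rdot[THEN iffD1, OF allI, of "LINT X|lebesgue. U X *\<^sub>R \<phi>' X"] this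
    show "(LINT X:?S|lebesgue. U X *\<^sub>R \<phi>' X) = - (LINT X:?S|lebesgue. \<phi> X *\<^sub>R H X)"
      unfolding set_lebesgue_integral_def e1 e2 by (metis inner_commute)
  qed
  moreover have "(LINT X:?S|lebesgue. conductivity k B X * (H X \<bullet> \<phi>' X)) = 0" if t: "test_function ?S \<phi> \<phi>'" for \<phi> \<phi>'
  proof -
    obtain b where b: "\<And>X. norm (\<phi>' X) \<le> b" using test_function_lipschitz[OF t] by metis
    have c: "continuous_on UNIV (\<lambda>X. v \<bullet> \<phi>' X)" for v using t by (auto simp: test_function_def intro!: continuous_intros)
    have b': "\<bar>1 \<bullet> \<phi>' X\<bar> \<le> b" "\<bar>\<i> \<bullet> \<phi>' X\<bar> \<le> b" for X
      using order_trans[OF abs_Re_le_cmod b[of X]] order_trans[OF abs_Im_le_cmod b[of X]] by (auto simp: inner_complex_def)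
    \<comment> \<open>As \<open>D\<close> is the flux turned by a right angle, the flux paired with
      \<open>\<phi>' X\<close> is a determinant of \<open>D X\<close> and \<open>\<phi>' X\<close>,
      the null Lagrangian for the directions 1 and \<open>\<i>\<close>.\<close>
    have e: "indicator ?S X *\<^sub>R (conductivity k B X * (H X \<bullet> \<phi>' X)) =
        (\<i> \<bullet> (indicator ?S X *\<^sub>R D X)) * (1 \<bullet> \<phi>' X) - (1 \<bullet> (indicator ?S X *\<^sub>R D X)) * (\<i> \<bullet> \<phi>' X)" for X
      by (simp add: D_def inner_complex_def algebra_simps)
    have "(LINT X:?S|lebesgue. conductivity k B X * (H X \<bullet> \<phi>' X)) =
        (LINT X|lebesgue. (\<i> \<bullet> (indicator ?S X *\<^sub>R D X)) * (1 \<bullet> \<phi>' X)) - (LINT X|lebesgue. (1 \<bullet> (indicator ?S X *\<^sub>R D X)) * (\<i> \<bullet> \<phi>' X))"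
      unfolding set_lebesgue_integral_def e
      by (rule Bochner_Integration.integral_diff[OF bm[OF DI(1) c b'(1)] bm[OF DI(1) c b'(2)]])
    also have "\<dots> = 0" using W.null_lagrangian[OF t, of 1 \<i>] by simp
    finally show ?thesis .
  qed
  ultimately show ?thesis unfolding conductivity_solution_def
    using HI(2) f \<rho> continuous_on_subset[OF U.cont subset_UNIV] by (auto simp: frontier_ball)
qed


section \<open>The explicit solution and its conjugate function\<close>

context two_disks begin

lemma V_lipschitz: "X \<in> cball Z \<rho> \<Longrightarrow> Y \<in> cball Z \<rho> \<Longrightarrow> norm (V X - V Y) \<le> W_bound * dist X Y"
proof -
  have "norm (V X - V Y) \<le> W_bound * norm (X - Y)" if X: "X \<in> ball Z \<rho>" and Y: "Y \<in> ball Z \<rho>" for X Y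
  proof (rule field_differentiable_bound[OF convex_ball _ _ X Y])
    fix z assume z: "z \<in> ball Z \<rho>"
    show "(V has_field_derivative W z) (at z within ball Z \<rho>)" by (rule has_field_derivative_at_within[OF V_has_derivative[OF z]])
    show "norm (W z) \<le> W_bound" by (rule norm_W) (use z in simp)
  qed
  then have "W_bound-lipschitz_on (ball Z \<rho>) V" by (intro lipschitz_onI W_bound_nonneg) (simp add: dist_norm)
  moreover have cl: "closure (ball Z \<rho>) = cball Z \<rho>" using \<rho> by simp
  ultimately have l: "W_bound-lipschitz_on (cball Z \<rho>) V"
    using lipschitz_on_closure[of W_bound "ball Z \<rho>" V] continuous_V by simp
  show "X \<in> cball Z \<rho> \<Longrightarrow> Y \<in> cball Z \<rho> \<Longrightarrow> norm (V X - V Y) \<le> W_bound * dist X Y"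
    using lipschitz_onD[OF l] by (simp add: dist_norm)
qed

text \<open>Conjugating the reflected term leaves its real part unchanged and makes the sum
  holomorphic outside the inner disk, so the imaginary part is a conjugate function.\<close>

definition E where "E X = V X - of_real \<sigma> * cnj (V (inversion c r X))"
definition E' where "E' X = W X + of_real \<sigma> * (cnj (W (inversion c r X)) * of_real (r\<^sup>2) / (X - c)\<^sup>2)"

lemma E_has_derivative:
  assumes X: "X \<in> ball Z \<rho>" "inversion c r X \<in> ball Z \<rho>" "X \<noteq> c"
  shows "(E has_field_derivative E' X) (at X)"
proof -
  have "(E has_field_derivative W X - of_real \<sigma> * - (cnj (W (inversion c r X)) * of_real (r\<^sup>2) / (X - c)\<^sup>2)) (at X)"
    unfolding E_def[abs_def]
    by (rule DERIV_diff[OF V_has_derivative[OF X(1)] DERIV_cmult[OF inversion_has_derivative_cnj[OF V_has_derivative[OF X(2)] X(3)]]])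
  then show ?thesis by (simp add: E'_def)
qed

lemma inversion_in: "X \<notin> ball c r \<Longrightarrow> inversion c r X \<in> cball c r"
  using disk_fold_in[OF r, of c X] by (simp add: disk_fold_def)

text \<open>Inside the inner disk the fold is the identity and the pair is
  \<open>(1 - \<sigma>) * Re (V X)\<close> and \<open>(1 + \<sigma>) * Im (V X)\<close>. The
  identity \<open>k * (1 - \<sigma>) = 1 + \<sigma>\<close> is the transmission condition, and
  continuity across the circle is that of the fold.\<close>

definition U where "U X = Re (V X) - \<sigma> * Re (V (disk_fold c r X))"
definition Wt where "Wt X = Im (V X) + \<sigma> * Im (V (disk_fold c r X))"
definition grad_U where "grad_U X = (if X \<in> ball c r then (1 - \<sigma>) *\<^sub>R cnj (W X) else cnj (E' X))"

lemma U_outside: "X \<notin> ball c r \<Longrightarrow> U X = Re (E X)" and Wt_outside: "X \<notin> ball c r \<Longrightarrow> Wt X = Im (E X)"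
  by (simp_all add: U_def Wt_def E_def disk_fold_def)

lemma GDERIV_outside:
  assumes X: "X \<in> ball Z \<rho> - cball c r"
  shows "GDERIV U X :> grad_U X" "GDERIV Wt X :> conductivity k (ball c r) X *\<^sub>R (\<i> * grad_U X)"
proof -
  have o: "open (ball Z \<rho> - cball c r)" by (intro open_Diff) auto
  have nb: "Y \<notin> ball c r" if "Y \<in> ball Z \<rho> - cball c r" for Y using that by auto
  have E: "(E has_field_derivative E' X) (at X)"
  proof (rule E_has_derivative)
    show "X \<in> ball Z \<rho>" "X \<noteq> c" using X r by auto
    show "inversion c r X \<in> ball Z \<rho>" using inversion_in[OF nb[OF X]] cball_sub by blast
  qed
  have g: "grad_U X = cnj (E' X)" using nb[OF X] by (simp add: grad_U_def)
  have k1: "conductivity k (ball c r) X *\<^sub>R (\<i> * grad_U X) = \<i> * cnj (E' X)" using nb[OF X] by (simp add: conductivity_def g)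
  show "GDERIV U X :> grad_U X" unfolding g
    by (rule GDERIV_transform_open[OF GDERIV_Re[OF E] o X]) (simp only: U_outside[OF nb])
  show "GDERIV Wt X :> conductivity k (ball c r) X *\<^sub>R (\<i> * grad_U X)" unfolding k1
    by (rule GDERIV_transform_open[OF GDERIV_Im[OF E] o X]) (simp only: Wt_outside[OF nb])
qed

lemma GDERIV_inside:
  assumes X: "X \<in> ball c r"
  shows "GDERIV U X :> grad_U X" "GDERIV Wt X :> conductivity k (ball c r) X *\<^sub>R (\<i> * grad_U X)"
proof -
  have "X \<in> ball Z \<rho>" using X ball_sub by blast
  from V_has_derivative[OF this]
  have 1: "((\<lambda>X. of_real (1 - \<sigma>) * V X) has_field_derivative of_real (1 - \<sigma>) * W X) (at X)"
    and 2: "((\<lambda>X. of_real (1 + \<sigma>) * V X) has_field_derivative of_real (1 + \<sigma>) * W X) (at X)"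
    by (rule DERIV_cmult)+
  have g: "grad_U X = cnj (of_real (1 - \<sigma>) * W X)" using X by (simp add: grad_U_def scaleR_conv_of_real)
  have k2: "conductivity k (ball c r) X *\<^sub>R (\<i> * grad_U X) = \<i> * cnj (of_real (1 + \<sigma>) * W X)"
  proof -
    have "conductivity k (ball c r) X *\<^sub>R (\<i> * grad_U X) = of_real (k * (1 - \<sigma>)) * (\<i> * cnj (W X))"
      using X by (simp add: conductivity_def grad_U_def scaleR_conv_of_real)
    then show ?thesis unfolding \<sigma>(2) by simp
  qed
  show "GDERIV U X :> grad_U X" unfolding g
    by (rule GDERIV_transform_open[OF GDERIV_Re[OF 1] open_ball X]) (simp add: U_def disk_fold_def algebra_simps)
  show "GDERIV Wt X :> conductivity k (ball c r) X *\<^sub>R (\<i> * grad_U X)" unfolding k2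
    by (rule GDERIV_transform_open[OF GDERIV_Im[OF 2] open_ball X]) (simp add: Wt_def disk_fold_def algebra_simps)
qed

lemma norm_grad_U: assumes X: "X \<in> cball Z \<rho>" shows "norm (grad_U X) \<le> 2 * W_bound"
proof (cases "X \<in> ball c r")
  case True
  have "\<bar>1 - \<sigma>\<bar> * norm (W X) \<le> 2 * W_bound" using \<sigma> by (intro mult_mono norm_W X) auto
  then show ?thesis using True by (simp add: grad_U_def)
next
  case False
  have "inversion c r X \<in> cball Z \<rho>" using inversion_in[OF False] ball_sub by blast
  note w = norm_W[OF this]
  have n: "r \<le> norm (X - c)" using False by (simp add: dist_norm norm_minus_commute)
  have s: "r\<^sup>2 / (norm (X - c))\<^sup>2 \<le> 1" using n r by (simp add: divide_le_eq power_mono)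
  have "norm (of_real \<sigma> * (cnj (W (inversion c r X)) * of_real (r\<^sup>2) / (X - c)\<^sup>2)) = \<bar>\<sigma>\<bar> * (norm (W (inversion c r X)) * (r\<^sup>2 / (norm (X - c))\<^sup>2))"
    by (simp add: norm_mult norm_divide norm_power)
  also have "\<dots> \<le> 1 * (W_bound * 1)" using \<sigma> w s W_bound_nonneg by (intro mult_mono) auto
  finally have "norm (E' X) \<le> W_bound + W_bound" unfolding E'_def using norm_W[OF X] by (intro norm_triangle_le add_mono) auto
  then show ?thesis using False by (simp add: grad_U_def)
qed

lemma measurable_grad_U: "grad_U \<in> borel_measurable (lebesgue_on (ball Z \<rho>))"
proof -
  have c1: "continuous_on (ball Z \<rho>) (\<lambda>X. cnj (W X))"
    by (intro continuous_on_cnj continuous_on_subset[OF continuous_W ball_subset_cball])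
  \<comment> \<open>The fold agrees with the inversion outside the inner disk and keeps the second
    branch well behaved on the whole of \<Omega>.\<close>
  have cf: "continuous_on UNIV (disk_fold c r)"
    using disk_fold_contract[OF r] by (intro lipschitz_on_continuous_on[of 1] lipschitz_onI) auto
  have c2: "continuous_on (ball Z \<rho>) (\<lambda>X. W (disk_fold c r X))"
    by (rule continuous_on_compose2[OF continuous_W continuous_on_subset[OF cf]]) (use disk_fold_in[OF r] ball_sub in blast)+
  have m: "(\<lambda>X. cnj (W X)) \<in> borel_measurable (lebesgue_on (ball Z \<rho>))" "(\<lambda>X. W (disk_fold c r X)) \<in> borel_measurable (lebesgue_on (ball Z \<rho>))"
    "(\<lambda>X. (cnj (X - c))\<^sup>2) \<in> borel_measurable (lebesgue_on (ball Z \<rho>))"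
    by (rule continuous_imp_measurable_on_sets_lebesgue[OF c1], simp) (rule continuous_imp_measurable_on_sets_lebesgue[OF c2], simp,
      rule continuous_imp_measurable_on_sets_lebesgue, intro continuous_intros, simp)
  have "(\<lambda>X. if X \<in> ball c r then (1 - \<sigma>) *\<^sub>R cnj (W X) else cnj (W X) + of_real \<sigma> * (W (disk_fold c r X) * of_real (r\<^sup>2) / (cnj (X - c))\<^sup>2))
      \<in> borel_measurable (lebesgue_on (ball Z \<rho>))"
  proof (rule measurable_If_set)
    show "ball c r \<inter> space (lebesgue_on (ball Z \<rho>)) \<in> sets (lebesgue_on (ball Z \<rho>))"
      by (subst sets_restrict_space_iff) auto
    show "(\<lambda>X. (1 - \<sigma>) *\<^sub>R cnj (W X)) \<in> borel_measurable (lebesgue_on (ball Z \<rho>))"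
      by (intro borel_measurable_scaleR borel_measurable_const m)
    show "(\<lambda>X. cnj (W X) + of_real \<sigma> * (W (disk_fold c r X) * of_real (r\<^sup>2) / (cnj (X - c))\<^sup>2)) \<in> borel_measurable (lebesgue_on (ball Z \<rho>))"
      by (intro borel_measurable_add borel_measurable_times borel_measurable_divide borel_measurable_const m)
  qed
  moreover have "grad_U = (\<lambda>X. if X \<in> ball c r then (1 - \<sigma>) *\<^sub>R cnj (W X) else cnj (W X) + of_real \<sigma> * (W (disk_fold c r X) * of_real (r\<^sup>2) / (cnj (X - c))\<^sup>2))"
    by (auto simp: fun_eq_iff grad_U_def E'_def disk_fold_def)
  ultimately show ?thesis by simp
qed

text \<open>The nearest-point projection turns functions on the closed disk into Lipschitz functions
  on the plane, as \<open>lipschitz_grad\<close> demands, without changing them on the disk.\<close>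

abbreviation (input) p where "p X \<equiv> closest_point (cball Z \<rho>) X"

lemma p: "p X \<in> cball Z \<rho>" "X \<in> cball Z \<rho> \<Longrightarrow> p X = X" "dist (p X) (p Y) \<le> dist X Y"
proof -
  have ne: "cball Z \<rho> \<noteq> {}" using \<rho> by simp
  show "p X \<in> cball Z \<rho>" by (rule closest_point_in_set[OF closed_cball ne])
  show "X \<in> cball Z \<rho> \<Longrightarrow> p X = X" by (rule closest_point_self)
  show "dist (p X) (p Y) \<le> dist X Y" by (rule closest_point_lipschitz[OF convex_cball closed_cball ne])
qed

text \<open>Projection and fold do not increase distances, so only the Lipschitz constant of
  \<open>V\<close> and \<open>\<bar>\<sigma>\<bar> < 1\<close> matter.\<close>

lemma extension_lipschitz:
  "\<bar>U (p X) - U (p Y)\<bar> \<le> 2 * W_bound * norm (X - Y)" "\<bar>Wt (p X) - Wt (p Y)\<bar> \<le> 2 * W_bound * norm (X - Y)"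
proof -
  have a: "norm (V (p X) - V (p Y)) \<le> W_bound * dist X Y"
    by (rule order_trans[OF V_lipschitz[OF p(1) p(1)]]) (intro mult_left_mono p W_bound_nonneg)
  have "norm (V (disk_fold c r (p X)) - V (disk_fold c r (p Y))) \<le> W_bound * dist (disk_fold c r (p X)) (disk_fold c r (p Y))"
    using disk_fold_in[OF r] ball_sub by (intro V_lipschitz) blast+
  also have "\<dots> \<le> W_bound * dist X Y"
    by (intro mult_left_mono W_bound_nonneg order_trans[OF disk_fold_contract[OF r] p(3)])
  finally have b: "norm (V (disk_fold c r (p X)) - V (disk_fold c r (p Y))) \<le> W_bound * dist X Y" .
  have c: "\<bar>\<sigma>\<bar> * \<bar>t\<bar> \<le> W_bound * dist X Y" if "\<bar>t\<bar> \<le> W_bound * dist X Y" for t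
    using mult_mono[of "\<bar>\<sigma>\<bar>" 1 "\<bar>t\<bar>" "W_bound * dist X Y"] \<sigma> that by simp
  note re = order_trans[OF abs_Re_le_cmod a] c[OF order_trans[OF abs_Re_le_cmod b]]
  note im = order_trans[OF abs_Im_le_cmod a] c[OF order_trans[OF abs_Im_le_cmod b]]
  have "U (p X) - U (p Y) = Re (V (p X) - V (p Y)) - \<sigma> * Re (V (disk_fold c r (p X)) - V (disk_fold c r (p Y)))"
    by (simp add: U_def algebra_simps)
  also have "\<bar>\<dots>\<bar> \<le> W_bound * dist X Y + W_bound * dist X Y"
    using re unfolding abs_mult[symmetric] by (rule order_trans[OF abs_triangle_ineq4 add_mono])
  finally show "\<bar>U (p X) - U (p Y)\<bar> \<le> 2 * W_bound * norm (X - Y)" by (simp add: dist_norm mult_ac)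
  have "Wt (p X) - Wt (p Y) = Im (V (p X) - V (p Y)) + \<sigma> * Im (V (disk_fold c r (p X)) - V (disk_fold c r (p Y)))"
    by (simp add: Wt_def algebra_simps)
  also have "\<bar>\<dots>\<bar> \<le> W_bound * dist X Y + W_bound * dist X Y"
    using im unfolding abs_mult[symmetric] by (rule order_trans[OF abs_triangle_ineq add_mono])
  finally show "\<bar>Wt (p X) - Wt (p Y)\<bar> \<le> 2 * W_bound * norm (X - Y)" by (simp add: dist_norm mult_ac)
qed

lemma AE_off_sphere: "AE X in lebesgue. X \<notin> sphere c r"
  by (rule AE_not_in) (use negligible_sphere[of c r] in \<open>simp add: negligible_iff_null_sets\<close>)

lemma lipschitz_grad_U: "lipschitz_grad (ball Z \<rho>) (\<lambda>X. U (p X)) grad_U (2 * W_bound)"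
  and lipschitz_grad_Wt: "lipschitz_grad (ball Z \<rho>) (\<lambda>X. Wt (p X)) (\<lambda>X. conductivity k (ball c r) X *\<^sub>R (\<i> * grad_U X)) (2 * W_bound)"
proof -
  have g: "GDERIV (\<lambda>X. U (p X)) X :> grad_U X" "GDERIV (\<lambda>X. Wt (p X)) X :> conductivity k (ball c r) X *\<^sub>R (\<i> * grad_U X)"
    if X: "X \<in> ball Z \<rho>" "X \<notin> sphere c r" for X
  proof -
    have e: "Y = p Y" if "Y \<in> ball Z \<rho>" for Y using p(2)[of Y] that by simp
    have "X \<in> ball c r \<or> X \<in> ball Z \<rho> - cball c r" using X by auto
    then have d: "GDERIV U X :> grad_U X" "GDERIV Wt X :> conductivity k (ball c r) X *\<^sub>R (\<i> * grad_U X)"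
      using GDERIV_inside GDERIV_outside by blast+
    show "GDERIV (\<lambda>X. U (p X)) X :> grad_U X"
      by (rule GDERIV_transform_open[OF d(1) open_ball X(1)]) (rule arg_cong[OF e])
    show "GDERIV (\<lambda>X. Wt (p X)) X :> conductivity k (ball c r) X *\<^sub>R (\<i> * grad_U X)"
      by (rule GDERIV_transform_open[OF d(2) open_ball X(1)]) (rule arg_cong[OF e])
  qed
  have cm: "conductivity k (ball c r) \<in> borel_measurable (lebesgue_on (ball Z \<rho>))"
    by (rule measurable_restrict_space1[OF conductivity_measurable]) simp
  have m: "(\<lambda>X. conductivity k (ball c r) X *\<^sub>R (\<i> * grad_U X)) \<in> borel_measurable (lebesgue_on (ball Z \<rho>))"
    by (intro borel_measurable_scaleR cm borel_measurable_times borel_measurable_const measurable_grad_U)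
  show "lipschitz_grad (ball Z \<rho>) (\<lambda>X. U (p X)) grad_U (2 * W_bound)"
  proof
    show "AE X in lebesgue. X \<in> ball Z \<rho> \<longrightarrow> GDERIV (\<lambda>X. U (p X)) X :> grad_U X"
      by (rule AE_mp[OF AE_off_sphere]) (intro AE_I2 impI g)
  qed (rule extension_lipschitz measurable_grad_U, simp?)+
  show "lipschitz_grad (ball Z \<rho>) (\<lambda>X. Wt (p X)) (\<lambda>X. conductivity k (ball c r) X *\<^sub>R (\<i> * grad_U X)) (2 * W_bound)"
  proof
    show "AE X in lebesgue. X \<in> ball Z \<rho> \<longrightarrow> GDERIV (\<lambda>X. Wt (p X)) X :> conductivity k (ball c r) X *\<^sub>R (\<i> * grad_U X)"
      by (rule AE_mp[OF AE_off_sphere]) (intro AE_I2 impI g)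
  qed (rule extension_lipschitz m, simp?)+
qed

text \<open>On the outer circle the reflected point is \<open>double_refl X\<close>, so
  \<open>V_rec\<close> cancels the reflected term.\<close>

lemma U_boundary: assumes X: "X \<in> sphere Z \<rho>" shows "U X = f X"
proof -
  have Xc: "X \<in> cball Z \<rho>" using X by simp
  have nb: "X \<notin> ball c r" using X ball_sub(1) by (auto simp: subset_iff)
  have "U X = Re (V X) - \<sigma> * Re (V (double_refl X))" using nb double_refl_inversion[OF X] by (simp add: U_def disk_fold_def)
  also have "\<dots> = Re (hol_ext X)" by (simp add: V_rec[OF Xc])
  finally show ?thesis by (simp add: Re_hol_ext[OF X])
qed

theorem solution: "conductivity_solution (ball Z \<rho>) (ball c r) k f (\<lambda>X. U (p X)) grad_U"
proof (rule conjugate_imp_conductivity_solution[OF lipschitz_grad_U lipschitz_grad_Wt k _ \<rho>])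
  show "norm (grad_U X) \<le> 2 * W_bound" if "X \<in> ball Z \<rho>" for X using that by (intro norm_grad_U) simp
  show "U (p X) = f X" if "X \<in> sphere Z \<rho>" for X using that p(2)[of X] U_boundary[OF that] by simp
qed simp

end

section \<open>Gradient bounds at the closest points\<close>

lemma grad_eq: "GDERIV g X :> D \<Longrightarrow> grad g X = D"
proof -
  assume D: "GDERIV g X :> D"
  show ?thesis unfolding grad_def
  proof (rule the_equality[where P = "\<lambda>D. GDERIV g X :> D", OF D])
    fix D' assume "GDERIV g X :> D'"
    from has_derivative_unique[OF this[unfolded gderiv_def] D[unfolded gderiv_def]]
    have "h \<bullet> D' = h \<bullet> D" for h by (rule fun_cong)
    then have "\<forall>h. h \<bullet> D' = h \<bullet> D" ..
    then show "D' = D" unfolding vector_eq_ldot .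
  qed
qed

lemma Re_of_real_mult: "Re (of_real t * w) = t * Re w" "Re (of_real t * cnj w) = t * Re w" by simp_all

lemma square_cancel:
  fixes n s w :: complex
  assumes "n \<noteq> 0" "s \<noteq> 0"
  shows "n * (w / (n * s)\<^sup>2 / 2) = w * inverse n / s\<^sup>2 / 2"
proof -
  have "n * (w / (n * s)\<^sup>2 / 2) = (n * inverse n) * (w * inverse n / s\<^sup>2 / 2)"
    by (simp only: power2_eq_square divide_inverse inverse_mult_distrib mult_ac)
  then show ?thesis using assms(1) by simp
qed

lemma unimodular_cancel:
  fixes n K :: complex
  assumes "cnj n = inverse n" "n \<noteq> 0" "s \<noteq> 0"
  shows "n * ((0 - - (cnj K * of_real t / (n * of_real s)\<^sup>2)) / 2) = of_real (t / s\<^sup>2 / 2) * cnj (n * K)"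
proof -
  have s: "complex_of_real s \<noteq> 0" using assms(3) by simp
  have e: "of_real (t / s\<^sup>2 / 2) = (of_real t / (of_real s)\<^sup>2 / 2 :: complex)" by simp
  have "n * ((cnj K * of_real t / (n * of_real s)\<^sup>2) / 2) = cnj K * of_real t * inverse n / (of_real s)\<^sup>2 / 2"
    by (rule square_cancel[OF assms(2) s])
  also have "\<dots> = of_real t / (of_real s)\<^sup>2 / 2 * (inverse n * cnj K)" by (simp only: divide_inverse mult_ac)
  finally show ?thesis unfolding e complex_cnj_mult assms(1) diff_minus_eq_add add_0 .
qed
lemma reflect_eq_inversion: "reflect Z s X = inversion Z s X"
proof (cases "X = Z")
  case False
  define w where "w = X - Z"
  have w: "w \<noteq> 0" using False by (simp add: w_def)
  have "of_real ((norm w)\<^sup>2) = w * cnj w" using complex_norm_square[of w] by simp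
  then have "of_real (s\<^sup>2 / (norm w)\<^sup>2) * w = of_real (s\<^sup>2) / cnj w"
    using w by (simp only: of_real_divide) simp
  then show ?thesis unfolding reflect_def inversion_def w_def[symmetric] by (simp add: scaleR_conv_of_real)
qed (simp add: reflect_def inversion_def)

text \<open>By the intermediate value theorem a sign change would produce a zero. The right end is
  left out of the assumption and recovered by continuity: at \<open>X2\<close> the potential has no
  pointwise derivative to read off.\<close>

lemma constant_sign:
  fixes h :: "real \<Rightarrow> real"
  assumes h: "continuous_on {s..t} h" and st: "s < t" and J: "0 < J" "\<And>x. s \<le> x \<Longrightarrow> x < t \<Longrightarrow> J \<le> \<bar>h x\<bar>"
  obtains e where "\<bar>e\<bar> = 1" "\<forall>x\<in>{s..t}. J \<le> e * h x"
proof -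
  have cl: "closure {s..<t} = {s..t}" using st by simp
  have "connected (h ` {s..<t})"
    by (rule connected_continuous_image[OF continuous_on_subset[OF h]]) auto
  note con = this
  have z: "\<not> (x \<in> {s..<t} \<and> y \<in> {s..<t} \<and> h x \<le> 0 \<and> 0 \<le> h y)" for x y
  proof
    assume a: "x \<in> {s..<t} \<and> y \<in> {s..<t} \<and> h x \<le> 0 \<and> 0 \<le> h y"
    then have "{h x..h y} \<subseteq> h ` {s..<t}" using con by (intro connected_contains_Icc) auto
    then have "0 \<in> h ` {s..<t}" using a by (auto simp: subset_iff)
    then obtain v where "v \<in> {s..<t}" "h v = 0" by (auto simp: image_iff)
    then show False using J(1) J(2)[of v] by simp
  qed
  have "(\<forall>x\<in>{s..<t}. J \<le> h x) \<or> (\<forall>x\<in>{s..<t}. J \<le> - h x)"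
  proof (cases "0 \<le> h s")
    case True
    have "J \<le> h x" if "x \<in> {s..<t}" for x using z[of x s] J(2)[of x] that st True by auto
    then show ?thesis by blast
  next
    case False
    have "J \<le> - h x" if "x \<in> {s..<t}" for x using z[of s x] J(2)[of x] that st False by auto
    then show ?thesis by blast
  qed
  then obtain e where e: "\<bar>e\<bar> = 1" "\<And>x. x \<in> {s..<t} \<Longrightarrow> J \<le> e * h x"
  proof (elim disjE)
    assume "\<forall>x\<in>{s..<t}. J \<le> h x" then show thesis using that[of 1] by auto
  next
    assume "\<forall>x\<in>{s..<t}. J \<le> - h x" then show thesis using that[of "-1"] by auto
  qed
  have c: "continuous_on (closure {s..<t}) (\<lambda>x. e * h x)" unfolding cl by (intro continuous_intros h)
  have "J \<le> e * h x" if "x \<in> {s..t}" for x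
    by (rule continuous_ge_on_closure[OF c _ e(2)]) (use that in \<open>simp add: cl\<close>)
  then show thesis using e(1) by (intro that ballI)
qed

section \<open>Signs and lower bounds along the axis\<close>

context two_disks begin

definition axis_point :: "real \<Rightarrow> complex" where "axis_point s = Z + n * of_real s"

lemma axis_coord_axis_point: "axis_coord (axis_point s) = of_real s" unfolding axis_point_def by (rule axis_coord_shift)

lemma dist_axis_point: "dist Z (axis_point s) = \<bar>s\<bar>" unfolding axis_point_def dist_iter_refl by simp

lemma axis_point_diff: "axis_point s - axis_point t = n * of_real (s - t)" by (simp add: axis_point_def algebra_simps)

lemma c_axis_point: "c = axis_point L" unfolding axis_point_def by (rule n(4))

lemma axis_point_Z: "axis_point 0 = Z" by (simp add: axis_point_def)

lemma inverse_n: "of_real t / cnj (n * of_real s) = n * of_real (t / s)"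
proof -
  have ni: "cnj n = inverse n" using n(2) inverse_unique[of n "cnj n"] by simp
  then show ?thesis by (simp add: divide_inverse)
qed

lemma inversion_axis_point: "inversion (axis_point s) t (axis_point u) = axis_point (s + t\<^sup>2 / (u - s))"
proof -
  have "of_real (t\<^sup>2) / cnj (n * of_real (u - s)) = n * of_real (t\<^sup>2 / (u - s))" by (rule inverse_n)
  then have "inversion (axis_point s) t (axis_point u) = axis_point s + n * of_real (t\<^sup>2 / (u - s))" unfolding inversion_def axis_point_diff by (rule arg_cong)
  also have "\<dots> = axis_point (s + t\<^sup>2 / (u - s))" unfolding axis_point_def of_real_add distrib_left by (rule add.assoc)
  finally show ?thesis .
qed
lemma segment_axis_point: "s \<in> closed_segment s1 s2 \<Longrightarrow> axis_point s \<in> closed_segment (axis_point s1) (axis_point s2)"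
proof -
  assume "s \<in> closed_segment s1 s2"
  then obtain u where u: "0 \<le> u" "u \<le> 1" "s = (1 - u) *\<^sub>R s1 + u *\<^sub>R s2" by (auto simp: in_segment)
  have "axis_point s = (1 - u) *\<^sub>R axis_point s1 + u *\<^sub>R axis_point s2" unfolding u(3) axis_point_def by (simp add: scaleR_conv_of_real algebra_simps)
  then show ?thesis using u by (auto simp: in_segment)
qed

text \<open>The gradient of the real part of \<open>hol_ext\<close> is the conjugate of
  \<open>hol_ext'\<close>, so this is its component along \<open>n\<close>.\<close>

definition normal_comp :: "real \<Rightarrow> real" where "normal_comp s = Re (n * hol_ext' (axis_point s))"

lemma continuous_normal_comp: "continuous_on {0..\<rho>} normal_comp"
proof -
  have c: "continuous_on {0..\<rho>} (\<lambda>s. hol_ext' (axis_point s))"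
    by (rule continuous_on_compose2[OF continuous_hol_ext(2)])
       (auto simp: axis_point_def[abs_def] dist_iter_refl intro!: continuous_intros)
  show ?thesis unfolding normal_comp_def[abs_def] by (intro continuous_intros c)
qed

text \<open>The iterates stay between \<open>a\<close> and \<open>y\<close>, where
  \<open>e * normal_comp\<close> is at least \<open>J\<close>, and the derivatives are real and at
  least \<open>q^(2*m)\<close>. With \<sigma> nonnegative, which is where \<open>k > 1\<close>
  enters, the series dominates a geometric one term by term.\<close>

lemma Re_W_lower:
  assumes \<sigma>0: "0 \<le> \<sigma>" and y: "ecc.a \<le> y" "y \<le> \<rho>" and J: "0 \<le> J"
    and h: "\<And>s. ecc.a \<le> s \<Longrightarrow> s \<le> y \<Longrightarrow> J \<le> e * normal_comp s"
  shows "J / (1 - \<sigma> * ecc.q\<^sup>2) \<le> e * Re (n * W (axis_point y))"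
proof -
  have yc: "axis_point y \<in> cball Z \<rho>" using y ecc.a_pos by (simp add: dist_axis_point)
  define t where "t m = of_real (\<sigma>^m) * (hol_ext' (iter_refl m (axis_point y)) * iter_refl_deriv m (axis_point y))" for m
  have "summable t" unfolding t_def[abs_def] by (rule summable_comparison_test'[OF summable_W_bound term_bound_W[OF yc]])
  then have "t sums W (axis_point y)" unfolding W_def t_def[symmetric] by (rule summable_sums)
  then have s: "(\<lambda>m. e * Re (n * t m)) sums (e * Re (n * W (axis_point y)))"
    by (intro sums_mult sums_Re)
  have g: "(\<lambda>m. J * (\<sigma> * ecc.q\<^sup>2)^m) sums (J * (1 / (1 - \<sigma> * ecc.q\<^sup>2)))"
    using \<sigma>q \<sigma>0 by (intro sums_mult geometric_sums) simp
  have "J * (\<sigma> * ecc.q\<^sup>2)^m \<le> e * Re (n * t m)" for m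
  proof -
    obtain y' where y': "ecc.a \<le> y'" "y' \<le> y" "ecc.mob m (of_real y) = of_real y'" using ecc.mob_axis[OF y] .
    obtain d where d: "ecc.q^(2*m) \<le> d" "ecc.mob' m (of_real y) = of_real d" using ecc.mob'_axis[OF y] .
    have "iter_refl m (axis_point y) = axis_point y'" unfolding iter_refl_def axis_coord_axis_point y'(3) by (simp add: axis_point_def)
    moreover have "iter_refl_deriv m (axis_point y) = of_real d" by (simp only: iter_refl_deriv_def axis_coord_axis_point d(2))
    ultimately have "n * t m = of_real (\<sigma>^m * d) * (n * hol_ext' (axis_point y'))" unfolding t_def by simp
    then have "Re (n * t m) = \<sigma>^m * d * normal_comp y'" unfolding normal_comp_def by (simp only: Re_of_real_mult)
    then have "e * Re (n * t m) = (\<sigma>^m * d) * (e * normal_comp y')" by simp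
    moreover have "\<sigma>^m * ecc.q^(2*m) * J \<le> (\<sigma>^m * d) * (e * normal_comp y')"
      using \<sigma>0 d(1) h[OF y'(1,2)] J ecc.qm(1)[of m] by (intro mult_mono mult_left_mono) auto
    moreover have "J * (\<sigma> * ecc.q\<^sup>2)^m = \<sigma>^m * ecc.q^(2*m) * J" unfolding power_mult_distrib power_mult by (simp only: mult_ac)
    ultimately show ?thesis by (simp only:)
  qed
  from sums_le[OF this g s] show ?thesis by simp
qed

text \<open>The minus sign of the reflected term and the one from differentiating the inversion
  cancel, so both contributions add with nonnegative factors when \<sigma> is nonnegative.\<close>

lemma n_E'_inner:
  assumes "X = axis_point s" "inversion c r X = axis_point t" "s \<noteq> L"
  shows "Re (n * E' X) = Re (n * W (axis_point s)) + \<sigma> * (r\<^sup>2 / (s - L)\<^sup>2) * Re (n * W (axis_point t))"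
proof -
  have ni: "cnj n = inverse n" using n(2) by (metis inverse_unique)
  have nz: "n \<noteq> 0" using n(1) by auto
  have Xc: "X - c = n * of_real (s - L)" unfolding assms(1) by (subst c_axis_point) (rule axis_point_diff)
  have "n * (cnj (W (axis_point t)) * of_real (r\<^sup>2) / (n * of_real (s - L))\<^sup>2) = of_real (r\<^sup>2 / (s - L)\<^sup>2) * cnj (n * W (axis_point t))"
    unfolding complex_cnj_mult ni using nz by (simp add: power2_eq_square divide_inverse)
  then have "n * E' X = n * W (axis_point s) + of_real (\<sigma> * (r\<^sup>2 / (s - L)\<^sup>2)) * cnj (n * W (axis_point t))"
    unfolding E'_def assms(2) Xc unfolding assms(1) distrib_left mult.left_commute[of n "of_real \<sigma>"] by simp
  then show ?thesis by simp
qed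

text \<open>The image of the boundary point \<rho> under \<open>T\<close> lies strictly inside the
  inner circle and not below \<open>a\<close>.\<close>

lemma L_bounds: "ecc.a < L + r" "L + r < \<rho>"
proof -
  have "norm (of_real ecc.a :: complex) \<le> \<rho>" using ecc.a_less ecc.a_pos by simp
  have "ecc.T (of_real \<rho>) = of_real (L + r\<^sup>2 / (\<rho> - L))"
    using ecc.rho_pos ecc.L_less by (simp add: ecc.T_def power2_eq_square divide_simps) (simp add: algebra_simps)
  have y: "ecc.a \<le> \<rho>" using ecc.a_less by simp
  obtain y' where y': "ecc.a \<le> y'" "ecc.mob 1 (of_real \<rho>) = of_real y'" using ecc.mob_axis[OF y order_refl, of 1] by metis
  have "of_real y' = ecc.T (of_real \<rho>)" using ecc.mob_Suc[of "of_real \<rho>" 0] y'(2) \<rho> by (simp add: ecc.mob_0)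
  then have "norm (complex_of_real (y' - L)) < r" using ecc.T_in[of "of_real \<rho>"] \<rho> by simp
  then have "\<bar>y' - L\<bar> < r" unfolding norm_of_real .
  then show "ecc.a < L + r" using y' by linarith
  show "L + r < \<rho>" by (rule ecc.gap)
qed

text \<open>This point is fixed by the inner reflection, so the reflected term is \<sigma> times the
  direct one and has the same sign.\<close>

lemma normal_gradient_X1:
  assumes \<sigma>0: "0 \<le> \<sigma>" and J: "0 < J" and h: "\<And>s. ecc.a \<le> s \<Longrightarrow> s \<le> L + r \<Longrightarrow> J \<le> \<bar>normal_comp s\<bar>"
  shows "J / (1 - \<sigma> * ecc.q\<^sup>2) \<le> norm (E' (axis_point (L + r)))"
proof -
  have c: "continuous_on {ecc.a..L + r} normal_comp"
    by (rule continuous_on_subset[OF continuous_normal_comp]) (use L_bounds ecc.a_pos in auto)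
  have hl: "J \<le> \<bar>normal_comp x\<bar>" if "ecc.a \<le> x" "x < L + r" for x using h[of x] that by simp
  obtain e where e: "\<bar>e\<bar> = 1" and all: "\<forall>x\<in>{ecc.a..L + r}. J \<le> e * normal_comp x"
    using constant_sign[OF c L_bounds(1) J hl] .
  have e2: "J \<le> e * normal_comp x" if "ecc.a \<le> x" "x \<le> L + r" for x using all that by simp
  define w where "w = Re (n * W (axis_point (L + r)))"
  have 1: "J / (1 - \<sigma> * ecc.q\<^sup>2) \<le> e * w" unfolding w_def
    by (rule Re_W_lower[OF \<sigma>0 _ _ less_imp_le[OF J] e2]) (use L_bounds in auto)
  have 2: "0 \<le> J / (1 - \<sigma> * ecc.q\<^sup>2)" using J \<sigma>q \<sigma>0 by simp
  have "inversion c r (axis_point (L + r)) = axis_point (L + r)"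
    by (subst c_axis_point) (unfold inversion_axis_point, use r in \<open>simp add: power2_eq_square\<close>)
  from n_E'_inner[OF refl this] have "Re (n * E' (axis_point (L + r))) = w + \<sigma> * w" using r by (simp add: w_def)
  then have "e * Re (n * E' (axis_point (L + r))) = e * w + \<sigma> * (e * w)" by (simp add: algebra_simps)
  then have "J / (1 - \<sigma> * ecc.q\<^sup>2) \<le> e * Re (n * E' (axis_point (L + r)))"
    using 1 mult_nonneg_nonneg[OF \<sigma>0, of "e * w"] 2 by linarith
  also have "\<dots> \<le> \<bar>e\<bar> * \<bar>Re (n * E' (axis_point (L + r)))\<bar>" unfolding abs_mult[symmetric] by (rule abs_ge_self)
  also have "\<dots> \<le> norm (n * E' (axis_point (L + r)))" unfolding e mult_1 by (rule abs_Re_le_cmod)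
  finally show ?thesis by (simp add: norm_mult n(1))
qed

text \<open>The reflected point is the first iterate of \<rho>, again on the axis above
  \<open>a\<close>, so the same lower bound applies to it and its contribution may be
  dropped.\<close>

lemma normal_gradient_X2:
  assumes \<sigma>0: "0 \<le> \<sigma>" and J: "0 < J" and h: "\<And>s. ecc.a \<le> s \<Longrightarrow> s < \<rho> \<Longrightarrow> J \<le> \<bar>normal_comp s\<bar>"
  shows "J / (1 - \<sigma> * ecc.q\<^sup>2) \<le> norm (E' (axis_point \<rho>))"
proof -
  have c: "continuous_on {ecc.a..\<rho>} normal_comp"
    by (rule continuous_on_subset[OF continuous_normal_comp]) (use ecc.a_pos in auto)
  have hl: "J \<le> \<bar>normal_comp x\<bar>" if "ecc.a \<le> x" "x < \<rho>" for x using h[of x] that by simp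
  obtain e where e: "\<bar>e\<bar> = 1" and all: "\<forall>x\<in>{ecc.a..\<rho>}. J \<le> e * normal_comp x"
    using constant_sign[OF c ecc.a_less J hl] .
  have e2: "J \<le> e * normal_comp x" if "ecc.a \<le> x" "x \<le> \<rho>" for x using all that by simp
  have al: "ecc.a \<le> \<rho>" using ecc.a_less by simp
  obtain y' where y': "ecc.a \<le> y'" "y' \<le> \<rho>" "ecc.mob 1 (of_real \<rho>) = of_real y'" using ecc.mob_axis[OF al order_refl, of 1] by metis
  have lower: "J / (1 - \<sigma> * ecc.q\<^sup>2) \<le> e * Re (n * W (axis_point y))" if "ecc.a \<le> y" "y \<le> \<rho>" for y
    by (rule Re_W_lower[OF \<sigma>0 that less_imp_le[OF J] e2]) (use that in auto)
  have X2: "axis_point \<rho> \<in> sphere Z \<rho>" using \<rho> by (simp add: dist_axis_point)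
  have "inversion c r (axis_point \<rho>) = ecc.T (of_real \<rho>) * n + Z"
    unfolding double_refl_inversion[OF X2] double_refl_def axis_coord_axis_point by simp
  also have "ecc.T (of_real \<rho>) = of_real y'" using ecc.mob_Suc[of "of_real \<rho>" 0] y'(3) \<rho> by (simp add: ecc.mob_0)
  finally have i: "inversion c r (axis_point \<rho>) = axis_point y'" by (simp add: axis_point_def)
  define w where "w = Re (n * W (axis_point \<rho>))"
  define w' where "w' = Re (n * W (axis_point y'))"
  have 1: "J / (1 - \<sigma> * ecc.q\<^sup>2) \<le> e * w" "J / (1 - \<sigma> * ecc.q\<^sup>2) \<le> e * w'"
    using lower[OF al order_refl] lower[OF y'(1,2)] by (simp_all add: w_def w'_def)
  have 2: "0 \<le> J / (1 - \<sigma> * ecc.q\<^sup>2)" using J \<sigma>q \<sigma>0 by simp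
  define \<tau> where "\<tau> = \<sigma> * (r\<^sup>2 / (\<rho> - L)\<^sup>2)"
  have \<tau>: "0 \<le> \<tau>" using \<sigma>0 by (simp add: \<tau>_def)
  have "Re (n * E' (axis_point \<rho>)) = w + \<tau> * w'" unfolding w_def w'_def \<tau>_def using ecc.L_less by (intro n_E'_inner[OF refl i]) simp
  then have "e * Re (n * E' (axis_point \<rho>)) = e * w + \<tau> * (e * w')" by (simp add: algebra_simps)
  then have "J / (1 - \<sigma> * ecc.q\<^sup>2) \<le> e * Re (n * E' (axis_point \<rho>))"
    using 1 mult_nonneg_nonneg[OF \<tau>, of "e * w'"] 2 by linarith
  also have "\<dots> \<le> \<bar>e\<bar> * \<bar>Re (n * E' (axis_point \<rho>))\<bar>" unfolding abs_mult[symmetric] by (rule abs_ge_self)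
  also have "\<dots> \<le> norm (n * E' (axis_point \<rho>))" unfolding e mult_1 by (rule abs_Re_le_cmod)
  finally show ?thesis by (simp add: norm_mult n(1))
qed

lemma inner_cnj: "cnj w \<bullet> n = Re (n * w)" by (simp add: inner_complex_def algebra_simps)

lemma double_layer_deriv_inside:
  assumes s: "0 \<le> s" "s < \<rho>"
  shows "double_layer_deriv Z \<rho> f n (axis_point s) = normal_comp s / 2"
proof -
  have X: "axis_point s \<in> ball Z \<rho>" "axis_point s \<notin> sphere Z \<rho>" using s by (simp_all add: dist_axis_point)
  have "((\<lambda>X. (hol_ext X + of_real mean) / 2) has_field_derivative (hol_ext' (axis_point s) + 0) / 2) (at (axis_point s))"
    by (intro DERIV_cdivide DERIV_add DERIV_const hol_ext_has_derivative X)
  from GDERIV_Re[OF this] have g: "GDERIV (double_layer Z \<rho> f) (axis_point s) :> cnj ((hol_ext' (axis_point s) + 0) / 2)"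
    by (rule GDERIV_transform_open[OF _ open_ball X(1)]) (simp add: double_layer_inside)
  show ?thesis unfolding double_layer_deriv_def grad_eq[OF g] inner_cnj using X(2) by (simp add: normal_comp_def)
qed

text \<open>The potential outside is a constant minus half the harmonic extension at the mirror
  point. The inversion sends the axis point \<open>s\<close> to \<open>\<rho>\<^sup>2 / s\<close>,
  reverses the normal, which restores the sign, and scales by
  \<open>\<rho>\<^sup>2 / s\<^sup>2\<close>.\<close>

lemma double_layer_deriv_outside:
  assumes s: "\<rho> < s"
  shows "double_layer_deriv Z \<rho> f n (axis_point s) = \<rho>\<^sup>2 / s\<^sup>2 * normal_comp (\<rho>\<^sup>2 / s) / 2"
proof -
  have s0: "s > 0" using s \<rho> by simp
  have X: "axis_point s \<in> - cball Z \<rho>" "axis_point s \<notin> sphere Z \<rho>" "axis_point s \<noteq> Z" using s s0 axis_point_diff[of s 0] n(1) by (auto simp: dist_axis_point axis_point_Z)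
  have i: "inversion Z \<rho> (axis_point s) = axis_point (\<rho>\<^sup>2 / s)" using inversion_axis_point[of 0 \<rho> s] by (simp add: axis_point_Z)
  define K where "K = hol_ext' (axis_point (\<rho>\<^sup>2 / s))"
  have "\<rho>\<^sup>2 / s < \<rho>" using s \<rho> by (simp add: divide_less_eq power2_eq_square)
  then have "axis_point (\<rho>\<^sup>2 / s) \<in> ball Z \<rho>" using s0 by (simp add: dist_axis_point)
  then have "(hol_ext has_field_derivative K) (at (inversion Z \<rho> (axis_point s)))" unfolding i K_def by (rule hol_ext_has_derivative)
  from inversion_has_derivative_cnj[OF this X(3)]
  have "((\<lambda>X. (of_real mean - cnj (hol_ext (inversion Z \<rho> X))) / 2) has_field_derivative (0 - - (cnj K * of_real (\<rho>\<^sup>2) / (axis_point s - Z)\<^sup>2)) / 2) (at (axis_point s))"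
    by (intro DERIV_cdivide DERIV_diff DERIV_const)
  from GDERIV_Re[OF this]
  have g: "GDERIV (double_layer Z \<rho> f) (axis_point s) :> cnj ((0 - - (cnj K * of_real (\<rho>\<^sup>2) / (axis_point s - Z)\<^sup>2)) / 2)"
  proof (rule GDERIV_transform_open[OF _ _ X(1)])
    show "open (- cball Z \<rho>)" by (rule open_Compl[OF closed_cball])
    show "Re ((of_real mean - cnj (hol_ext (inversion Z \<rho> Y))) / 2) = double_layer Z \<rho> f Y" if "Y \<in> - cball Z \<rho>" for Y
      using double_layer_outside[of Y] that by (simp add: inversion_def)
  qed
  have ni: "cnj n = inverse n" using n(2) by (metis inverse_unique)
  have nz: "n \<noteq> 0" using n(1) by auto
  have Xs: "axis_point s - Z = n * of_real s" by (simp add: axis_point_def)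
  have s1: "s \<noteq> 0" using s0 by simp
  have "Re (n * ((0 - - (cnj K * of_real (\<rho>\<^sup>2) / (axis_point s - Z)\<^sup>2)) / 2)) = \<rho>\<^sup>2 / s\<^sup>2 / 2 * Re (n * K)"
    unfolding Xs unimodular_cancel[OF ni nz s1] by (rule Re_of_real_mult)
  then show ?thesis unfolding double_layer_deriv_def grad_eq[OF g] inner_cnj using X(2) by (simp add: normal_comp_def K_def)
qed

section \<open>One-sided gradient limits of a given solution\<close>

lemma continuous_E': "continuous_on (cball Z \<rho> - ball c r) E'"
proof -
  have nz: "X \<noteq> c" if "X \<in> cball Z \<rho> - ball c r" for X using that r by auto
  have i: "continuous_on (cball Z \<rho> - ball c r) (inversion c r)"
    unfolding inversion_def[abs_def] using nz by (intro continuous_intros) auto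
  have w: "continuous_on (cball Z \<rho> - ball c r) (\<lambda>X. W (inversion c r X))"
    by (rule continuous_on_compose2[OF continuous_W i]) (use inversion_in ball_sub in blast)
  show ?thesis unfolding E'_def[abs_def] using nz
    by (intro continuous_intros w continuous_on_subset[OF continuous_W]) auto
qed

context
  fixes u :: "complex \<Rightarrow> real" and G :: "complex \<Rightarrow> complex"
  assumes u: "conductivity_solution (ball Z \<rho>) (ball c r) k f u G"
begin

lemma u_eq: "X \<in> cball Z \<rho> \<Longrightarrow> u X = U X"
proof -
  assume X: "X \<in> cball Z \<rho>"
  have "u X = U (p X)" by (rule conductivity_solution_unique(1)[OF k r \<rho> u solution X])
  then show "u X = U X" unfolding p(2)[OF X] .
qed

text \<open>By uniqueness \<open>u\<close> is the explicit solution, whose gradient formula is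
  continuous on the closed region between the disks, both circles included.\<close>

lemma solution_grad_limit:
  assumes X: "X \<in> cball Z \<rho> - ball c r"
  shows "grad_limit u (ball Z \<rho> - cball c r) X (cnj (E' X))"
proof -
  have o: "open (ball Z \<rho> - cball c r)" by (intro open_Diff) auto
  have g: "GDERIV u Y :> cnj (E' Y)" if Y: "Y \<in> ball Z \<rho> - cball c r" for Y
  proof -
    have "grad_U Y = cnj (E' Y)" using Y by (auto simp: grad_U_def)
    moreover have "GDERIV u Y :> grad_U Y"
      by (rule GDERIV_transform_open[OF GDERIV_outside(1)[OF Y] o Y]) (simp add: u_eq less_imp_le)
    ultimately show ?thesis by simp
  qed
  have sub: "ball Z \<rho> - cball c r \<subseteq> cball Z \<rho> - ball c r" by auto
  have "(E' \<longlongrightarrow> E' X) (at X within cball Z \<rho> - ball c r)"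
    using continuous_E' X unfolding continuous_on_def by (rule bspec)
  from tendsto_cnj[OF tendsto_within_subset[OF this sub]]
  have l: "((\<lambda>Y. cnj (E' Y)) \<longlongrightarrow> cnj (E' X)) (at X within ball Z \<rho> - cball c r)" .
  have e: "\<forall>\<^sub>F Y in at X within ball Z \<rho> - cball c r. Y \<in> ball Z \<rho> - cball c r"
    unfolding eventually_at_filter by simp
  have "\<forall>\<^sub>F Y in at X within ball Z \<rho> - cball c r. cnj (E' Y) = grad u Y"
    by (rule eventually_mono[OF e]) (rule grad_eq[OF g, symmetric])
  from Lim_transform_eventually[OF l this]
  have lim: "(grad u \<longlongrightarrow> cnj (E' X)) (at X within ball Z \<rho> - cball c r)" .
  have "\<forall>\<^sub>F Y in at X within ball Z \<rho> - cball c r. \<exists>D. GDERIV u Y :> D"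
    by (rule eventually_mono[OF e]) (rule exI, rule g)
  then show ?thesis unfolding grad_limit_def using lim by (rule conjI)
qed

lemma solution_grad_limit_boundary: "grad_limit u (ball Z \<rho>) (axis_point \<rho>) (cnj (E' (axis_point \<rho>)))"
proof -
  have X: "axis_point \<rho> \<in> cball Z \<rho>" "axis_point \<rho> \<notin> ball Z \<rho>" using \<rho> by (simp_all add: dist_axis_point)
  then have nc: "axis_point \<rho> \<in> - cball c r" "axis_point \<rho> \<notin> ball c r" using cball_sub ball_sub by blast+
  \<comment> \<open>The closed inner disk stays away from this point, so removing it does not change
    the limit.\<close>
  have "at (axis_point \<rho>) within ball Z \<rho> = at (axis_point \<rho>) within (ball Z \<rho> - cball c r)"
    by (rule at_within_nhd[OF nc(1)]) auto
  then show ?thesis using solution_grad_limit[of "axis_point \<rho>"] X nc by (simp add: grad_limit_def)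
qed

lemma solution_Linfty: "Linfty_norm (ball Z \<rho>) G \<le> ereal (2 * W_bound)"
proof -
  have "G \<in> borel_measurable (lebesgue_on (ball Z \<rho>))" using u by (simp add: conductivity_solution_def square_integrable_on_def)
  then have m: "(\<lambda>X. ereal (norm (G X))) \<in> borel_measurable (lebesgue_on (ball Z \<rho>))" by simp
  have "AE X in lebesgue. X \<in> ball Z \<rho> \<longrightarrow> G X = grad_U X" by (rule conductivity_solution_unique(2)[OF k r \<rho> u solution])
  then have "AE X in lebesgue. X \<in> ball Z \<rho> \<longrightarrow> ereal (norm (G X)) \<le> ereal (2 * W_bound)"
  proof (rule eventually_mono, intro impI)
    fix X assume "X \<in> ball Z \<rho> \<longrightarrow> G X = grad_U X" and X: "X \<in> ball Z \<rho>"
    then have e: "G X = grad_U X" by (rule mp)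
    have "X \<in> cball Z \<rho>" using X by simp
    then show "ereal (norm (G X)) \<le> ereal (2 * W_bound)" unfolding e ereal_less_eq by (rule norm_grad_U)
  qed
  then have "AE X in lebesgue_on (ball Z \<rho>). ereal (norm (G X)) \<le> ereal (2 * W_bound)"
    by (rule AE_restrict_space_iff[THEN iffD2, rotated]) simp
  with m show ?thesis unfolding Linfty_norm_def by (rule esssup_I)
qed

end

end

section \<open>Positions of the closest points and of the fixed points\<close>

lemma setdist_ball_sphere:
  fixes c Z :: complex
  assumes r: "0 < r" and \<rho>: "0 < \<rho>" and sub: "ball c r \<subseteq> ball Z \<rho>"
  shows "setdist (ball c r) (sphere Z \<rho>) = \<rho> - norm (c - Z) - r"
proof (rule antisym)
  \<comment> \<open>The gap is attained along the ray from \<open>Z\<close> through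
    \<open>c\<close>; for equal centres any direction will do.\<close>
  define d where "d = (if c = Z then 1 else sgn (c - Z))"
  have d: "norm d = 1" "norm (c - Z) *\<^sub>R d = c - Z" by (auto simp: d_def norm_sgn sgn_div_norm)
  have le: "norm (c - Z) + r \<le> \<rho>" using sub r by (simp add: ball_subset_ball_iff dist_norm)
  have "setdist (ball c r) (sphere Z \<rho>) = setdist (cball c r) (sphere Z \<rho>)"
    using setdist_closure_1[of "ball c r" "sphere Z \<rho>"] r by simp
  also have "\<dots> \<le> dist (c + r *\<^sub>R d) (Z + \<rho> *\<^sub>R d)"
    by (rule setdist_le_dist) (use d r \<rho> in \<open>simp_all add: dist_norm\<close>)
  also have "\<dots> = norm ((norm (c - Z) + r - \<rho>) *\<^sub>R d)"
    unfolding dist_norm scaleR_diff_left scaleR_add_left d(2) by (simp add: algebra_simps)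
  also have "\<dots> = \<rho> - norm (c - Z) - r" using d le by simp
  finally show "setdist (ball c r) (sphere Z \<rho>) \<le> \<rho> - norm (c - Z) - r" .
  show "\<rho> - norm (c - Z) - r \<le> setdist (ball c r) (sphere Z \<rho>)"
  proof (rule le_setdistI)
    show "ball c r \<noteq> {}" "sphere Z \<rho> \<noteq> {}" using r \<rho> by auto
    fix x y assume x: "x \<in> ball c r" and y: "y \<in> sphere Z \<rho>"
    have "dist Z y \<le> dist Z c + dist c x + dist x y" using dist_triangle[of Z y c] dist_triangle[of c y x] by linarith
    then show "\<rho> - norm (c - Z) - r \<le> dist x y" using x y by (simp add: dist_norm norm_minus_commute)
  qed
qed

context two_disks begin

text \<open>A closest point must reach the distance \<open>\<rho> - L - r\<close> of the axis point.
  That is equality in the triangle inequality through \<open>c\<close>, and equality determines the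
  direction.\<close>

lemma X1_eq:
  assumes "closest_point_to (sphere Z \<rho>) (sphere c r) X1" shows "X1 = axis_point (L + r)"
proof -
  have X1: "X1 \<in> sphere c r" and m: "infdist X1 (sphere Z \<rho>) \<le> infdist (axis_point (L + r)) (sphere Z \<rho>)"
  proof -
    have "axis_point (L + r) \<in> sphere c r" using r by (subst c_axis_point) (simp add: dist_norm axis_point_diff norm_mult n(1))
    then show "X1 \<in> sphere c r" "infdist X1 (sphere Z \<rho>) \<le> infdist (axis_point (L + r)) (sphere Z \<rho>)"
      using assms by (auto simp: closest_point_to_def)
  qed
  have ne: "sphere Z \<rho> \<noteq> {}" using \<rho> by simp
  have "infdist (axis_point (L + r)) (sphere Z \<rho>) \<le> dist (axis_point (L + r)) (axis_point \<rho>)"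
    by (rule infdist_le) (use \<rho> in \<open>simp add: dist_axis_point\<close>)
  also have "\<dots> = \<rho> - L - r" using L_bounds unfolding dist_norm axis_point_diff norm_mult n(1) norm_of_real by simp
  finally have u: "infdist (axis_point (L + r)) (sphere Z \<rho>) \<le> \<rho> - L - r" .
  have "\<rho> - dist Z X1 \<le> infdist X1 (sphere Z \<rho>)"
    unfolding infdist_notempty[OF ne]
  proof (rule cINF_greatest[OF ne])
    fix y assume "y \<in> sphere Z \<rho>" then show "\<rho> - dist Z X1 \<le> dist X1 y" using dist_triangle[of Z y X1] by simp
  qed
  then have "L + r \<le> norm ((c - Z) + (X1 - c))" using m u by (simp add: dist_norm norm_minus_commute)
  moreover have nX: "norm (X1 - c) = r" "norm (c - Z) = L" using X1 by (simp_all add: dist_norm norm_minus_commute L_def)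
  ultimately have "norm ((c - Z) + (X1 - c)) = norm (c - Z) + norm (X1 - c)"
    using norm_triangle_ineq[of "c - Z" "X1 - c"] by linarith
  from norm_triangle_eq[THEN iffD1, OF this] have "L *\<^sub>R (X1 - c) = r *\<^sub>R (c - Z)" unfolding nX .
  moreover have cZ: "c - Z = n * of_real L" using n(4) by (metis add_diff_cancel_left')
  ultimately have "of_real L * (X1 - c) = of_real L * (n * of_real r)"
    by (simp add: scaleR_conv_of_real mult_ac)
  then have "X1 - c = n * of_real r" using L_pos by simp
  then have "X1 = c + n * of_real r" by (simp add: algebra_simps)
  then show ?thesis by (subst (asm) c_axis_point) (simp add: axis_point_def algebra_simps)
qed

text \<open>Equality in the triangle inequality again, now for the path from \<open>Z\<close>
  through \<open>c\<close> to \<open>X2\<close>.\<close>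

lemma X2_eq:
  assumes "closest_point_to (sphere c r) (sphere Z \<rho>) X2" shows "X2 = axis_point \<rho>"
proof -
  have X2: "X2 \<in> sphere Z \<rho>" and m: "infdist X2 (sphere c r) \<le> infdist (axis_point \<rho>) (sphere c r)"
  proof -
    have "axis_point \<rho> \<in> sphere Z \<rho>" using \<rho> by (simp add: dist_axis_point)
    then show "X2 \<in> sphere Z \<rho>" "infdist X2 (sphere c r) \<le> infdist (axis_point \<rho>) (sphere c r)"
      using assms by (auto simp: closest_point_to_def)
  qed
  have ne: "sphere c r \<noteq> {}" using r by simp
  have "axis_point (L + r) \<in> sphere c r" using r by (subst c_axis_point) (simp add: dist_norm axis_point_diff norm_mult n(1))
  then have "infdist (axis_point \<rho>) (sphere c r) \<le> dist (axis_point \<rho>) (axis_point (L + r))" by (rule infdist_le)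
  also have "\<dots> = \<rho> - L - r" using L_bounds unfolding dist_norm axis_point_diff norm_mult n(1) norm_of_real by simp
  finally have u: "infdist (axis_point \<rho>) (sphere c r) \<le> \<rho> - L - r" .
  have "dist c X2 - r \<le> infdist X2 (sphere c r)"
    unfolding infdist_notempty[OF ne]
  proof (rule cINF_greatest[OF ne])
    fix y assume "y \<in> sphere c r" then show "dist c X2 - r \<le> dist X2 y"
      using dist_triangle[of c X2 y] by (simp add: dist_commute)
  qed
  then have le: "norm (X2 - c) \<le> \<rho> - L" using m u by (simp add: dist_norm norm_minus_commute)
  have nX: "norm (X2 - Z) = \<rho>" "norm (c - Z) = L" using X2 by (simp_all add: dist_norm norm_minus_commute L_def)
  have tr: "norm ((c - Z) + (X2 - c)) \<le> norm (c - Z) + norm (X2 - c)" by (rule norm_triangle_ineq)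
  have e: "(c - Z) + (X2 - c) = X2 - Z" by simp
  have nX2: "norm (X2 - c) = \<rho> - L" using tr le nX unfolding e by linarith
  then have "norm ((c - Z) + (X2 - c)) = norm (c - Z) + norm (X2 - c)" using nX unfolding e by simp
  from norm_triangle_eq[THEN iffD1, OF this] have "L *\<^sub>R (X2 - c) = (\<rho> - L) *\<^sub>R (c - Z)" unfolding nX nX2 .
  moreover have cZ: "c - Z = n * of_real L" using n(4) by (metis add_diff_cancel_left')
  ultimately have "of_real L * (X2 - c) = of_real L * (n * of_real (\<rho> - L))"
    by (simp add: scaleR_conv_of_real mult_ac)
  then have "X2 - c = n * of_real (\<rho> - L)" using L_pos by simp
  then have "X2 = c + n * of_real (\<rho> - L)" by (simp add: algebra_simps)
  then show ?thesis by (subst (asm) c_axis_point) (simp add: axis_point_def algebra_simps)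
qed

text \<open>The center is excluded because there the convention \<open>x / 0 = 0\<close> keeps
  \<open>Z\<close> in place instead of sending it to infinity.\<close>

lemma double_refl_eq_inversions:
  assumes X: "X \<in> cball Z \<rho>" "X \<noteq> Z" shows "inversion c r (inversion Z \<rho> X) = double_refl X"
proof -
  define y where "y = axis_coord X"
  have X': "X = Z + n * y" unfolding y_def by (rule axis_coord_inv)
  have y: "y \<noteq> 0" using X(2) X' by auto
  have ny: "norm y \<le> \<rho>" using X(1) by (simp add: y_def norm_axis_coord)
  have nz: "n \<noteq> 0" and ni: "cnj n = inverse n" using n(1,2) inverse_unique[of n "cnj n"] by auto
  define w where "w = of_real (\<rho>\<^sup>2) - of_real L * y"
  have w: "w \<noteq> 0" unfolding w_def by (rule ecc.T_den_nz[OF ny])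
  have 1: "of_real t / cnj (n * v) = n * (of_real t / cnj v)" for t and v
    using nz by (simp add: ni divide_inverse)
  have "inversion Z \<rho> X = Z + n * (of_real (\<rho>\<^sup>2) / cnj y)"
    unfolding inversion_def X' add_diff_cancel_left' 1 ..
  moreover have "Z - c = - (n * of_real L)" by (subst n(4)) simp
  ultimately have "inversion Z \<rho> X - c = n * (of_real (\<rho>\<^sup>2) / cnj y - of_real L)"
    by (simp add: algebra_simps)
  also have "of_real (\<rho>\<^sup>2) / cnj y - of_real L = cnj (w / y)" using y by (simp add: w_def diff_divide_distrib)
  finally have e: "inversion Z \<rho> X - c = n * cnj (w / y)" .
  have "inversion c r (inversion Z \<rho> X) = c + n * (of_real (r\<^sup>2) / (w / y))"
    unfolding inversion_def[of c r] e 1 complex_cnj_cnj ..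
  also have "of_real (r\<^sup>2) / (w / y) = of_real (r\<^sup>2) * y / w" by simp
  also have "c + n * (of_real (r\<^sup>2) * y / w) = double_refl X"
    unfolding double_refl_def ecc.T_def y_def[symmetric] w_def[symmetric] by (subst n(4)) (simp add: algebra_simps)
  finally show ?thesis .
qed

lemma double_refl_fixed: "X \<in> cball Z \<rho> \<Longrightarrow> double_refl X = X \<Longrightarrow> X = axis_point ecc.a"
proof -
  assume X: "X \<in> cball Z \<rho>" "double_refl X = X"
  have "ecc.T (axis_coord X) = axis_coord (double_refl X)" unfolding double_refl_def by (simp only: axis_coord_shift)
  then have "axis_coord X = of_real ecc.a" unfolding X(2) using X(1) by (intro ecc.fixed_point_T) (simp_all add: norm_axis_coord)
  then show "X = axis_point ecc.a" using axis_coord_inv[of X] by (simp add: axis_point_def)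
qed

text \<open>By convention the outer reflection fixes \<open>Z\<close>, so \<open>P1 = Z\<close> has
  to be excluded: then \<open>Z\<close> would lie on the inner circle, whereas \<open>P1\<close> is
  in the open disk.\<close>

lemma P1_eq:
  assumes P1: "P1 \<in> ball c r" "(reflect c r \<circ> reflect Z \<rho>) P1 = P1" shows "P1 = axis_point ecc.a"
proof -
  have e: "inversion c r (inversion Z \<rho> P1) = P1" using P1(2) by (simp add: reflect_eq_inversion)
  have "P1 \<noteq> Z"
  proof
    assume PZ: "P1 = Z"
    then have "inversion c r Z = Z" using e by (simp add: inversion_def[of Z])
    then have "norm (Z - c) = r\<^sup>2 / norm (Z - c)" using inversion_norm[of c r Z] by simp
    then have "(norm (Z - c))\<^sup>2 = r\<^sup>2" using c by (simp add: power2_eq_square field_simps)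
    then have "norm (Z - c) = r" using r by (simp add: power2_eq_iff_nonneg)
    then show False using P1(1) PZ by (simp add: dist_norm norm_minus_commute)
  qed
  moreover have "P1 \<in> cball Z \<rho>" using P1(1) ball_sub by blast
  ultimately show ?thesis using double_refl_eq_inversions[of P1] e by (intro double_refl_fixed) auto
qed

text \<open>The inner reflection of \<open>P2\<close> lies in \<Omega> and is fixed by the double
  reflection, hence it is the point of \<open>a\<close>. Its mirror image in the outer circle is the
  point of \<open>b\<close>, because \<open>a * b = \<rho>\<^sup>2\<close>.\<close>

lemma P2_eq:
  assumes P2: "P2 \<notin> cball Z \<rho>" "(reflect Z \<rho> \<circ> reflect c r) P2 = P2" shows "P2 = axis_point ecc.b"
proof -
  define Q where "Q = inversion c r P2"
  have e: "inversion Z \<rho> Q = P2" using P2(2) by (simp add: reflect_eq_inversion Q_def)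
  have "P2 \<notin> ball c r" using P2(1) ball_sub by blast
  then have Q: "Q \<in> cball Z \<rho>" using inversion_in[of P2] ball_sub unfolding Q_def by blast
  have QZ: "Q \<noteq> Z" using e P2(1) \<rho> by (auto simp: inversion_def)
  have "double_refl Q = Q" using double_refl_eq_inversions[OF Q QZ] unfolding e by (simp add: Q_def)
  from double_refl_fixed[OF Q this] have "P2 = inversion Z \<rho> (axis_point ecc.a)" using e by simp
  also have "\<dots> = axis_point (\<rho>\<^sup>2 / ecc.a)" using inversion_axis_point[of 0 \<rho> ecc.a] by (simp add: axis_point_Z)
  also have "\<rho>\<^sup>2 / ecc.a = ecc.b" using ecc.ab ecc.a_pos by (simp add: field_simps)
  finally show ?thesis .
qed

lemma normals: "unit_normal c r (axis_point (L + r)) = n" "unit_normal Z \<rho> (axis_point \<rho>) = n"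
proof -
  have "axis_point (L + r) - c = n * of_real r" by (subst c_axis_point) (simp add: axis_point_diff)
  then show "unit_normal c r (axis_point (L + r)) = n" using r by (simp add: unit_normal_def scaleR_conv_of_real divide_inverse)
  have "axis_point \<rho> - Z = n * of_real \<rho>" by (simp add: axis_point_def)
  then show "unit_normal Z \<rho> (axis_point \<rho>) = n" using \<rho> by (simp add: unit_normal_def scaleR_conv_of_real)
qed

section \<open>Bounds in terms of the square root of the gap\<close>

context
  fixes x :: real
  assumes x: "0 \<le> x" "\<rho> * r * x\<^sup>2 = (\<rho> - r) * (\<rho> - r - L)"
begin

text \<open>\<open>1 - \<sigma> * q\<^sup>2\<close> is
  \<open>(1 - \<sigma>) + \<sigma> * (1 - q\<^sup>2)\<close>, and
  \<open>1 - q\<^sup>2 \<le> 4 * x\<close>; this is the origin of the 4 in the denominator. The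
  factor 2 in the assumption is given away.\<close>

lemma quotient_bound:
  assumes \<sigma>0: "0 \<le> \<sigma>" and I: "0 < I" and J: "2 * I / (1 - \<sigma> * ecc.q\<^sup>2) \<le> N"
  shows "I / (1 - \<sigma> + 4 * x) \<le> N"
proof -
  have d: "0 < 1 - \<sigma> * ecc.q\<^sup>2" using \<sigma>q \<sigma>0 by simp
  have "\<sigma> * (1 - ecc.q\<^sup>2) \<le> 1 * (1 - ecc.q\<^sup>2)" using \<sigma> q2 by (intro mult_right_mono) auto
  then have "1 - \<sigma> * ecc.q\<^sup>2 \<le> 1 - \<sigma> + 4 * x" using ecc.multiplier_bounds(1)[OF x] by (simp add: algebra_simps)
  then have "I / (1 - \<sigma> + 4 * x) \<le> 2 * I / (1 - \<sigma> * ecc.q\<^sup>2)" using d I by (intro frac_le) auto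
  then show ?thesis using J by simp
qed

lemma nonpos_quotient: "0 \<le> \<sigma> \<Longrightarrow> I \<le> 0 \<Longrightarrow> I / (1 - \<sigma> + 4 * x) \<le> norm (w :: complex)"
  using \<sigma> x(1) by (intro order_trans[OF divide_nonpos_nonneg norm_ge_zero]) auto

lemma lower_bound_X1:
  assumes \<sigma>0: "0 \<le> \<sigma>"
  shows "(INF X\<in>closed_segment (axis_point ecc.a) (axis_point (L + r)). \<bar>double_layer_deriv Z \<rho> f n X\<bar>) / (1 - \<sigma> + 4 * x) \<le> norm (cnj (E' (axis_point (L + r))))"
proof -
  define I where "I = (INF X\<in>closed_segment (axis_point ecc.a) (axis_point (L + r)). \<bar>double_layer_deriv Z \<rho> f n X\<bar>)"
  show ?thesis unfolding I_def[symmetric]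
  proof (cases "I \<le> 0")
    case False
    then have I: "0 < I" by simp
    have "2 * I \<le> \<bar>normal_comp s\<bar>" if s: "ecc.a \<le> s" "s \<le> L + r" for s
    proof -
      have "axis_point s \<in> closed_segment (axis_point ecc.a) (axis_point (L + r))" using s by (intro segment_axis_point) (simp add: closed_segment_eq_real_ivl)
      then have "I \<le> \<bar>double_layer_deriv Z \<rho> f n (axis_point s)\<bar>" unfolding I_def
        by (intro cINF_lower bdd_belowI[of _ 0]) auto
      also have "double_layer_deriv Z \<rho> f n (axis_point s) = normal_comp s / 2"
        by (rule double_layer_deriv_inside) (use s L_bounds ecc.a_pos in linarith)+
      finally show ?thesis by simp
    qed
    then have "2 * I / (1 - \<sigma> * ecc.q\<^sup>2) \<le> norm (E' (axis_point (L + r)))" using I by (intro normal_gradient_X1[OF \<sigma>0]) auto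
    then show "I / (1 - \<sigma> + 4 * x) \<le> norm (cnj (E' (axis_point (L + r))))"
      unfolding complex_mod_cnj by (rule quotient_bound[OF \<sigma>0 I])
  qed (rule nonpos_quotient[OF \<sigma>0])
qed

text \<open>Each axis point \<open>s\<close> from \<open>a\<close> up to but excluding \<rho> is the
  mirror image of \<open>t = \<rho>\<^sup>2 / s\<close> on the outer segment, and the scaling
  \<open>\<rho>\<^sup>2 / t\<^sup>2\<close> is at most 1, so the infimum bounds
  \<open>normal_comp s\<close> from below.\<close>

lemma lower_bound_X2:
  assumes \<sigma>0: "0 \<le> \<sigma>"
  shows "(INF X\<in>closed_segment (axis_point ecc.b) (axis_point \<rho>). \<bar>double_layer_deriv Z \<rho> f n X\<bar>) / (1 - \<sigma> + 4 * x) \<le> norm (cnj (E' (axis_point \<rho>)))"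
proof -
  define I where "I = (INF X\<in>closed_segment (axis_point ecc.b) (axis_point \<rho>). \<bar>double_layer_deriv Z \<rho> f n X\<bar>)"
  show ?thesis unfolding I_def[symmetric]
  proof (cases "I \<le> 0")
    case False
    then have I: "0 < I" by simp
    have "2 * I \<le> \<bar>normal_comp s\<bar>" if s: "ecc.a \<le> s" "s < \<rho>" for s
    proof -
      have s0: "0 < s" using s ecc.a_pos by linarith
      define t where "t = \<rho>\<^sup>2 / s"
      have t: "\<rho> < t" "t \<le> ecc.b"
      proof -
        show "\<rho> < t" using s s0 \<rho> by (simp add: t_def less_divide_eq power2_eq_square)
        have "ecc.a * ecc.b \<le> s * ecc.b" using s(1) ecc.b_gt \<rho> by (intro mult_right_mono) auto
        then show "t \<le> ecc.b" unfolding ecc.ab t_def using s0 by (simp add: divide_le_eq mult.commute)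
      qed
      have st: "\<rho>\<^sup>2 / t = s" using s0 \<rho> by (simp add: t_def)
      have "axis_point t \<in> closed_segment (axis_point ecc.b) (axis_point \<rho>)" using t by (intro segment_axis_point) (simp add: closed_segment_eq_real_ivl)
      then have "I \<le> \<bar>double_layer_deriv Z \<rho> f n (axis_point t)\<bar>" unfolding I_def
        by (intro cINF_lower bdd_belowI[of _ 0]) auto
      also have "double_layer_deriv Z \<rho> f n (axis_point t) = \<rho>\<^sup>2 / t\<^sup>2 * (normal_comp s / 2)"
        using double_layer_deriv_outside[OF t(1)] unfolding st by simp
      also have "\<bar>\<rho>\<^sup>2 / t\<^sup>2 * (normal_comp s / 2)\<bar> \<le> 1 * \<bar>normal_comp s / 2\<bar>"
        unfolding abs_mult using t(1) \<rho> by (intro mult_right_mono) (auto simp: divide_le_eq intro!: power_mono)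
      finally show ?thesis by simp
    qed
    then have "2 * I / (1 - \<sigma> * ecc.q\<^sup>2) \<le> norm (E' (axis_point \<rho>))" using I by (intro normal_gradient_X2[OF \<sigma>0]) auto
    then show "I / (1 - \<sigma> + 4 * x) \<le> norm (cnj (E' (axis_point \<rho>)))"
      unfolding complex_mod_cnj by (rule quotient_bound[OF \<sigma>0 I])
  qed (rule nonpos_quotient[OF \<sigma>0])
qed

text \<open>\<open>d\<close> is at least \<open>1 - \<bar>\<sigma>\<bar>\<close> and at least
  \<open>1 - q\<^sup>2 \<ge> x / 2\<close>, so \<open>1 - \<bar>\<sigma>\<bar> + x\<close> is at
  most \<open>4 * d\<close>. Together with \<open>2 * W_bound = 8 * ext_bound / d\<close> this gives
  the 32.\<close>

lemma upper_bound:
  assumes x1: "x \<le> 1" and u: "conductivity_solution (ball Z \<rho>) (ball c r) k f u G"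
  shows "Linfty_norm (ball Z \<rho>) G \<le> ereal (32 * cst * C1_holder_norm Z \<rho> \<alpha> f / (1 - \<bar>\<sigma>\<bar> + x))"
proof -
  define d where "d = 1 - \<bar>\<sigma>\<bar> * ecc.q\<^sup>2"
  have d: "0 < d" using \<sigma>q by (simp add: d_def)
  have "\<bar>\<sigma>\<bar> * ecc.q\<^sup>2 \<le> \<bar>\<sigma>\<bar>" "\<bar>\<sigma>\<bar> * ecc.q\<^sup>2 \<le> ecc.q\<^sup>2"
    using q2 \<sigma> by (auto intro: mult_left_le mult_left_le_one_le)
  then have "1 - \<bar>\<sigma>\<bar> + x \<le> 4 * d" using ecc.multiplier_bounds(2)[OF x x1] \<sigma>(1) d_def by argo
  then have "1 / d \<le> 4 / (1 - \<bar>\<sigma>\<bar> + x)" using d \<sigma>(1) x(1) by (simp add: divide_simps)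
  from mult_left_mono[OF this, of "8 * ext_bound"] have "2 * W_bound \<le> 32 * ext_bound / (1 - \<bar>\<sigma>\<bar> + x)"
    using ext_bound_nonneg by (simp add: W_bound_def d_def[symmetric])
  then have "ereal (2 * W_bound) \<le> ereal (32 * cst * C1_holder_norm Z \<rho> \<alpha> f / (1 - \<bar>\<sigma>\<bar> + x))" by (simp add: ext_bound_def mult.assoc)
  then show ?thesis by (rule order_trans[OF solution_Linfty[OF u]])
qed

end

end

lemma small_gap:
  assumes r: "0 < r" and \<rho>: "0 < \<rho>"
  shows "\<exists>\<epsilon>0>0. \<forall>c Z \<epsilon>. ball c r \<subseteq> ball Z \<rho> \<longrightarrow> \<epsilon> = setdist (ball c r) (sphere Z \<rho>) \<longrightarrow> 0 < \<epsilon> \<longrightarrow> \<epsilon> < \<epsilon>0 \<longrightarrow>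
    c \<noteq> Z \<and> dist Z c + r < \<rho> \<and> 0 \<le> r_star \<rho> r * sqrt \<epsilon> \<and> r_star \<rho> r * sqrt \<epsilon> \<le> 1 \<and>
    \<rho> * r * (r_star \<rho> r * sqrt \<epsilon>)\<^sup>2 = (\<rho> - r) * (\<rho> - r - norm (c - Z :: complex))"
proof -
  \<comment> \<open>The first bound rules out equal centres, where the gap would be
    \<open>\<rho> - r\<close>; the second makes \<open>r_star \<rho> r * sqrt \<epsilon>\<close> at
    most 1. If \<open>r\<close> is not below \<rho> there is no positive gap and any value will
    do.\<close>
  define \<epsilon>0 where "\<epsilon>0 = (if r < \<rho> then min ((\<rho> - r) / 2) (\<rho> * r / (\<rho> - r)) else 1)"
  have e0: "0 < \<epsilon>0" using r \<rho> by (simp add: \<epsilon>0_def)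
  have "c \<noteq> Z \<and> dist Z c + r < \<rho> \<and> 0 \<le> r_star \<rho> r * sqrt \<epsilon> \<and> r_star \<rho> r * sqrt \<epsilon> \<le> 1 \<and>
    \<rho> * r * (r_star \<rho> r * sqrt \<epsilon>)\<^sup>2 = (\<rho> - r) * (\<rho> - r - norm (c - Z))"
    if s: "ball c r \<subseteq> ball Z \<rho>" and \<epsilon>: "0 < \<epsilon>" "\<epsilon> < \<epsilon>0" "\<epsilon> = setdist (ball c r) (sphere Z \<rho>)" for c Z :: complex and \<epsilon>
  proof -
    have e: "\<epsilon> = \<rho> - norm (c - Z) - r" unfolding \<epsilon>(3) by (rule setdist_ball_sphere[OF r \<rho> s])
    have r\<rho>: "r < \<rho>" using e \<epsilon>(1) norm_ge_zero[of "c - Z"] by linarith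
    then have \<epsilon>0: "\<epsilon> < (\<rho> - r) / 2" "\<epsilon> < \<rho> * r / (\<rho> - r)" using \<epsilon>(2) by (simp_all add: \<epsilon>0_def)
    have c: "c \<noteq> Z" using e \<epsilon>0(1) r\<rho> by auto
    have x2: "(r_star \<rho> r * sqrt \<epsilon>)\<^sup>2 = (\<rho> - r) / (\<rho> * r) * \<epsilon>"
      using r \<rho> r\<rho> \<epsilon>(1) by (simp add: r_star_def power_mult_distrib)
    have "(\<rho> - r) * \<epsilon> \<le> \<rho> * r" using \<epsilon>0(2) r\<rho> by (simp add: less_divide_eq mult.commute less_imp_le)
    then have "(r_star \<rho> r * sqrt \<epsilon>)\<^sup>2 \<le> 1\<^sup>2" unfolding x2 using r \<rho> by (simp add: divide_le_eq)
    then have "r_star \<rho> r * sqrt \<epsilon> \<le> 1" by (rule power2_le_imp_le) simp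
    moreover have "0 \<le> r_star \<rho> r * sqrt \<epsilon>" using r \<rho> r\<rho> \<epsilon>(1) by (simp add: r_star_def)
    moreover have "\<rho> * r * (r_star \<rho> r * sqrt \<epsilon>)\<^sup>2 = (\<rho> - r) * (\<rho> - r - norm (c - Z))"
      unfolding x2 using r \<rho> e by simp
    moreover have "dist Z c + r < \<rho>" using e \<epsilon>(1) by (simp add: dist_norm norm_minus_commute)
    ultimately show ?thesis using c by blast
  qed
  with e0 show ?thesis by blast
qed

theorem theorem1p2:
  fixes Z :: complex and \<rho> \<alpha> :: real
  assumes "\<rho> > 0" and "\<alpha> > 0"
  shows
    "(\<exists>C1>0. \<forall>r>0. \<exists>\<epsilon>0>0. \<forall>c k f u G \<epsilon> X1 X2 P1 P2.
        ball c r \<subseteq> ball Z \<rho> \<and>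
        \<epsilon> = setdist (ball c r) (sphere Z \<rho>) \<and> 0 < \<epsilon> \<and> \<epsilon> < \<epsilon>0 \<and>
        k > 1 \<and> C1_holder_circle Z \<rho> \<alpha> f \<and>
        conductivity_solution (ball Z \<rho>) (ball c r) k f u G \<and>
        closest_point_to (sphere Z \<rho>) (sphere c r) X1 \<and>
        closest_point_to (sphere c r) (sphere Z \<rho>) X2 \<and>
        P1 \<in> ball c r \<and> (reflect c r \<circ> reflect Z \<rho>) P1 = P1 \<and>
        P2 \<notin> cball Z \<rho> \<and> (reflect Z \<rho> \<circ> reflect c r) P2 = P2 \<longrightarrow>
        (\<exists>L1. grad_limit u (ball Z \<rho> - cball c r) X1 L1 \<and>
           C1 * (INF X\<in>closed_segment P1 X1. \<bar>double_layer_deriv Z \<rho> f (unit_normal c r X1) X\<bar>)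
             / (1 - contrast k + 4 * r_star \<rho> r * sqrt \<epsilon>) \<le> norm L1) \<and>
        (\<exists>L2. grad_limit u (ball Z \<rho>) X2 L2 \<and>
           C1 * (INF X\<in>closed_segment P2 X2. \<bar>double_layer_deriv Z \<rho> f (unit_normal Z \<rho> X2) X\<bar>)
             / (1 - contrast k + 4 * r_star \<rho> r * sqrt \<epsilon>) \<le> norm L2))
     \<and>
     (\<exists>C2. \<forall>r>0. \<exists>\<epsilon>0>0. \<forall>c k f u G \<epsilon>.
        ball c r \<subseteq> ball Z \<rho> \<and>
        \<epsilon> = setdist (ball c r) (sphere Z \<rho>) \<and> 0 < \<epsilon> \<and> \<epsilon> < \<epsilon>0 \<and>
        0 < k \<and> k \<noteq> 1 \<and> C1_holder_circle Z \<rho> \<alpha> f \<and>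
        conductivity_solution (ball Z \<rho>) (ball c r) k f u G \<longrightarrow>
        Linfty_norm (ball Z \<rho>) G
          \<le> ereal (C2 * C1_holder_norm Z \<rho> \<alpha> f
                    / (1 - \<bar>contrast k\<bar> + r_star \<rho> r * sqrt \<epsilon>)))"
proof (rule conjI, goal_cases)
  case 1
  show ?case
  \<comment> \<open>The constant 1 suffices: inside \<Omega> the normal derivative of the harmonic
    extension is twice that of the potential, and \<open>quotient_bound\<close> spends this
    factor.\<close>
  proof (rule exI[of _ 1], intro conjI allI impI, goal_cases)
    case (2 r)
    obtain \<epsilon>0 where \<epsilon>0: "0 < \<epsilon>0" and gap: "\<forall>c Z \<epsilon>. ball c r \<subseteq> ball Z \<rho> \<longrightarrow> \<epsilon> = setdist (ball c r) (sphere Z \<rho>) \<longrightarrow> 0 < \<epsilon> \<longrightarrow> \<epsilon> < \<epsilon>0 \<longrightarrow>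
      c \<noteq> Z \<and> dist Z c + r < \<rho> \<and> 0 \<le> r_star \<rho> r * sqrt \<epsilon> \<and> r_star \<rho> r * sqrt \<epsilon> \<le> 1 \<and>
      \<rho> * r * (r_star \<rho> r * sqrt \<epsilon>)\<^sup>2 = (\<rho> - r) * (\<rho> - r - norm (c - Z :: complex))"
      using small_gap[OF 2 assms(1)] by (elim exE conjE)
    show ?case
    proof (rule exI[of _ \<epsilon>0], intro conjI[OF \<epsilon>0] allI impI, goal_cases)
      case (1 c k f u G \<epsilon> X1 X2 P1 P2)
      then have \<epsilon>: "\<epsilon> = setdist (ball c r) (sphere Z \<rho>)" "0 < \<epsilon>" "\<epsilon> < \<epsilon>0" and s: "ball c r \<subseteq> ball Z \<rho>" and k1: "k > 1"
        and f: "C1_holder_circle Z \<rho> \<alpha> f" and u: "conductivity_solution (ball Z \<rho>) (ball c r) k f u G"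
        and X: "closest_point_to (sphere Z \<rho>) (sphere c r) X1" "closest_point_to (sphere c r) (sphere Z \<rho>) X2"
        and P: "P1 \<in> ball c r" "(reflect c r \<circ> reflect Z \<rho>) P1 = P1" "P2 \<notin> cball Z \<rho>" "(reflect Z \<rho> \<circ> reflect c r) P2 = P2"
        by blast+
      have g: "c \<noteq> Z" "dist Z c + r < \<rho>" "0 \<le> r_star \<rho> r * sqrt \<epsilon>"
        "\<rho> * r * (r_star \<rho> r * sqrt \<epsilon>)\<^sup>2 = (\<rho> - r) * (\<rho> - r - norm (c - Z))"
        using gap[rule_format, OF s \<epsilon>] by simp_all
      interpret two_disks Z \<rho> \<alpha> f c r k by unfold_locales (use assms f g 2 k1 in auto)
      have x: "\<rho> * r * (r_star \<rho> r * sqrt \<epsilon>)\<^sup>2 = (\<rho> - r) * (\<rho> - r - L)" using g(4) by (simp only: L_def)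
      have \<sigma>0: "0 \<le> \<sigma>" using k1 by (simp add: \<sigma>_def contrast_def)
      have XP: "X1 = axis_point (L + r)" "X2 = axis_point \<rho>" "P1 = axis_point ecc.a" "P2 = axis_point ecc.b"
        using X1_eq[OF X(1)] X2_eq[OF X(2)] P1_eq[OF P(1,2)] P2_eq[OF P(3,4)] by simp_all
      have X1: "axis_point (L + r) \<in> cball Z \<rho> - ball c r"
      proof -
        have "axis_point (L + r) \<notin> ball c r" using r by (subst c_axis_point) (simp add: dist_norm axis_point_diff norm_mult n(1) del: of_real_add)
        then show ?thesis using L_bounds L_pos r by (simp add: dist_axis_point)
      qed
      show ?case unfolding XP normals mult_1 \<sigma>_def[symmetric] mult.assoc[of 4]
        using solution_grad_limit[OF u X1] solution_grad_limit_boundary[OF u] lower_bound_X1[OF g(3) x \<sigma>0] lower_bound_X2[OF g(3) x \<sigma>0] by blast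
    qed
  qed simp
next
  case 2
  show ?case
  \<comment> \<open>\<open>cst\<close> takes only \<rho> and \<alpha>, so it is available before
    \<open>r\<close>, \<open>k\<close> and \<open>f\<close> are introduced.\<close>
  proof (rule exI[of _ "32 * C1_holder_data.cst \<rho> \<alpha>"], intro allI impI, goal_cases)
    case (1 r)
    obtain \<epsilon>0 where \<epsilon>0: "0 < \<epsilon>0" and gap: "\<forall>c Z \<epsilon>. ball c r \<subseteq> ball Z \<rho> \<longrightarrow> \<epsilon> = setdist (ball c r) (sphere Z \<rho>) \<longrightarrow> 0 < \<epsilon> \<longrightarrow> \<epsilon> < \<epsilon>0 \<longrightarrow>
      c \<noteq> Z \<and> dist Z c + r < \<rho> \<and> 0 \<le> r_star \<rho> r * sqrt \<epsilon> \<and> r_star \<rho> r * sqrt \<epsilon> \<le> 1 \<and>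
      \<rho> * r * (r_star \<rho> r * sqrt \<epsilon>)\<^sup>2 = (\<rho> - r) * (\<rho> - r - norm (c - Z :: complex))"
      using small_gap[OF 1 assms(1)] by (elim exE conjE)
    show ?case
    proof (rule exI[of _ \<epsilon>0], intro conjI[OF \<epsilon>0] allI impI, goal_cases)
      case (1 c k f u G \<epsilon>)
      then have \<epsilon>: "\<epsilon> = setdist (ball c r) (sphere Z \<rho>)" "0 < \<epsilon>" "\<epsilon> < \<epsilon>0" and s: "ball c r \<subseteq> ball Z \<rho>" and k: "k > 0"
        and f: "C1_holder_circle Z \<rho> \<alpha> f" and u: "conductivity_solution (ball Z \<rho>) (ball c r) k f u G"
        by blast+
      have g: "c \<noteq> Z" "dist Z c + r < \<rho>" "0 \<le> r_star \<rho> r * sqrt \<epsilon>" "r_star \<rho> r * sqrt \<epsilon> \<le> 1"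
        "\<rho> * r * (r_star \<rho> r * sqrt \<epsilon>)\<^sup>2 = (\<rho> - r) * (\<rho> - r - norm (c - Z))"
        using gap[rule_format, OF s \<epsilon>] by simp_all
      interpret two_disks Z \<rho> \<alpha> f c r k by unfold_locales (use assms f g \<open>r > 0\<close> k in auto)
      have x: "\<rho> * r * (r_star \<rho> r * sqrt \<epsilon>)\<^sup>2 = (\<rho> - r) * (\<rho> - r - L)" using g(5) by (simp only: L_def)
      show ?case unfolding \<sigma>_def[symmetric] by (rule upper_bound[OF g(3) x g(4) u])
    qed
  qed
qed

end
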